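(* Fix $\xi\in\mathbb S^{d-1}$. Suppose there are constants with $0<\underline\lambda_\Sigma\le\lambda_{\min}(\Sigma)\le\lambda_{\max}(\Sigma)\le\overline\lambda_\Sigma<\infty$ and $0<\underline\lambda_V\le\lambda_{\min}(V)$, where $\Sigma=\mathbb E[XX^\top]$ and $V=\mathbb E[XX^\top(Y-X^\top\beta_0)^2]$. Suppose there are $q_x,q_y,K_x,K_y\ge1$ with $q_{xy}:=(1/q_x+1/q_y)^{-1}>2$, $\sup_{u\in\mathbb S^{d-1}}\mathbb E|u^\top\Sigma^{-1/2}X|^{q_x}\le K_x^{q_x}$ and $\mathbb E|Y-X^\top\beta_0|^{q_y}\le K_y^{q_y}$. Below, $C>0$ denotes a constant not depending on $n$ or $d$. 1. Let $s=q_{xy}\wedge3$. Then there exists $C>0$ such that $$\sup_{\alpha\in(0,1)}\left(\mathbb P\big(\xi^\top\beta_0\notin\widehat{\mathrm{CI}}^{\rm SeN}_\alpha(\xi^\top\beta_0)\big)-\alpha\right)_+\le C\,\frac{\log^{s/2}(end)}{n^{s/2-1}} .$$ 2. If moreover $q:=\min\{q_x/2,q_{xy}\}>2$, then there exists $C>0$ such that $$\sup_{\alpha\in(0,1)}\left(\mathbb P\big(\xi^\top\beta_0\notin\widehat{\mathrm{CI}}^{\rm SpN}_\alpha(\xi^\top\beta_0)\big)-\alpha\right)_+\le C\left[\sqrt{\frac dn}+\left(\frac{\log(en)}{n}\right)^{1-2/(q\wedge4)}\right].$$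
   Context: Misspecified linear regression. $(X,Y),(X_1,Y_1),\dots,(X_n,Y_n)$ are i.i.d. with $X\in\mathbb R^d$, $Y\in\mathbb R$. $\beta_0=\arg\min_{\theta\in\mathbb R^d}\mathbb E[(Y-X^\top\theta)^2]=\Sigma^{-1}\mathbb E[XY]$; $\psi((x,y),\theta)=-x(y-x^\top\theta)$. $n$ is even; $[n]$ is partitioned into $\mathcal I_1,\mathcal I_2$ of sizes $n_1=n_2=n/2$; $\mathcal D_k=\{(X_i,Y_i):i\in\mathcal I_k\}$; $d\le n/2$, so that the ordinary least squares (OLS) estimator is well defined on each split. $\widehat\beta_2$ is the OLS estimator from $\mathcal D_2$ and $\widehat\Sigma_2=n_2^{-1}\sum_{i\in\mathcal I_2}X_iX_i^\top$. $\bar\psi_1(\theta)=n_1^{-1}\sum_{i\in\mathcal I_1}\psi((X_i,Y_i),\theta)$; $\widehat V_1(\theta)=n_1^{-1}\sum_{i\in\mathcal I_1}(\psi((X_i,Y_i),\theta)-\bar\psi_1(\theta))(\psi((X_i,Y_i),\theta)-\bar\psi_1(\theta))^\top$; $\mathbf e_j$ are canonical basis vectors; $z_\gamma$ is the upper $\gamma$-quantile of $\mathcal N(0,1)$. $\widehat{\mathscr C}^{\rm SeN}_\alpha=\Big\{\theta:\dfrac{\sqrt{n_1}|\xi^\top\widehat\Sigma_2^{-1}\bar\psi_1(\theta)|}{\sqrt{\xi^\top\widehat\Sigma_2^{-1}\widehat V_1(\theta)\widehat\Sigma_2^{-1}\xi}}\le z_{\alpha/2}\Big\}$, $\widehat{\mathscr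 C}^{\rm SpN}_\alpha=\Big\{\theta:\dfrac{\sqrt{n_1}|\xi^\top\widehat\Sigma_2^{-1}\bar\psi_1(\theta)|}{\sqrt{\xi^\top\widehat\Sigma_2^{-1}\widehat V_1(\widehat\beta_2)\widehat\Sigma_2^{-1}\xi}}\le z_{\alpha/2}\Big\}$, and $T^{\rm SeN}(\theta;\widehat\Sigma_2^{-1})=\max_{j\in[d]}\dfrac{\sqrt{n_1}|\mathbf e_j^\top\widehat\Sigma_2^{-1}\bar\psi_1(\theta)|}{\sqrt{\mathbf e_j^\top\widehat\Sigma_2^{-1}\widehat V_1(\theta)\widehat\Sigma_2^{-1}\mathbf e_j}}$. For ${\rm a}\in\{{\rm SeN},{\rm SpN}\}$, $\widehat{\mathrm{CI}}^{\rm a}_\alpha(\xi^\top\beta_0)=\{\xi^\top\theta:\theta\in\widehat{\mathscr C}^{\rm a}_\alpha\text{ and }T^{\rm SeN}(\theta;\widehat\Sigma_2^{-1})\le z_{1/(2nd)}\}$. $a_+=\max\{a,0\}$, $a\wedge b=\min\{a,b\}$. *)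

theory Defs
  imports
    "HOL-Probability.Independent_Family"
    "HOL-Probability.Characteristic_Functions"
    "Jordan_Normal_Form.Gauss_Jordan_Elimination"
    "Jordan_Normal_Form.Spectral_Radius"
begin

text \<open>The dimension \<open>d\<close> is quantified inside the constants of the theorem, so \<open>\<real>\<^sup>d\<close> is
  \<^term>\<open>carrier_vec d :: real Matrix.vec set\<close> rather than a type. The following hides the
  type-indexed vectors of \<open>HOL-Analysis\<close>.\<close>

hide_type (open) Finite_Cartesian_Product.vec
hide_const (open) Finite_Cartesian_Product.vec
unbundle no vec_syntax and no inner_syntax

definition borel_vec :: "nat \<Rightarrow> real vec measure" where
  "borel_vec d =
     vimage_algebra (carrier_vec d) (\<lambda>v. \<lambda>j\<in>{..<d}. v $ j) (\<Pi>\<^sub>M j\<in>{..<d}. borel)"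

definition unit_sphere :: "nat \<Rightarrow> real vec set" where
  "unit_sphere d = {u \<in> carrier_vec d. sqrt (u \<bullet> u) = 1}"

definition outer :: "real vec \<Rightarrow> real vec \<Rightarrow> real mat" where
  "outer v w = mat (dim_vec v) (dim_vec w) (\<lambda>(j, k). v $ j * w $ k)"

definition lambda_min :: "real mat \<Rightarrow> real" where
  "lambda_min A = Min (spectrum A)"

definition lambda_max :: "real mat \<Rightarrow> real" where
  "lambda_max A = Max (spectrum A)"

text \<open>The inverse is the zero matrix when \<open>A\<close> is singular. For \<open>A\<close> the empirical second moment
  matrix, both numerator and denominator of the ratios below then vanish, and \<open>0 / 0 = 0\<close>:
  without a well-defined OLS estimator no parameter value is rejected.\<close>

definition minv :: "real mat \<Rightarrow> real mat" where
  "minv A = (case mat_inverse A of Some B \<Rightarrow> B | None \<Rightarrow> 0\<^sub>m (dim_row A) (dim_col A))"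

definition psd :: "real mat \<Rightarrow> bool" where
  "psd A \<longleftrightarrow> square_mat A \<and> transpose_mat A = A \<and>
     (\<forall>v \<in> carrier_vec (dim_row A). 0 \<le> v \<bullet> (A *\<^sub>v v))"

definition msqrt :: "real mat \<Rightarrow> real mat" where
  "msqrt A = (THE R. psd R \<and> R * R = A)"


text \<open>Population quantities. \<open>P\<close> is the joint law of \<open>(X, Y)\<close>.\<close>

definition regression_law :: "nat \<Rightarrow> (real vec \<times> real) measure \<Rightarrow> bool" where
  "regression_law d P \<longleftrightarrow>
     prob_space P \<and> sets P = sets (borel_vec d \<Otimes>\<^sub>M borel) \<and>
     (\<forall>j<d. integrable P (\<lambda>(x, y). (x $ j)\<^sup>2)) \<and> integrable P (\<lambda>(x, y). y\<^sup>2)"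

definition mat_expectation ::
    "nat \<Rightarrow> (real vec \<times> real) measure \<Rightarrow> (real vec \<times> real \<Rightarrow> real mat) \<Rightarrow> real mat" where
  "mat_expectation d P F = mat d d (\<lambda>(j, k). \<integral>z. F z $$ (j, k) \<partial>P)"

definition Sigma_mat :: "nat \<Rightarrow> (real vec \<times> real) measure \<Rightarrow> real mat" where
  "Sigma_mat d P = mat_expectation d P (\<lambda>(x, y). outer x x)"

definition beta0 :: "nat \<Rightarrow> (real vec \<times> real) measure \<Rightarrow> real vec" where
  "beta0 d P = arg_min_on (\<lambda>\<theta>. \<integral>(x, y). (y - x \<bullet> \<theta>)\<^sup>2 \<partial>P) (carrier_vec d)"

definition V_mat :: "nat \<Rightarrow> (real vec \<times> real) measure \<Rightarrow> real mat" where
  "V_mat d P = mat_expectation d P (\<lambda>(x, y). (y - x \<bullet> beta0 d P)\<^sup>2 \<cdot>\<^sub>m outer x x)"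

definition spectral_bounds ::
    "nat \<Rightarrow> (real vec \<times> real) measure \<Rightarrow> real \<Rightarrow> real \<Rightarrow> real \<Rightarrow> bool" where
  "spectral_bounds d P lS uS lV \<longleftrightarrow>
     lS \<le> lambda_min (Sigma_mat d P) \<and> lambda_max (Sigma_mat d P) \<le> uS \<and>
     lV \<le> lambda_min (V_mat d P)"

definition moment_bounds ::
    "nat \<Rightarrow> (real vec \<times> real) measure \<Rightarrow> real \<Rightarrow> real \<Rightarrow> real \<Rightarrow> real \<Rightarrow> bool" where
  "moment_bounds d P qx qy Kx Ky \<longleftrightarrow>
     (SUP u \<in> unit_sphere d.
        \<integral>\<^sup>+(x, y). ennreal (\<bar>u \<bullet> (msqrt (minv (Sigma_mat d P)) *\<^sub>v x)\<bar> powr qx) \<partial>P)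
       \<le> ennreal (Kx powr qx) \<and>
     (\<integral>\<^sup>+(x, y). ennreal (\<bar>y - x \<bullet> beta0 d P\<bar> powr qy) \<partial>P) \<le> ennreal (Ky powr qy)"


definition iid_sample ::
    "'a measure \<Rightarrow> (real vec \<times> real) measure \<Rightarrow> nat \<Rightarrow> (nat \<Rightarrow> 'a \<Rightarrow> real vec \<times> real) \<Rightarrow> bool" where
  "iid_sample M P n Z \<longleftrightarrow>
     prob_space M \<and> prob_space.indep_vars M (\<lambda>_. P) Z {1..n} \<and>
     (\<forall>i\<in>{1..n}. distr M P (Z i) = P)"

definition half_split :: "nat \<Rightarrow> nat set \<Rightarrow> nat set \<Rightarrow> bool" where
  "half_split n I1 I2 \<longleftrightarrow>
     even n \<and> I1 \<union> I2 = {1..n} \<and> I1 \<inter> I2 = {} \<and> card I1 = n div 2 \<and> card I2 = n div 2"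


text \<open>Statistics of a realised data set \<open>D i = (X\<^sub>i, Y\<^sub>i)\<close>.\<close>

definition psi :: "real vec \<times> real \<Rightarrow> real vec \<Rightarrow> real vec" where
  "psi z \<theta> = - (snd z - fst z \<bullet> \<theta>) \<cdot>\<^sub>v fst z"

definition vec_mean :: "nat \<Rightarrow> nat set \<Rightarrow> (nat \<Rightarrow> real vec) \<Rightarrow> real vec" where
  "vec_mean d I v = vec d (\<lambda>j. (\<Sum>i\<in>I. v i $ j) / real (card I))"

definition mat_mean :: "nat \<Rightarrow> nat set \<Rightarrow> (nat \<Rightarrow> real mat) \<Rightarrow> real mat" where
  "mat_mean d I A = mat d d (\<lambda>(j, k). (\<Sum>i\<in>I. A i $$ (j, k)) / real (card I))"

definition ols :: "nat \<Rightarrow> nat set \<Rightarrow> (nat \<Rightarrow> real vec \<times> real) \<Rightarrow> real vec" where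
  "ols d I D = arg_min_on (\<lambda>\<theta>. \<Sum>i\<in>I. (snd (D i) - fst (D i) \<bullet> \<theta>)\<^sup>2) (carrier_vec d)"

definition Sigma_hat :: "nat \<Rightarrow> nat set \<Rightarrow> (nat \<Rightarrow> real vec \<times> real) \<Rightarrow> real mat" where
  "Sigma_hat d I D = mat_mean d I (\<lambda>i. outer (fst (D i)) (fst (D i)))"

definition psi_bar :: "nat \<Rightarrow> nat set \<Rightarrow> (nat \<Rightarrow> real vec \<times> real) \<Rightarrow> real vec \<Rightarrow> real vec" where
  "psi_bar d I D \<theta> = vec_mean d I (\<lambda>i. psi (D i) \<theta>)"

definition V_hat :: "nat \<Rightarrow> nat set \<Rightarrow> (nat \<Rightarrow> real vec \<times> real) \<Rightarrow> real vec \<Rightarrow> real mat" where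
  "V_hat d I D \<theta> =
     mat_mean d I (\<lambda>i. outer (psi (D i) \<theta> - psi_bar d I D \<theta>) (psi (D i) \<theta> - psi_bar d I D \<theta>))"

text \<open>Division is that of \<^typ>\<open>ereal\<close>, so \<open>c / 0 = \<infinity>\<close> for \<open>c > 0\<close>, and \<open>0 / 0 = 0\<close>.\<close>

definition t_ratio :: "nat \<Rightarrow> real vec \<Rightarrow> real mat \<Rightarrow> real vec \<Rightarrow> real mat \<Rightarrow> ereal" where
  "t_ratio m v A p W =
     ereal (sqrt (real m) * \<bar>v \<bullet> (A *\<^sub>v p)\<bar>) / ereal (sqrt (v \<bullet> ((A * W * A) *\<^sub>v v)))"

definition upper_quantile :: "real \<Rightarrow> real" where
  "upper_quantile \<gamma> = (THE x. measure std_normal_distribution {x<..} = \<gamma>)"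

definition C_SeN ::
    "nat \<Rightarrow> nat set \<Rightarrow> nat set \<Rightarrow> (nat \<Rightarrow> real vec \<times> real) \<Rightarrow> real vec \<Rightarrow> real \<Rightarrow> real vec set" where
  "C_SeN d I1 I2 D \<xi> \<alpha> =
     {\<theta> \<in> carrier_vec d.
        t_ratio (card I1) \<xi> (minv (Sigma_hat d I2 D)) (psi_bar d I1 D \<theta>) (V_hat d I1 D \<theta>)
          \<le> ereal (upper_quantile (\<alpha> / 2))}"

definition C_SpN ::
    "nat \<Rightarrow> nat set \<Rightarrow> nat set \<Rightarrow> (nat \<Rightarrow> real vec \<times> real) \<Rightarrow> real vec \<Rightarrow> real \<Rightarrow> real vec set" where
  "C_SpN d I1 I2 D \<xi> \<alpha> =
     {\<theta> \<in> carrier_vec d.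
        t_ratio (card I1) \<xi> (minv (Sigma_hat d I2 D)) (psi_bar d I1 D \<theta>) (V_hat d I1 D (ols d I2 D))
          \<le> ereal (upper_quantile (\<alpha> / 2))}"

definition T_SeN ::
    "nat \<Rightarrow> nat set \<Rightarrow> (nat \<Rightarrow> real vec \<times> real) \<Rightarrow> real vec \<Rightarrow> real mat \<Rightarrow> ereal" where
  "T_SeN d I1 D \<theta> A =
     Max ((\<lambda>j. t_ratio (card I1) (unit_vec d j) A (psi_bar d I1 D \<theta>) (V_hat d I1 D \<theta>)) ` {..<d})"

definition CI ::
    "nat \<Rightarrow> nat \<Rightarrow> nat set \<Rightarrow> nat set \<Rightarrow> (nat \<Rightarrow> real vec \<times> real) \<Rightarrow> real vec \<Rightarrow> real vec set \<Rightarrow> real set"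
  where
  "CI d n I1 I2 D \<xi> C =
     {\<xi> \<bullet> \<theta> | \<theta>. \<theta> \<in> C \<and>
        T_SeN d I1 D \<theta> (minv (Sigma_hat d I2 D)) \<le> ereal (upper_quantile (1 / (2 * real n * real d)))}"

definition CI_SeN ::
    "nat \<Rightarrow> nat \<Rightarrow> nat set \<Rightarrow> nat set \<Rightarrow> (nat \<Rightarrow> real vec \<times> real) \<Rightarrow> real vec \<Rightarrow> real \<Rightarrow> real set" where
  "CI_SeN d n I1 I2 D \<xi> \<alpha> = CI d n I1 I2 D \<xi> (C_SeN d I1 I2 D \<xi> \<alpha>)"

definition CI_SpN ::
    "nat \<Rightarrow> nat \<Rightarrow> nat set \<Rightarrow> nat set \<Rightarrow> (nat \<Rightarrow> real vec \<times> real) \<Rightarrow> real vec \<Rightarrow> real \<Rightarrow> real set" where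
  "CI_SpN d n I1 I2 D \<xi> \<alpha> = CI d n I1 I2 D \<xi> (C_SpN d I1 I2 D \<xi> \<alpha>)"

text \<open>The event that a projected confidence set misses a value is a projection, whose measurability
  is not immediate, while \<^const>\<open>measure\<close> is 0 off the measurable sets. Hence the outer
  measure, which agrees with the probability on every measurable event.\<close>

definition outer_prob :: "'a measure \<Rightarrow> ('a \<Rightarrow> bool) \<Rightarrow> real" where
  "outer_prob M Q = enn2real (outer_measure_of M {\<omega> \<in> space M. Q \<omega>})"

definition miscoverage_excess ::
    "'a measure \<Rightarrow> (nat \<Rightarrow> 'a \<Rightarrow> real vec \<times> real) \<Rightarrow> real \<Rightarrow>
     ((nat \<Rightarrow> real vec \<times> real) \<Rightarrow> real \<Rightarrow> real set) \<Rightarrow> real" where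
  "miscoverage_excess M Z t S =
     (SUP \<alpha>\<in>{0<..<1}. max (outer_prob M (\<lambda>\<omega>. t \<notin> S (\<lambda>i. Z i \<omega>) \<alpha>) - \<alpha>) 0)"

end

theory Submission
  imports Defs "HOL-Computational_Algebra.Formal_Power_Series"
begin

text \<open>Conditionally on the second half of the sample the direction \<open>v = \<Sigma>\<^sub>2\<inverse> \<xi>\<close> is fixed, and the ratio at
  \<open>\<beta>\<^sub>0\<close> is a self-normalised sum of the i.i.d. centred scores \<open>v \<bullet> \<psi>(Z\<^sub>i, \<beta>\<^sub>0)\<close>, whose standardised
  moments are bounded by the constants of the theorem alone. Coverage then follows from a two-sided
  Berry-Esseen bound for self-normalised sums, uniform over such laws: Stein's method with randomised
  concentration after truncation, and exponential tilting for large thresholds. The coordinatewise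
  constraint costs \<open>d\<close> tail probabilities at the level \<open>1/(2nd)\<close>.
  For the plug-in variance the extra error is of the order of the distance from the OLS estimator to
  \<open>\<beta>\<^sub>0\<close>. Its mean is \<open>O(\<surd>(d/n))\<close> off the event that the smallest eigenvalue of the empirical second
  moment matrix is small, and symmetrisation and contraction for truncated squares over a rational net
  of directions bound the probability of that event by \<open>O(\<surd>(d/n))\<close>.\<close>

text \<open>Coverage only asks that \<open>beta0\<close> itself satisfy the constraints, so the
  projection never has to be analysed. Centring the sample variance merely turns the threshold z for
  the studentised ratio into z / sqrt (1 + z^2 / m) for |S| / sqrt V. The obstacle is the random
  root. It is minorised by 1 + R/2 - R^2/2, with R the relative error of the sum of squares: the
  linear part is merged into the summands, the quadratic part becomes the random width of an
  interval, whence the randomised concentration inequality. The merged summands stay bounded only if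
  x * a stays below a constant, a being the truncation level in units of sqrt m. As x may reach the
  order of sqrt (log m), a is taken of order 1 / sqrt (log m), and a^(-s) is the source of the
  factor log^(s/2). With the plug-in variance a deterministic lower bound for the estimate suffices,
  and the threshold is no longer random. Lower bounds on sums of nonnegative terms are cheap in
  moments; the same is true of the smallest eigenvalue, where capped squares are Lipschitz and the
  dimension enters only through a trace.\<close>

lemmas sq_simps = power2_eq_square algebra_simps
lemmas sq_field_simps = power2_eq_square field_simps
lemmas Bintegral_cong = Bochner_Integration.integral_cong
lemmas Bintegrable_add = Bochner_Integration.integrable_add
lemmas Bintegral_add = Bochner_Integration.integral_add
lemmas Bintegrable_bound = Bochner_Integration.integrable_bound
lemmas Bintegral_sum = Bochner_Integration.integral_sum
lemmas Bintegrable_sum = Bochner_Integration.integrable_sum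
lemmas Bintegrable_diff = Bochner_Integration.integrable_diff
lemmas Bintegral_diff = Bochner_Integration.integral_diff

subsection \<open>Normal tail\<close>

abbreviation "dnorm \<equiv> std_normal_density"

definition Q :: "real => real" where
 "Q x = measure std_normal_distribution {x<..}"

interpretation stdn: prob_space std_normal_distribution
 using prob_space_normal_density[of 1 0] by simp

lemma dnorm_pos: "0 < dnorm x"
 by (rule normal_density_pos) simp

lemma dnorm_minus: "dnorm (- x) = dnorm x"
 by (simp add: std_normal_density_def)

lemma dnorm_deriv: "(dnorm has_real_derivative - x * dnorm x) (at x)"
 unfolding std_normal_density_def
 by (auto intro!: derivative_eq_intros simp: sq_field_simps)

lemma dnorm_le: "dnorm x <= 1 / 2"
proof -
 have "2 <= sqrt (2 * pi)"
  by (rule real_le_rsqrt) (use pi_gt3 in simp)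
 hence "1 / sqrt (2*pi) <= 1/2" by (simp add: field_simps)
 moreover have "exp (- x\<^sup>2 / 2) <= 1" by simp
 ultimately have "(1 / sqrt (2*pi)) * exp (- x\<^sup>2 / 2) <= (1/2) * 1"
  by (intro mult_mono) auto
 thus ?thesis by (simp add: std_normal_density_def)
qed

lemma dnorm_antimono: "0 <= x ==> x <= y ==> dnorm y <= dnorm x"
 unfolding std_normal_density_def
 by (intro mult_left_mono) (auto intro: power_mono)

lemma Q_diff: assumes "a <= b" shows "Q a - Q b = integral {a..b} dnorm"
proof -
 have "{a<..} = {a<..b} \<union> {b<..}" using assms by auto
 hence "Q a = measure std_normal_distribution {a<..b} + Q b"
  unfolding Q_def by (simp add: stdn.finite_measure_Union Int_def)
 moreover have "measure std_normal_distribution {a<..b} = integral {a..b} dnorm"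
 proof -
  have "measure std_normal_distribution {a<..b}
    = (LINT x|std_normal_distribution. indicator {a<..b} x)" by simp
  also have "... = (LINT x|lborel. dnorm x * indicator {a<..b} x)"
   by (subst integral_real_density) auto
  also have "... = (LINT x|lborel. indicator {a..b} x * dnorm x)"
  proof (rule integral_cong_AE)
   show "AE x in lborel. dnorm x * indicator {a<..b} x = indicator {a..b} x * dnorm x"
    using AE_lborel_singleton[of a] by eventually_elim (auto simp: indicator_def)
  qed auto
  also have "... = set_lebesgue_integral lborel {a..b} dnorm"
   by (simp add: set_lebesgue_integral_def)
  also have "... = integral {a..b} dnorm"
   by (intro set_borel_integral_eq_integral(2))
    (use integrable_mult_indicator[of "{a..b}" lborel dnorm] integrable_normal_density[of 1 0]
    in \<open>auto simp: set_integrable_def\<close>)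
  finally show ?thesis .
 qed
 ultimately show ?thesis by simp
qed

lemma continuous_dnorm: "continuous_on S dnorm"
 by (metis DERIV_isCont continuous_at_imp_continuous_on dnorm_deriv)

lemma Q_deriv: "(Q has_real_derivative - dnorm x) (at x)"
proof -
 have 1: "((%t. integral {x-1..t} dnorm) has_real_derivative dnorm x) (at x within {x-1..x+1})"
  by (rule integral_has_real_derivative[OF continuous_dnorm]) auto
 have "((%t. integral {x-1..t} dnorm) has_real_derivative dnorm x) (at x)"
  using 1 by (subst (asm) at_within_interior) (auto simp: interior_atLeastAtMost_real)
 hence "((%t. Q (x - 1) - integral {x-1..t} dnorm) has_real_derivative - dnorm x) (at x)"
  by (auto intro!: derivative_eq_intros)
 moreover have "eventually (%t. Q (x - 1) - integral {x-1..t} dnorm = Q t) (nhds x)"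
 proof -
  have "eventually (%t. t \<in> {x-1<..}) (nhds x)"
   by (intro eventually_nhds_in_open) auto
  thus ?thesis by eventually_elim (simp add: Q_diff[symmetric])
 qed
 ultimately show ?thesis by (subst DERIV_cong_ev[OF refl _ refl, symmetric]) auto
qed

lemma Q_nonneg: "0 <= Q x" and Q_le_1: "Q x <= 1"
 by (simp_all add: Q_def)

lemma Q_strict_antimono: assumes "x < y" shows "Q y < Q x"
 using DERIV_neg_imp_decreasing[OF assms, of Q] Q_deriv dnorm_pos by (meson neg_less_0_iff_less)

lemma Q_antimono: "x <= y ==> Q y <= Q x"
 using Q_strict_antimono[of x y] by (cases "x = y") auto

text \<open>The density is even, so Q (- x) + Q x has derivative zero and is constant; its limit
  along the naturals identifies the constant as 1.\<close>

lemma Q_minus: "Q (- x) = 1 - Q x"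
proof -
 have "DERIV (%x. Q (- x) + Q x) x :> 0" for x
  by (auto intro!: derivative_eq_intros DERIV_chain'[where g=Q, OF _ Q_deriv]
    Q_deriv simp: dnorm_minus)
 hence c: "Q (- x) + Q x = Q (-0) + Q 0" for x
  by (metis (no_types, lifting) DERIV_isconst_all)
 have "((%n. measure std_normal_distribution {real n<..}) \<longlonglongrightarrow>
   measure std_normal_distribution (\<Inter>n. {real n<..}))"
  by (rule stdn.finite_Lim_measure_decseq) (auto simp: decseq_def)
 moreover have "(\<Inter>n. {real n<..}) = {}"
  by (auto, metis less_asym reals_Archimedean2)
 ultimately have l1: "(%n. Q (real n)) \<longlonglongrightarrow> 0" by (simp add: Q_def)
 have "((%n. measure std_normal_distribution {- real n<..}) \<longlonglongrightarrow>
   measure std_normal_distribution (\<Union>n. {- real n<..}))"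
  by (rule stdn.finite_Lim_measure_incseq) (auto simp: incseq_def)
 moreover have "(\<Union>n. {- real n<..}) = UNIV"
  by (auto, metis minus_less_iff reals_Archimedean2)
 ultimately have l2: "(%n. Q (- real n)) \<longlonglongrightarrow> 1" using stdn.prob_space by (simp add: Q_def)
 have "(%n. Q (- real n) + Q (real n)) \<longlonglongrightarrow> 1 + 0" using tendsto_add[OF l2 l1] .
 hence "Q 0 + Q 0 = 1" using c by (simp add: LIMSEQ_const_iff)
 thus ?thesis using c[of x] by simp
qed

lemma Q_0: "Q 0 = 1 / 2" using Q_minus[of 0] by simp

lemma Q_at_top: "(Q \<longlongrightarrow> 0) at_top"
proof -
 have "(%n. Q (real n)) \<longlonglongrightarrow> 0"
 proof -
  have "((%n. measure std_normal_distribution {real n<..}) \<longlonglongrightarrow>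
    measure std_normal_distribution (\<Inter>n. {real n<..}))"
   by (rule stdn.finite_Lim_measure_decseq) (auto simp: decseq_def)
  moreover have "(\<Inter>n. {real n<..}) = {}"
   by (auto, metis less_asym reals_Archimedean2)
  ultimately show ?thesis by (simp add: Q_def)
 qed
 show ?thesis
 proof (rule tendstoI)
  fix e :: real assume "e > 0"
  from LIMSEQ_D[OF \<open>(%n. Q (real n)) \<longlonglongrightarrow> 0\<close> this] obtain n where n: "Q (real n) < e"
   by (auto simp: Q_nonneg abs_of_nonneg)
  have "eventually (%x. x \<ge> real n) at_top" by (rule eventually_ge_at_top)
  thus "eventually (%x. dist (Q x) 0 < e) at_top"
  proof eventually_elim
   case (elim x)
   thus ?case using Q_antimono[of "real n" x] n by (simp add: Q_nonneg abs_of_nonneg)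
  qed
 qed
qed

lemma Q_Lipschitz: "Q x - Q y <= abs (x - y) / 2"
proof (cases "x < y")
 case True
 from MVT2[OF this, of Q "%x. - dnorm x"] Q_deriv obtain z where
  "Q y - Q x = (y - x) * - dnorm z" by blast
 hence "Q x - Q y = (y - x) * dnorm z" by simp
 also have "... <= (y - x) * (1/2)" using dnorm_le[of z] True by (intro mult_left_mono) auto
 finally show ?thesis using True by simp
next
 case False
 hence "Q x - Q y <= 0" using Q_antimono by simp
 also have "0 <= abs (x - y) / 2" by simp
 finally show ?thesis .
qed

text \<open>To the right of x the function dnorm t - x * Q t is nonincreasing in t and tends to 0,
  hence it is nonnegative at t = x.\<close>

lemma Mills_upper: assumes "0 <= x" shows "x * Q x <= dnorm x"
proof (cases "x = 0")
 case True thus ?thesis using dnorm_pos[of 0] by simp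
next
 case False
 hence x: "0 < x" using assms by simp
 have lim: "((%t. dnorm t - x * Q t) \<longlongrightarrow> 0 - x * 0) at_top"
 proof (intro tendsto_intros Q_at_top)
  show "(dnorm \<longlongrightarrow> 0) at_top"
   unfolding std_normal_density_def by real_asymp
 qed
 have mono: "dnorm t - x * Q t \<ge> dnorm t' - x * Q t'" if "x <= t" "t <= t'" for t t'
 proof (rule DERIV_nonpos_imp_nonincreasing[OF that(2)])
  fix u assume "t <= u" "u <= t'"
  have "((%t. dnorm t - x * Q t) has_real_derivative (- u * dnorm u - x * (- dnorm u))) (at u)"
   by (auto intro!: derivative_eq_intros dnorm_deriv Q_deriv)
  moreover have "- u * dnorm u - x * (- dnorm u) <= 0"
   using \<open>t <= u\<close> that dnorm_pos[of u] by (simp add: algebra_simps mult_right_mono)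
  ultimately show "\<exists>y. ((%t. dnorm t - x * Q t) has_real_derivative y) (at u) \<and> y <= 0" by blast
 qed
 have "0 <= dnorm x - x * Q x"
 proof (rule tendsto_upperbound[OF lim[simplified]])
  show "\<forall>\<^sub>F t in at_top. dnorm t - x * Q t <= dnorm x - x * Q x"
   using eventually_ge_at_top[of x] by eventually_elim (rule mono, auto)
 qed auto
 thus ?thesis by simp
qed

text \<open>A mean value on [x, x + 1] is crude but loses only a shift of the argument by 1, which
  the lower bound on quantiles can afford.\<close>

lemma Q_lower: "dnorm (x + 1) <= Q x" if "0 <= x"
proof -
 from MVT2[of x "x+1" Q "%x. - dnorm x"] Q_deriv obtain z where
  z: "x < z" "z < x + 1" "Q (x+1) - Q x = (x + 1 - x) * - dnorm z" by auto
 have "dnorm (x+1) <= dnorm z" using z that by (intro dnorm_antimono) auto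
 thus ?thesis using z Q_nonneg[of "x+1"] by simp
qed

text \<open>For x <= 1/2 the right side is at least 7/8 while Q is at most 1/2; beyond that Mills'
  inequality gives Q x <= 2 * dnorm x, and 2 / sqrt (2 * pi) <= 1.\<close>

lemma Q_le_exp: assumes "0 <= x" shows "Q x <= exp (- x\<^sup>2 / 2)"
proof -
 have "Q x - exp (- x\<^sup>2 / 2) <= 0"
 proof (cases "x <= 1/2")
  case True
  have "x^2 <= (1/2)^2" using True assms by (intro power_mono) auto
  hence "- x\<^sup>2 / 2 \<ge> - 1/8" by (simp add: power2_eq_square)
  moreover have "exp (- x\<^sup>2 / 2) \<ge> 1 + (- x\<^sup>2/2)" by (rule exp_ge_add_one_self)
  ultimately have "exp (- x\<^sup>2 / 2) \<ge> 7/8" by linarith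
  thus ?thesis using Q_antimono[OF assms] Q_0 by simp
 next
  case False
  have "x * Q x <= dnorm x" by (rule Mills_upper[OF assms])
  hence "Q x <= dnorm x / x" using False by (simp add: field_simps)
  also have "... <= dnorm x / (1/2)" using False dnorm_pos[of x] by (intro divide_left_mono) auto
  also have "... = (2 / sqrt (2*pi)) * exp (- x\<^sup>2 / 2)" by (simp add: std_normal_density_def)
  also have "... <= 1 * exp (- x\<^sup>2 / 2)"
  proof (rule mult_right_mono)
   have "2 <= sqrt (2 * pi)" by (rule real_le_rsqrt) (use pi_gt3 in simp)
   thus "2 / sqrt (2*pi) <= 1" by (simp add: field_simps)
  qed simp
  finally show ?thesis by simp
 qed
 thus ?thesis by simp
qed

text \<open>The description operator in \<open>upper_quantile\<close> is resolved by continuity,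
  through the intermediate value theorem, and strict monotonicity of Q.\<close>

lemma Q_upper_quantile: assumes "0 < g" "g < 1" shows "Q (upper_quantile g) = g"
proof -
 have cont: "continuous_on S Q" for S
  by (metis DERIV_isCont continuous_at_imp_continuous_on Q_deriv)
 have ev: "\<exists>b\<ge>0. Q b < c" if "c > 0" for c :: real
 proof -
  have "eventually (%x. Q x < c) at_top" using order_tendstoD(2)[OF Q_at_top that] .
  hence "eventually (%x. Q x < c \<and> x \<ge> 0) at_top"
   using eventually_ge_at_top[of 0] by eventually_elim auto
  thus ?thesis unfolding eventually_at_top_linorder by blast
 qed
 obtain b where b: "b \<ge> 0" "Q b < g" using ev[of g] assms by auto
 obtain a where a: "a \<ge> 0" "Q a < 1 - g" using ev[of "1-g"] assms by auto
 have "\<exists>x\<ge>-a. x <= b \<and> Q x = g"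
  using a b Q_minus[of a] by (intro IVT2'[OF _ _ _ cont]) auto
 then obtain x where x: "Q x = g" by blast
 have "upper_quantile g = x"
  unfolding upper_quantile_def Q_def[symmetric]
  using x by (intro the_equality) (auto, metis Q_strict_antimono linorder_neqE_linordered_idom order_less_irrefl)
 thus ?thesis using x by simp
qed

lemma upper_quantile_nonneg: assumes "0 < g" "g <= 1/2" shows "0 <= upper_quantile g"
proof (rule ccontr)
 assume "\<not> 0 <= upper_quantile g"
 hence "Q 0 < Q (upper_quantile g)" by (intro Q_strict_antimono) auto
 thus False using Q_upper_quantile[of g] assms Q_0 by simp
qed

subsection \<open>Stein's equation\<close>

text \<open>The two smooth branches of the bounded solution of Stein's equation f'(w) - w * f(w) =
  1{w <= z} - (1 - Q z). They are kept as functions on the whole line so that the mean value theorem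
  applies to each of them on its side of z.\<close>

definition stein1 :: "real => real => real" where
 "stein1 z w = Q z * (1 - Q w) / dnorm w"

definition stein2 :: "real => real => real" where
 "stein2 z w = (1 - Q z) * Q w / dnorm w"

definition stein :: "real => real => real" where
 "stein z w = (if w <= z then stein1 z w else stein2 z w)"

text \<open>Defined by solving Stein's equation for f' rather than as a derivative, so that it has a
  value at w = z, where the solution has a kink.\<close>

definition stein' :: "real => real => real" where
 "stein' z w = w * stein z w + (if w <= z then 1 else 0) - (1 - Q z)"

lemma stein1_deriv: "(stein1 z has_real_derivative w * stein1 z w + Q z) (at w)"
 unfolding stein1_def
 using dnorm_pos[of w]
 by (auto intro!: derivative_eq_intros dnorm_deriv Q_deriv simp: field_simps)

lemma stein2_deriv: "(stein2 z has_real_derivative w * stein2 z w - (1 - Q z)) (at w)"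
 unfolding stein2_def
 using dnorm_pos[of w]
 by (auto intro!: derivative_eq_intros dnorm_deriv Q_deriv simp: field_simps)

definition Mills :: "real => real" where "Mills x = Q x / dnorm x"

text \<open>The bound 2 comes from x * Mills x <= 1 when x >= 1/2, and from Q x <= 1/2 together with
  dnorm x >= 1/4 when x < 1/2.\<close>

lemma Mills_bounds: assumes "0 <= x" shows "0 <= Mills x" "x * Mills x <= 1" "Mills x <= 2"
proof -
 show "0 <= Mills x" using dnorm_pos[of x] Q_nonneg[of x] by (simp add: Mills_def)
 show A: "x * Mills x <= 1" using Mills_upper[OF assms] dnorm_pos[of x] by (simp add: Mills_def field_simps)
 show "Mills x <= 2"
 proof (cases "x \<ge> 1/2")
  case True
  have "1/2 * Mills x <= x * Mills x" using True \<open>0 <= Mills x\<close> by (intro mult_right_mono) auto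
  thus ?thesis using A by simp
 next
  case False
  have "dnorm (1/2) <= dnorm x" using False assms by (intro dnorm_antimono) auto
  moreover have "dnorm (1/2) \<ge> 1/4"
  proof -
   have "sqrt (2 * pi) <= 3" by (rule real_le_lsqrt) (use pi_less_4 in simp_all)
   hence "1 / sqrt (2*pi) \<ge> 1/3" by (simp add: field_simps)
   moreover have "exp (- (1/2)\<^sup>2/2) \<ge> (1 + (- (1/2)\<^sup>2/2 :: real))" by (rule exp_ge_add_one_self)
   hence "exp (- (1/2)\<^sup>2/2) \<ge> (7/8::real)" by (simp add: power2_eq_square)
   ultimately have "(1 / sqrt (2*pi)) * exp (- (1/2)\<^sup>2/2) \<ge> 1/3 * (7/8)"
    by (intro mult_mono) auto
   moreover have "dnorm (1/2) = (1 / sqrt (2*pi)) * exp (- (1/2)\<^sup>2/2)"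
    by (simp only: std_normal_density_def)
   ultimately show ?thesis by linarith
  qed
  moreover have "Q x <= 1/2" using Q_antimono[OF assms] Q_0 by simp
  ultimately show ?thesis using dnorm_pos[of x] by (simp add: Mills_def field_simps)
 qed
qed

text \<open>On either side of z one of the two tail factors is compared with the corresponding
  factor at w by monotonicity of Q and the other one is at most 1. Comparison with the Mills ratio
  at |w| yields the bounds on f and on w * f at once.\<close>

lemma stein_le_Mills: "0 <= stein z w" "stein z w <= Mills \<bar>w\<bar>"
proof -
 note p = dnorm_pos[of w] Q_nonneg[of z] Q_nonneg[of w] Q_le_1[of z] Q_le_1[of w]
 show "0 <= stein z w" using p by (auto simp: stein_def stein1_def stein2_def)
 have d: "dnorm \<bar>w\<bar> = dnorm w" by (cases "w \<ge> 0") (auto simp: dnorm_minus)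
 have "(if w <= z then Q z * (1 - Q w) else (1 - Q z) * Q w) <= Q \<bar>w\<bar>"
 proof (cases "w <= z")
  case True
  hence "Q z <= Q w" by (rule Q_antimono)
  show ?thesis
  proof (cases "w \<ge> 0")
   case T: True
   have "Q z * (1 - Q w) <= Q w * 1" using p \<open>Q z <= Q w\<close> by (intro mult_mono) auto
   thus ?thesis using T True by simp
  next
   case F: False
   have "Q z * (1 - Q w) <= 1 * (1 - Q w)" using p by (intro mult_right_mono) auto
   thus ?thesis using F True Q_minus[of w] by simp
  qed
 next
  case False
  hence "Q w <= Q z" by (intro Q_antimono) auto
  show ?thesis
  proof (cases "w \<ge> 0")
   case T: True
   have "(1 - Q z) * Q w <= 1 * Q w" using p by (intro mult_right_mono) auto
   thus ?thesis using T False by simp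
  next
   case F: False
   have "(1 - Q z) * Q w <= (1 - Q w) * 1" using p \<open>Q w <= Q z\<close> by (intro mult_mono) auto
   thus ?thesis using F False Q_minus[of w] by simp
  qed
 qed
 hence "(if w <= z then Q z * (1 - Q w) else (1 - Q z) * Q w) / dnorm w <= Q \<bar>w\<bar> / dnorm w"
  using p by (intro divide_right_mono) auto
 thus "stein z w <= Mills \<bar>w\<bar>"
  by (auto simp: Mills_def d stein_def stein1_def stein2_def split: if_splits)
qed

lemma stein_bounds: "abs (stein z w) <= 2" "abs (w * stein z w) <= 1"
proof -
 show "abs (stein z w) <= 2" using stein_le_Mills[where z=z and w=w] Mills_bounds(3)[of "abs w"] by simp
 have "abs (w * stein z w) = abs w * stein z w" using stein_le_Mills(1) by (simp add: abs_mult)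
 also have "... <= abs w * Mills \<bar>w\<bar>" using stein_le_Mills(2) by (intro mult_left_mono) auto
 also have "... <= 1" by (rule Mills_bounds) simp
 finally show "abs (w * stein z w) <= 1" .
qed

lemma stein'_bound: "abs (stein' z w) <= 2"
 using stein_bounds(2)[where z=z and w=w] Q_nonneg[of z] Q_le_1[of z]
 unfolding stein'_def by (auto split: if_splits)

lemma stein_at: "stein1 z z = stein2 z z" by (simp add: stein1_def stein2_def)

lemma stein_MVT:
 assumes "a < b" "b <= z \<or> z <= a"
 shows "\<exists>c. a < c \<and> c < b \<and> stein z b - stein z a = (b - a) * stein' z c"
 using assms(2)
proof
 assume b: "b <= z"
 from MVT2[OF assms(1), of "stein1 z" "%w. w * stein1 z w + Q z"] stein1_deriv obtain c where
  c: "a < c" "c < b" "stein1 z b - stein1 z a = (b - a) * (c * stein1 z c + Q z)" by blast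
 moreover have "stein z b = stein1 z b" "stein z a = stein1 z a" "stein' z c = c * stein1 z c + Q z"
  using b c by (auto simp: stein_def stein'_def)
 ultimately show ?thesis by auto
next
 assume a: "z <= a"
 from MVT2[OF assms(1), of "stein2 z" "%w. w * stein2 z w - (1 - Q z)"] stein2_deriv obtain c where
  c: "a < c" "c < b" "stein2 z b - stein2 z a = (b - a) * (c * stein2 z c - (1 - Q z))" by blast
 moreover have "stein z b = stein2 z b" "stein z a = stein2 z a" "stein' z c = c * stein2 z c - (1 - Q z)"
  using a c assms(1) stein_at[of z] by (auto simp: stein_def stein'_def)
 ultimately show ?thesis by auto
qed

lemma stein_Lipschitz: "abs (stein z x - stein z y) <= 2 * abs (x - y)"
proof -
 have one: "abs (stein z b - stein z a) <= 2 * (b - a)" if "a <= b" "b <= z \<or> z <= a" for a b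
 proof (cases "a = b")
  case False
  with stein_MVT[of a b z] that obtain c where "stein z b - stein z a = (b - a) * stein' z c" by force
  hence "abs (stein z b - stein z a) = (b - a) * abs (stein' z c)" using that(1) by (simp add: abs_mult)
  also have "... <= (b - a) * 2" using stein'_bound[of z c] that(1) by (intro mult_left_mono) auto
  finally show ?thesis by simp
 qed simp
 have two: "abs (stein z b - stein z a) <= 2 * (b - a)" if "a <= b" for a b
 proof (cases "b <= z \<or> z <= a")
  case True thus ?thesis using one that by blast
 next
  case False
  have "abs (stein z z - stein z a) <= 2 * (z - a)" "abs (stein z b - stein z z) <= 2 * (b - z)"
   using False one[of a z] one[of z b] by auto
  thus ?thesis by (auto simp: abs_le_iff)
 qed
 show ?thesis using two[of x y] two[of y x] by (cases "x <= y") auto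
qed

text \<open>The derivative is Lipschitz, up to a factor growing with |w|, except for a unit jump at
  z. The indicator records whether the jump lies within reach of u; its expectation is what the
  concentration inequality has to control.\<close>

lemma stein'_diff:
 "abs (stein' z (w + u) - stein' z w) <= 2 * abs u * (1 + abs w) + (if abs (w - z) <= abs u then 1 else 0)"
proof -
 have e: "(w + u) * stein z (w + u) - w * stein z w
   = u * stein z (w + u) + w * (stein z (w + u) - stein z w)" by (simp add: algebra_simps)
 have "abs (u * stein z (w + u)) <= abs u * 2"
  using stein_bounds(1) by (simp add: abs_mult mult_left_mono)
 moreover have "abs (w * (stein z (w + u) - stein z w)) <= abs w * (2 * abs u)"
  using stein_Lipschitz[of z "w+u" w] by (simp add: abs_mult mult_left_mono)
 ultimately have "abs ((w + u) * stein z (w + u) - w * stein z w) <= 2 * abs u * (1 + abs w)"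
  unfolding e by (simp add: algebra_simps)
 moreover have "abs ((if w + u <= z then 1 else 0) - (if w <= z then 1 else 0))
   <= (if abs (w - z) <= abs u then 1 else (0::real))" by auto
 ultimately show ?thesis unfolding stein'_def by linarith
qed

text \<open>If z is within reach, only the Lipschitz bound 2 * |u| and |f'| <= 2 are available,
  whence the constant 4. Otherwise no kink is crossed and the increment is u times a derivative at
  an intermediate point, to which the previous estimate applies.\<close>

lemma stein_Taylor:
 "abs (stein z (w + u) - stein z w - u * stein' z w)
  <= abs u * (2 * abs u * (1 + abs w) + (if abs (w - z) <= abs u then 4 else 0))"
proof (cases "abs (w - z) <= abs u")
 case True
 have "abs (stein z (w + u) - stein z w) <= 2 * abs u" using stein_Lipschitz[of z "w+u" w] by simp
 moreover have "abs (u * stein' z w) <= abs u * 2"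
  using stein'_bound by (simp add: abs_mult mult_left_mono)
 moreover have "0 <= abs u * (2 * abs u * (1 + abs w))" by simp
 ultimately have "abs (stein z (w + u) - stein z w - u * stein' z w)
   <= abs u * (2 * abs u * (1 + abs w)) + abs u * 4" by linarith
 thus ?thesis using True by (simp add: distrib_left)
next
 case False
 have "\<exists>t. abs t <= abs u \<and> stein z (w + u) - stein z w = u * stein' z (w + t)"
 proof (cases "u = 0")
  case u: False
  show ?thesis
  proof (cases "u > 0")
   case True
   with False have "w + u <= z \<or> z <= w" by auto
   from stein_MVT[OF _ this] True obtain c where
    "w < c" "c < w + u" "stein z (w+u) - stein z w = u * stein' z c" by auto
   thus ?thesis by (intro exI[of _ "c - w"]) auto
  next
   case F: False
   with u False have "w <= z \<or> z <= w + u" by auto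
   from stein_MVT[OF _ this] F u obtain c where
    "w + u < c" "c < w" "stein z w - stein z (w+u) = (-u) * stein' z c" by auto
   thus ?thesis by (intro exI[of _ "c - w"]) auto
  qed
 qed auto
 then obtain t where t: "abs t <= abs u" "stein z (w + u) - stein z w = u * stein' z (w + t)" by blast
 have "abs (stein z (w + u) - stein z w - u * stein' z w) = abs u * abs (stein' z (w + t) - stein' z w)"
  unfolding t(2) by (simp add: abs_mult[symmetric] algebra_simps)
 also have "... <= abs u * (2 * abs t * (1 + abs w) + (if abs (w - z) <= abs t then 1 else 0))"
  by (intro mult_left_mono stein'_diff) auto
 also have "... <= abs u * (2 * abs u * (1 + abs w) + 0)"
  using t(1) False by (intro mult_left_mono add_mono mult_right_mono) auto
 finally show ?thesis using False by simp
qed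

lemma borel_measurable_Q [measurable]: "Q \<in> borel_measurable borel"
 by (intro borel_measurable_continuous_onI continuous_at_imp_continuous_on ballI)
  (metis DERIV_isCont Q_deriv)

lemma borel_measurable_stein [measurable]: "stein z \<in> borel_measurable borel"
 unfolding stein_def[abs_def] stein1_def stein2_def by measurable

lemma borel_measurable_stein' [measurable]: "stein' z \<in> borel_measurable borel"
 unfolding stein'_def[abs_def] by measurable

subsection \<open>Bounded functions of independent coordinates\<close>

text \<open>The bound holds everywhere, not just almost everywhere: the class is then closed under
  products, maxima and substitution of coordinates, and integrability over every product space comes
  for free. Truncated summands belong to it.\<close>

definition bm :: "'c measure => ('c => real) => bool" where
 "bm M f \<longleftrightarrow> f \<in> borel_measurable M \<and> (\<exists>K. \<forall>x. abs (f x) <= K)"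

lemma bm_measurable [measurable_dest]: "bm M f ==> f \<in> borel_measurable M"
 by (simp add: bm_def)

lemma bm_bound: assumes "bm M f" obtains K where "0 <= K" "!!x. abs (f x) <= K"
 using assms unfolding bm_def by (metis abs_ge_zero order_trans)

lemma bmI: "f \<in> borel_measurable M ==> (!!x. abs (f x) <= K) ==> bm M f"
 unfolding bm_def by blast

named_theorems bm_intros

lemma bm_const [bm_intros]: "bm M (%_. c)"
 by (rule bmI[of _ _ "abs c"]) auto

lemma bm_add [bm_intros]: assumes "bm M f" "bm M g" shows "bm M (%x. f x + g x)"
proof -
 obtain K L where "!!x. abs (f x) <= K" "!!x. abs (g x) <= L" using assms by (metis bm_bound)
 thus ?thesis using assms
  by (intro bmI[of _ _ "K + L"]) (auto intro: order_trans[OF abs_triangle_ineq] add_mono)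
qed

lemma bm_mult [bm_intros]: assumes "bm M f" "bm M g" shows "bm M (%x. f x * g x)"
proof -
 obtain K L where "!!x. abs (f x) <= K" "!!x. abs (g x) <= L" "0 <= K" using assms by (metis bm_bound)
 thus ?thesis using assms
  by (intro bmI[of _ _ "K * L"]) (auto simp: abs_mult intro!: mult_mono)
qed

lemma bm_minus [bm_intros]: assumes "bm M f" shows "bm M (%x. - f x)"
 using bm_mult[OF bm_const[of M "-1"] assms] by simp

lemma bm_diff [bm_intros]: assumes "bm M f" "bm M g" shows "bm M (%x. f x - g x)"
 using bm_add[OF assms(1) bm_minus[OF assms(2)]] by simp

lemma bm_divide [bm_intros]: assumes "bm M f" shows "bm M (%x. f x / c)"
 using bm_mult[OF assms bm_const[of M "1/c"]] by simp

lemma bm_abs [bm_intros]: assumes "bm M f" shows "bm M (%x. abs (f x))"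
 using assms by (auto simp: bm_def)

lemma bm_power [bm_intros]: assumes "bm M f" shows "bm M (%x. f x ^ n)"
 by (induction n) (auto intro: bm_intros assms)

lemma bm_min [bm_intros]: assumes "bm M f" "bm M g" shows "bm M (%x. min (f x) (g x))"
proof -
 obtain K L where "!!x. abs (f x) <= K" "!!x. abs (g x) <= L" using assms by (metis bm_bound)
 hence "abs (min (f x) (g x)) <= max K L" for x by (metis max.coboundedI1 max.coboundedI2 min_def)
 thus ?thesis using assms by (intro bmI[of _ _ "max K L"]) auto
qed

lemma bm_max [bm_intros]: assumes "bm M f" "bm M g" shows "bm M (%x. max (f x) (g x))"
proof -
 obtain K L where "!!x. abs (f x) <= K" "!!x. abs (g x) <= L" using assms by (metis bm_bound)
 hence "abs (max (f x) (g x)) <= max K L" for x by (metis max.coboundedI1 max.coboundedI2 max_def)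
 thus ?thesis using assms by (intro bmI[of _ _ "max K L"]) auto
qed

lemma bm_sum [bm_intros]: assumes "!!i. i \<in> J ==> bm M (f i)" shows "bm M (%x. \<Sum>i\<in>J. f i x)"
 using assms by (induction J rule: infinite_finite_induct) (auto intro: bm_intros)

lemma bm_if [bm_intros]: assumes "Measurable.pred M P" shows "bm M (%x. if P x then c else (d::real))"
 using assms by (intro bmI[of _ _ "max \<bar>c\<bar> \<bar>d\<bar>"]) auto

lemma bm_comp: assumes "g \<in> borel_measurable borel" "!!x. abs (g x) <= (K::real)" "f \<in> borel_measurable M"
 shows "bm M (%x. g (f x))"
 using assms by (intro bmI[of _ _ K]) auto

lemma (in finite_measure) bm_integrable: "bm M f ==> integrable M f"
 by (metis bm_def integrable_const_bound AE_I2 real_norm_def)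

lemma pred_le:
 fixes f g :: "'c => real"
 assumes "f \<in> borel_measurable M" "g \<in> borel_measurable M"
 shows "Measurable.pred M (%x. f x <= g x)"
 unfolding pred_def by (rule borel_measurable_le[OF assms])

lemma pred_less:
 fixes f g :: "'c => real"
 assumes "f \<in> borel_measurable M" "g \<in> borel_measurable M"
 shows "Measurable.pred M (%x. f x < g x)"
 unfolding pred_def by (rule borel_measurable_less[OF assms])

definition SS :: "('b => real) => nat set => (nat => 'b) => real" where
 "SS f J w = (\<Sum>j\<in>J. f (w j))"

lemma SS_upd: "i \<notin> J ==> SS f J (x(i := y)) = SS f J x"
 unfolding SS_def by (intro sum.cong) auto

lemma SS_insert: "finite J ==> i \<notin> J ==> SS f (insert i J) x = SS f J x + f (x i)"
 unfolding SS_def by simp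

lemma SS_empty [simp]: "SS f {} x = 0" by (simp add: SS_def)

locale iid = prob_space N for N :: "'b measure"
begin

abbreviation PI :: "nat set => (nat => 'b) measure" where "PI J \<equiv> PiM J (%_. N)"

lemma prob_space_PI: "prob_space (PI J)"
 by (rule prob_space_PiM) (rule prob_space_axioms)

sublocale psf: product_sigma_finite "%_. N"
 by unfold_locales

lemma bm_coord [bm_intros]: assumes "bm N f" "i \<in> J" shows "bm (PI J) (%w. f (w i))"
proof -
 obtain K where "!!x. abs (f x) <= K" using assms by (metis bm_bound)
 thus ?thesis using assms
  by (intro bmI[of _ _ K]) (auto simp: bm_def intro!: measurable_compose[OF measurable_component_singleton[of i J]])
qed

lemma measurable_SS [measurable]:
 "f \<in> borel_measurable N ==> J \<subseteq> J' ==> SS f J \<in> borel_measurable (PI J')"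
 unfolding SS_def[abs_def]
 by (rule borel_measurable_sum) (auto intro!: measurable_compose[OF measurable_component_singleton])

lemma bm_SS [bm_intros]: "bm N f ==> J \<subseteq> J' ==> bm (PI J') (SS f J)"
 unfolding SS_def[abs_def] by (auto intro!: bm_intros)

lemma int_PI: "bm (PI J) f ==> integrable (PI J) f"
 using prob_space_PI by (meson finite_measure.bm_integrable prob_space_def)

lemma int_N: "bm N f ==> integrable N f" by (rule bm_integrable)

lemma measurable_upd:
 assumes "f \<in> borel_measurable (PI (insert i J))"
 shows "(%(x, y). f (x(i := y))) \<in> borel_measurable (PI J \<Otimes>\<^sub>M N)"
 using measurable_comp[OF measurable_add_dim[of i J "%_. N"] assms]
 by (simp add: comp_def split_beta')

lemma PI_insert_rev:
 assumes J: "finite J" "i \<notin> J" and f: "bm (PI (insert i J)) f"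
 shows "integral\<^sup>L (PI (insert i J)) f = (LINT y|N. (LINT x|PI J. f (x(i := y))))"
proof -
 interpret A: prob_space "PI J" by (rule prob_space_PI)
 interpret B: pair_prob_space "PI J" N ..
 obtain K where K: "!!x. abs (f x) <= K" using f by (metis bm_bound)
 have "integral\<^sup>L (PI (insert i J)) f = (LINT x|PI J. (LINT y|N. f (x(i := y))))"
  by (rule psf.product_integral_insert[OF J int_PI[OF f]])
 also have "... = (LINT y|N. (LINT x|PI J. f (x(i := y))))"
 proof (rule B.Fubini_integral[symmetric])
  show "integrable (PI J \<Otimes>\<^sub>M N) (%(x, y). f (x(i := y)))"
   using K measurable_upd[of f i J] f
   by (intro B.integrable_const_bound[of _ K]) (auto simp: bm_def)
 qed
 finally show ?thesis .
qed

text \<open>Independence of coordinate i from a function that ignores it; the latter is what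
  \<open>ind\<close> expresses.\<close>

lemma E_prod:
 assumes J: "finite J" "i \<notin> J" and a: "bm N a" and b: "bm (PI J) b" "bm (PI (insert i J)) b"
  and ind: "!!x y. b (x(i := y)) = b x"
 shows "(LINT w|PI (insert i J). a (w i) * b w) = (LINT y|N. a y) * (LINT x|PI J. b x)"
proof -
 have "(LINT w|PI (insert i J). a (w i) * b w) = (LINT y|N. (LINT x|PI J. a y * b x))"
  using a b by (subst PI_insert_rev[OF J]) (auto intro!: bm_intros simp: ind)
 thus ?thesis by simp
qed

text \<open>Conditioning on coordinate i: a bound on the expectation over the others, valid for each
  fixed value y, may be integrated in y.\<close>

lemma E_le:
 assumes J: "finite J" "i \<notin> J" and f: "bm (PI (insert i J)) f" and h: "bm N h"
  and le: "!!y. (LINT x|PI J. f (x(i := y))) <= h y"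
 shows "integral\<^sup>L (PI (insert i J)) f <= (LINT y|N. h y)"
proof -
 interpret A: prob_space "PI J" by (rule prob_space_PI)
 obtain K where K: "!!x. abs (f x) <= K" "0 <= K" using f by (metis bm_bound)
 have m: "(%(y, x). f (x(i := y))) \<in> borel_measurable (N \<Otimes>\<^sub>M PI J)"
  using measurable_upd[of f i J] f by (subst measurable_pair_swap_iff) (auto simp: bm_def)
 have "bm N (%y. \<integral>x. f (x(i := y)) \<partial>PI J)"
 proof (rule bmI[of _ _ K])
  show "(%y. \<integral>x. f (x(i := y)) \<partial>PI J) \<in> borel_measurable N"
   using m by (rule A.borel_measurable_lebesgue_integral)
  fix y
  have "abs (\<integral>x. f (x(i := y)) \<partial>PI J) <= (LINT x|PI J. abs (f (x(i := y))))" by (rule integral_abs_bound)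
  also have "... <= K"
  proof (cases "integrable (PI J) (%x. abs (f (x(i := y))))")
   case True
   have "(LINT x|PI J. abs (f (x(i := y)))) <= (LINT x|PI J. K)" using K True by (intro integral_mono) auto
   thus ?thesis using A.prob_space by simp
  next
   \<comment> \<open>A non-integrable section has integral 0 by convention, and K covers that
     value.\<close>
   case False thus ?thesis using K by (simp add: not_integrable_integral_eq)
  qed
  finally show "abs (\<integral>x. f (x(i := y)) \<partial>PI J) <= K" .
 qed
 thus ?thesis unfolding PI_insert_rev[OF J f] using le h by (intro integral_mono int_N) auto
qed

lemma E_coord:
 fixes f :: "'b => real"
 assumes "i \<in> J" "f \<in> borel_measurable N"
 shows "(LINT w|PI J. f (w i)) = integral\<^sup>L N f"
proof -
 have "integral\<^sup>L N f = integral\<^sup>L (distr (PI J) N (%w. w i)) f"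
  using distr_PiM_component[of J "%_. N" i] assms prob_space_axioms by auto
 also have "... = (LINT w|PI J. f (w i))"
  by (rule integral_distr[OF measurable_component_singleton[OF assms(1), of "%_. N"] assms(2)])
 finally show ?thesis by simp
qed

lemma integrable_coord:
 fixes f :: "'b => real"
 assumes "i \<in> J" "integrable N f"
 shows "integrable (PI J) (%w. f (w i))"
proof -
 have d: "distr (PI J) N (%w. w i) = N"
  using distr_PiM_component[of J "%_. N" i] assms prob_space_axioms by auto
 have "integrable (distr (PI J) N (%w. w i)) f" unfolding d by (rule assms)
 thus ?thesis
  using integrable_distr[OF measurable_component_singleton[OF assms(1), of "%_. N"], of f] by simp
qed

lemma E_SS: assumes "integrable N f" shows "(LINT w|PI J. SS f J w) = card J * integral\<^sup>L N f"
proof -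
 have "(LINT w|PI J. SS f J w) = (\<Sum>j\<in>J. \<integral>w. f (w j) \<partial>PI J)"
  unfolding SS_def using integrable_coord assms by (intro Bintegral_sum) auto
 also have "... = (\<Sum>j\<in>J. integral\<^sup>L N f)" using assms by (intro sum.cong E_coord) auto
 finally show ?thesis by simp
qed

lemma E_SS_SS:
 assumes J: "finite J" and f: "bm N f" "integral\<^sup>L N f = 0" and g: "bm N g" "integral\<^sup>L N g = 0"
 shows "(LINT w|PI J. SS f J w * SS g J w) = card J * (LINT y|N. f y * g y)"
 using J
proof (induction J)
 case empty thus ?case by simp
next
 case (insert i J)
 note b = f(1) g(1)
 have s1: "J \<subseteq> insert i J" by auto
 have "(LINT w|PI (insert i J). SS f (insert i J) w * SS g (insert i J) w)
  = (LINT w|PI (insert i J). (1 * (SS f J w * SS g J w) + g (w i) * SS f J w) +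
    (f (w i) * SS g J w + (f (w i) * g (w i)) * 1))"
  using insert by (intro Bintegral_cong) (auto simp: SS_insert algebra_simps)
 also have "... = ((LINT w|PI (insert i J). 1 * (SS f J w * SS g J w)) + (LINT w|PI (insert i J). g (w i) * SS f J w))
   + ((LINT w|PI (insert i J). f (w i) * SS g J w) + (LINT w|PI (insert i J). (f (w i) * g (w i)) * 1))"
  using b s1 by (subst Bintegral_add; (intro int_PI bm_intros)?; auto)+
 also have "(LINT w|PI (insert i J). 1 * (SS f J w * SS g J w)) = card J * (LINT y|N. f y * g y)"
  using insert b E_prod[of J i "%_. 1" "%w. SS f J w * SS g J w"] prob_space
  by (auto intro!: bm_intros simp: SS_upd)
 also have "(LINT w|PI (insert i J). g (w i) * SS f J w) = 0"
  using insert b g E_prod[of J i g "SS f J"] by (auto intro!: bm_intros simp: SS_upd)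
 also have "(LINT w|PI (insert i J). f (w i) * SS g J w) = 0"
  using insert b f E_prod[of J i f "SS g J"] by (auto intro!: bm_intros simp: SS_upd)
 also have "(LINT w|PI (insert i J). (f (w i) * g (w i)) * 1) = (LINT y|N. f y * g y)"
  using E_coord[of i "insert i J" "%y. f y * g y"] b by auto
 finally show ?case using insert by (simp add: algebra_simps)
qed

lemma E_SS_sq:
 assumes "finite J" "bm N f" "integral\<^sup>L N f = 0"
 shows "(LINT w|PI J. (SS f J w)^2) = card J * (LINT y|N. (f y)^2)"
 using E_SS_SS[OF assms assms(2,3)] by (simp add: power2_eq_square)

text \<open>The integral of the square of s * g - r * f equals s * (s * t - r^2), and s is
  positive.\<close>

lemma CS_bm:
 assumes "bm N f" "bm N g" "0 < (LINT y|N. (f y)^2)"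
 shows "(LINT y|N. f y * g y)^2 <= (LINT y|N. (f y)^2) * (LINT y|N. (g y)^2)"
proof -
 define s t r where "s = (LINT y|N. (f y)^2)" "t = (LINT y|N. (g y)^2)" "r = (LINT y|N. f y * g y)"
 have "0 <= (LINT y|N. (s * g y - r * f y)^2)" by simp
 also have "... = (LINT y|N. s^2 * (g y)^2 + (- (2 * s * r) * (f y * g y) + r^2 * (f y)^2))"
  by (intro Bintegral_cong) (auto simp: sq_simps)
 also have "... = s^2 * t + (- (2 * s * r) * r + r^2 * s)"
 proof -
  have "integrable N (%y. s^2 * (g y)^2)" "integrable N (%y. - (2 * s * r) * (f y * g y))"
   "integrable N (%y. r^2 * (f y)^2)" using assms by (auto intro!: int_N bm_intros)
  thus ?thesis
   by (simp only: Bintegral_add Bintegrable_add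
    integral_mult_right_zero s_t_r_def)
 qed
 also have "... = s * (s * t - r^2)" by (simp add: sq_simps)
 finally have "0 <= s * (s * t - r^2)" .
 hence "0 <= s * t - r^2" using assms(3) unfolding s_t_r_def by (simp add: zero_le_mult_iff)
 thus ?thesis unfolding s_t_r_def by simp
qed

text \<open>Adding one coordinate, all terms that are odd in the new or in the old centred factor
  vanish. The remainder is at most 6 * k * s * t + m by Cauchy-Schwarz, which fits the increment 3 *
  (k + 1)^2 - 3 * k^2 = 6 * k + 3 of the leading coefficient.\<close>

lemma E_SS_sq_sq:
 assumes J: "finite J" and f: "bm N f" "integral\<^sup>L N f = 0" and g: "bm N g" "integral\<^sup>L N g = 0"
  and s: "0 < (LINT y|N. (f y)^2)"
 shows "(LINT w|PI J. (SS f J w)^2 * (SS g J w)^2)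
  <= 3 * (card J * (LINT y|N. (f y)^2)) * (card J * (LINT y|N. (g y)^2))
    + card J * (LINT y|N. (f y)^2 * (g y)^2)"
 using J
proof (induction J)
 case empty thus ?case by simp
next
 case (insert i J)
 define s t r m where "s = (LINT y|N. (f y)^2)" "t = (LINT y|N. (g y)^2)" "r = (LINT y|N. f y * g y)"
  "m = (LINT y|N. (f y)^2 * (g y)^2)"
 note b = f(1) g(1)
 let ?P = "PI (insert i J)"
 let ?L = "SS f J" and ?Q = "SS g J"
 have s1: "J \<subseteq> insert i J" by auto
 have E: "(LINT w|?P. a (w i) * b w) = (LINT y|N. a y) * (LINT x|PI J. b x)"
  if "bm N a" "bm (PI J) b" "bm ?P b" "!!x y. b (x(i := y)) = b x" for a b
  using E_prod[OF insert(1,2) that] .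
 have bl: "bm ?P ?L" "bm ?P ?Q" "bm (PI J) ?L" "bm (PI J) ?Q" using b by (auto intro!: bm_intros)
 have z: "(LINT x|PI J. ?L x) = 0" "(LINT x|PI J. ?Q x) = 0"
  using E_SS[OF int_N] b f g by auto
 have q: "(LINT x|PI J. (?L x)^2) = card J * s" "(LINT x|PI J. (?Q x)^2) = card J * t"
  "(LINT x|PI J. ?L x * ?Q x) = card J * r"
  using E_SS_sq E_SS_SS insert(1) f g by (auto simp: s_t_r_m_def)
 have "(LINT w|?P. (SS f (insert i J) w)^2 * (SS g (insert i J) w)^2)
  = (LINT w|?P. 1 * ((?L w)^2 * (?Q w)^2) + (2 * f (w i) * (?L w * (?Q w)^2) + (2 * g (w i) * (?Q w * (?L w)^2)
    + ((g (w i))^2 * (?L w)^2 + ((f (w i))^2 * (?Q w)^2 + ((4 * f (w i) * g (w i)) * (?L w * ?Q w)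
    + ((2 * f (w i) * (g (w i))^2) * ?L w + ((2 * (f (w i))^2 * g (w i)) * ?Q w
    + ((f (w i))^2 * (g (w i))^2) * 1))))))))"
  using insert by (intro Bintegral_cong) (auto simp: SS_insert algebra_simps power2_eq_square)
 also have "... = (LINT w|?P. 1 * ((?L w)^2 * (?Q w)^2)) + ((LINT w|?P. 2 * f (w i) * (?L w * (?Q w)^2)) + ((LINT w|?P. 2 * g (w i) * (?Q w * (?L w)^2))
    + ((LINT w|?P. (g (w i))^2 * (?L w)^2) + ((LINT w|?P. (f (w i))^2 * (?Q w)^2) + ((LINT w|?P. (4 * f (w i) * g (w i)) * (?L w * ?Q w))
    + ((LINT w|?P. (2 * f (w i) * (g (w i))^2) * ?L w) + ((LINT w|?P. (2 * (f (w i))^2 * g (w i)) * ?Q w)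
    + (LINT w|?P. ((f (w i))^2 * (g (w i))^2) * 1))))))))"
 proof -
  have I: "integrable ?P (%w. a (w i) * c w)" if "bm N a" "bm ?P c" for a c
   using that by (intro int_PI bm_intros) auto
  note I' = I[of "%_. 1" "%w. (?L w)^2 * (?Q w)^2"] I[of "%y. 2 * f y" "%w. ?L w * (?Q w)^2"]
   I[of "%y. 2 * g y" "%w. ?Q w * (?L w)^2"] I[of "%y. (g y)^2" "%w. (?L w)^2"]
   I[of "%y. (f y)^2" "%w. (?Q w)^2"] I[of "%y. 4 * f y * g y" "%w. ?L w * ?Q w"]
   I[of "%y. 2 * f y * (g y)^2" "?L"] I[of "%y. 2 * (f y)^2 * g y" "?Q"] I[of "%y. (f y)^2 * (g y)^2" "%_. 1"]
  have "integrable ?P (%w. 1 * ((?L w)^2 * (?Q w)^2))" "integrable ?P (%w. 2 * f (w i) * (?L w * (?Q w)^2))"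
   "integrable ?P (%w. 2 * g (w i) * (?Q w * (?L w)^2))" "integrable ?P (%w. (g (w i))^2 * (?L w)^2)"
   "integrable ?P (%w. (f (w i))^2 * (?Q w)^2)" "integrable ?P (%w. (4 * f (w i) * g (w i)) * (?L w * ?Q w))"
   "integrable ?P (%w. (2 * f (w i) * (g (w i))^2) * ?L w)" "integrable ?P (%w. (2 * (f (w i))^2 * g (w i)) * ?Q w)"
   "integrable ?P (%w. ((f (w i))^2 * (g (w i))^2) * 1)"
   by (rule I'; intro bm_intros bl b)+
  thus ?thesis
   by (simp only: Bintegral_add Bintegrable_add)
 qed
 also have "(LINT w|?P. 1 * ((?L w)^2 * (?Q w)^2)) = (LINT w|PI J. (?L w)^2 * (?Q w)^2)"
  using E[of "%_. 1" "%w. (?L w)^2 * (?Q w)^2"] bl prob_space insert(2) by (simp add: bm_intros SS_upd)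
 also have "(LINT w|?P. 2 * f (w i) * (?L w * (?Q w)^2)) = 0"
  using E[of "%y. 2 * f y" "%w. ?L w * (?Q w)^2"] bl b f insert(2) by (simp add: bm_intros SS_upd)
 also have "(LINT w|?P. 2 * g (w i) * (?Q w * (?L w)^2)) = 0"
  using E[of "%y. 2 * g y" "%w. ?Q w * (?L w)^2"] bl b g insert(2) by (simp add: bm_intros SS_upd)
 also have "(LINT w|?P. (g (w i))^2 * (?L w)^2) = t * (card J * s)"
  using E[of "%y. (g y)^2" "%w. (?L w)^2"] bl b q insert(2) by (simp add: bm_intros SS_upd s_t_r_m_def)
 also have "(LINT w|?P. (f (w i))^2 * (?Q w)^2) = s * (card J * t)"
  using E[of "%y. (f y)^2" "%w. (?Q w)^2"] bl b q insert(2) by (simp add: bm_intros SS_upd s_t_r_m_def)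
 also have "(LINT w|?P. (4 * f (w i) * g (w i)) * (?L w * ?Q w)) = 4 * r * (card J * r)"
  using E[of "%y. 4 * f y * g y" "%w. ?L w * ?Q w"] bl b q insert(2) by (simp add: bm_intros SS_upd s_t_r_m_def mult.assoc)
 also have "(LINT w|?P. (2 * f (w i) * (g (w i))^2) * ?L w) = 0"
  using E[of "%y. 2 * f y * (g y)^2" "?L"] bl b z insert(2) by (simp add: bm_intros SS_upd)
 also have "(LINT w|?P. (2 * (f (w i))^2 * g (w i)) * ?Q w) = 0"
  using E[of "%y. 2 * (f y)^2 * g y" "?Q"] bl b z insert(2) by (simp add: bm_intros SS_upd)
 also have "(LINT w|?P. ((f (w i))^2 * (g (w i))^2) * 1) = m"
  using E_coord[of i "insert i J" "%y. (f y)^2 * (g y)^2"] b by (auto simp: s_t_r_m_def)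
 also have "(LINT w|PI J. (?L w)^2 * (?Q w)^2) + (0 + (0 + (t * (card J * s) + (s * (card J * t) + (4 * r * (card J * r) + (0 + (0 + m)))))))
  <= 3 * (card J * s) * (card J * t) + card J * m + (2 * card J * s * t + 4 * card J * r^2 + m)"
  using insert.IH by (simp add: s_t_r_m_def sq_simps)
 also have "... <= 3 * (card J * s) * (card J * t) + card J * m + (2 * card J * s * t + 4 * card J * (s * t) + m)"
  using CS_bm[OF b s] by (intro add_mono mult_left_mono order_refl) (auto simp: s_t_r_m_def)
 also have "... <= 3 * (card (insert i J) * s) * (card (insert i J) * t) + card (insert i J) * m"
 proof -
  have "0 <= s * t" by (simp add: s_t_r_m_def)
  thus ?thesis using insert by (simp add: algebra_simps)
 qed
 finally show ?case by (simp add: s_t_r_m_def)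
qed

end

section \<open>Concentration on intervals of random width\<close>

lemma max_Lip: "abs (a - a') <= e ==> abs (b - b') <= e ==> abs (max a b - max a' b') <= (e::real)"
 by (auto simp: max_def)

lemma min_Lip: "abs (a - a') <= e ==> abs (b - b') <= e ==> abs (min a b - min a' b') <= (e::real)"
 by (auto simp: min_def)

text \<open>The clamp is the test function of the concentration argument: as a function of w it has
  slope one on [z - D - dl, z + dl] and is constant outside. Both its centre and its levels move
  with D / 2.\<close>

lemma clamp_Lipschitz:
 fixes w z D D' dl :: real
 shows "abs (max (-(D/2+dl)) (min (D/2+dl) (w - z + D/2)) - max (-(D'/2+dl)) (min (D'/2+dl) (w - z + D'/2))) <= abs (D - D') / 2"
 by (intro max_Lip min_Lip) (auto simp: abs_if)

lemma clamp_bound: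
 fixes w z D dl :: real
 assumes "0 <= D" "0 <= dl"
 shows "abs (max (-(D/2+dl)) (min (D/2+dl) (w - z + D/2))) <= D/2 + dl"
 using assms by (auto simp: max_def min_def)

text \<open>Inside the window a shift by y stays on the slope for at least min |y| dl, in the
  direction of y; outside, monotonicity alone gives a nonnegative product.\<close>

lemma clamp_slope:
 fixes w z D dl y :: real
 assumes "0 <= D" "0 <= dl"
 defines "F \<equiv> %w. max (-(D/2+dl)) (min (D/2+dl) (w - z + D/2))"
 shows "(if z - D <= w \<and> w <= z then abs y * min \<bar>y\<bar> dl else 0) <= y * (F w - F (w - y))"
proof -
 have mono: "F u <= F v" if "u <= v" for u v
  unfolding F_def using that by (intro max.mono min.mono) auto
 have in1: "min h dl <= F w - F (w - h) \<and> min h dl <= F (w + h) - F w" if "z - D <= w" "w <= z" "0 <= h" for h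
 proof -
  define h' where "h' = min h dl"
  have h': "0 <= h'" "h' <= h" "h' <= dl" using that assms by (auto simp: h'_def)
  have F: "F u = u - z + D/2" if "z - D - dl <= u" "u <= z + dl" for u
   unfolding F_def using that by (auto simp: max_def min_def)
  have "F (w - h) <= F (w - h')" "F (w + h') <= F (w + h)" using h' by (auto intro: mono)
  moreover have "F (w - h') = w - h' - z + D/2" "F (w + h') = w + h' - z + D/2" "F w = w - z + D/2"
   using h' that assms by (subst F; simp)+
  ultimately show ?thesis unfolding h'_def[symmetric] by simp
 qed
 show ?thesis
 proof (cases "0 <= y")
  case True
  have "(if z - D <= w \<and> w <= z then min y dl else 0) <= F w - F (w - y)"
   using in1[of y] True mono[of "w - y" w] by auto
  from mult_left_mono[OF this True] show ?thesis using True by (auto split: if_splits)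
 next
  case False
  have "(if z - D <= w \<and> w <= z then min (-y) dl else 0) <= F (w - y) - F w"
   using in1[of "-y"] False mono[of w "w - y"] by auto
  from mult_left_mono[OF this, of "-y"] show ?thesis using False by (auto simp: algebra_simps split: if_splits)
 qed
qed

context iid
begin

text \<open>The expectation of L times the clamp is computed twice. From above it is small because
  the clamp is at most half the width plus dl. From below, comparison with the leave-one-out sum
  shows that it dominates the indicator of the event times Y, the sum of |h| * min |h| dl, and Y is
  unlikely to be small. The width depends on the sample through a square, so removing a coordinate
  changes it only by a controlled amount.\<close>

lemma randomised_concentration:
 assumes J: "finite J" and h: "bm N h" "integral\<^sup>L N h = 0" "!!y. abs (h y) <= 1"
  and q: "bm N q" "integral\<^sup>L N q = 0"
  and var: "1/2 <= card J * (LINT y|N. (h y)^2)" "card J * (LINT y|N. (h y)^2) <= 2"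
  and dl: "card J * (LINT y|N. abs (h y)^3) <= dl" "0 < dl" "dl <= 1"
  and nn: "0 <= lam" "0 <= c"
 defines "g \<equiv> %v. lam + c * (SS q J v)^2"
 shows "\<P>(v in PI J. z - g v <= SS h J v \<and> SS h J v <= z)
  <= 140 * (dl + lam + c * (card J * (LINT y|N. (q y)^2)))"
proof -
 interpret A: prob_space "PI J" by (rule prob_space_PI)
 define s t m3 where "s = (LINT y|N. (h y)^2)" "t = (LINT y|N. (q y)^2)" "m3 = (LINT y|N. abs (h y)^3)"
 define k where "k = real (card J)"
 have kpos: "0 < k"
 proof -
  have "k ~= 0"
  proof
   assume "k = 0"
   thus False using var(1) unfolding k_def by simp
  qed
  thus ?thesis unfolding k_def by simp
 qed
 have spos: "0 < s"
 proof (rule ccontr)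
  assume "\<not> 0 < s"
  moreover have "0 <= s" unfolding s_t_m3_def by simp
  ultimately have "s = 0" by simp
  thus False using var(1) unfolding s_t_m3_def by simp
 qed
 have tn: "0 <= t" unfolding s_t_m3_def by simp
 define L where "L = SS h J" define R where "R = SS q J"
 define F where "F = (%w D. max (-(D/2+dl)) (min (D/2+dl) (w - z + D/2)))"
 define ind where "ind = (%v. if z - g v <= L v \<and> L v <= z then 1 else (0::real))"
 define y0 where "y0 = (%y. abs (h y) * min \<bar>h y\<bar> dl)"
 have bL: "bm (PI J) L" "bm (PI J) R" unfolding L_def R_def using h q by (auto intro!: bm_intros)
 have b\<Delta>: "bm (PI J) g" unfolding g_def R_def[symmetric] using bL by (intro bm_intros)
 have bF: "bm M (%v. F (w v) (D v))" if "bm M w" "bm M D" for M :: "'x measure" and w D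
  unfolding F_def using that by (intro bm_intros)
 have bind: "bm (PI J) ind"
 proof -
  show ?thesis unfolding ind_def
   by (intro bm_if pred_intros_logic pred_le borel_measurable_diff borel_measurable_const
    bm_measurable[OF bL(1)] bm_measurable[OF b\<Delta>])
 qed
 have by0: "bm N y0" unfolding y0_def using h by (intro bm_intros)
 have \<Delta>n: "0 <= g v" for v unfolding g_def using nn by simp

 have EL2: "(LINT v|PI J. (L v)^2) = k * s" unfolding L_def k_def s_t_m3_def by (rule E_SS_sq[OF J h(1,2)])
 have ER2: "(LINT v|PI J. (R v)^2) = k * t" unfolding R_def k_def s_t_m3_def by (rule E_SS_sq[OF J q])
 have absL: "(LINT v|PI J. abs (L v)) <= 3/2"
 proof -
  have "(LINT v|PI J. abs (L v)) <= (LINT v|PI J. 1/2 + (L v)^2 / 2)"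
  proof (intro integral_mono int_PI bm_intros bL)
   fix v
   have "0 <= (abs (L v) - 1)^2" by simp
   thus "abs (L v) <= 1/2 + (L v)^2 / 2" by (simp add: sq_simps)
  qed
  also have "... = 1/2 + k * s / 2"
   using int_PI[OF bm_power[OF bL(1), of 2]] EL2 A.prob_space by simp
  finally show ?thesis using var(2) unfolding s_t_m3_def k_def by simp
 qed
 \<comment> \<open>The random width and L are dependent. Since |L| * R^2 <= (R^2 + L^2 * R^2) / 2,
   their joint contribution reduces to the mixed fourth moment.\<close>
 have absLR: "(LINT v|PI J. abs (L v) * (R v)^2) <= 4 * k * t"
 proof -
  have m: "(LINT y|N. (h y)^2 * (q y)^2) <= t"
   unfolding s_t_m3_def using h q
  proof (intro integral_mono int_N bm_intros)
   fix y show "(h y)^2 * (q y)^2 <= (q y)^2"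
    using h(3)[of y] by (intro mult_left_le_one_le) (auto simp: abs_square_le_1)
  qed
  have "(LINT v|PI J. (L v)^2 * (R v)^2) <= 3 * (k * s) * (k * t) + k * (LINT y|N. (h y)^2 * (q y)^2)"
   using E_SS_sq_sq[OF J h(1,2) q] spos unfolding L_def R_def k_def s_t_m3_def by simp
  also have "... <= 3 * 2 * (k * t) + k * t"
   using var(2) m kpos tn unfolding k_def[symmetric] s_t_m3_def(1)[symmetric]
   by (intro add_mono mult_right_mono mult_left_mono) auto
  finally have 1: "(LINT v|PI J. (L v)^2 * (R v)^2) <= 7 * k * t" by simp
  have "(LINT v|PI J. abs (L v) * (R v)^2) <= (LINT v|PI J. (R v)^2 / 2 + ((L v)^2 * (R v)^2) / 2)"
  proof (intro integral_mono int_PI bm_intros bL)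
   fix v
   have "0 <= (abs (L v) - 1)^2 * (R v)^2" by simp
   thus "abs (L v) * (R v)^2 <= (R v)^2/2 + ((L v)^2 * (R v)^2) / 2"
    by (simp add: sq_simps)
  qed
  also have "... = k * t / 2 + (LINT v|PI J. (L v)^2 * (R v)^2) / 2"
   using int_PI[OF bm_power[OF bL(2), of 2]] int_PI[OF bm_mult[OF bm_power[OF bL(1), of 2] bm_power[OF bL(2), of 2]]]
   ER2 by simp
  finally show ?thesis using 1 by simp
 qed
 have up: "(LINT v|PI J. L v * F (L v) (g v)) <= 3/2 * (lam/2 + dl) + 2 * c * (k * t)"
 proof -
  have "(LINT v|PI J. L v * F (L v) (g v)) <= (LINT v|PI J. abs (L v) * (lam/2+dl) + c/2 * (abs (L v) * (R v)^2))"
  proof (intro integral_mono int_PI bm_intros bL bF b\<Delta>)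
   fix v
   have "L v * F (L v) (g v) <= abs (L v) * abs (F (L v) (g v))" by (metis abs_ge_self abs_mult)
   also have "... <= abs (L v) * (g v / 2 + dl)"
    unfolding F_def using clamp_bound[OF \<Delta>n] dl by (intro mult_left_mono) auto
   finally show "L v * F (L v) (g v) <= abs (L v) * (lam/2+dl) + c/2 * (abs (L v) * (R v)^2)"
    by (simp add: g_def R_def algebra_simps add_divide_distrib)
  qed
  also have "... = (LINT v|PI J. abs (L v)) * (lam/2+dl) + c/2 * (LINT v|PI J. abs (L v) * (R v)^2)"
   using int_PI[OF bm_abs[OF bL(1)]] int_PI[OF bm_mult[OF bm_abs[OF bL(1)] bm_power[OF bL(2), of 2]]]
   by simp
  also have "... <= 3/2 * (lam/2+dl) + c/2 * (4 * k * t)"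
   using absL absLR nn dl by (intro add_mono mult_right_mono mult_left_mono) auto
  finally show ?thesis by simp
 qed
 \<comment> \<open>The factor h (v i) is centred and independent of the leave-one-out pair, so the
   clamp at that pair may be subtracted for free. Moving the sum gains at least
   \<open>ind v * y0 (v i)\<close>; moving the width costs at most 2 * c * t.\<close>
 have low: "(LINT v|PI J. h (v i) * F (L v) (g v)) \<ge> (LINT v|PI J. ind v * y0 (v i)) - 2 * c * t" if i: "i \<in> J" for i
 proof -
  define J' where "J' = J - {i}"
  have J': "finite J'" "i \<notin> J'" "J = insert i J'" "J' \<subseteq> J" using i J by (auto simp: J'_def)
  define L' where "L' = SS h J'" define R' where "R' = SS q J'"
  define g' where "g' = (%v. lam + c * (R' v)^2)"
  have LL: "L v = L' v + h (v i)" "R v = R' v + q (v i)" for v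
   using SS_insert[OF J'(1,2)] unfolding L_def R_def L'_def R'_def J'(3) by auto
  have bL': "bm (PI J'') L'" "bm (PI J'') R'" if "J'' = J \<or> J'' = J'" for J''
   unfolding L'_def R'_def using h q J' that by (auto intro!: bm_intros)
  have b\<Delta>': "bm (PI J'') g'" if "J'' = J \<or> J'' = J'" for J''
   unfolding g'_def using bL' that by (intro bm_intros) auto
  have E: "(LINT v|PI J. a (v i) * b v) = (LINT y|N. a y) * (LINT x|PI J'. b x)"
   if "bm N a" "bm (PI J') b" "bm (PI J) b" "!!x y. b (x(i := y)) = b x" for a b
   using E_prod[OF J'(1,2) that(1,2)] that(3,4) unfolding J'(3) by auto
  have bc: "bm (PI J) (%v. a (v i))" if "bm N a" for a using bm_coord[OF that i] .
  have zero: "(LINT v|PI J. h (v i) * F (L' v) (g' v)) = 0"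
  proof -
   have "bm (PI J'') (%v. F (L' v) (g' v))" if "J'' = J \<or> J'' = J'" for J''
    using bF[OF bL'(1) b\<Delta>'] that by auto
   moreover have "F (L' (x(i := y))) (g' (x(i := y))) = F (L' x) (g' x)" for x y
    using J'(2) by (simp add: g'_def L'_def R'_def SS_upd)
   ultimately show ?thesis using E[of h "%v. F (L' v) (g' v)"] h(1,2) by simp
  qed
  have eR: "(LINT x|PI J'. (R' x)^2) <= k * t"
  proof -
   have "(LINT x|PI J'. (R' x)^2) = card J' * t"
    unfolding R'_def s_t_m3_def by (rule E_SS_sq[OF J'(1) q])
   also have "... <= k * t" using J' J tn by (intro mult_right_mono) (auto simp: k_def intro!: card_mono)
   finally show ?thesis .
  qed
  have rem: "(LINT v|PI J. c/2 * (abs (h (v i)) * abs (q (v i)) * (2 * abs (R' v) + abs (q (v i))))) <= 2 * c * t"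
  proof -
   have "(LINT v|PI J. c/2 * (abs (h (v i)) * abs (q (v i)) * (2 * abs (R' v) + abs (q (v i)))))
    <= (LINT v|PI J. c/2 * ((h (v i))^2 * (R' v)^2 + 2 * (q (v i))^2))"
   proof (intro integral_mono int_PI bm_intros i h(1) q(1) bL' disjI1 refl mult_left_mono)
    fix v
    have 1: "2 * (abs (h (v i)) * abs (R' v)) * abs (q (v i)) <= (abs (h (v i)) * abs (R' v))^2 + abs (q (v i))^2"
    by (rule sum_squares_bound)
    have 2: "abs (h (v i)) * (q (v i))^2 <= 1 * (q (v i))^2" using h(3) by (intro mult_right_mono) auto
    have "abs (h (v i)) * abs (q (v i)) * (2 * abs (R' v) + abs (q (v i)))
    = 2 * (abs (h (v i)) * abs (R' v)) * abs (q (v i)) + abs (h (v i)) * (q (v i))^2"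
    proof -
    have "(q (v i))^2 = abs (q (v i)) * abs (q (v i))" by (simp add: power2_eq_square)
    thus ?thesis by (simp add: algebra_simps)
    qed
    thus "abs (h (v i)) * abs (q (v i)) * (2 * abs (R' v) + abs (q (v i))) <= (h (v i))^2 * (R' v)^2 + 2 * (q (v i))^2"
    using 1 2 by (simp add: power_mult_distrib)
   qed (use nn in auto)
   also have "... = c/2 * ((LINT v|PI J. (h (v i))^2 * (R' v)^2) + 2 * (LINT v|PI J. (q (v i))^2))"
   proof -
    have "integrable (PI J) (%v. (h (v i))^2 * (R' v)^2)" "integrable (PI J) (%v. 2 * (q (v i))^2)"
    by (intro int_PI bm_intros i h(1) q(1) bL' disjI1 refl)+
    thus ?thesis by simp
   qed
   also have "(LINT v|PI J. (h (v i))^2 * (R' v)^2) = s * (LINT x|PI J'. (R' x)^2)"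
    using E[of "%y. (h y)^2" "%v. (R' v)^2"] h bL' J'(2)
    by (simp add: R'_def SS_upd s_t_m3_def bm_power)
   also have "(LINT v|PI J. (q (v i))^2) = t"
    using E_coord[OF i, of "%y. (q y)^2"] q by (simp add: s_t_m3_def bm_measurable)
   also have "c/2 * (s * (LINT x|PI J'. (R' x)^2) + 2 * t) <= c/2 * (s * (k * t) + 2 * t)"
    using eR spos nn by (intro mult_left_mono add_mono) auto
   also have "... = c/2 * ((k * s) * t + 2 * t)" by simp
   also have "... <= c/2 * (2 * t + 2 * t)"
    using var(2) tn nn unfolding k_def[symmetric] s_t_m3_def(1)[symmetric]
    by (intro mult_left_mono add_mono mult_right_mono) auto
   finally show ?thesis by simp
  qed
  have "(LINT v|PI J. (ind v * y0 (v i) + h (v i) * F (L' v) (g' v))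
    - c/2 * (abs (h (v i)) * abs (q (v i)) * (2 * abs (R' v) + abs (q (v i))))) <= (LINT v|PI J. h (v i) * F (L v) (g v))"
  proof (intro integral_mono int_PI bm_intros i h(1) q(1) bL' bL bF b\<Delta> b\<Delta>' by0 bind disjI1 refl)
   fix v
   let ?e = "h (v i)"
   have 1: "ind v * y0 (v i) <= ?e * (F (L v) (g v) - F (L' v) (g v))"
   proof -
    have Le: "L' v = L v - ?e" using LL(1)[of v] by simp
    have cs: "(if z - g v <= L v \<and> L v <= z then abs ?e * min \<bar>?e\<bar> dl else 0)
    <= ?e * (F (L v) (g v) - F (L' v) (g v))"
    unfolding F_def Le using clamp_slope[OF \<Delta>n[of v] less_imp_le[OF dl(2)], of z "L v" ?e] .
    moreover have "ind v * y0 (v i) = (if z - g v <= L v \<and> L v <= z then abs ?e * min \<bar>?e\<bar> dl else 0)"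
    unfolding ind_def y0_def by simp
    ultimately show ?thesis by simp
   qed
   have "abs (F (L' v) (g v) - F (L' v) (g' v)) <= abs (g v - g' v) / 2"
    unfolding F_def by (rule clamp_Lipschitz)
   also have "g v - g' v = c * (q (v i) * (2 * R' v + q (v i)))"
    using LL(2)[of v] unfolding g_def g'_def R_def[symmetric] by (simp add: algebra_simps power2_eq_square)
   also have "abs ... / 2 = c/2 * (abs (q (v i)) * abs (2 * R' v + q (v i)))" using nn by (simp add: abs_mult)
   also have "... <= c/2 * (abs (q (v i)) * (2 * abs (R' v) + abs (q (v i))))"
    using nn abs_triangle_ineq[of "2 * R' v" "q (v i)"] by (intro mult_left_mono) (auto simp: abs_mult)
   finally have "abs ?e * abs (F (L' v) (g v) - F (L' v) (g' v))
    <= abs ?e * (c/2 * (abs (q (v i)) * (2 * abs (R' v) + abs (q (v i)))))" by (rule mult_left_mono) simp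
   hence 2: "abs (?e * (F (L' v) (g v) - F (L' v) (g' v)))
    <= c/2 * (abs (h (v i)) * abs (q (v i)) * (2 * abs (R' v) + abs (q (v i))))"
    by (simp only: abs_mult mult_ac)
   have "?e * F (L v) (g v) = ?e * (F (L v) (g v) - F (L' v) (g v))
    + ?e * (F (L' v) (g v) - F (L' v) (g' v)) + ?e * F (L' v) (g' v)" by (simp add: algebra_simps)
   thus "(ind v * y0 (v i) + ?e * F (L' v) (g' v))
    - c/2 * (abs (h (v i)) * abs (q (v i)) * (2 * abs (R' v) + abs (q (v i)))) <= ?e * F (L v) (g v)"
    using 1 2 by linarith
  qed
  moreover have "(LINT v|PI J. (ind v * y0 (v i) + h (v i) * F (L' v) (g' v))
    - c/2 * (abs (h (v i)) * abs (q (v i)) * (2 * abs (R' v) + abs (q (v i)))))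
   = (LINT v|PI J. ind v * y0 (v i)) + (LINT v|PI J. h (v i) * F (L' v) (g' v))
    - (LINT v|PI J. c/2 * (abs (h (v i)) * abs (q (v i)) * (2 * abs (R' v) + abs (q (v i)))))"
  proof -
   have "integrable (PI J) (%v. ind v * y0 (v i))" "integrable (PI J) (%v. h (v i) * F (L' v) (g' v))"
    "integrable (PI J) (%v. c/2 * (abs (h (v i)) * abs (q (v i)) * (2 * abs (R' v) + abs (q (v i)))))"
    by (intro int_PI bm_intros i h(1) q(1) bL' bL bF b\<Delta> b\<Delta>' by0 bind disjI1 refl)+
   thus ?thesis by (simp only: Bintegral_add Bintegral_diff
    Bintegrable_add)
  qed
  ultimately show ?thesis using zero rem by linarith
 qed
 define Y where "Y = SS y0 J"
 have bY: "bm (PI J) Y" unfolding Y_def using by0 by (intro bm_intros) auto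
 have indY: "(LINT v|PI J. ind v * Y v) <= 3/2 * (lam/2 + dl) + 4 * c * (k * t)"
 proof -
  have "(LINT v|PI J. ind v * Y v) = (\<Sum>i\<in>J. \<integral>v. ind v * y0 (v i) \<partial>PI J)"
   unfolding Y_def SS_def sum_distrib_left using bind by0
   by (intro Bintegral_sum int_PI bm_intros) auto
  also have "... <= (\<Sum>i\<in>J. (LINT v|PI J. h (v i) * F (L v) (g v)) + 2 * c * t)"
   using low by (intro sum_mono) (auto simp: algebra_simps)
  also have "... = (\<Sum>i\<in>J. (LINT v|PI J. h (v i) * F (L v) (g v))) + k * (2 * c * t)"
   by (simp add: sum.distrib k_def)
  also have "(\<Sum>i\<in>J. (LINT v|PI J. h (v i) * F (L v) (g v))) = (LINT v|PI J. L v * F (L v) (g v))"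
   unfolding L_def SS_def sum_distrib_right
   using h(1) bF b\<Delta> bL(1)[unfolded L_def SS_def[abs_def]]
   by (intro Bintegral_sum[symmetric] int_PI bm_intros) auto
  finally show ?thesis using up by (simp add: algebra_simps)
 qed
 define e0 where "e0 = integral\<^sup>L N y0"
 have y0b: "0 <= y0 y" "y0 y <= dl * abs (h y)" for y
 proof -
  show "0 <= y0 y" using dl unfolding y0_def by simp
  have "abs (h y) * min \<bar>h y\<bar> dl <= abs (h y) * dl" by (intro mult_left_mono) auto
  thus "y0 y <= dl * abs (h y)" unfolding y0_def by (simp only: mult.commute)
 qed
 \<comment> \<open>Since min u dl >= u - u^2 / (4 * dl), capping loses at most m3 / (4 * dl), that
   is 1/4 after summation, out of a variance of at least 1/2.\<close>
 have e0: "1/4 <= k * e0"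
 proof -
  have "s - m3 / (4*dl) = (LINT y|N. (h y)^2 - abs (h y)^3 / (4*dl))"
   unfolding s_t_m3_def using int_N[OF bm_power[OF h(1), of 2]] int_N[OF bm_divide[OF bm_power[OF bm_abs[OF h(1)], of 3]], of "4*dl"]
   by simp
  also have "... <= e0" unfolding e0_def
  proof (intro integral_mono int_N bm_intros h by0)
   fix y
   define u where "u = abs (h y)"
   have "u * (u - u^2 / (4*dl)) <= u * min u dl"
   proof (rule mult_left_mono)
    have "0 <= (u - 2 * dl)^2" by simp
    hence "u * (4 * dl) - u^2 <= dl * (4 * dl)" by (simp add: sq_simps)
    hence "u - u^2 / (4*dl) <= dl" using dl(2) by (simp add: field_simps)
    thus "u - u^2 / (4*dl) <= min u dl" using dl by simp
   qed (simp add: u_def)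
   thus "(h y)^2 - abs (h y)^3 / (4*dl) <= y0 y"
    unfolding y0_def u_def by (simp add: power3_eq_cube sq_simps)
  qed
  finally have "k * (s - m3 / (4*dl)) <= k * e0" using kpos by (intro mult_left_mono) auto
  moreover have "k * m3 / (4 * dl) <= 1/4" using dl unfolding k_def s_t_m3_def by (simp add: field_simps)
  ultimately show ?thesis using var(1) unfolding k_def[symmetric] s_t_m3_def(1)[symmetric]
   by (simp add: algebra_simps)
 qed
 have varY: "(LINT v|PI J. (Y v - k * e0)^2) <= 2 * dl"
 proof -
  have "(LINT v|PI J. (Y v - k * e0)^2) = (LINT v|PI J. (SS (%y. y0 y - e0) J v)^2)"
   by (simp add: Y_def SS_def sum_subtractf k_def)
  also have "... = k * (LINT y|N. (y0 y - e0)^2)"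
   unfolding k_def using by0 int_N[OF by0] prob_space J
   by (intro E_SS_sq bm_intros) (auto simp: e0_def)
  also have "(LINT y|N. (y0 y - e0)^2) = (LINT y|N. (y0 y)^2) - e0^2"
   unfolding e0_def using int_N[OF by0] int_N[OF bm_power[OF by0, of 2]] by (intro variance_eq) auto
  also have "... <= (LINT y|N. (y0 y)^2)" by simp
  also have "... <= (LINT y|N. dl^2 * (h y)^2)"
  proof (intro integral_mono int_N bm_intros h by0)
   fix y have "(y0 y)^2 <= (dl * abs (h y))^2" using y0b by (intro power_mono) auto
   thus "(y0 y)^2 <= dl^2 * (h y)^2" by (simp add: power_mult_distrib)
  qed
  also have "... = dl^2 * s" by (simp add: s_t_m3_def)
  finally have "(LINT v|PI J. (Y v - k * e0)^2) <= dl^2 * (k * s)" using kpos by (simp add: algebra_simps)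
  also have "... <= dl * 2"
  proof -
   have ks2: "k * s <= 2" using var(2) unfolding k_def s_t_m3_def .
   show ?thesis unfolding power2_eq_square using ks2 dl spos kpos by (intro mult_mono mult_left_le) auto
  qed
  finally show ?thesis by simp
 qed
 have "\<P>(v in PI J. z - g v <= SS h J v \<and> SS h J v <= z) = (LINT v|PI J. ind v)"
 proof -
  have "(LINT v|PI J. ind v) = (LINT v|PI J. indicator {v \<in> space (PI J). z - g v <= SS h J v \<and> SS h J v <= z} v)"
   by (intro Bintegral_cong) (auto simp: ind_def L_def)
  thus ?thesis by (simp add: Int_def conj_commute)
 qed
 \<comment> \<open>Where Y >= 1/8 the indicator is at most 8 times its product with Y. Where Y <
   1/8, Y is at least 1/8 away from its mean, which is at least 1/4, and 64 times the squared
   deviation exceeds 1.\<close>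
 also have "... <= (LINT v|PI J. 8 * (ind v * Y v) + 64 * (Y v - k * e0)^2)"
 proof (intro integral_mono int_PI bm_intros bind bY)
  fix v
  have Yn: "0 <= Y v" unfolding Y_def SS_def by (intro sum_nonneg y0b)
  show "ind v <= 8 * (ind v * Y v) + 64 * (Y v - k * e0)^2"
  proof (cases "Y v < 1/8")
   case True
   hence "1/8 <= k * e0 - Y v" using e0 by linarith
   from power_mono[OF this, of 2] have "1/64 <= (k * e0 - Y v)^2"
    by (simp add: power2_eq_square[of "1/8::real"])
   hence "1/64 <= (Y v - k * e0)^2" by (subst power2_commute)
   moreover have "0 <= 8 * (ind v * Y v)" using Yn by (simp add: ind_def)
   moreover have "ind v <= 1" by (simp add: ind_def)
   ultimately show ?thesis by linarith
  next
   case False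
   have "ind v <= 8 * (ind v * Y v)" using False by (auto simp: ind_def)
   moreover have "0 <= 64 * (Y v - k * e0)^2" by simp
   ultimately show ?thesis by linarith
  qed
 qed
 also have "... = 8 * (LINT v|PI J. ind v * Y v) + 64 * (LINT v|PI J. (Y v - k * e0)^2)"
 proof -
  have "integrable (PI J) (%v. ind v * Y v)" "integrable (PI J) (%v. (Y v - k * e0)^2)"
   by (intro int_PI bm_intros bind bY)+
  thus ?thesis by simp
 qed
 also have "... <= 8 * (3/2 * (lam/2 + dl) + 4 * c * (k * t)) + 64 * (2 * dl)"
  using indY varY by (intro add_mono mult_left_mono) auto
 also have "... <= 140 * (dl + lam + c * (k * t))"
 proof -
  have "0 <= c * (k * t)" using nn kpos tn by simp
  thus ?thesis using nn dl by (simp add: algebra_simps)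
 qed
 finally show ?thesis unfolding k_def s_t_m3_def .
qed

end

section \<open>Berry-Esseen bound for bounded summands\<close>

lemma abs_mean_mult:
 fixes y m :: real assumes "0 <= m"
 shows "m^2 * abs y + m * y^2 <= abs y^3 + m^3"
proof -
 have "0 <= (abs y - m)^2 * (abs y + m)" using assms by simp
 also have "... = abs y^3 + m^3 - (m^2 * abs y + m * y^2)"
  by (simp add: power2_eq_square power3_eq_cube algebra_simps flip: abs_mult)
 finally show ?thesis by simp
qed

context iid
begin

text \<open>An association inequality for |h| and h^2: the pointwise bound at m = sqrt s is
  integrated and the terms s * sqrt s cancel. It lets the error s * E|c| in Stein's method be
  absorbed by the third moment.\<close>

lemma third_moment_ge:
 assumes h: "bm N h"
 shows "(LINT y|N. (h y)^2) * (LINT y|N. abs (h y)) <= (LINT y|N. abs (h y)^3)"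
proof -
 define s where "s = (LINT y|N. (h y)^2)"
 have s: "0 <= s" unfolding s_def by simp
 have "s * (LINT y|N. abs (h y)) + sqrt s * s = (LINT y|N. s * abs (h y) + sqrt s * (h y)^2)"
  unfolding s_def using int_N[OF bm_abs[OF h]] int_N[OF bm_power[OF h, of 2]] by simp
 also have "... <= (LINT y|N. abs (h y)^3 + sqrt s ^ 3)"
  using abs_mean_mult[of "sqrt s"] s by (intro integral_mono int_N bm_intros h) auto
 also have "... = (LINT y|N. abs (h y)^3) + sqrt s * s"
  using int_N[OF bm_power[OF bm_abs[OF h], of 3]] prob_space s by (simp add: power3_eq_cube)
 finally show ?thesis by (simp add: s_def)
qed

text \<open>Stein's method with leave-one-out sums. For each coordinate, c_i * f(W) is expanded
  around V = W - c_i, and the jump of f' costs the probability that V lies within |c_i| of z,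
  bounded by concentration with a nonrandom width. Nothing has to be shown once the third-moment sum
  reaches 1.\<close>

theorem Berry_Esseen_bounded:
 assumes J: "finite J" and c: "bm N c" "integral\<^sup>L N c = 0" "!!y. abs (c y) <= 1"
  and var: "card J * (LINT y|N. (c y)^2) = 1"
 shows "\<P>(w in PI J. z < SS c J w)
  <= Q z + 3400 * (card J * (LINT y|N. abs (c y)^3))"
proof -
 interpret A: prob_space "PI J" by (rule prob_space_PI)
 define s m3 m1 where "s = (LINT y|N. (c y)^2)" "m3 = (LINT y|N. abs (c y)^3)" "m1 = (LINT y|N. abs (c y))"
 define n where "n = real (card J)"
 define g where "g = n * m3"
 note defs = s_m3_m1_def n_def
 have ns: "n * s = 1" using var unfolding defs .
 have npos: "0 < n"
 proof -
  have "n ~= 0" using ns by auto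
  thus ?thesis unfolding n_def by simp
 qed
 have spos: "0 < s"
 proof -
  have "s ~= 0" using ns by auto
  moreover have "0 <= s" unfolding s_m3_m1_def by simp
  ultimately show ?thesis by simp
 qed
 have m3n: "0 <= m3" unfolding defs by simp
 have sm: "s * m1 <= m3" using third_moment_ge[OF c(1)] unfolding defs .
 have m1n: "0 <= m1" unfolding defs by simp
 have m3pos: "0 < m3"
 proof -
  have "s = (LINT y|N. (c y)^2)" by (simp add: defs)
  also have "... <= (LINT y|N. abs (c y))"
  proof (intro integral_mono int_N bm_intros c)
   fix y show "(c y)^2 <= abs (c y)"
    using c(3)[of y] mult_left_le_one_le[of "abs (c y)" "abs (c y)"] by (simp add: power2_eq_square)
  qed
  finally have "s <= m1" by (simp add: defs)
  hence "0 < s * m1" using spos by simp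
  thus ?thesis using sm by linarith
 qed
 have gpos: "0 < g" unfolding g_def using npos m3pos by simp
 show ?thesis
 proof (cases "g < 1")
  case False
  have "\<P>(w in PI J. z < SS c J w) <= 1" by (rule A.prob_le_1)
  also have "1 <= Q z + 3400 * g" using False Q_nonneg[of z] by simp
  finally show ?thesis by (simp add: g_def defs)
 next
  case True
  \<comment> \<open>A single summand would have third moment at least 1. With two or more, s <= 1/2,
    so the leave-one-out sum keeps at least half of the variance, as the concentration inequality
    demands.\<close>
  have n2: "2 <= n"
  proof (rule ccontr)
   assume "\<not> 2 <= n"
   hence "card J = 1" using npos unfolding n_def by linarith
   hence n1: "n = 1" by (simp add: n_def)
   hence s1: "s = 1" using ns by simp
   have "(LINT y|N. abs (c y) + (c y)^2) <= (LINT y|N. abs (c y)^3 + 1)"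
    using abs_mean_mult[of 1] by (intro integral_mono int_N bm_intros c) auto
   hence "m1 + s <= m3 + 1"
    using int_N[OF bm_abs[OF c(1)]] int_N[OF bm_power[OF c(1), of 2]]
    int_N[OF bm_power[OF bm_abs[OF c(1)], of 3]] prob_space by (simp add: defs)
   moreover have "s <= m1" unfolding defs
   proof (intro integral_mono int_N bm_intros c)
    fix y show "(c y)^2 <= abs (c y)"
    using c(3)[of y] mult_left_le_one_le[of "abs (c y)" "abs (c y)"] by (simp add: power2_eq_square)
   qed
   ultimately have "1 <= m3" using s1 by simp
   thus False using True n1 by (simp add: g_def)
  qed
  define f where "f = stein z" define h where "h = stein' z"
  define W where "W = SS c J"
  have fm: "f \<in> borel_measurable borel" "h \<in> borel_measurable borel" by (simp_all add: f_def h_def)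
  have bW: "bm (PI J) W" unfolding W_def using c by (intro bm_intros) auto
  have bf: "bm M (%x. f (u x))" if "u \<in> borel_measurable M" for M :: "'x measure" and u
   using fm(1) stein_bounds(1) that unfolding f_def by (rule bm_comp)
  have bh: "bm M (%x. h (u x))" if "u \<in> borel_measurable M" for M :: "'x measure" and u
   using fm(2) stein'_bound that unfolding h_def by (rule bm_comp)
  define Eh where "Eh = (LINT w|PI J. h (W w))"
  have main: "abs ((LINT w|PI J. c (w i) * f (W w)) - s * Eh) <= 2248 * m3 + 1120 * (s * g)"
   if i: "i \<in> J" for i
  proof -
   define J' where "J' = J - {i}"
   have J': "finite J'" "i \<notin> J'" "J = insert i J'" "J' \<subseteq> J" using i J by (auto simp: J'_def)
   have cJ': "card J' = n - 1" using J' npos by (simp add: n_def)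
   define V where "V = SS c J'"
   have WV: "W w = V w + c (w i)" for w
    using SS_insert[OF J'(1,2)] unfolding W_def V_def J'(3) by auto
   have bV: "bm (PI J'') V" if "J'' = J \<or> J'' = J'" for J''
    unfolding V_def using c J' that by (auto intro!: bm_intros)
   have bV1: "bm (PI J) V" "bm (PI J') V" using bV by auto
   have VI: "V (x(i := y)) = V x" for x y unfolding V_def using J' by (simp add: SS_upd)
   have E: "(LINT w|PI J. a (w i) * b w) = (LINT y|N. a y) * (LINT x|PI J'. b x)"
    if "bm N a" "bm (PI J') b" "bm (PI J) b" "!!x y. b (x(i := y)) = b x" for a b
    using E_prod[OF J'(1,2) that(1,2)] that(3,4) unfolding J'(3) by auto
   have bc: "bm (PI J) (%w. a (w i))" if "bm N a" for a using bm_coord[OF that i] .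
   interpret A': prob_space "PI J'" by (rule prob_space_PI)
   have absV: "(LINT x|PI J'. abs (V x)) <= 1"
   proof -
    have "(LINT w|PI J'. abs (V w)) <= (LINT w|PI J'. 1/2 + (V w)^2 / 2)"
    proof (intro integral_mono int_PI bm_intros bV1)
    fix w
    have "0 <= (abs (V w) - 1)^2" by simp
    thus "abs (V w) <= 1/2 + (V w)^2 / 2" by (simp add: sq_simps)
    qed
    also have "... = 1/2 + (LINT w|PI J'. (V w)^2) / 2"
    using int_PI[OF bm_power[OF bV1(2), of 2]] A'.prob_space by simp
    also have "(LINT w|PI J'. (V w)^2) = (n - 1) * s"
    unfolding V_def cJ'[symmetric] s_m3_m1_def by (rule E_SS_sq[OF J'(1) c(1,2)])
    also have "... <= 1" using ns spos by (simp add: algebra_simps)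
    finally show ?thesis by simp
   qed
   \<comment> \<open>The event is an interval of constant width 2 * |u| ending at z + |u|, so the
     random part of the width is switched off by c = 0 and q = 0.\<close>
   have conc: "(LINT x|PI J'. (if abs (V x - z) <= abs u then 1 else 0)) <= 140 * (g + 2 * abs u)" for u
   proof -
    have "(LINT x|PI J'. (if abs (V x - z) <= abs u then 1 else 0))
    = (LINT x|PI J'. indicator {x \<in> space (PI J'). (z + abs u) - (2 * abs u + 0 * (SS (%_. 0) J' x)^2) <= SS c J' x \<and> SS c J' x <= z + abs u} x)"
    by (intro Bintegral_cong) (auto simp: V_def indicator_def abs_le_iff)
    also have "... = \<P>(x in PI J'. (z + abs u) - (2 * abs u + 0 * (SS (%_. 0) J' x)^2) <= SS c J' x \<and> SS c J' x <= z + abs u)"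
    by (simp add: Int_def conj_commute)
    also have "... <= 140 * (g + 2 * abs u + 0 * (card J' * (LINT y|N. (0::real)^2)))"
    proof (rule randomised_concentration[OF J'(1) c, of "%_. 0" g "2 * abs u" 0 "z + abs u"])
    have "1 * s <= (n - 1) * s" using n2 spos by (intro mult_right_mono) auto
    moreover have "(n - 1) * s = 1 - s" using ns by (simp add: algebra_simps)
    ultimately have "1/2 <= (n - 1) * s" "(n - 1) * s <= 2" using spos by auto
    thus "1/2 <= card J' * (LINT y|N. (c y)^2)" "card J' * (LINT y|N. (c y)^2) <= 2"
    unfolding cJ' s_m3_m1_def by auto
    have "(n - 1) * m3 <= g" unfolding g_def using m3n by (intro mult_right_mono) auto
    thus "card J' * (LINT y|N. abs (c y)^3) <= g" unfolding cJ' s_m3_m1_def .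
    qed (use gpos True in \<open>auto intro: bm_intros\<close>)
    finally show ?thesis by simp
   qed
   define r where "r = (%u v. 2 * abs u * (1 + abs v) + (if abs (v - z) <= abs u then 4 else (0::real)))"
   have br: "bm M (%w. r (u w) (v w))" if "bm M u" "bm M v" for M :: "'x measure" and u v
   proof -
    have "bm M (%w. (if abs (v w - z) <= abs (u w) then 4 else (0::real)))"
    using that[THEN bm_measurable]
    by (intro bm_if pred_le borel_measurable_abs borel_measurable_diff borel_measurable_const)
    from this that show ?thesis unfolding r_def
    by (intro bm_add bm_mult bm_const bm_abs)
   qed
   \<comment> \<open>Four times the concentration constant 140 gives 560. Together with 4 * |u| from
     the smooth part this makes 1124 * |u| + 560 * g, the source of the constants below.\<close>
   have Er: "(LINT x|PI J'. r u (V x)) <= 4 * abs u + 560 * (g + 2 * abs u)" for u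
   proof -
    have b: "bm (PI J') (%x. (if abs (V x - z) <= abs u then 1 else (0::real)))"
    using bm_measurable[OF bV1(2)]
    by (intro bm_if pred_le borel_measurable_abs borel_measurable_diff borel_measurable_const)
    have "(LINT x|PI J'. r u (V x)) = (LINT x|PI J'. 2 * abs u + (2 * abs u) * abs (V x) + 4 * (if abs (V x - z) <= abs u then 1 else 0))"
    unfolding r_def by (intro Bintegral_cong) (auto simp: algebra_simps)
    also have "... = 2 * abs u + (2 * abs u) * (LINT x|PI J'. abs (V x)) + 4 * (LINT x|PI J'. (if abs (V x - z) <= abs u then 1 else 0))"
    using int_PI[OF b] int_PI[OF bm_abs[OF bV1(2)]] A'.prob_space by simp
    also have "... <= 2 * abs u + (2 * abs u) * 1 + 4 * (140 * (g + 2 * abs u))"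
    using absV conc[of u] by (intro add_mono mult_left_mono) auto
    finally show ?thesis by simp
   qed
   have zero: "(LINT w|PI J. c (w i) * f (V w)) = 0"
    using E[of c "%w. f (V w)", OF c(1) bf[OF bm_measurable[OF bV1(2)]] bf[OF bm_measurable[OF bV1(1)]]]
    c(2) VI by simp
   have sq: "(LINT w|PI J. (c (w i))^2 * h (V w)) = s * (LINT x|PI J'. h (V x))"
    using E[of "%y. (c y)^2" "%w. h (V w)", OF bm_power[OF c(1)] bh[OF bm_measurable[OF bV1(2)]] bh[OF bm_measurable[OF bV1(1)]]]
    VI by (simp add: s_m3_m1_def)
   have hV: "(LINT w|PI J. h (V w)) = (LINT x|PI J'. h (V x))"
    using E[of "%_. 1" "%w. h (V w)", OF bm_const bh[OF bm_measurable[OF bV1(2)]] bh[OF bm_measurable[OF bV1(1)]]]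
    VI prob_space by simp
   have bV2: "V \<in> borel_measurable (PI J)" "W \<in> borel_measurable (PI J)" using bV1 bW by (auto simp: bm_def)
   have bnd: "(LINT w|PI J. a (w i) * r (c (w i)) (V w)) <= (LINT y|N. a y * (1124 * abs (c y) + 560 * g))"
    if a: "bm N a" "!!y. 0 <= a y" for a
    unfolding J'(3)
   proof (rule E_le[OF J'(1,2)])
    show "bm (PI (insert i J')) (%w. a (w i) * r (c (w i)) (V w))"
    unfolding J'(3)[symmetric] using bc[OF a(1)] br[OF bc[OF c(1)] bV1(1)] by (rule bm_mult)
    show "bm N (%y. a y * (1124 * abs (c y) + 560 * g))" using a c by (intro bm_intros)
    fix y
    have "(LINT x|PI J'. a ((x(i := y)) i) * r (c ((x(i := y)) i)) (V (x(i := y)))) = a y * (LINT x|PI J'. r (c y) (V x))"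
    by (simp add: VI)
    also have "... <= a y * (4 * abs (c y) + 560 * (g + 2 * abs (c y)))"
    using Er a(2) by (intro mult_left_mono)
    finally show "(LINT x|PI J'. a ((x(i := y)) i) * r (c ((x(i := y)) i)) (V (x(i := y)))) <= a y * (1124 * abs (c y) + 560 * g)"
    by (simp add: algebra_simps)
   qed
   have I1: "integrable (PI J) (%w. c (w i) * f (W w))" "integrable (PI J) (%w. c (w i) * f (V w))"
    "integrable (PI J) (%w. (c (w i))^2 * h (V w))" "integrable (PI J) (%w. h (W w))" "integrable (PI J) (%w. h (V w))"
    "integrable (PI J) (%w. (c (w i))^2 * r (c (w i)) (V w))" "integrable (PI J) (%w. 1 * r (c (w i)) (V w))"
    using bV2 c(1) bV1(1) i by (auto intro!: int_PI bm_intros bf bh br)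
   have e1: "abs ((LINT w|PI J. c (w i) * f (W w)) - s * (LINT x|PI J'. h (V x))) <= 1124 * m3 + 560 * (s * g)"
   proof -
    have "(LINT w|PI J. c (w i) * f (W w)) - s * (LINT x|PI J'. h (V x))
    = (LINT w|PI J. c (w i) * f (W w) - c (w i) * f (V w) - (c (w i))^2 * h (V w))"
    using I1 zero sq by simp
    hence "abs ((LINT w|PI J. c (w i) * f (W w)) - s * (LINT x|PI J'. h (V x)))
    <= (LINT w|PI J. abs (c (w i) * f (W w) - c (w i) * f (V w) - (c (w i))^2 * h (V w)))"
    by (simp only: integral_abs_bound)
    also have "... <= (LINT w|PI J. (c (w i))^2 * r (c (w i)) (V w))"
    proof (intro integral_mono integrable_abs Bintegrable_diff I1)
    fix w
    let ?e = "c (w i)"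
    have "abs (?e * f (W w) - ?e * f (V w) - ?e^2 * h (V w)) = abs ?e * abs (f (V w + ?e) - f (V w) - ?e * h (V w))"
    unfolding WV by (simp add: abs_mult[symmetric] algebra_simps power2_eq_square)
    also have "... <= abs ?e * (abs ?e * r ?e (V w))"
    unfolding f_def h_def r_def by (intro mult_left_mono stein_Taylor) auto
    finally show "abs (?e * f (W w) - ?e * f (V w) - ?e^2 * h (V w)) <= ?e^2 * r ?e (V w)"
    by (simp add: power2_eq_square mult.assoc[symmetric] flip: abs_mult)
    qed
    also have "... <= (LINT y|N. (c y)^2 * (1124 * abs (c y) + 560 * g))"
    using c(1) by (intro bnd bm_intros) auto
    also have "... = (LINT y|N. 1124 * abs (c y)^3 + 560 * g * (c y)^2)"
    by (intro Bintegral_cong) (auto simp: power2_eq_square power3_eq_cube algebra_simps simp flip: abs_mult)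
    also have "... = 1124 * m3 + 560 * (s * g)"
    using int_N[OF bm_power[OF bm_abs[OF c(1)], of 3]] int_N[OF bm_power[OF c(1), of 2]] by (simp add: s_m3_m1_def)
    finally show ?thesis .
   qed
   have e2: "abs (Eh - (LINT x|PI J'. h (V x))) <= 1124 * m1 + 560 * g"
   proof -
    have "Eh - (LINT x|PI J'. h (V x)) = (LINT w|PI J. h (W w) - h (V w))"
    unfolding Eh_def using I1 hV by simp
    hence "abs (Eh - (LINT x|PI J'. h (V x))) <= (LINT w|PI J. abs (h (W w) - h (V w)))"
    by (simp only: integral_abs_bound)
    also have "... <= (LINT w|PI J. 1 * r (c (w i)) (V w))"
    proof (intro integral_mono integrable_abs Bintegrable_diff I1)
    fix w
    show "abs (h (W w) - h (V w)) <= 1 * r (c (w i)) (V w)"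
    using stein'_diff[of z "V w" "c (w i)"] unfolding WV h_def r_def by (auto split: if_splits)
    qed
    also have "... <= (LINT y|N. 1 * (1124 * abs (c y) + 560 * g))" by (intro bnd bm_intros) auto
    also have "... = 1124 * m1 + 560 * g"
    using int_N[OF bm_abs[OF c(1)]] prob_space by (simp add: s_m3_m1_def)
    finally show ?thesis .
   qed
   have "abs (s * Eh - s * (LINT x|PI J'. h (V x))) = s * abs (Eh - (LINT x|PI J'. h (V x)))"
    using spos by (simp add: abs_mult right_diff_distrib[symmetric])
   also have "... <= s * (1124 * m1 + 560 * g)" using e2 spos by (intro mult_left_mono) auto
   also have "... = 1124 * (s * m1) + 560 * (s * g)" by (simp add: algebra_simps)
   also have "... <= 1124 * m3 + 560 * (s * g)" using sm by simp
   finally show ?thesis using e1 by (auto simp: abs_le_iff)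
  qed
  have bfW: "W \<in> borel_measurable (PI J)" using bW by (auto simp: bm_def)
  have "abs ((LINT w|PI J. W w * f (W w)) - Eh) = abs (\<Sum>i\<in>J. ((LINT w|PI J. c (w i) * f (W w)) - s * Eh))"
  proof -
   have "(LINT w|PI J. W w * f (W w)) = (LINT w|PI J. (\<Sum>i\<in>J. c (w i) * f (W w)))"
    by (intro Bintegral_cong) (auto simp: W_def SS_def sum_distrib_right)
   also have "... = (\<Sum>i\<in>J. \<integral>w. c (w i) * f (W w) \<partial>PI J)"
    using c(1) bf[OF bfW] by (intro Bintegral_sum int_PI bm_intros) auto
   finally have 1: "(LINT w|PI J. W w * f (W w)) = (\<Sum>i\<in>J. \<integral>w. c (w i) * f (W w) \<partial>PI J)" .
   have "(\<Sum>i\<in>J. s * Eh) = (n * s) * Eh" by (simp add: n_def)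
   hence 2: "(\<Sum>i\<in>J. s * Eh) = Eh" by (simp only: ns mult_1)
   show ?thesis by (simp only: sum_subtractf 1 2)
  qed
  also have "... <= (\<Sum>i\<in>J. 2248 * m3 + 1120 * (s * g))"
   by (rule order_trans[OF sum_abs sum_mono]) (rule main)
  also have "... = 2248 * (n * m3) + 1120 * ((n * s) * g)" by (simp add: n_def algebra_simps)
  also have "... = 3368 * g" using ns by (simp add: g_def)
  finally have err: "abs ((LINT w|PI J. W w * f (W w)) - Eh) <= 3368 * g" .
  have bW2: "bm (PI J) (%w. if z < W w then 1 else 0)" using bfW by (intro bm_if pred_less borel_measurable_const)
  \<comment> \<open>Stein's equation integrated: the difference bounded by \<open>err\<close> is
    exactly the tail probability minus Q z.\<close>
  have "Eh = (LINT w|PI J. W w * f (W w) + (Q z - (if z < W w then 1 else 0)))"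
   unfolding Eh_def by (intro Bintegral_cong) (auto simp: h_def stein'_def f_def)
  also have "... = (LINT w|PI J. W w * f (W w)) + (Q z - (LINT w|PI J. (if z < W w then 1 else 0)))"
   using int_PI[OF bW2] int_PI[OF bm_mult[OF bW bf[OF bfW]]] A.prob_space by simp
  also have "(LINT w|PI J. (if z < W w then 1 else 0)) = (LINT w|PI J. indicator {w \<in> space (PI J). z < SS c J w} w)"
   by (intro Bintegral_cong) (auto simp: W_def)
  also have "... = measure (PI J) ({w \<in> space (PI J). z < SS c J w} \<inter> space (PI J))" by simp
  also have "{w \<in> space (PI J). z < SS c J w} \<inter> space (PI J) = {w \<in> space (PI J). z < SS c J w}" by auto
  finally have "\<P>(w in PI J. z < SS c J w) <= Q z + 3368 * g"
   using err by (auto simp: abs_le_iff)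
  thus ?thesis using gpos unfolding g_def defs by simp
 qed
qed

end

subsection \<open>Berry-Esseen bounds by truncation\<close>

text \<open>Shifting the threshold by 2 * e costs e because Q is 1/2-Lipschitz. Rescaling it by g
  costs at most (g - 1) * y * dnorm y, where y * dnorm y <= 1 uniformly and g - 1 <= g^2 - 1 <= 4 *
  e.\<close>

lemma Q_scale:
 assumes x: "0 <= x" and e: "0 <= e" and s: "1/2 <= g" "g^2 <= 1 + 4 * e"
 shows "Q ((x - 2 * e) / g) <= Q x + 5 * e"
proof (cases "x - 2 * e <= 0")
 case True
 have "Q ((x - 2 * e) / g) - Q 0 <= abs ((x - 2 * e) / g - 0) / 2" by (rule Q_Lipschitz)
 also have "... = ((2 * e - x) / g) / 2" using True s by (simp add: abs_divide)
 also have "... <= ((2 * e) / (1/2)) / 2"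
  using s x e True by (intro divide_right_mono frac_le) auto
 finally have "Q ((x - 2 * e) / g) - Q 0 <= 2 * e" by simp
 moreover have "Q 0 - Q x <= abs (0 - x) / 2" by (rule Q_Lipschitz)
 ultimately show ?thesis using True x e by simp
next
 case False
 define z where "z = x - 2 * e"
 have z: "0 < z" using False by (simp add: z_def)
 have zx: "Q z - Q x <= e" using Q_Lipschitz[of z x] e by (simp add: z_def)
 show ?thesis
 proof (cases "g <= 1")
  case True
  hence "z * g <= z * 1" using z by (intro mult_left_mono) auto
  hence "z <= z / g" using s by (simp add: le_divide_eq)
  hence "Q (z / g) <= Q z" by (rule Q_antimono)
  thus ?thesis using zx e by (simp add: z_def)
 next
  case F: False
  define y where "y = z / g"
  have y: "0 < y" "y < z" using z F s by (auto simp: y_def divide_less_eq)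
  from MVT2[OF y(2), of Q "%x. - dnorm x"] Q_deriv obtain c where
   c: "y < c" "Q z - Q y = (z - y) * - dnorm c" by blast
  have "Q y - Q z = (z - y) * dnorm c" using c by simp
  also have "... <= (z - y) * dnorm y" using y c by (intro mult_left_mono dnorm_antimono) auto
  also have "z - y = (g - 1) * y" using F s by (simp add: y_def field_simps)
  also have "(g - 1) * y * dnorm y = (g - 1) * (y * dnorm y)" by simp
  also have "... <= (g - 1) * 1"
  proof (intro mult_left_mono)
   have "0 <= (y - 1)^2" by simp
   hence "y <= 1 + y^2 / 2" by (simp add: sq_simps)
   also have "... <= exp (y^2 / 2)" by (rule exp_ge_add_one_self)
   finally have "y * exp (- y\<^sup>2 / 2) <= exp (y^2/2) * exp (- y\<^sup>2 / 2)" by (intro mult_right_mono) auto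
   hence 1: "y * exp (- y\<^sup>2 / 2) <= 1" by (simp flip: exp_add)
   have "2 <= sqrt (2 * pi)" by (rule real_le_rsqrt) (use pi_gt3 in simp)
   hence "1 / sqrt (2*pi) <= 1" using pi_gt3 by (simp add: divide_le_eq_1)
   hence "(1 / sqrt (2*pi)) * (y * exp (- y\<^sup>2 / 2)) <= 1 * 1" using 1 y by (intro mult_mono) auto
   thus "y * dnorm y <= 1" by (simp add: std_normal_density_def mult_ac)
  qed (use F in auto)
  also have "... <= g^2 - 1"
  proof -
   have "g * 1 <= g * g" using F by (intro mult_left_mono) auto
   thus ?thesis by (simp add: power2_eq_square)
  qed
  finally have "Q y - Q z <= 4 * e" using s by simp
  thus ?thesis using zx by (simp add: y_def z_def)
 qed
qed

lemma cube_sum3: "0 <= p ==> 0 <= q ==> 0 <= r ==> (p + q + r)^3 <= 9 * (p^3 + q^3 + (r::real)^3)"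
proof -
 assume n: "0 <= p" "0 <= q" "0 <= r"
 have A: "x^2 * y + x * y^2 <= x^3 + y^3" if "0 <= x" "0 <= y" for x y :: real
 proof -
  have "0 <= (x - y)^2 * (x + y)" using that by simp
  thus ?thesis by (simp add: power2_eq_square power3_eq_cube algebra_simps)
 qed
 have B: "3 * (p * q * r) <= p^3 + q^3 + r^3"
 proof -
  have "0 <= (p + q + r) * ((p - q)^2 + (q - r)^2 + (r - p)^2)" using n by simp
  thus ?thesis by (simp add: power2_eq_square power3_eq_cube algebra_simps)
 qed
 show ?thesis using A[of p q] A[of q r] A[of p r] B n
  by (simp add: power2_eq_square power3_eq_cube algebra_simps)
qed

lemma sixteenth_bound: "0 <= p ==> 0 <= m ==> 1/16 * (p + m) <= 1/8 * p + (m::real)"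
 by simp

lemma (in prob_space) measure_le_integral:
 assumes "E \<in> events" "integrable M f" "!!x. x \<in> space M ==> indicator E x <= f x"
 shows "prob E <= integral\<^sup>L M f"
proof -
 have "prob E = (LINT x|M. indicator E x)" using assms(1) by (simp add: sets.Int_space_eq2)
 also have "... <= integral\<^sup>L M f"
  using assms by (intro integral_mono integrable_real_indicator) (auto simp: less_top[symmetric])
 finally show ?thesis .
qed

lemma integral_if_pred:
 "(LINT x|M. (if P x then 1 else 0)) = \<P>(x in M. P x)"
proof -
 have "(LINT x|M. (if P x then 1 else 0)) = (LINT x|M. indicator {x \<in> space M. P x} x)"
  by (intro Bintegral_cong) auto
 also have "... = measure M ({x \<in> space M. P x} \<inter> space M)" by simp
 also have "{x \<in> space M. P x} \<inter> space M = {x \<in> space M. P x}" by auto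
 finally show ?thesis .
qed

context iid
begin

text \<open>After truncation at 1 the random threshold is split: k * R / 2 is a sum over the
  observations and joins the summands, while the part quadratic in R becomes a random interval
  width. The event then forces a truncated observation, or L > z, or L within the random width below
  z. The condition k * a <= 1/4 keeps the merged summands below 1 and their variance within 4 * e of
  1.\<close>

lemma truncated_Berry_Esseen:
 assumes J: "finite J" "J ~= {}" and v: "v \<in> borel_measurable N" "integrable N (%y. (v y)^2)" "integral\<^sup>L N v = 0"
  and a: "0 < a" "a <= 1/4" and var: "a^2 * (card J * (LINT y|N. (v y)^2)) = 1"
  and e: "0 < e"
  and w1: "card J * (LINT y|N. (if abs (v y) <= 1 then 0 else (v y)^2)) <= e"
  and w2: "card J * (LINT y|N. (if abs (v y) <= 1 then abs (v y)^3 else 0)) <= e"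
  and k: "0 <= k" "k * a <= 1/4" and x: "0 <= x"
 defines "R \<equiv> %w. a^2 * SS (%y. (v y)^2) J w - 1"
 shows "\<P>(w in PI J. x + k * (R w / 2 - (R w)^2 / 2) < a * SS v J w)
  <= Q x + 1000000 * e"
proof (cases "e <= 1/100")
 case False
 interpret A: prob_space "PI J" by (rule prob_space_PI)
 have "\<P>(w in PI J. x + k * (R w / 2 - (R w)^2 / 2) < a * SS v J w) <= 1"
  by (rule A.prob_le_1)
 thus ?thesis using False Q_nonneg[of x] by linarith
next
 case e1: True
 interpret A: prob_space "PI J" by (rule prob_space_PI)
 define n where "n = real (card J)"
 have n: "1 <= n" using J unfolding n_def by (metis One_nat_def Suc_leI card_gt_0_iff of_nat_1 of_nat_le_iff)
 define u where "u = (%y. if abs (v y) <= 1 then v y else 0)"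
 have u1: "abs (u y) <= 1" for y by (simp add: u_def)
 have bu: "bm N u" using v(1) u1 by (intro bmI[of _ _ 1]) (auto simp: u_def[abs_def])
 have iv: "integrable N v"
 proof (rule Bintegrable_bound)
  show "integrable N (%y. 1 + (v y)^2)" using v(2) by simp
  show "AE y in N. norm (v y) <= norm (1 + (v y)^2)"
  proof (rule AE_I2)
   fix y
   have "0 <= (abs (v y) - 1)^2" by simp
   hence "2 * abs (v y) <= 1 + (v y)^2" by (simp add: sq_simps)
   moreover have "0 <= abs (v y)" by simp
   ultimately have "abs (v y) <= 1 + (v y)^2" by linarith
   thus "norm (v y) <= norm (1 + (v y)^2)" by simp
  qed
 qed (use v in auto)
 define tail where "tail = (%y. if abs (v y) <= 1 then 0 else (v y)^2)"
 have it: "integrable N tail"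
 proof (rule Bintegrable_bound[OF v(2)])
  show "AE y in N. norm (tail y) <= norm ((v y)^2)" by (simp add: tail_def)
 qed (use v(1) in \<open>auto simp: tail_def[abs_def]\<close>)
 define m where "m = integral\<^sup>L N u"
 define r where "r = (LINT y|N. tail y)"
 have r: "0 <= r" "n * r <= e" using w1 unfolding r_def tail_def n_def by (auto intro!: integral_nonneg_AE)
 have m: "n * abs m <= e"
 proof -
  have "m = (LINT y|N. u y - v y)" unfolding m_def using v(3) iv int_N[OF bu] by simp
  hence "abs m <= (LINT y|N. abs (u y - v y))" by (simp only: integral_abs_bound)
  also have "... <= (LINT y|N. tail y)"
  proof (intro integral_mono integrable_abs Bintegrable_diff int_N[OF bu] iv it)
   fix y show "abs (u y - v y) <= tail y"
   proof (cases "abs (v y) <= 1")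
    case False
    hence "abs (v y) * 1 <= abs (v y) * abs (v y)" by (intro mult_left_mono) auto
    thus ?thesis using False by (simp add: u_def tail_def power2_eq_square)
   qed (simp add: u_def tail_def)
  qed
  finally have "n * abs m <= n * r" unfolding r_def using n by (intro mult_left_mono) auto
  thus ?thesis using r by simp
 qed
 define m2 where "m2 = (LINT y|N. (u y)^2)"
 define m3 where "m3 = (LINT y|N. abs (u y)^3)"
 define m4 where "m4 = (LINT y|N. (u y)^4)"
 have m3: "n * m3 <= e"
 proof -
  have "m3 = (LINT y|N. (if abs (v y) <= 1 then abs (v y)^3 else 0))"
   unfolding m3_def by (intro Bintegral_cong) (auto simp: u_def)
  thus ?thesis using w2 by (simp add: n_def)
 qed
 have m43: "m4 <= m3" unfolding m4_def m3_def
 proof (intro integral_mono int_N bm_intros bu)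
  fix y
  have "abs (u y) * abs (u y)^3 <= 1 * abs (u y)^3" using u1 by (intro mult_right_mono) auto
  thus "(u y)^4 <= abs (u y)^3" by (simp add: power4_eq_xxxx power3_eq_cube mult.assoc abs_mult_self_eq)
 qed
 have m2: "0 <= m2" "m2 <= 1" "a^2 * (n * m2) = 1 - a^2 * (n * r)"
 proof -
  show "0 <= m2" by (simp add: m2_def)
  have "m2 <= (LINT y|N. 1)" unfolding m2_def using u1
   by (intro integral_mono int_N bm_intros bu) (simp add: abs_square_le_1)
  thus "m2 <= 1" using prob_space by simp
  have "m2 = (LINT y|N. (v y)^2 - tail y)" unfolding m2_def
   by (intro Bintegral_cong) (auto simp: u_def tail_def)
  also have "... = (LINT y|N. (v y)^2) - r" unfolding r_def using v(2) it by simp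
  finally have vv: "(LINT y|N. (v y)^2) = m2 + r" by simp
  have "a^2 * (n * (m2 + r)) = 1" using var unfolding vv n_def .
  thus "a^2 * (n * m2) = 1 - a^2 * (n * r)" by (simp add: algebra_simps)
 qed
 have m22: "m2^2 <= m4"
 proof -
  have "0 <= (LINT y|N. ((u y)^2 - m2)^2)" by simp
  also have "... = (LINT y|N. ((u y)^2)^2) - m2^2"
   unfolding m2_def using int_N[OF bm_power[OF bu, of 2]] int_N[OF bm_power[OF bm_power[OF bu, of 2], of 2]]
   by (rule variance_eq)
  finally show ?thesis by (simp add: m4_def flip: power_mult)
 qed
 have a2: "a^2 <= 1/16" using power_mono[OF a(2), of 2] a(1) by (simp add: power2_eq_square)
 have \<kappa>a: "k * a^2 <= 1/16"
 proof -
  have "(k * a) * a <= 1/4 * (1/4)" using k a by (intro mult_mono) auto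
  thus ?thesis by (simp add: power2_eq_square mult.assoc)
 qed
 define q where "q = (%y. a^2 * ((u y)^2 - m2))"
 \<comment> \<open>The linear part k * R / 2 of the random threshold is carried to the other side
   and merged into the summands; q is its centred contribution per observation.\<close>
 define h where "h = (%y. a * (u y - m) - k / 2 * q y)"
 have bq: "bm N q" unfolding q_def using bu by (intro bm_intros)
 have b\<eta>: "bm N h" unfolding h_def using bu bq by (intro bm_intros)
 have Eq0: "integral\<^sup>L N q = 0" unfolding q_def
  using int_N[OF bm_power[OF bu, of 2]] prob_space by (simp add: m2_def)
 have E\<eta>0: "integral\<^sup>L N h = 0" unfolding h_def
  using int_N[OF bu] int_N[OF bq] prob_space Eq0 by (simp add: m_def)
 have \<mu>1: "abs m <= 1"
 proof -
  have "1 * abs m <= n * abs m" using n by (intro mult_right_mono) auto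
  thus ?thesis using m e1 by simp
 qed
 have \<eta>b: "abs (h y) <= a * (abs (u y) + abs m) + 1/16 * (abs (u y) + m2)" for y
 proof -
  have "abs (h y) <= abs (a * (u y - m)) + abs (k / 2 * q y)" unfolding h_def by (rule abs_triangle_ineq4)
  moreover have "abs (a * (u y - m)) <= a * (abs (u y) + abs m)"
   using a by (simp add: abs_mult abs_triangle_ineq4)
  moreover have "abs (k / 2 * q y) <= 1/16 * (abs (u y) + m2)"
  proof -
   have "abs (k / 2 * q y) = (k * a^2) / 2 * abs ((u y)^2 - m2)" unfolding q_def using k by (simp add: abs_mult)
   also have "... <= 1/16 * abs ((u y)^2 - m2)" using \<kappa>a by (intro mult_right_mono) auto
   also have "... <= 1/16 * (abs (u y) + m2)"
   proof (rule mult_left_mono)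
    have "abs (u y) * abs (u y) <= abs (u y) * 1" using u1 by (intro mult_left_mono) auto
    hence "(u y)^2 <= abs (u y)" by (simp add: power2_eq_square)
    moreover have "0 <= (u y)^2" by simp
    ultimately show "abs ((u y)^2 - m2) <= abs (u y) + m2" using m2(1) abs_ge_zero[of "u y"]
    unfolding abs_le_iff by (intro conjI; linarith)
   qed simp
   finally show ?thesis .
  qed
  ultimately show ?thesis by linarith
 qed
 have \<eta>58: "abs (h y) <= 5/8" for y
 proof -
  have 1: "a * (abs (u y) + abs m) <= 1/4 * (1 + 1)" using a u1 \<mu>1 by (intro mult_mono add_mono) auto
  have 2: "1/16 * (abs (u y) + m2) <= 1/16 * (1 + 1)" using m2 u1 by (intro mult_left_mono add_mono) auto
  show ?thesis using order_trans[OF \<eta>b[of y] add_mono[OF 1 2]] by simp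
 qed
 have q4: "n * (LINT y|N. (q y)^2) <= a^2 * (a^2 * e)"
 proof -
  have "(LINT y|N. (q y)^2) = a^2 * (a^2 * (LINT y|N. ((u y)^2 - m2)^2))"
   unfolding q_def by (simp add: power_mult_distrib power2_eq_square[of "a^2"])
  also have "(LINT y|N. ((u y)^2 - m2)^2) = (LINT y|N. ((u y)^2)^2) - m2^2"
   unfolding m2_def using int_N[OF bm_power[OF bu, of 2]] int_N[OF bm_power[OF bm_power[OF bu, of 2], of 2]]
   by (rule variance_eq)
  also have "... = m4 - m2^2" by (simp add: m4_def flip: power_mult)
  also have "... <= m3" using m43 zero_le_power2[of m2] by linarith
  finally have "n * (LINT y|N. (q y)^2) <= n * (a^2 * (a^2 * m3))" using n by (intro mult_left_mono) (auto simp: mult_left_mono)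
  also have "... = a^2 * (a^2 * (n * m3))" by simp
  also have "... <= a^2 * (a^2 * e)" using m3 by (intro mult_left_mono) auto
  finally show ?thesis .
 qed
 have \<kappa>q4: "k * (n * (LINT y|N. (q y)^2)) <= e"
 proof -
  have "k * (n * (LINT y|N. (q y)^2)) <= k * (a^2 * (a^2 * e))" using q4 k by (intro mult_left_mono) auto
  also have "... = (k * a^2) * (a^2 * e)" by simp
  also have "... <= 1 * (1 * e)" using \<kappa>a a2 e k by (intro mult_mono) auto
  finally show ?thesis by simp
 qed
 define s where "s = (LINT y|N. (h y)^2)"
 \<comment> \<open>Four perturbations of the unit variance, each at most e: truncation, recentring,
   the cross term with q and the square of q.\<close>
 have s: "abs (n * s - 1) <= 4 * e"
 proof -
  define c1 where "c1 = (LINT y|N. (u y - m)^2)"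
  define c2 where "c2 = (LINT y|N. (u y - m) * ((u y)^2 - m2))"
  define c3 where "c3 = (LINT y|N. (q y)^2)"
  have "s = (LINT y|N. a^2 * (u y - m)^2 + (- (k * a * a^2) * ((u y - m) * ((u y)^2 - m2)) + k^2 / 4 * (q y)^2))"
   unfolding s_def h_def q_def
   by (intro Bintegral_cong) (auto simp: sq_field_simps)
  also have "... = a^2 * c1 + (- (k * a * a^2) * c2 + k^2 / 4 * c3)"
  proof -
   have "integrable N (%y. a^2 * (u y - m)^2)" "integrable N (%y. - (k * a * a^2) * ((u y - m) * ((u y)^2 - m2)))"
    "integrable N (%y. k^2 / 4 * (q y)^2)"
    using bu bq by (auto intro!: int_N bm_intros)
   thus ?thesis unfolding c1_def c2_def c3_def
    by (simp only: Bintegral_add Bintegrable_add integral_mult_right_zero)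
  qed
  finally have se: "s = a^2 * c1 + (- (k * a * a^2) * c2 + k^2 / 4 * c3)" .
  have s': "n * s = a^2 * (n * c1) - (k * a) * a^2 * (n * c2) + k^2 / 4 * (n * c3)"
   unfolding se by (simp add: algebra_simps)
  have c1: "c1 = m2 - m^2" unfolding c1_def m_def m2_def
   using int_N[OF bu] int_N[OF bm_power[OF bu, of 2]] by (rule variance_eq)
  have "a^2 * (n * c1) = 1 - a^2 * (n * r) - a^2 * (n * m^2)" unfolding c1 using m2(3) by (simp add: algebra_simps)
  moreover have "0 <= a^2 * (n * r)" using r n by simp
  moreover have "a^2 * (n * r) <= 1 * e"
   by (rule mult_mono) (use r n a2 e in auto)
  moreover have "0 <= a^2 * (n * m^2)" using n by simp
  moreover have "a^2 * (n * m^2) <= 1 * e"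
  proof -
   have "n * m^2 = (n * abs m) * abs m" by (simp add: power2_eq_square)
   also have "... <= e * 1" using m \<mu>1 n e by (intro mult_mono) auto
   finally have "n * m^2 <= e" by simp
   thus ?thesis by (intro mult_mono[of "a^2" 1]) (use a2 n e in auto)
  qed
  moreover have "abs ((k * a) * a^2 * (n * c2)) <= e"
  proof -
   have "c2 = (LINT y|N. ((u y)^3 - m2 * u y) - m * ((u y)^2 - m2))" unfolding c2_def
    by (intro Bintegral_cong) (auto simp: power2_eq_square power3_eq_cube algebra_simps)
   also have "... = (LINT y|N. (u y)^3) - m2 * m"
    using int_N[OF bu] int_N[OF bm_power[OF bu, of 2]] int_N[OF bm_power[OF bu, of 3]] prob_space
    by (simp add: m2_def m_def)
   finally have "abs c2 <= abs (\<integral>y. (u y)^3 \<partial>N) + abs (m2 * m)" by (simp only: abs_triangle_ineq4)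
   moreover have "abs (\<integral>y. (u y)^3 \<partial>N) <= m3"
    unfolding m3_def power_abs[symmetric] by (rule integral_abs_bound)
   moreover have "abs (m2 * m) <= 1 * abs m" unfolding abs_mult using m2 by (intro mult_right_mono) auto
   ultimately have "abs c2 <= m3 + abs m" by linarith
   hence "n * abs c2 <= n * (m3 + abs m)" using n by (intro mult_left_mono) auto
   hence nc2: "n * abs c2 <= 2 * e" using m3 m by (simp add: algebra_simps)
   have "abs ((k * a) * a^2 * (n * c2)) = ((k * a) * a^2) * (n * abs c2)"
    using k a n by (simp add: abs_mult)
   also have "... <= (1/4 * 1) * (2 * e)"
   proof (rule mult_mono[OF _ nc2])
    show "k * a * a^2 <= 1/4 * 1" using k a a2 by (intro mult_mono) auto
   qed (use n in auto)
   also have "... <= e" using e by simp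
   finally show ?thesis .
  qed
  moreover have "0 <= k^2 / 4 * (n * c3)" unfolding c3_def using n by simp
  moreover have "k^2 / 4 * (n * c3) <= e"
  proof -
   have "k^2 / 4 * (n * c3) <= k^2 / 4 * (a^2 * (a^2 * e))"
    unfolding c3_def using q4 by (intro mult_left_mono) auto
   also have "... = (k * a) * (k * a) * (a^2 * e) / 4" by (simp add: power2_eq_square)
   also have "... <= (1/4) * (1/4) * (1 * e) / 4" using k a a2 e by (intro divide_right_mono mult_mono) auto
   also have "... <= e" using e by simp
   finally show ?thesis .
  qed
  ultimately show ?thesis unfolding s' abs_le_iff by linarith
 qed
 have ns: "1/2 <= n * s" "n * s <= 2" using s e1 by (auto simp: abs_le_iff)
 have g3: "n * (LINT y|N. abs (h y)^3) <= 36 * e"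
 proof -
  have "(LINT y|N. abs (h y)^3) <= (LINT y|N. 9 * (2 * abs (u y)^3 + (abs m + m3)))"
  proof (intro integral_mono int_N bm_intros b\<eta> bu)
   fix y
   have "a * (abs (u y) + abs m) <= 1 * (abs (u y) + abs m)" using a by (intro mult_right_mono) auto
   hence "abs (h y) <= 9/8 * abs (u y) + abs m + m2"
    using order_trans[OF \<eta>b[of y] add_mono[OF _ sixteenth_bound[of "abs (u y)" m2]]] m2(1) by fastforce
   hence "abs (h y)^3 <= (9/8 * abs (u y) + abs m + m2)^3" by (intro power_mono) auto
   also have "... <= 9 * ((9/8 * abs (u y))^3 + abs m^3 + m2^3)" using m2 by (intro cube_sum3) auto
   also have "... <= 9 * (2 * abs (u y)^3 + abs m + m3)"
   proof (intro mult_left_mono add_mono)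
    show "(9/8 * abs (u y))^3 <= 2 * abs (u y)^3" by (simp add: power_mult_distrib power3_eq_cube[of "9/8"] power_divide)
    have "abs m^3 <= abs m^1" using \<mu>1 by (intro power_decreasing) auto
    thus "abs m^3 <= abs m" by simp
    have "m2^3 <= m2^2" using m2 by (intro power_decreasing) auto
    thus "m2^3 <= m3" using m22 m43 by linarith
   qed auto
   finally show "abs (h y)^3 <= 9 * (2 * abs (u y)^3 + (abs m + m3))" by simp
  qed
  also have "... = 9 * (2 * m3 + (abs m + m3))"
   using int_N[OF bm_power[OF bm_abs[OF bu], of 3]] prob_space by (simp add: m3_def)
  finally have "n * (LINT y|N. abs (h y)^3) <= n * (9 * (2 * m3 + (abs m + m3)))" using n by (intro mult_left_mono) auto
  also have "... = 9 * (3 * (n * m3) + n * abs m)" by (simp add: algebra_simps)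
  also have "... <= 9 * (3 * e + e)" using m3 m by (intro mult_left_mono add_mono) auto
  finally show ?thesis by simp
 qed
 define z where "z = x - 2 * e"
 \<comment> \<open>The quadratic part of the threshold as a random width; the summand 0 matches the
   form lam + c * (sum)^2 of the concentration inequality.\<close>
 define D where "D = (%w. 0 + k * (SS q J w)^2)"
 define L where "L = SS h J"
 have RC: "\<P>(w in PI J. z - D w <= L w \<and> L w <= z) <= 140 * (37 * e)"
 proof -
  have "\<P>(w in PI J. z - D w <= L w \<and> L w <= z)
   <= 140 * (36 * e + 0 + k * (card J * (LINT y|N. (q y)^2)))"
   unfolding D_def L_def
  proof (rule randomised_concentration[OF J(1) b\<eta> E\<eta>0 _ bq Eq0])
   show "abs (h y) <= 1" for y using \<eta>58[of y] by simp
  qed (use ns g3 e e1 k in \<open>auto simp: n_def s_def\<close>)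
  also have "... <= 140 * (36 * e + 0 + e)" using \<kappa>q4 by (simp add: n_def)
  finally show ?thesis by simp
 qed
 define g where "g = sqrt (n * s)"
 have g: "5/8 <= g" "g^2 = n * s" "g^2 <= 1 + 4 * e"
 proof -
  have "(5/8)^2 <= n * s" using ns(1) by (simp add: power2_eq_square)
  thus "5/8 <= g" unfolding g_def by (rule real_le_rsqrt)
  show "g^2 = n * s" unfolding g_def using ns by simp
  thus "g^2 <= 1 + 4 * e" using s by (auto simp: abs_le_iff)
 qed
 \<comment> \<open>Division by g restores unit variance, and g^3 >= 1/8 turns 36 * e into 288 * e.
   The product 3400 * 288 accounts for most of the final constant 1000000.\<close>
 have BE: "\<P>(w in PI J. z < L w) <= Q x + 5 * e + 3400 * (288 * e)"
 proof -
  have "{w \<in> space (PI J). z < L w} = {w \<in> space (PI J). z / g < SS (%y. h y / g) J w}"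
   using g(1) by (auto simp: L_def SS_def divide_strict_right_mono simp flip: sum_divide_distrib)
    (simp_all add: divide_less_cancel)
  hence "\<P>(w in PI J. z < L w)
   <= Q (z / g) + 3400 * (card J * (LINT y|N. abs (h y / g)^3))"
  proof (simp only:, intro Berry_Esseen_bounded J bm_divide b\<eta>)
   show "(LINT y|N. h y / g) = 0" using E\<eta>0 by simp
   show "abs (h y / g) <= 1" for y using \<eta>58[of y] g(1) by (simp add: abs_divide divide_le_eq)
   have "card J * (LINT y|N. (h y / g)^2) = (n * s) / g^2"
    by (simp add: power_divide n_def s_def)
   also have "... = 1" unfolding g(2) using ns by (intro divide_self) auto
   finally show "card J * (LINT y|N. (h y / g)^2) = 1" .
  qed
  also have "card J * (LINT y|N. abs (h y / g)^3) = (n * (LINT y|N. abs (h y)^3)) / g^3"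
   using g(1) by (simp add: abs_divide power_divide n_def)
  also have "... <= (36 * e) / (1/8)"
  proof (rule frac_le)
   have "(1/2)^3 <= g^3" using g(1) by (intro power_mono) auto
   thus "1/8 <= g^3" by (simp add: power3_eq_cube)
  qed (use g3 e in auto)
  also have "Q (z / g) <= Q x + 5 * e" unfolding z_def using Q_scale[OF x less_imp_le[OF e] _ g(3)] g(1) by simp
  finally show ?thesis by simp
 qed
 define w0 where "w0 = (%y. if abs (v y) <= 1 then 0 else (1::real))"
 have bw0: "bm N w0" unfolding w0_def using v(1) by (intro bm_if pred_le) auto
 have W0: "(LINT w|PI J. SS w0 J w) <= e"
 proof -
  have "integral\<^sup>L N w0 <= r" unfolding r_def
  proof (intro integral_mono int_N[OF bw0] it)
   fix y show "w0 y <= tail y"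
    using one_le_power[of "abs (v y)" 2] by (auto simp: w0_def tail_def)
  qed
  hence "n * integral\<^sup>L N w0 <= n * r" using n by (intro mult_left_mono) auto
  thus ?thesis using E_SS[OF int_N[OF bw0]] r by (simp add: n_def)
 qed
 have mL: "L \<in> borel_measurable (PI J)" "SS q J \<in> borel_measurable (PI J)"
  using b\<eta> bq unfolding L_def by (auto simp: bm_def)
 have b1: "bm (PI J) (%w. if z < L w then 1 else 0)" using mL by (intro bm_if pred_less) auto
 have b2: "bm (PI J) (%w. if z - D w <= L w \<and> L w <= z then 1 else 0)"
  using mL unfolding D_def by (intro bm_if pred_intros_logic pred_le) auto
 have "\<P>(w in PI J. x + k * (R w / 2 - (R w)^2 / 2) < a * SS v J w)
  <= (LINT w|PI J. SS w0 J w + ((if z < L w then 1 else 0) + (if z - D w <= L w \<and> L w <= z then 1 else 0)))"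
 proof (rule A.measure_le_integral)
  have [measurable]: "SS v J \<in> borel_measurable (PI J)" "SS (%y. (v y)^2) J \<in> borel_measurable (PI J)"
   using v(1) by auto
  show "{w \<in> space (PI J). x + k * (R w / 2 - (R w)^2 / 2) < a * SS v J w} \<in> A.events"
   unfolding R_def by measurable
  show "integrable (PI J) (%w. SS w0 J w + ((if z < L w then 1 else 0) + (if z - D w <= L w \<and> L w <= z then 1 else 0)))"
   by (rule int_PI) (intro bm_add b1 b2 bm_SS bw0 order_refl)
  fix w
  let ?E = "{w \<in> space (PI J). x + k * (R w / 2 - (R w)^2 / 2) < a * SS v J w}"
  have w0n: "0 <= w0 y" for y by (simp add: w0_def)
  show "indicator ?E w <= SS w0 J w + ((if z < L w then 1 else 0) + (if z - D w <= L w \<and> L w <= z then 1 else 0))"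
  proof (cases "\<exists>j\<in>J. \<not> \<bar>v (w j)\<bar> <= 1")
   case True
   then obtain j where j: "j \<in> J" "\<not> \<bar>v (w j)\<bar> <= 1" by blast
   have "w0 (w j) <= SS w0 J w" unfolding SS_def using j J w0n by (intro member_le_sum) auto
   moreover have "w0 (w j) = 1" using j by (simp add: w0_def)
   moreover have "indicator ?E w <= (1::real)" by (simp add: indicator_def)
   moreover have "0 <= (if z < L w then 1 else 0) + (if z - D w <= L w \<and> L w <= z then 1 else (0::real))" by simp
   ultimately show ?thesis by linarith
  next
   case False
   have S0: "0 <= SS w0 J w" unfolding SS_def by (intro sum_nonneg w0n)
   have vu: "SS v J w = SS u J w" "SS (%y. (v y)^2) J w = SS (%y. (u y)^2) J w"
    using False unfolding SS_def by (auto intro!: sum.cong simp: u_def)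
   have "z - D w <= L w" if E: "w \<in> ?E"
   proof -
    define T where "T = SS q J w"
    define b where "b = - (a^2 * (n * r))"
    have "T = a^2 * SS (%y. (u y)^2) J w - a^2 * (n * m2)"
    unfolding T_def q_def SS_def by (simp add: sum_distrib_left[symmetric] sum_subtractf n_def algebra_simps)
    hence RT: "R w = T + b" unfolding R_def vu b_def using m2(3) by simp
    have LT: "L w = a * SS u J w - a * (n * m) - k / 2 * T"
    proof -
    have "L w = (\<Sum>j\<in>J. a * u (w j)) - (\<Sum>j\<in>J. a * m) - (\<Sum>j\<in>J. k / 2 * q (w j))"
    unfolding L_def h_def SS_def by (simp only: right_diff_distrib sum_subtractf)
    thus ?thesis unfolding T_def SS_def sum_distrib_left n_def by simp
    qed
    have b: "0 <= - b" "- b <= a^2 * e" "- b <= 1"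
    proof -
    show "0 <= - b" unfolding b_def using n r by simp
    show b2: "- b <= a^2 * e" unfolding b_def using r by (simp add: mult_left_mono)
    also have "a^2 * e <= 1 * 1" using a2 e e1 by (intro mult_mono) auto
    finally show "- b <= 1" by simp
    qed
    have bb: "b^2 <= - b" using mult_left_mono[OF b(3) b(1)] by (simp add: power2_eq_square)
    \<comment> \<open>Uses (T + b)^2 <= 2 * T^2 + 2 * b^2, where b is minus the scaled second moment
      lost by truncation, a quantity of order a^2 * e.\<close>
    have "R w / 2 - (R w)^2 / 2 \<ge> T / 2 - T^2 + (b / 2 - b^2)"
    proof -
    have "0 <= (T - b)^2" by simp
    thus ?thesis unfolding RT by (simp add: sq_simps)
    qed
    hence "k * (R w / 2 - (R w)^2 / 2) \<ge> k * (T / 2 - T^2 + (b / 2 - b^2))"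
    using k by (intro mult_left_mono) auto
    moreover have "x + k * (R w / 2 - (R w)^2 / 2) < a * SS u J w" using E vu by simp
    moreover have "k * (b / 2 - b^2) \<ge> - e"
    proof -
    have "k * (b^2 - b / 2) <= k * (2 * (a^2 * e))" using b bb k by (intro mult_left_mono) auto
    also have "... = 2 * (k * a^2) * e" by simp
    also have "... <= 2 * (1/16) * e" using \<kappa>a e by (intro mult_right_mono mult_left_mono) auto
    finally show ?thesis using e by (simp add: algebra_simps)
    qed
    moreover have "a * (n * m) \<ge> - e" "a * (n * m) <= e"
    proof -
    have "abs (a * (n * m)) = a * (n * abs m)" using a n by (simp add: abs_mult)
    also have "... <= 1 * e" using a m n by (intro mult_mono) auto
    finally show "a * (n * m) \<ge> - e" "a * (n * m) <= e" by (auto simp: abs_le_iff)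
    qed
    ultimately have "x - 2 * e <= L w + k * T^2" unfolding LT by (simp add: algebra_simps)
    thus ?thesis by (simp add: z_def D_def T_def)
   qed
   thus ?thesis using S0 by (auto simp: indicator_def not_less)
  qed
 qed
 also have "... = (LINT w|PI J. SS w0 J w) + (\<P>(w in PI J. z < L w)
   + \<P>(w in PI J. z - D w <= L w \<and> L w <= z))"
  unfolding integral_if_pred[symmetric]
  using int_PI[OF b1] int_PI[OF b2] int_PI[OF bm_SS[OF bw0 order_refl]]
  by (simp only: Bintegral_add Bintegrable_add)
 also have "... <= e + ((Q x + 5 * e + 3400 * (288 * e)) + 140 * (37 * e))"
  by (intro add_mono W0 BE RC)
 also have "... <= Q x + 1000000 * e" using e by simp
 finally show ?thesis .
qed

end

subsection \<open>Moderate deviations\<close>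

text \<open>In the expansion of exp (y - y^2 / 2) the quadratic terms cancel, so the error is cubic
  for small y and hence at most of order |y| powr s. For large |y| the exponent never exceeds 1/2:
  self-normalisation makes exponential moments finite under a power moment only.\<close>

lemma exp_tangent_bound:
 fixes y s :: real
 assumes s: "2 < s" "s <= 3"
 shows "exp (y - y^2 / 2) <= 1 + y + 5 * abs y powr s"
proof (cases "abs y <= 1")
 case True
 define w where "w = y - y^2 / 2"
 have y2: "y^2 <= abs y" using True mult_left_mono[of "abs y" 1 "abs y"] by (simp add: power2_eq_square)
 have w: "abs w <= 3/2 * abs y"
 proof -
  have "abs w <= abs y + abs (y^2 / 2)" unfolding w_def by (rule abs_triangle_ineq4)
  thus ?thesis using y2 by simp
 qed
 obtain t where t: "abs t <= abs w" "exp w = (\<Sum>m<3. w ^ m / fact m) + exp t / fact 3 * w ^ 3"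
  using Maclaurin_exp_le[of w 3] by blast
 have "abs w <= 3/2" using w True by simp
 hence "t <= 3/2" using t(1) by linarith
 hence "exp t <= exp (3/2)" by simp
 also have "exp (3/2) <= (6::real)"
 proof -
  have "exp (3/2) = exp (1/2 :: real) ^ 3" by (simp flip: exp_of_nat_mult)
  also have "... <= (7/4) ^ 3"
   using exp_bound[of "1/2"] by (intro power_mono) (auto simp: power2_eq_square)
  finally show ?thesis by (simp add: power3_eq_cube)
 qed
 finally have et: "exp t <= 6" .
 have "exp t / fact 3 * w^3 <= exp t / fact 3 * abs w^3"
  by (intro mult_left_mono) (auto simp flip: power_abs)
 also have "... <= 1 * (3/2 * abs y)^3"
  using et w by (intro mult_mono power_mono) (auto simp: fact_numeral)
 finally have r0: "exp t / fact 3 * w^3 <= 1 * (3/2 * abs y)^3" .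
 have "(3/2 * abs y)^3 = 27/8 * abs y^3" by (simp add: power_mult_distrib power3_eq_cube)
 hence r: "exp t / fact 3 * w^3 <= 27/8 * abs y^3" using r0 by linarith
 have "(\<Sum>m<3. w ^ m / fact m) = 1 + w + w^2 / 2"
  by (simp add: numeral_3_eq_3 power2_eq_square)
 also have "... = 1 + y - y^3 / 2 + y^4 / 8"
  unfolding w_def by (simp add: power2_eq_square power3_eq_cube power4_eq_xxxx field_simps)
 also have "... <= 1 + y + abs y^3 / 2 + abs y^3 / 8"
 proof -
  have "- (y^3) <= abs y^3" by (metis abs_ge_minus_self power_abs)
  moreover have "y^4 <= abs y^3"
  proof -
   have "abs y^4 <= abs y^3" using True by (intro power_decreasing) auto
   thus ?thesis by simp
  qed
  ultimately show ?thesis by simp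
 qed
 finally have "exp w <= 1 + y + abs y^3 / 2 + abs y^3 / 8 + 27/8 * abs y^3" unfolding t(2) using r by linarith
 also have "... = 1 + y + 4 * abs y^3" by simp
 also have "abs y^3 <= abs y powr s"
 proof (cases "y = 0")
  case False
  hence "abs y^3 = abs y powr 3" by simp
  also have "... <= abs y powr s" using True False s by (intro powr_mono') auto
  finally show ?thesis .
 qed simp
 finally have "exp w <= 1 + y + 4 * abs y powr s" by simp
 thus ?thesis unfolding w_def using powr_ge_zero[of "abs y" s] by linarith
next
 case False
 have "0 <= (y - 1)^2" by simp
 hence "y - y^2 / 2 <= 1/2" by (simp add: sq_simps)
 hence "exp (y - y^2 / 2) <= exp (1/2)" by simp
 also have "... <= 2" using exp_bound[of "1/2"] by (simp add: power2_eq_square)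
 finally have e: "exp (y - y^2 / 2) <= 2" .
 have "abs y powr 1 <= abs y powr s" using False s by (intro powr_mono) auto
 hence "abs y <= abs y powr s" using False by simp
 thus ?thesis using e False by (auto simp: abs_if split: if_splits)
qed

lemma exp_minus_bound:
 fixes t p :: real
 assumes t: "0 <= t" and p: "1 < p" "p <= 2"
 shows "exp (- t) <= 1 - t + t powr p"
proof (cases "t <= 1")
 case True
 have "exp (- t) <= 1 - t + t^2"
 proof -
  have "1 + t <= exp t" by (rule exp_ge_add_one_self)
  hence "exp (- t) <= 1 / (1 + t)" using t by (simp add: exp_minus field_simps)
  also have "... <= 1 - t + t^2" using t by (simp add: field_simps power2_eq_square power3_eq_cube)
  finally show ?thesis .
 qed
 also have "t^2 <= t powr p"
 proof (cases "t = 0")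
  case False
  hence "t^2 = t powr 2" using t by simp
  also have "... <= t powr p" using True False p t by (intro powr_mono') auto
  finally show ?thesis .
 qed simp
 finally show ?thesis by simp
next
 case False
 have "t powr 1 <= t powr p" using False p by (intro powr_mono) auto
 moreover have "exp (- t) <= 1" using t by simp
 moreover have "t powr 1 = t" using t by simp
 ultimately show ?thesis by linarith
qed

lemma divide_sqrt_powr:
 fixes y n s :: real
 assumes "0 <= y" "0 < n"
 shows "(y / sqrt n) powr s = y powr s * n powr (- s / 2)"
proof -
 have "sqrt n powr s = (n powr (1/2)) powr s" using assms by (simp only: powr_half_sqrt less_imp_le)
 also have "... = n powr (s / 2)" unfolding powr_powr by simp
 finally have "(y / sqrt n) powr s = y powr s / n powr (s / 2)" using assms by (simp add: powr_divide)
 thus ?thesis using powr_minus_divide[of n "s/2"] by simp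
qed

context iid
begin

lemma E_prod_powers:
 assumes "finite J" "integrable N h"
 shows "(LINT w|PI J. (\<Prod>j\<in>J. h (w j))) = (integral\<^sup>L N h :: real) ^ card J"
  and "integrable (PI J) (%w. \<Prod>j\<in>J. h (w j))"
 using psf.product_integral_prod[OF assms(1), of "%_. h"] psf.product_integrable_prod[OF assms(1), of "%_. h"] assms
 by auto

text \<open>Exponential Markov inequality on the left side, where nonnegativity makes a p-th moment
  with p > 1 sufficient. The parameter lam solves lam^p * B = lam * e / 2, so the moment term eats
  half of the linear gain.\<close>

lemma lower_tail:
 fixes Y :: "'b => real" and p e B :: real
 assumes J: "finite J" and Y: "Y \<in> borel_measurable N" "!!y. 0 <= Y y" "integrable N Y" "integral\<^sup>L N Y = 1"
  and p: "1 < p" "p <= 2" and Yp: "integrable N (%y. Y y powr p)" "(LINT y|N. Y y powr p) <= B" and B: "1 <= B"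
  and e: "0 < e"
 shows "\<P>(w in PI J. SS Y J w <= card J * (1 - e))
  <= exp (- (card J * (e powr (p / (p - 1)) / (2 * (2 * B) powr (1 / (p - 1))))))"
proof -
 interpret A: prob_space "PI J" by (rule prob_space_PI)
 define n where "n = real (card J)"
 define lam where "lam = (e / (2 * B)) powr (1 / (p - 1))"
 have lam: "0 < lam" unfolding lam_def using e B by simp
 have lp: "lam powr p = lam * (e / (2 * B))"
 proof -
  have "lam powr p = lam powr (1 + (p - 1))" by simp
  also have "... = lam powr 1 * lam powr (p - 1)" by (rule powr_add)
  also have "lam powr (p - 1) = e / (2 * B)" unfolding lam_def powr_powr using p e B by simp
  finally show ?thesis using lam by simp
 qed
 define h where "h = (%y. exp (- (lam * Y y)))"
 have ih: "integrable N h"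
  unfolding h_def using Y lam by (intro integrable_const_bound[of _ 1]) auto
 have "integral\<^sup>L N h <= (LINT y|N. 1 - lam * Y y + lam powr p * Y y powr p)"
 proof (intro integral_mono ih Bintegrable_add Bintegrable_diff integrable_mult_right Y Yp)
  fix y
  show "h y <= 1 - lam * Y y + lam powr p * Y y powr p"
   unfolding h_def using exp_minus_bound[of "lam * Y y" p] Y(2)[of y] lam p by (simp add: powr_mult)
 qed auto
 also have "... = 1 - lam + lam powr p * (LINT y|N. Y y powr p)"
  using Y Yp prob_space by simp
 also have "... <= 1 - lam + lam powr p * B" using Yp by (intro add_left_mono mult_left_mono) auto
 also have "... = 1 + (- lam + lam * (e / 2))" unfolding lp using B by simp
 also have "... <= exp (- lam + lam * (e / 2))" by (rule exp_ge_add_one_self)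
 finally have eh: "integral\<^sup>L N h <= exp (- lam + lam * (e / 2))" .
 have hn: "0 <= integral\<^sup>L N h" by (simp add: h_def)
 have "\<P>(w in PI J. SS Y J w <= n * (1 - e))
  <= (LINT w|PI J. exp (lam * (n * (1 - e))) * (\<Prod>j\<in>J. h (w j)))"
 proof (rule A.measure_le_integral)
  have [measurable]: "SS Y J \<in> borel_measurable (PI J)" using Y by auto
  show "{w \<in> space (PI J). SS Y J w <= n * (1 - e)} \<in> A.events" by measurable
  show "integrable (PI J) (%w. exp (lam * (n * (1 - e))) * (\<Prod>j\<in>J. h (w j)))"
   using E_prod_powers(2)[OF J ih] by simp
  fix w
  have "exp (lam * (n * (1 - e))) * (\<Prod>j\<in>J. h (w j)) = exp (lam * (n * (1 - e)) - lam * SS Y J w)"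
  proof -
   have "(\<Prod>j\<in>J. h (w j)) = exp (\<Sum>j\<in>J. - (lam * Y (w j)))"
    unfolding h_def by (rule exp_sum[OF J, symmetric])
   also have "(\<Sum>j\<in>J. - (lam * Y (w j))) = - (lam * SS Y J w)" by (simp add: SS_def sum_negf sum_distrib_left)
   finally show ?thesis by (simp flip: exp_add)
  qed
  moreover have "1 <= exp (lam * (n * (1 - e)) - lam * SS Y J w)" if "SS Y J w <= n * (1 - e)"
   using that lam by simp
  ultimately show "indicator {w \<in> space (PI J). SS Y J w <= n * (1 - e)} w
    <= exp (lam * (n * (1 - e))) * (\<Prod>j\<in>J. h (w j))"
   by (auto simp: indicator_def)
 qed
 also have "... = exp (lam * (n * (1 - e))) * integral\<^sup>L N h ^ card J"
  using E_prod_powers(1)[OF J ih] by simp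
 also have "... <= exp (lam * (n * (1 - e))) * exp (- lam + lam * (e / 2)) ^ card J"
  using eh hn by (intro mult_left_mono power_mono) auto
 also have "... = exp (lam * (n * (1 - e)) + n * (- lam + lam * (e / 2)))"
  by (simp add: n_def exp_add flip: exp_of_nat_mult)
 also have "lam * (n * (1 - e)) + n * (- lam + lam * (e / 2)) = - (n * (lam * e / 2))"
  by (simp add: algebra_simps)
 also have "lam * e / 2 = e powr (p / (p - 1)) / (2 * (2 * B) powr (1 / (p - 1)))"
 proof -
  have "e powr (p / (p - 1)) = e powr (1 + 1 / (p - 1))" using p by (simp add: field_simps)
  also have "... = e * e powr (1 / (p - 1))" using e by (simp add: powr_add)
  finally show ?thesis unfolding lam_def using e B by (simp add: powr_divide mult.commute)
 qed
 finally show ?thesis by (simp add: n_def)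
qed

end

locale iid_moment = iid N for N :: "'b measure" +
 fixes X :: "'b => real" and s B :: real
 assumes X_meas [measurable]: "X \<in> borel_measurable N"
  and s: "2 < s" "s <= 3" and B: "1 <= B"
  and X_mom: "integrable N (%y. abs (X y) powr s)" "(LINT y|N. abs (X y) powr s) <= B"
  and X_sq: "integrable N (%y. (X y)^2)" "(LINT y|N. (X y)^2) = 1"
  and X_mean: "integrable N X" "integral\<^sup>L N X = 0"
begin

lemma iid_moment_minus: "iid_moment N (%y. - X y) s B"
 using X_meas s B X_mom X_sq X_mean by unfold_locales auto

text \<open>Scaling by t = a * sqrt n makes truncation at 1 a truncation of X at a * sqrt n. As 2 <
  s <= 3, both the large squares and the small cubes of v lie below |v| powr s, so a single s-th
  moment yields e; its dependence on a is the factor a powr (- s).\<close>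

lemma Berry_Esseen_quadratic:
 assumes J: "finite J" "J ~= {}" and a: "0 < a" "a <= 1/4" and k: "0 <= k" "k * a <= 1/4" and x: "0 <= x"
 defines "n \<equiv> real (card J)"
 defines "R \<equiv> %w. SS (%y. (X y)^2) J w / n - 1"
 shows "\<P>(w in PI J. x + k * (R w / 2 - (R w)^2 / 2) < SS X J w / sqrt n)
  <= Q x + 1000000 * (B * n powr (1 - s / 2) * a powr (- s))"
proof -
 have n: "0 < n" using J unfolding n_def by (simp add: card_gt_0_iff)
 define t where "t = a * sqrt n"
 have t: "0 < t" using a n by (simp add: t_def)
 define v where "v = (%y. X y / t)"
 define e where "e = B * n powr (1 - s / 2) * a powr (- s)"
 have e0: "e = n * (B * t powr (- s))"
 proof -
  have "n * t powr (- s) = n powr 1 * (a powr (- s) * sqrt n powr (- s))"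
   unfolding t_def using a n by (simp add: powr_mult)
  also have "sqrt n powr (- s) = n powr (- s / 2)"
   using n by (simp add: powr_half_sqrt[symmetric] powr_powr)
  also have "n powr 1 * (a powr (- s) * n powr (- s / 2)) = a powr (- s) * (n powr 1 * n powr (- s / 2))"
   by (simp only: mult.left_commute)
  also have "n powr 1 * n powr (- s / 2) = n powr (1 - s / 2)"
   by (simp only: powr_add[symmetric]) simp
  finally show ?thesis unfolding e_def by (simp add: mult_ac)
 qed
 have epos: "0 < e" unfolding e_def using B n a by simp
 have vs: "integrable N (%y. abs (v y) powr s)" "n * (LINT y|N. abs (v y) powr s) <= e"
 proof -
  have eq: "abs (v y) powr s = t powr (- s) * abs (X y) powr s" for y
   unfolding v_def using t by (simp add: abs_divide powr_divide powr_minus field_simps)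
  show "integrable N (%y. abs (v y) powr s)" unfolding eq using X_mom by simp
  have "(LINT y|N. abs (v y) powr s) = t powr (- s) * (LINT y|N. abs (X y) powr s)" unfolding eq by simp
  also have "... <= t powr (- s) * B" using X_mom by (intro mult_left_mono) auto
  finally show "n * (LINT y|N. abs (v y) powr s) <= e" unfolding e0 using n by (simp add: mult_ac)
 qed
 have vm: "v \<in> borel_measurable N" unfolding v_def by measurable
 have main: "\<P>(w in PI J. x + k * ((a^2 * SS (%y. (v y)^2) J w - 1) / 2 - (a^2 * SS (%y. (v y)^2) J w - 1)^2 / 2) < a * SS v J w)
  <= Q x + 1000000 * e"
 proof (rule truncated_Berry_Esseen[OF J vm _ _ a _ epos _ _ k x])
  show "integrable N (%y. (v y)^2)" unfolding v_def using X_sq by (simp add: power_divide)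
  show "integral\<^sup>L N v = 0" unfolding v_def using X_mean by simp
  have "a^2 * (n * (1 / t^2)) = 1" unfolding t_def using a n by (simp add: power_mult_distrib)
  moreover have v2: "(LINT y|N. (v y)^2) = 1 / t^2" unfolding v_def using X_sq by (simp add: power_divide)
  ultimately show "a^2 * (card J * (LINT y|N. (v y)^2)) = 1" unfolding n_def[symmetric] v2 by blast
  have "(LINT y|N. (if abs (v y) <= 1 then 0 else (v y)^2)) <= (LINT y|N. abs (v y) powr s)"
  proof (rule integral_mono_AE')
   show "AE y in N. (if abs (v y) <= 1 then 0 else (v y)^2) <= abs (v y) powr s"
   proof (rule AE_I2)
    fix y
    have "(v y)^2 <= abs (v y) powr s" if "1 < abs (v y)"
    proof -
    have "(v y)^2 = abs (v y) powr 2" using that by (subst powr_numeral) auto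
    also have "... <= abs (v y) powr s" using that s by (intro powr_mono) auto
    finally show ?thesis .
    qed
    thus "(if abs (v y) <= 1 then 0 else (v y)^2) <= abs (v y) powr s" by simp
   qed
  qed (use vs in auto)
  hence "n * (LINT y|N. (if abs (v y) <= 1 then 0 else (v y)^2)) <= n * (LINT y|N. abs (v y) powr s)"
   using n by (intro mult_left_mono) auto
  thus "card J * (LINT y|N. (if abs (v y) <= 1 then 0 else (v y)^2)) <= e" using vs(2) by (simp add: n_def)
  have "(LINT y|N. (if abs (v y) <= 1 then abs (v y)^3 else 0)) <= (LINT y|N. abs (v y) powr s)"
  proof (rule integral_mono_AE')
   show "AE y in N. (if abs (v y) <= 1 then abs (v y)^3 else 0) <= abs (v y) powr s"
   proof (rule AE_I2)
    fix y
    have "abs (v y)^3 <= abs (v y) powr s" if "abs (v y) <= 1"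
    proof (cases "v y = 0")
    case False
    hence "abs (v y)^3 = abs (v y) powr 3" by simp
    also have "... <= abs (v y) powr s" using that False s by (intro powr_mono') auto
    finally show ?thesis .
    qed simp
    thus "(if abs (v y) <= 1 then abs (v y)^3 else 0) <= abs (v y) powr s" by simp
   qed
  qed (use vs in auto)
  hence "n * (LINT y|N. (if abs (v y) <= 1 then abs (v y)^3 else 0)) <= n * (LINT y|N. abs (v y) powr s)"
   using n by (intro mult_left_mono) auto
  thus "card J * (LINT y|N. (if abs (v y) <= 1 then abs (v y)^3 else 0)) <= e" using vs(2) by (simp add: n_def)
 qed
 have eq1: "a * SS v J w = SS X J w / sqrt n" for w
  unfolding v_def SS_def t_def using a n by (simp add: sum_divide_distrib[symmetric])
 have eq2: "a^2 * SS (%y. (v y)^2) J w = SS (%y. (X y)^2) J w / n" for w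
  unfolding v_def SS_def t_def using a n by (simp add: power_divide power_mult_distrib sum_divide_distrib[symmetric])
 show ?thesis using main unfolding eq1 eq2 R_def e_def .
qed

lemma Berry_Esseen_one_sided:
 assumes J: "finite J" "J ~= {}" and x: "0 <= x"
 defines "n \<equiv> real (card J)"
 shows "\<P>(w in PI J. x < SS X J w / sqrt n) <= Q x + 64000000 * (B * n powr (1 - s / 2))"
proof -
 have n: "0 < n" using J unfolding n_def by (simp add: card_gt_0_iff)
 have "\<P>(w in PI J. x < SS X J w / sqrt n) <= Q x + 1000000 * (B * n powr (1 - s / 2) * (1/4) powr (- s))"
  using Berry_Esseen_quadratic[OF J, of "1/4" 0 x] x unfolding n_def by simp
 also have "(1/4) powr (- s) <= (64::real)"
 proof -
  have "(1/4) powr (- s) = (4::real) powr s" by (simp add: powr_minus_divide powr_divide)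
  also have "... <= 4 powr 3" using s by (intro powr_mono) auto
  finally show ?thesis by simp
 qed
 also have "Q x + 1000000 * (B * n powr (1 - s / 2) * 64) = Q x + 64000000 * (B * n powr (1 - s / 2))" by simp
 finally show ?thesis using B by (simp add: mult_left_mono)
qed

lemma SS_minus: "SS (%y. - X y) J w = - SS X J w"
 unfolding SS_def by (simp add: sum_negf)

lemma Berry_Esseen_two_sided:
 assumes J: "finite J" "J ~= {}" and x: "0 <= x"
 defines "n \<equiv> real (card J)"
 shows "\<P>(w in PI J. x < abs (SS X J w) / sqrt n) <= 2 * Q x + 128000000 * (B * n powr (1 - s / 2))"
proof -
 interpret A: prob_space "PI J" by (rule prob_space_PI)
 interpret m: iid_moment N "%y. - X y" s B by (rule iid_moment_minus)
 have [measurable]: "SS X J \<in> borel_measurable (PI J)" by auto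
 have "{w \<in> space (PI J). x < abs (SS X J w) / sqrt n}
   \<subseteq> {w \<in> space (PI J). x < SS X J w / sqrt n} \<union> {w \<in> space (PI J). x < - SS X J w / sqrt n}"
  by (auto simp: abs_if)
 hence "\<P>(w in PI J. x < abs (SS X J w) / sqrt n)
  <= measure (PI J) ({w \<in> space (PI J). x < SS X J w / sqrt n} \<union> {w \<in> space (PI J). x < - SS X J w / sqrt n})"
  by (intro A.finite_measure_mono) measurable
 also have "... <= \<P>(w in PI J. x < SS X J w / sqrt n) + \<P>(w in PI J. x < - SS X J w / sqrt n)"
  by (intro measure_subadditive) (auto simp: A.emeasure_finite)
 also have "... <= (Q x + 64000000 * (B * n powr (1 - s / 2))) + (Q x + 64000000 * (B * n powr (1 - s / 2)))"
  using Berry_Esseen_one_sided[OF J x] m.Berry_Esseen_one_sided[OF J x]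
  unfolding n_def SS_minus by (intro add_mono) auto
 finally show ?thesis by simp
qed

text \<open>The linear term of \<open>exp_tangent_bound\<close> integrates to zero, and only the
  s-th moment remains.\<close>

lemma exp_moment:
 assumes lam: "0 <= lam"
 shows "integrable N (%y. exp (lam * X y - (lam * X y)^2 / 2))"
  "(LINT y|N. exp (lam * X y - (lam * X y)^2 / 2)) <= exp (5 * lam powr s * B)"
proof -
 show i: "integrable N (%y. exp (lam * X y - (lam * X y)^2 / 2))"
 proof (rule integrable_const_bound)
  show "AE y in N. norm (exp (lam * X y - (lam * X y)^2 / 2)) <= exp (1/2)"
  proof (rule AE_I2)
   fix y
   have "0 <= (lam * X y - 1)^2" by simp
   hence "lam * X y - (lam * X y)^2 / 2 <= 1/2" by (simp add: sq_simps)
   thus "norm (exp (lam * X y - (lam * X y)^2 / 2)) <= exp (1/2)" by simp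
  qed
 qed measurable
 have "(LINT y|N. exp (lam * X y - (lam * X y)^2 / 2)) <= (LINT y|N. 1 + lam * X y + 5 * lam powr s * abs (X y) powr s)"
 proof (intro integral_mono i Bintegrable_add integrable_mult_right X_mean X_mom)
  fix y show "exp (lam * X y - (lam * X y)^2 / 2) <= 1 + lam * X y + 5 * lam powr s * abs (X y) powr s"
   using exp_tangent_bound[OF s, of "lam * X y"] lam by (simp add: abs_mult powr_mult)
 qed auto
 also have "... = 1 + 5 * lam powr s * (LINT y|N. abs (X y) powr s)" using X_mean X_mom prob_space by simp
 also have "... <= 1 + 5 * lam powr s * B" using X_mom by (intro add_left_mono mult_left_mono) auto
 also have "... <= exp (5 * lam powr s * B)" by (rule exp_ge_add_one_self)
 finally show "(LINT y|N. exp (lam * X y - (lam * X y)^2 / 2)) <= exp (5 * lam powr s * B)" .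
qed

text \<open>On [2/3, 4/3] the function y - y^2 / 2 is at least 4/9, close to its maximum 1/2.
  Knowing the normaliser up to a factor of two is therefore enough, and finitely many tilting
  parameters cover its whole range.\<close>

lemma dyadic_scale:
 fixes w :: real
 assumes "1/2 <= w" "2 * w <= 2 ^ K"
 obtains k where "k <= K" "2/3 <= 8/3 * w / 2^k" "8/3 * w / 2^k <= 4/3"
proof -
 define k where "k = (LEAST k. 2 * w <= (2::real)^k)"
 have k: "2 * w <= 2^k" unfolding k_def by (rule LeastI[of _ K]) (rule assms(2))
 have kK: "k <= K" unfolding k_def by (rule Least_le) (rule assms(2))
 have "8/3 * w / 2^k <= 4/3" using k by (simp add: field_simps)
 moreover have "2/3 <= 8/3 * w / 2^k"
 proof (cases k)
  case 0 thus ?thesis using assms(1) by simp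
 next
  case (Suc j)
  have "\<not> 2 * w <= 2^j" using not_less_Least[of j "%k. 2 * w <= (2::real)^k"] Suc unfolding k_def by auto
  thus ?thesis unfolding Suc by (simp add: field_simps)
 qed
 ultimately show ?thesis using that kK by blast
qed

text \<open>The ideal parameter x / sqrt V in the exponential bound depends on the sample. It is
  replaced by a dyadic grid with K + 1 points, which serves all values n / 4 < V < n^3. The lower
  range is excluded by \<open>lower_tail\<close> at e = 3/4, the upper one by Markov's inequality,
  since V has mean n. The grid costs the factor K + 1 and the drop from 1/2 to 4/9 in the
  exponent.\<close>

lemma moderate_deviation_one_sided:
 assumes J: "finite J" "J ~= {}" and x: "0 < x" and K: "2 * real (card J) <= 2 ^ K"
 defines "n \<equiv> real (card J)"
 defines "c \<equiv> (3/4) powr (s / (s - 2)) / (2 * (2 * B) powr (2 / (s - 2)))"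
 shows "\<P>(v in PI J. x * sqrt (SS (%y. (X y)^2) J v) < SS X J v)
  <= real (K + 1) * exp (5 * B * (8/3 * x) powr s * n powr (1 - s/2) - 4/9 * x^2) + exp (- (n * c)) + 1 / n^2"
proof -
 interpret A: prob_space "PI J" by (rule prob_space_PI)
 have n: "0 < n" using J unfolding n_def by (simp add: card_gt_0_iff)
 define V where "V = SS (%y. (X y)^2) J"
 have [measurable]: "SS X J \<in> borel_measurable (PI J)" "V \<in> borel_measurable (PI J)" unfolding V_def by auto
 define lam where "lam = (%k. 8/3 * x / sqrt n / 2^k :: real)"
 have lam: "0 < lam k" "lam k <= 8/3 * x / sqrt n" for k
 proof -
  show "0 < lam k" using x n by (simp add: lam_def)
  have "8/3 * x / sqrt n / 2^k <= 8/3 * x / sqrt n / 1" using x n by (intro divide_left_mono) auto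
  thus "lam k <= 8/3 * x / sqrt n" by (simp add: lam_def)
 qed
 define h where "h = (%k y. exp (lam k * X y - (lam k * X y)^2 / 2))"
 have hp: "(\<Prod>j\<in>J. h k (v j)) = exp (lam k * SS X J v - (lam k)^2 * V v / 2)" for k v
  unfolding h_def V_def SS_def using J
  by (simp add: exp_sum[symmetric] sum_subtractf power_mult_distrib sum_distrib_left sum_divide_distrib)
 have ih: "integrable N (h k)" for k unfolding h_def using exp_moment(1)[OF less_imp_le[OF lam(1)]] .
 have I1: "integrable (PI J) (%v. exp (lam k * SS X J v - (lam k)^2 * V v / 2))" for k
  using E_prod_powers(2)[OF J(1) ih] unfolding hp .
 define G where "G = 5 * B * (8/3 * x) powr s * n powr (1 - s/2)"
 have E1: "(LINT v|PI J. exp (lam k * SS X J v - (lam k)^2 * V v / 2)) <= exp G" for k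
 proof -
  have "(LINT v|PI J. exp (lam k * SS X J v - (lam k)^2 * V v / 2)) = integral\<^sup>L N (h k) ^ card J"
   using E_prod_powers(1)[OF J(1) ih] unfolding hp .
  also have "... <= exp (5 * lam k powr s * B) ^ card J"
   unfolding h_def using exp_moment(2)[OF less_imp_le[OF lam(1)]] by (intro power_mono) auto
  also have "... = exp (n * (5 * lam k powr s * B))" by (simp add: n_def exp_of_nat_mult)
  also have "... <= exp G"
  proof -
   have "lam k powr s <= (8/3 * x / sqrt n) powr s" using lam[of k] s by (intro powr_mono2) auto
   also have "... = (8/3 * x) powr s * n powr (- s / 2)"
    using x n by (intro divide_sqrt_powr) auto
   finally have "n * (5 * lam k powr s * B) <= n * (5 * ((8/3 * x) powr s * n powr (- s / 2)) * B)"
    using n B by (intro mult_left_mono mult_right_mono) auto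
   also have "... = 5 * B * (8/3 * x) powr s * (n powr 1 * n powr (- s / 2))" using n by simp
   also have "n powr 1 * n powr (- s / 2) = n powr (1 - s/2)" by (simp only: powr_add[symmetric]) simp
   finally show ?thesis by (simp add: G_def)
  qed
  finally show ?thesis .
 qed
 have low: "\<P>(v in PI J. V v <= n * (1 - 3/4)) <= exp (- (n * c))"
 proof -
  have eq: "(X y)\<^sup>2 powr (s/2) = abs (X y) powr s" for y
  proof (cases "X y = 0")
   case False
   hence e: "(X y)^2 = abs (X y) powr 2" by (subst powr_numeral) auto
   show ?thesis unfolding e powr_powr by simp
  qed simp
  have p: "s / 2 / (s / 2 - 1) = s / (s - 2)" "1 / (s / 2 - 1) = 2 / (s - 2)" using s by (auto simp: field_simps)
  show ?thesis
   using lower_tail[OF J(1), of "%y. (X y)^2" "s/2" B "3/4"] X_sq X_mom s B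
   unfolding eq V_def n_def c_def p by simp
 qed
 have hi: "(LINT v|PI J. V v / n^3) = 1 / n^2" "integrable (PI J) (%v. V v / n^3)"
 proof -
  have "(LINT v|PI J. V v) = n" unfolding V_def n_def using E_SS[OF X_sq(1)] X_sq(2) by simp
  thus "(LINT v|PI J. V v / n^3) = 1 / n^2" using n by (simp add: power3_eq_cube power2_eq_square)
  show "integrable (PI J) (%v. V v / n^3)"
   unfolding V_def SS_def[abs_def] using X_sq integrable_coord
   by (intro integrable_divide Bintegrable_sum) auto
 qed
 let ?f = "%v. (\<Sum>k\<le>K. exp (- (4/9 * x^2)) * exp (lam k * SS X J v - (lam k)^2 * V v / 2))"
 have "\<P>(v in PI J. x * sqrt (V v) < SS X J v)
  <= (LINT v|PI J. ?f v + ((if V v <= n * (1 - 3/4) then 1 else 0) + V v / n^3))"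
 proof (rule A.measure_le_integral)
  show "{v \<in> space (PI J). x * sqrt (V v) < SS X J v} \<in> A.events" by measurable
  have "bm (PI J) (%v. if V v <= n * (1 - 3/4) then 1 else 0)" by (intro bm_if pred_le) auto
  thus "integrable (PI J) (%v. ?f v + ((if V v <= n * (1 - 3/4) then 1 else 0) + V v / n^3))"
   using I1 hi(2) int_PI
   by (intro Bintegrable_add Bintegrable_sum integrable_mult_right) auto
  fix v
  have V0: "0 <= V v" unfolding V_def SS_def by (intro sum_nonneg) auto
  have f0: "0 <= ?f v" by (intro sum_nonneg) auto
  have g0: "0 <= V v / n^3" using V0 n by simp
  show "indicator {v \<in> space (PI J). x * sqrt (V v) < SS X J v} v
   <= ?f v + ((if V v <= n * (1 - 3/4) then 1 else 0) + V v / n^3)"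
  proof (cases "V v <= n * (1 - 3/4) \<or> n^3 <= V v \<or> \<not> x * sqrt (V v) < SS X J v")
   case True
   thus ?thesis
   proof (elim disjE)
    assume "n^3 <= V v"
    hence "1 <= V v / n^3" using n by simp
    thus ?thesis using f0 by (auto simp: indicator_def)
   qed (use f0 g0 in \<open>auto simp: indicator_def\<close>)
  next
   case False
   define w where "w = sqrt (V v / n)"
   have Vw: "sqrt (V v) = sqrt n * w" unfolding w_def using n by (simp add: real_sqrt_divide)
   have V2: "V v = n * w^2" unfolding w_def using n V0 by simp
   have w1: "1/2 <= w" unfolding w_def using False n
    by (intro real_le_rsqrt) (simp add: field_simps power2_eq_square)
   have "w <= n" unfolding w_def using False n
    by (intro real_le_lsqrt) (auto simp: field_simps power2_eq_square power3_eq_cube)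
   hence "2 * w <= 2^K" using K unfolding n_def by linarith
   from dyadic_scale[OF w1 this] obtain k where
    k: "k <= K" "2/3 <= 8/3 * w / 2^k" "8/3 * w / 2^k <= 4/3" by blast
   define y where "y = 8/3 * w / 2^k"
   have ly: "lam k * sqrt (V v) = x * y" unfolding lam_def Vw y_def using n by simp
   have lV: "(lam k)^2 * V v = x^2 * y^2"
   proof -
    have "(lam k)^2 * V v = (lam k * sqrt (V v))^2" using V0 by (simp add: power_mult_distrib)
    thus ?thesis unfolding ly by (simp add: power_mult_distrib)
   qed
   have "lam k * (x * sqrt (V v)) <= lam k * SS X J v" using False lam(1)[of k] by (intro mult_left_mono) auto
   moreover have "lam k * (x * sqrt (V v)) = x^2 * y" using ly by (simp add: sq_simps)
   ultimately have "x^2 * (y - y^2 / 2) <= lam k * SS X J v - (lam k)^2 * V v / 2"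
    unfolding lV by (simp add: algebra_simps)
   moreover have "x^2 * (4/9) <= x^2 * (y - y^2 / 2)"
   proof (rule mult_left_mono)
    have "0 <= (y - 2/3) * (4/3 - y)" using k by (simp add: y_def)
    thus "4/9 <= y - y^2 / 2" by (simp add: sq_field_simps)
   qed simp
   ultimately have "1 <= exp (- (4/9 * x^2)) * exp (lam k * SS X J v - (lam k)^2 * V v / 2)"
    by (simp flip: exp_add)
   also have "... <= ?f v" using k by (intro member_le_sum) auto
   finally show ?thesis using g0 by (auto simp: indicator_def)
  qed
 qed
 also have "... = (\<Sum>k\<le>K. exp (- (4/9 * x^2)) * (LINT v|PI J. exp (lam k * SS X J v - (lam k)^2 * V v / 2)))
   + (\<P>(v in PI J. V v <= n * (1 - 3/4)) + 1 / n^2)"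
 proof -
  have "bm (PI J) (%v. if V v <= n * (1 - 3/4) then 1 else 0)" by (intro bm_if pred_le) auto
  hence i: "integrable (PI J) (%v. if V v <= n * (1 - 3/4) then 1 else (0::real))" by (rule int_PI)
  have i2: "integrable (PI J) ?f" using I1 by (intro Bintegrable_sum integrable_mult_right) auto
  have "(LINT v|PI J. ?f v + ((if V v <= n * (1 - 3/4) then 1 else 0) + V v / n^3))
   = (LINT v|PI J. ?f v) + ((LINT v|PI J. (if V v <= n * (1 - 3/4) then 1 else 0)) + (LINT v|PI J. V v / n^3))"
   using i i2 hi(2) by (simp only: Bintegral_add Bintegrable_add)
  also have "(LINT v|PI J. ?f v) = (\<Sum>k\<le>K. (LINT v|PI J. exp (- (4/9 * x^2)) * exp (lam k * SS X J v - (lam k)^2 * V v / 2)))"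
   using I1 by (intro Bintegral_sum integrable_mult_right)
  finally show ?thesis unfolding integral_if_pred hi(1) by simp
 qed
 also have "... <= (\<Sum>k\<le>K. exp (- (4/9 * x^2)) * exp G) + (exp (- (n * c)) + 1 / n^2)"
  using E1 low by (intro add_mono sum_mono mult_left_mono) auto
 also have "(\<Sum>k\<le>K. exp (- (4/9 * x^2)) * exp G) = real (K + 1) * exp (G - 4/9 * x^2)"
 proof -
  have "exp (- (4/9 * x^2)) * exp G = exp (G - 4/9 * x^2)" by (simp flip: exp_add)
  thus ?thesis by (simp only: sum_constant card_atMost) simp
 qed
 finally show ?thesis unfolding V_def G_def by simp
qed

lemma moderate_deviation:
 assumes J: "finite J" "J ~= {}" and x: "0 < x" and K: "2 * real (card J) <= 2 ^ K"
 defines "n \<equiv> real (card J)"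
 defines "c \<equiv> (3/4) powr (s / (s - 2)) / (2 * (2 * B) powr (2 / (s - 2)))"
 shows "\<P>(w in PI J. x * sqrt (SS (%y. (X y)^2) J w) < abs (SS X J w))
  <= 2 * (real (K + 1) * exp (5 * B * (8/3 * x) powr s * n powr (1 - s/2) - 4/9 * x^2) + exp (- (n * c)) + 1 / n^2)"
proof -
 interpret A: prob_space "PI J" by (rule prob_space_PI)
 interpret m: iid_moment N "%y. - X y" s B by (rule iid_moment_minus)
 define V where "V = SS (%y. (X y)^2) J"
 have [measurable]: "SS X J \<in> borel_measurable (PI J)" "V \<in> borel_measurable (PI J)" unfolding V_def by auto
 have "\<P>(w in PI J. x * sqrt (V w) < abs (SS X J w))
  <= measure (PI J) ({w \<in> space (PI J). x * sqrt (V w) < SS X J w} \<union> {w \<in> space (PI J). x * sqrt (V w) < - SS X J w})"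
  by (intro A.finite_measure_mono) (auto simp: abs_if)
 also have "... <= \<P>(w in PI J. x * sqrt (V w) < SS X J w) + \<P>(w in PI J. x * sqrt (V w) < - SS X J w)"
  by (intro measure_subadditive) (auto simp: A.emeasure_finite)
 also have "... <= (real (K + 1) * exp (5 * B * (8/3 * x) powr s * n powr (1 - s/2) - 4/9 * x^2) + exp (- (n * c)) + 1 / n^2)
   + (real (K + 1) * exp (5 * B * (8/3 * x) powr s * n powr (1 - s/2) - 4/9 * x^2) + exp (- (n * c)) + 1 / n^2)"
  using moderate_deviation_one_sided[OF J x K] m.moderate_deviation_one_sided[OF J x K]
  unfolding SS_minus n_def c_def V_def power2_minus by (rule add_mono)
 finally show ?thesis unfolding V_def mult_2 .
qed

end

subsection \<open>Self-normalised sums\<close>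

text \<open>The centring term S^2 / m of the sample variance has been moved to the right-hand side
  of the hypothesis. Taking roots there leaves the uncentred self-normalised ratio with a slightly
  smaller threshold.\<close>

lemma self_normalised_event:
 fixes S V z m :: real
 assumes "0 <= V" "0 < m" "0 <= z" "z^2 * V < S^2 * (1 + z^2 / m)"
 shows "z / sqrt (1 + z^2 / m) * sqrt V < abs S"
proof (rule ccontr)
 assume "\<not> z / sqrt (1 + z^2 / m) * sqrt V < abs S"
 hence "abs S^2 <= (z / sqrt (1 + z^2 / m) * sqrt V)^2" by (intro power_mono) auto
 also have "... = z^2 * V / (1 + z^2 / m)"
  using assms by (simp add: power_mult_distrib power_divide)
 finally have "S^2 * (1 + z^2 / m) <= z^2 * V / (1 + z^2 / m) * (1 + z^2 / m)"
  using assms by (intro mult_right_mono) auto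
 moreover have "1 + z^2 / m > 0" using assms by (simp add: add_pos_nonneg)
 ultimately show False using assms by simp
qed

text \<open>Both sides grow with the threshold; what matters is that z^2 / (1 + z^2 / m) is
  increasing in z.\<close>

lemma self_normalised_mono:
 fixes S V z z' m :: real
 assumes "0 < m" "0 < z'" "z' <= z" "z^2 * V < S^2 * (1 + z^2 / m)"
 shows "z'^2 * V < S^2 * (1 + z'^2 / m)"
proof -
 have "z'^2 * (z^2 * V) < z'^2 * (S^2 * (1 + z^2 / m))" using assms by (intro mult_strict_left_mono) auto
 also have "... = S^2 * (z'^2 + z'^2 * z^2 / m)" by (simp add: algebra_simps)
 also have "... <= S^2 * (z^2 + z'^2 * z^2 / m)"
  using assms by (intro mult_left_mono add_right_mono power_mono) auto
 also have "... = z^2 * (S^2 * (1 + z'^2 / m))" by (simp add: algebra_simps)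
 finally have "z^2 * (z'^2 * V) < z^2 * (S^2 * (1 + z'^2 / m))" by (simp add: algebra_simps)
 moreover have "0 < z^2" using assms by simp
 ultimately show ?thesis using mult_less_cancel_left_pos by blast
qed

text \<open>The effective threshold x differs from z by O(z^3 / m), which is negligible as long as
  z^2 is of order log m. The bound on squares serves the exponent of the moderate deviation
  estimate.\<close>

lemma self_normalised_threshold:
 fixes z m :: real
 assumes "0 <= z" "0 < m"
 defines "x \<equiv> z / sqrt (1 + z^2 / m)"
 shows "0 <= x" "x <= z" "z - x <= z^3 / (2 * m)" "z^2 - z^4 / m <= x^2"
proof -
 define t where "t = z^2 / m"
 have t: "0 <= t" using assms by (simp add: t_def)
 have s1: "1 <= sqrt (1 + t)" using t by simp
 show "0 <= x" unfolding x_def using assms by simp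
 show "x <= z" unfolding x_def t_def[symmetric] using s1 assms mult_left_mono[OF s1 assms(1)] by (simp add: divide_le_eq)
 have s2: "sqrt (1 + t) <= 1 + t / 2"
  using t by (intro real_le_lsqrt) (auto simp: sq_simps)
 have "z * (1 - t/2) * sqrt (1 + t) <= z"
 proof (cases "t <= 2")
  case True
  have "(1 - t/2) * sqrt (1 + t) <= (1 - t/2) * (1 + t/2)" using s2 True by (intro mult_left_mono) auto
  also have "... <= 1" by (simp add: algebra_simps)
  finally show ?thesis using mult_left_mono[OF _ assms(1), of "(1 - t/2) * sqrt (1 + t)" 1] by (simp add: mult.assoc)
 next
  case False
  have "z * (1 - t/2) * sqrt (1 + t) <= 0" using False assms s1
   by (intro mult_nonpos_nonneg mult_nonneg_nonpos) auto
  thus ?thesis using assms by simp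
 qed
 hence "z * (1 - t/2) <= x" unfolding x_def t_def[symmetric] using s1 by (simp add: le_divide_eq)
 thus "z - x <= z^3 / (2 * m)" unfolding t_def by (simp add: algebra_simps power2_eq_square power3_eq_cube)
 have "x^2 = z^2 / (1 + t)" unfolding x_def t_def[symmetric] using t by (simp add: power_divide)
 moreover have "z^2 * (1 - t) * (1 + t) <= z^2"
 proof -
  have "z^2 * ((1 - t) * (1 + t)) <= z^2 * 1" by (intro mult_left_mono) (auto simp: algebra_simps)
  thus ?thesis by (simp add: mult.assoc)
 qed
 hence "z^2 * (1 - t) <= z^2 / (1 + t)" using t by (simp add: le_divide_eq)
 ultimately show "z^2 - z^4 / m <= x^2" unfolding t_def
  by (simp add: algebra_simps power2_eq_square power4_eq_xxxx)
qed

lemma dyadic_exponent: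
 assumes "1 <= m"
 obtains K :: nat where "2 * real m <= 2^K" "2^K <= 4 * real m"
proof -
 define K where "K = (LEAST k. 2 * real m <= 2^k)"
 have "\<exists>k. 2 * real m <= 2^k" using real_arch_pow[of 2 "2 * real m"] by (auto intro: less_imp_le)
 hence 1: "2 * real m <= 2^K" unfolding K_def by (rule LeastI_ex)
 have "2^K <= 4 * real m"
 proof (cases K)
  case 0 thus ?thesis using assms by simp
 next
  case (Suc j)
  have "\<not> 2 * real m <= 2^j" using not_less_Least[of j "%k. 2 * real m <= 2^k"] Suc unfolding K_def by auto
  thus ?thesis unfolding Suc by simp
 qed
 thus ?thesis using that 1 by blast
qed

lemma ln_one_div: "0 < w ==> ln (1 / w) = - ln (w::real)"
 by (simp add: ln_div)

lemma sqrt_powr: "0 <= x ==> sqrt x powr s = x powr (s / 2)"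
proof -
 assume x: "0 <= x"
 have "sqrt x powr s = (x powr (1/2)) powr s" by (simp only: powr_half_sqrt[OF x])
 thus ?thesis unfolding powr_powr by simp
qed

lemma one_div_powr_minus: "0 < w ==> (1 / w) powr (- s) = w powr (s::real)"
 by (simp add: powr_divide powr_minus)

lemma exp_minus_le_square: assumes "0 < (w::real)" shows "exp (- w) <= 2 / w^2"
proof -
 have "w^2 / 2 <= exp w" using exp_lower_Taylor_quadratic[of w] assms by simp
 hence "1 / exp w <= 1 / (w^2 / 2)" using assms by (intro divide_left_mono) auto
 thus ?thesis by (simp add: exp_minus inverse_eq_divide)
qed

lemma half_le_ln_2: "1/2 <= ln (2::real)"
 using exp_bound[of "1/2"] by (subst ln_ge_iff) (auto simp: power2_eq_square)

text \<open>The upper bound uses the Gaussian tail and 4 * m * d <= (2 * m)^2. The lower one uses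
  \<open>Q_lower\<close> and (z + 1)^2 <= 10/9 * z^2 + 10; the coefficient 1.8 is 2 divided by
  10/9.\<close>

lemma quantile_bounds:
 fixes m d :: nat and z :: real
 assumes md: "1 <= d" "d <= m" and Qz: "Q z = 1 / (4 * real m * real d)" and z: "0 <= z"
 shows "z^2 <= 4 * ln (2 * real m)" "1.8 * ln (real m * real d) - 9 <= z^2"
proof -
 have m: "1 <= real m" "1 <= real d" "real d <= real m" using md by auto
 have p: "0 < 4 * real m * real d" using m by simp
 have "1 / (4 * real m * real d) <= exp (- z\<^sup>2 / 2)" using Q_le_exp[OF z] Qz by simp
 hence "ln (1 / (4 * real m * real d)) <= - z\<^sup>2 / 2" using p by (subst (asm) ln_le_cancel_iff[symmetric]) auto
 hence "z^2 / 2 <= ln (4 * real m * real d)" unfolding ln_one_div[OF p] by simp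
 also have "... <= ln ((2 * real m)^2)" using m by (subst ln_le_cancel_iff) (auto simp: power2_eq_square intro: mult_left_mono)
 also have "... = real 2 * ln (2 * real m)" by (rule ln_realpow)
 finally show "z^2 <= 4 * ln (2 * real m)" by simp
 have sp: "sqrt (2 * pi) <= 3" by (rule real_le_lsqrt) (use pi_less_4 in simp_all)
 have "dnorm (z + 1) <= 1 / (4 * real m * real d)" using Q_lower[OF z] Qz by simp
 hence "exp (- (z + 1)\<^sup>2 / 2) <= sqrt (2 * pi) / (4 * real m * real d)"
  unfolding std_normal_density_def by (simp add: field_simps)
 also have "... <= 4 / (4 * real m * real d)" using sp p by (intro divide_right_mono) auto
 also have "... = 1 / (real m * real d)" by simp
 finally have "- (z + 1)\<^sup>2 / 2 <= ln (1 / (real m * real d))"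
  using m by (subst ln_ge_iff) auto
 moreover have "0 < real m * real d" using m by simp
 ultimately have "2 * ln (real m * real d) <= (z + 1)^2" by (simp only: ln_one_div)
 also have "(z + 1)^2 <= 10/9 * z^2 + 10"
 proof -
  have "0 <= (z / 3 - 3)^2" by simp
  thus ?thesis by (simp add: sq_simps)
 qed
 finally show "1.8 * ln (real m * real d) - 9 <= z^2" by simp
qed

lemma ln_sq_bound: assumes "1 <= t" shows "(ln t)^2 <= 4 * (t::real)"
proof -
 have "ln t <= t powr (1/2) / (1/2)" using assms by (intro ln_powr_bound) auto
 hence "ln t <= 2 * sqrt t" using assms by (simp add: powr_half_sqrt)
 hence "(ln t)^2 <= (2 * sqrt t)^2" using assms by (intro power_mono) auto
 thus ?thesis using assms by (simp add: power_mult_distrib)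
qed

text \<open>Since 4/9 * 1.8 = 0.8, the exponential is of order (m * d)^(-0.8). Multiplied by d and
  by K + 1 = O(m^0.1) it becomes m^(-0.7) * d^0.2, at most m^(-1/2) because d <= m. The suboptimal
  exponent 4/9 is thus affordable.\<close>

lemma moderate_deviation_rate:
 fixes s B c :: real
 assumes s: "2 < s" "s <= 3" and B: "1 <= B" and c: "0 < c"
 shows "\<exists>C>0. \<forall>m d K::nat. \<forall>z. 1 <= d \<and> d <= m \<and> Q z = 1 / (4 * real m * real d) \<and> 0 <= z \<and> 2^K <= 4 * real m \<longrightarrow>
  real d * (2 * (real (K + 1) * exp (5 * B * (8/3 * (z / sqrt (1 + z^2 / m))) powr s * m powr (1 - s/2)
    - 4/9 * (z / sqrt (1 + z^2 / m))^2) + exp (- (m * c)) + 1 / (real m)^2)) <= C * m powr (- (1/2))"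
proof -
 \<comment> \<open>With this exponent ln t <= t powr e / e gives a power s/2 of the logarithm
   bounded by m powr (s/2 - 1), exactly compensating m powr (1 - s/2).\<close>
 define e where "e = (s - 2) / s"
 have e: "0 < e" using s by (simp add: e_def)
 define G0 where "G0 = 5 * B * (16/3) powr s * (2 powr (s/2 - 1) * (1/e) powr (s/2))"
 define C where "C = 2 * (84 * exp (G0 + 61) + 2 / c^2 + 1)"
 have Cpos: "0 < C" unfolding C_def by (simp add: add_pos_nonneg)
 have main: "real d * (2 * (real (K + 1) * exp (5 * B * (8/3 * (z / sqrt (1 + z^2 / m))) powr s * m powr (1 - s/2)
    - 4/9 * (z / sqrt (1 + z^2 / m))^2) + exp (- (m * c)) + 1 / (real m)^2)) <= C * m powr (- (1/2))"
  if h: "1 <= d" "d <= m" "Q z = 1 / (4 * real m * real d)" "0 <= z" "2^K <= 4 * real m" for m d K :: nat and z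
 proof -
  define x where "x = z / sqrt (1 + z^2 / m)"
  have m: "1 <= real m" "1 <= real d" "real d <= real m" using h by auto
  note z = quantile_bounds[OF h(1-4)]
  have mp: "0 < real m" using m by simp
  note x = self_normalised_threshold[OF h(4) mp, folded x_def]
  define L where "L = ln (2 * real m)"
  have L0: "0 <= L" unfolding L_def using m by simp
  have z4: "z^4 / m <= 128"
  proof -
   have "z^4 = z^2 * z^2" by (simp add: power4_eq_xxxx power2_eq_square)
   also have "... <= (4 * L) * (4 * L)" using z(1) L0 unfolding L_def by (intro mult_mono) auto
   also have "... = 16 * L^2" by (simp add: power2_eq_square)
   also have "... <= 16 * (4 * (2 * real m))" unfolding L_def using m by (intro mult_left_mono ln_sq_bound) auto
   finally show ?thesis using m by (simp add: divide_le_eq)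
  qed
  have x2: "1.8 * ln (real m * real d) - 137 <= x^2" using x(4) z(2) z4 by linarith
  have G: "5 * B * (8/3 * x) powr s * m powr (1 - s/2) <= G0"
  proof -
   have "z = sqrt (z^2)" using h(4) by simp
   also have "... <= sqrt (4 * L)" using z(1) unfolding L_def by (rule real_sqrt_le_mono)
   also have "... = 2 * sqrt L" by (simp add: real_sqrt_mult)
   finally have "8/3 * x <= 16/3 * sqrt L" using x(2) by simp
   hence "(8/3 * x) powr s <= (16/3 * sqrt L) powr s" using x(1) s by (intro powr_mono2) auto
   also have "... = (16/3) powr s * L powr (s/2)" unfolding sqrt_powr[OF L0, symmetric]
    using L0 by (intro powr_mult)
   also have "L powr (s/2) <= ((2 * real m) powr e / e) powr (s/2)"
    using L0 s e m unfolding L_def by (intro powr_mono2 ln_powr_bound) auto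
   also have "... = (2 * real m) powr (e * (s/2)) * (1/e) powr (s/2)"
    using e m by (simp add: powr_divide powr_powr)
   also have "e * (s/2) = s/2 - 1" using s by (simp add: e_def field_simps)
   also have "(2 * real m) powr (s/2 - 1) = 2 powr (s/2 - 1) * m powr (s/2 - 1)" using m by (simp add: powr_mult)
   finally have "(8/3 * x) powr s * m powr (1 - s/2)
    <= ((16/3) powr s * (2 powr (s/2 - 1) * m powr (s/2 - 1) * (1/e) powr (s/2))) * m powr (1 - s/2)"
    by (intro mult_right_mono) (auto simp: mult_left_mono)
   also have "... = (16/3) powr s * (2 powr (s/2 - 1) * (1/e) powr (s/2)) * (m powr (s/2 - 1) * m powr (1 - s/2))"
    by simp
   also have "m powr (s/2 - 1) * m powr (1 - s/2) = 1" using mp by (simp only: powr_add[symmetric]) simp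
   finally show ?thesis unfolding G0_def using B by (simp add: mult.assoc mult_left_mono)
  qed
  have e1: "exp (5 * B * (8/3 * x) powr s * m powr (1 - s/2) - 4/9 * x^2) <= exp (G0 + 61) * (real m * real d) powr (- 0.8)"
  proof -
   have "5 * B * (8/3 * x) powr s * m powr (1 - s/2) - 4/9 * x^2 <= (G0 + 61) + (- 0.8) * ln (real m * real d)"
    using G x2 by simp
   hence "exp (5 * B * (8/3 * x) powr s * m powr (1 - s/2) - 4/9 * x^2) <= exp ((G0 + 61) + (- 0.8) * ln (real m * real d))" by simp
   also have "... = exp (G0 + 61) * (real m * real d) powr (- 0.8)" unfolding exp_add using m by (simp add: powr_def)
   finally show ?thesis .
  qed
  have K: "real (K + 1) <= 84 * m powr 0.1"
  proof -
   have "real K * ln 2 = ln (2^K)" by (simp add: ln_realpow)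
   also have "... <= ln (4 * real m)" using h(5) m by (subst ln_le_cancel_iff) auto
   also have "... <= (4 * real m) powr 0.1 / 0.1" using m by (intro ln_powr_bound) auto
   finally have 1: "real K * ln 2 <= 10 * (4 * real m) powr 0.1" by simp
   have "1/2 <= ln (2::real)" by (rule half_le_ln_2)
   hence "real K * (1/2) <= real K * ln 2" by (intro mult_left_mono) auto
   hence 2: "real K <= 20 * (4 * real m) powr 0.1" using 1 by simp
   have "1 <= (4 * real m) powr 0.1" using m by (intro ge_one_powr_ge_zero) auto
   hence "real (K + 1) <= 21 * (4 * real m) powr 0.1" using 2 by simp
   also have "(4 * real m) powr 0.1 = 4 powr 0.1 * m powr 0.1" using m by (simp add: powr_mult)
   also have "... <= 4 powr 1 * m powr 0.1" by (intro mult_right_mono powr_mono) auto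
   finally show ?thesis by simp
  qed
  have t1: "real d * (real (K + 1) * exp (5 * B * (8/3 * x) powr s * m powr (1 - s/2) - 4/9 * x^2)) <= 84 * exp (G0 + 61) * m powr (- (1/2))"
  proof -
   have "real d * (real (K + 1) * exp (5 * B * (8/3 * x) powr s * m powr (1 - s/2) - 4/9 * x^2))
    <= real d * ((84 * m powr 0.1) * (exp (G0 + 61) * (real m * real d) powr (- 0.8)))"
    using K e1 by (intro mult_left_mono mult_mono) auto
   also have "... = 84 * exp (G0 + 61) * (m powr 0.1 * m powr (- 0.8) * (d powr 1 * d powr (- 0.8)))"
    using m by (simp add: powr_mult)
   also have "d powr 1 * d powr (- 0.8) = d powr 0.2" by (simp only: powr_add[symmetric]) simp
   also have "84 * exp (G0 + 61) * (m powr 0.1 * m powr (- 0.8) * d powr 0.2)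
    <= 84 * exp (G0 + 61) * (m powr 0.1 * m powr (- 0.8) * m powr 0.2)"
    using m by (intro mult_left_mono powr_mono2) auto
   also have "m powr 0.1 * m powr (- 0.8) * m powr 0.2 = m powr (- (1/2))" by (simp only: powr_add[symmetric]) simp
   finally show ?thesis .
  qed
  have im: "1 / real m <= m powr (- (1/2))"
  proof -
   have "1 / real m = m powr (- 1)" using m by (simp add: powr_minus_divide)
   also have "... <= m powr (- (1/2))" using m by (intro powr_mono) auto
   finally show ?thesis .
  qed
  have t2: "real d * exp (- (m * c)) <= 2 / c^2 * m powr (- (1/2))"
  proof -
   have mc: "0 < real m * c" using mp c by simp
   have "exp (- (m * c)) <= 2 / (m * c)^2" by (rule exp_minus_le_square[OF mc])
   hence "real d * exp (- (m * c)) <= real m * (2 / (m * c)^2)" using m by (intro mult_mono) auto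
   also have "... = 2 / c^2 * (1 / real m)" using mp by (simp add: power2_eq_square)
   also have "... <= 2 / c^2 * m powr (- (1/2))" using im by (intro mult_left_mono) auto
   finally show ?thesis .
  qed
  have t3: "real d * (1 / (real m)^2) <= m powr (- (1/2))"
  proof -
   have "real d * (1 / (real m)^2) <= real m * (1 / (real m)^2)" using m by (intro mult_right_mono) auto
   thus ?thesis using im mp by (simp add: power2_eq_square)
  qed
  have "real d * (2 * (real (K + 1) * exp (5 * B * (8/3 * x) powr s * m powr (1 - s/2) - 4/9 * x^2) + exp (- (m * c)) + 1 / (real m)^2))
   = 2 * (real d * (real (K + 1) * exp (5 * B * (8/3 * x) powr s * m powr (1 - s/2) - 4/9 * x^2)) + real d * exp (- (m * c)) + real d * (1 / (real m)^2))"
   by (simp only: distrib_left mult.left_commute)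
  also have "... <= 2 * (84 * exp (G0 + 61) * m powr (- (1/2)) + 2 / c^2 * m powr (- (1/2)) + m powr (- (1/2)))"
   using t1 t2 t3 by (intro mult_left_mono add_mono) auto
  also have "... = C * m powr (- (1/2))" by (simp add: C_def algebra_simps)
  finally show ?thesis unfolding x_def .
 qed
 show ?thesis using Cpos main by blast
qed

text \<open>With t = sqrt (1 + R) the difference of the two sides is t * (t - 1)^2 * (t + 2) /
  2.\<close>

lemma sqrt_quadratic_bound:
 fixes R :: real assumes "-1 <= R" shows "1 + R / 2 - R^2 / 2 <= sqrt (1 + R)"
proof -
 define t where "t = sqrt (1 + R)"
 have t: "0 <= t" "R = t^2 - 1" using assms by (auto simp: t_def)
 have "0 <= t * ((t - 1)^2 * (t + 2))" using t by simp
 hence "1 + (t^2 - 1) / 2 - (t^2 - 1)^2 / 2 <= t" by (simp add: sq_field_simps)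
 hence "1 + R / 2 - R^2 / 2 <= t" unfolding t(2)[symmetric] .
 thus ?thesis unfolding t_def .
qed

text \<open>With all denominators cleared the condition is invariant under rescaling of X and false
  when all summands vanish, in agreement with the convention 0 / 0 = 0.\<close>

definition self_normalised_excess :: "('b => real) => nat set => real => (nat => 'b) => bool" where
 "self_normalised_excess X J z w \<longleftrightarrow>
  z^2 * SS (%y. (X y)^2) J w < (SS X J w)^2 * (1 + z^2 / card J)"

text \<open>For a half sample of size m = n / 2 the coordinatewise level 1 / (2 * n * d) is 1 / (4 *
  m * d). The factor d on the left already pays for the union over the coordinates. The constant
  precedes the law and the dimension.\<close>

theorem self_normalised_tail:
 fixes s B :: real
 assumes s: "2 < s" "s <= 3" and B: "1 <= B"
 shows "\<exists>C>0. \<forall>(N :: 'b measure) X J d. iid_moment N X s B \<and> finite J \<and> J ~= {} \<and> 1 <= d \<and> d <= card J \<longrightarrow>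
  real d * \<P>(w in PiM J (%_. N). self_normalised_excess X J (upper_quantile (1 / (4 * real (card J) * real d))) w) <= C * card J powr (- (1/2))"
proof -
 define c where "c = (3/4) powr (s / (s - 2)) / (2 * (2 * B) powr (2 / (s - 2)))"
 have c: "0 < c" unfolding c_def using B by simp
 obtain C where C: "0 < C" "!!m d K z. 1 <= d ==> d <= m ==> Q z = 1 / (4 * real m * real d) ==> 0 <= z ==> 2^K <= 4 * real m ==>
  real d * (2 * (real (K + 1) * exp (5 * B * (8/3 * (z / sqrt (1 + z^2 / m))) powr s * m powr (1 - s/2)
    - 4/9 * (z / sqrt (1 + z^2 / m))^2) + exp (- (m * c)) + 1 / (real m)^2)) <= C * m powr (- (1/2))"
  using moderate_deviation_rate[OF s B c] by blast
 have "real d * \<P>(w in PiM J (%_. N). self_normalised_excess X J (upper_quantile (1 / (4 * real (card J) * real d))) w) <= C * card J powr (- (1/2))"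
  if h: "iid_moment N X s B" "finite J" "J ~= {}" "1 <= d" "d <= card J" for N :: "'b measure" and X J d
 proof -
  interpret iid_moment N X s B by fact
  interpret A: prob_space "PI J" by (rule prob_space_PI)
  have m: "1 <= card J" using h by simp
  define z where "z = upper_quantile (1 / (4 * real (card J) * real d))"
  have g: "0 < 1 / (4 * real (card J) * real d)" "1 / (4 * real (card J) * real d) <= 1/4"
  proof -
   have "1 <= real (card J) * real d" using m h by (metis mult_le_mono nat_mult_1 of_nat_1 of_nat_le_iff of_nat_mult)
   thus "0 < 1 / (4 * real (card J) * real d)" "1 / (4 * real (card J) * real d) <= 1/4" by (auto simp: field_simps)
  qed
  have Qz: "Q z = 1 / (4 * real (card J) * real d)" unfolding z_def using g by (intro Q_upper_quantile) linarith+
  have z0: "0 <= z" unfolding z_def using g by (intro upper_quantile_nonneg) linarith+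
  have zp: "0 < z"
  proof (rule ccontr)
   assume "\<not> 0 < z"
   hence "z = 0" using z0 by simp
   hence "Q z = 1/2" using Q_0 by simp
   thus False using Qz g(2) by linarith
  qed
  define x where "x = z / sqrt (1 + z^2 / card J)"
  have xp: "0 < x" unfolding x_def using zp by (simp add: add_pos_nonneg)
  obtain K where K: "2 * real (card J) <= 2^K" "2^K <= 4 * real (card J)" using dyadic_exponent[OF m] .
  have [measurable]: "SS X J \<in> borel_measurable (PI J)" "SS (%y. (X y)^2) J \<in> borel_measurable (PI J)" by auto
  have "\<P>(w in PI J. self_normalised_excess X J z w)
   <= \<P>(w in PI J. x * sqrt (SS (%y. (X y)^2) J w) < abs (SS X J w))"
  proof (rule A.finite_measure_mono)
   show "{w \<in> space (PI J). self_normalised_excess X J z w} \<subseteq> {w \<in> space (PI J). x * sqrt (SS (%y. (X y)^2) J w) < abs (SS X J w)}"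
   proof safe
    fix w assume "self_normalised_excess X J z w"
    hence ev: "z^2 * SS (%y. (X y)^2) J w < (SS X J w)^2 * (1 + z^2 / card J)" by (simp add: self_normalised_excess_def)
    have "0 <= SS (%y. (X y)^2) J w" unfolding SS_def by (intro sum_nonneg) auto
    from self_normalised_event[OF this _ z0 ev] m
    show "x * sqrt (SS (%y. (X y)^2) J w) < abs (SS X J w)" unfolding x_def by simp
   qed
  qed measurable
  also have "... <= 2 * (real (K + 1) * exp (5 * B * (8/3 * x) powr s * card J powr (1 - s/2) - 4/9 * x^2) + exp (- (card J * c)) + 1 / (real (card J))^2)"
   unfolding c_def by (rule moderate_deviation[OF h(2,3) xp K(1)])
  finally have "real d * \<P>(w in PI J. self_normalised_excess X J z w)
   <= real d * (2 * (real (K + 1) * exp (5 * B * (8/3 * x) powr s * card J powr (1 - s/2) - 4/9 * x^2) + exp (- (card J * c)) + 1 / (real (card J))^2))"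
   by (intro mult_left_mono) auto
  also have "... <= C * card J powr (- (1/2))" unfolding x_def by (rule C(2)[OF h(4,5) Qz z0 K(2)])
  finally show ?thesis unfolding z_def .
 qed
 thus ?thesis using C(1) by blast
qed

text \<open>Large thresholds are reduced by monotonicity to a quantile at which the moderate
  deviation bound is already below the error. Below it, z <= 2 * sqrt l with l = 1 + ln m; the
  effective threshold is close to z, and the quadratic minorant of the root brings the event into
  the form of \<open>Berry_Esseen_quadratic\<close>.\<close>

theorem self_normalised_Berry_Esseen:
 fixes s B :: real
 assumes s: "2 < s" "s <= 3" and B: "1 <= B"
 shows "\<exists>C>0. \<forall>(N :: 'b measure) X J z. iid_moment N X s B \<and> finite J \<and> J ~= {} \<and> 0 <= z \<longrightarrow>
  \<P>(v in PiM J (%_. N). self_normalised_excess X J z v)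
   <= 2 * Q z + C * (card J powr (1 - s/2) * (1 + ln (card J)) powr (s/2))"
proof -
 obtain C1 where C1: "0 < C1" "!!(N :: 'b measure) X J d. iid_moment N X s B ==> finite J ==> J ~= {} ==> 1 <= d ==> d <= card J ==>
  real d * \<P>(v in PiM J (%_. N). self_normalised_excess X J (upper_quantile (1 / (4 * real (card J) * real d))) v) <= C1 * card J powr (- (1/2))"
  using self_normalised_tail[OF s B, where ?'b='b] by blast
 define C where "C = C1 + 8 + 2000000 * B * 8 powr s"
 have Cpos: "0 < C" unfolding C_def using C1(1) B by (intro add_pos_nonneg) auto
 have main: "\<P>(v in PiM J (%_. N). self_normalised_excess X J z v)
   <= 2 * Q z + C * (card J powr (1 - s/2) * (1 + ln (card J)) powr (s/2))"
  if h: "iid_moment N X s B" "finite J" "J ~= {}" "0 <= z" for N :: "'b measure" and X J z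
 proof -
  interpret iid_moment N X s B by fact
  interpret A: prob_space "PI J" by (rule prob_space_PI)
  have cJ: "1 <= card J" using h by (simp add: Suc_le_eq card_gt_0_iff)
  define m where "m = real (card J)"
  have m: "1 <= m" using cJ by (simp add: m_def)
  define l where "l = 1 + ln m"
  have l: "1 <= l" using m by (simp add: l_def)
  define r where "r = m powr (1 - s/2) * l powr (s/2)"
  have rm: "m powr (- (1/2)) <= r"
  proof -
   have "m powr (- (1/2)) * 1 <= m powr (1 - s/2) * l powr (s/2)"
    using m l s by (intro mult_mono powr_mono ge_one_powr_ge_zero) auto
   thus ?thesis by (simp add: r_def)
  qed
  have rn: "0 <= r" unfolding r_def by simp
  have [measurable]: "SS X J \<in> borel_measurable (PI J)" "SS (%y. (X y)^2) J \<in> borel_measurable (PI J)" by auto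
  have evm: "{v \<in> space (PI J). self_normalised_excess X J z v} \<in> A.events" for z
   unfolding self_normalised_excess_def by measurable
  \<comment> \<open>The tail bound with d = 1: at this quantile the probability is at most C1 * m
    powr (- (1/2)), which the claimed error dominates because s <= 3.\<close>
  define z1 where "z1 = upper_quantile (1 / (4 * real (card J) * real 1))"
  have g: "0 < 1 / (4 * real (card J) * real 1)" "1 / (4 * real (card J) * real 1) <= 1/4" using m unfolding m_def by auto
  have Qz1: "Q z1 = 1 / (4 * real (card J) * real 1)" unfolding z1_def using g by (intro Q_upper_quantile) linarith+
  have z10: "0 <= z1" unfolding z1_def using g by (intro upper_quantile_nonneg) linarith+
  have z1p: "0 < z1"
  proof (rule ccontr)
   assume "\<not> 0 < z1"
   hence "z1 = 0" using z10 by simp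
   hence "Q z1 = 1/2" using Q_0 by simp
   thus False using Qz1 g(2) by linarith
  qed
  show ?thesis
  proof (cases "z1 <= z")
   case True
   have "\<P>(v in PI J. self_normalised_excess X J z v)
    <= \<P>(v in PI J. self_normalised_excess X J z1 v)"
    using evm[of z1] m unfolding m_def
    by (intro A.finite_measure_mono)
    (auto simp: self_normalised_excess_def intro!: self_normalised_mono[OF _ z1p True])
   also have "... <= C1 * m powr (- (1/2))"
    using C1(2)[OF h(1-3), of 1] cJ unfolding z1_def m_def by simp
   also have "... <= C * r" using C1(1) rm B rn unfolding C_def by (intro mult_mono) auto
   finally show ?thesis using Q_nonneg[of z] unfolding r_def m_def l_def by linarith
  next
   case False
   have "z^2 <= z1^2" using False h(4) by (intro power_mono) auto
   also have "... <= 4 * ln (2 * m)"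
    unfolding m_def using quantile_bounds(1)[OF _ cJ Qz1 z10] by simp
   also have "ln (2 * m) = ln 2 + ln m" using m by (simp add: ln_mult)
   also have "... <= l" unfolding l_def using ln_2_less_1 by simp
   finally have z2: "z^2 <= 4 * l" by simp
   have zl: "z <= 2 * sqrt l"
   proof -
    have "z = sqrt (z^2)" using h(4) by simp
    also have "... <= sqrt (4 * l)" using z2 by (rule real_sqrt_le_mono)
    finally show ?thesis by (simp add: real_sqrt_mult)
   qed
   define x where "x = z / sqrt (1 + z^2 / m)"
   have mp: "0 < m" using m by simp
   note x = self_normalised_threshold[OF h(4) mp, folded x_def]
   have zx: "z - x <= 4 * r"
   proof -
    have "z^3 = z * z^2" by (simp add: power3_eq_cube power2_eq_square)
    also have "... <= (2 * sqrt l) * (4 * l)" using zl z2 h(4) l by (intro mult_mono) auto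
    finally have "z^3 / (2 * m) <= (2 * sqrt l) * (4 * l) / (2 * m)"
    using mp by (intro divide_right_mono) auto
    hence "z - x <= (2 * sqrt l) * (4 * l) / (2 * m)" using x(3) by (rule order_trans[rotated])
    also have "... = 4 * (l * (sqrt l / m))" by simp
    also have "l * (sqrt l / m) <= l powr (s/2) * m powr (- (1/2))"
    proof (rule mult_mono)
    have "l powr 1 <= l powr (s/2)" using l s by (intro powr_mono) auto
    thus "l <= l powr (s/2)" using l by simp
    have "l <= m" unfolding l_def using ln_le_minus_one[of m] mp by simp
    hence "sqrt l <= sqrt m" by simp
    hence "sqrt l / m <= sqrt m / m" using mp by (intro divide_right_mono) auto
    also have "sqrt m / m = 1 / sqrt m" using mp real_sqrt_mult_self[of m] by (simp add: field_simps)
    also have "... = m powr (- (1/2))" using mp by (simp add: powr_minus_divide powr_half_sqrt)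
    finally show "sqrt l / m <= m powr (- (1/2))" .
    qed (use l mp in auto)
    also have "... <= l powr (s/2) * m powr (1 - s/2)" using m s by (intro mult_left_mono powr_mono) auto
    finally show ?thesis by (simp add: r_def mult.commute)
   qed
   define sl where "sl = sqrt l"
   \<comment> \<open>Chosen so that x * a <= 1/4 for every x up to 2 * sqrt l; the price a powr (-
     s) = 8 powr s * l powr (s/2) is the logarithmic factor in the rate.\<close>
   define a where "a = 1 / (8 * sl)"
   have sl: "1 <= sl" using l unfolding sl_def by simp
   have a: "0 < a" "a <= 1/4" unfolding a_def using sl by (auto simp: field_simps)
   have xa: "x * a <= 1/4"
   proof -
    have "x * a <= (2 * sl) * a" using x(2) zl a unfolding sl_def by (intro mult_right_mono) auto
    also have "... = 1/4" unfolding a_def using sl by simp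
    finally show ?thesis .
   qed
   have as: "a powr (- s) = 8 powr s * l powr (s/2)"
   proof -
    have "a powr (- s) = (8 * sl) powr s" unfolding a_def using sl by (intro one_div_powr_minus) auto
    also have "... = 8 powr s * sl powr s" using sl by (intro powr_mult)
    finally show ?thesis unfolding sl_def using sqrt_powr[of l s] l by simp
   qed
   interpret mi: iid_moment N "%y. - X y" s B by (rule iid_moment_minus)
   define R where "R = (%v. SS (%y. (X y)^2) J v / m - 1)"
   have one: "\<P>(v in PI J. x + x * (R v / 2 - (R v)^2 / 2) < SS X J v / sqrt m) <= Q x + 1000000 * B * 8 powr s * r"
    "\<P>(v in PI J. x + x * (R v / 2 - (R v)^2 / 2) < - SS X J v / sqrt m) <= Q x + 1000000 * B * 8 powr s * r"
    using Berry_Esseen_quadratic[OF h(2,3) a x(1) xa x(1)] mi.Berry_Esseen_quadratic[OF h(2,3) a x(1) xa x(1)]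
    unfolding R_def m_def[symmetric] as r_def SS_minus power2_minus by (simp_all add: mult_ac)
   have "{v \<in> space (PI J). self_normalised_excess X J z v}
    \<subseteq> {v \<in> space (PI J). x + x * (R v / 2 - (R v)^2 / 2) < SS X J v / sqrt m}
    \<union> {v \<in> space (PI J). x + x * (R v / 2 - (R v)^2 / 2) < - SS X J v / sqrt m}"
   proof
    fix v assume w: "v \<in> {v \<in> space (PI J). self_normalised_excess X J z v}"
    define V where "V = SS (%y. (X y)^2) J v"
    have V: "0 <= V" unfolding V_def SS_def by (intro sum_nonneg) auto
    have "x * sqrt V < abs (SS X J v)"
    unfolding x_def using self_normalised_event[OF V mp h(4)] w
    by (simp add: self_normalised_excess_def V_def m_def)
    hence "x * sqrt V / sqrt m < abs (SS X J v) / sqrt m" using mp by (intro divide_strict_right_mono) auto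
    moreover have "x * sqrt V / sqrt m = x * sqrt (1 + R v)" unfolding R_def V_def by (simp add: real_sqrt_divide)
    moreover have "x * (1 + R v / 2 - (R v)^2 / 2) <= x * sqrt (1 + R v)"
    using x(1) V mp by (intro mult_left_mono sqrt_quadratic_bound) (auto simp: R_def V_def)
    ultimately have "x * (1 + R v / 2 - (R v)^2 / 2) < abs (SS X J v) / sqrt m" by linarith
    hence "x + x * (R v / 2 - (R v)^2 / 2) < abs (SS X J v) / sqrt m" by (simp add: algebra_simps)
    thus "v \<in> {v \<in> space (PI J). x + x * (R v / 2 - (R v)^2 / 2) < SS X J v / sqrt m}
    \<union> {v \<in> space (PI J). x + x * (R v / 2 - (R v)^2 / 2) < - SS X J v / sqrt m}"
    using w by (cases "0 <= SS X J v") auto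
   qed
   hence "\<P>(v in PI J. self_normalised_excess X J z v)
    <= measure (PI J) ({v \<in> space (PI J). x + x * (R v / 2 - (R v)^2 / 2) < SS X J v / sqrt m}
    \<union> {v \<in> space (PI J). x + x * (R v / 2 - (R v)^2 / 2) < - SS X J v / sqrt m})"
    by (rule A.finite_measure_mono) (unfold R_def, measurable)
   also have "... <= \<P>(v in PI J. x + x * (R v / 2 - (R v)^2 / 2) < SS X J v / sqrt m)
    + \<P>(v in PI J. x + x * (R v / 2 - (R v)^2 / 2) < - SS X J v / sqrt m)"
   proof (rule measure_subadditive)
    show "{v \<in> space (PI J). x + x * (R v / 2 - (R v)^2 / 2) < SS X J v / sqrt m} \<in> A.events"
    "{v \<in> space (PI J). x + x * (R v / 2 - (R v)^2 / 2) < - SS X J v / sqrt m} \<in> A.events"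
    unfolding R_def by measurable
   qed (auto simp: A.emeasure_finite)
   also have "... <= 2 * Q x + 2000000 * B * 8 powr s * r" using one by simp
   also have "2 * Q x <= 2 * Q z + 4 * r" using Q_Lipschitz[of x z] zx x(2) by simp
   finally have "\<P>(v in PI J. self_normalised_excess X J z v) <= 2 * Q z + (4 + 2000000 * B * 8 powr s) * r"
    by (simp add: algebra_simps)
   also have "... <= 2 * Q z + C * r" using rn C1(1) unfolding C_def by (intro add_left_mono mult_right_mono) auto
   finally show ?thesis unfolding r_def m_def l_def .
  qed
 qed
 show ?thesis using Cpos main by blast
qed

subsection \<open>Symmetric matrices\<close>

lemma scalar_prod_sum: "v \<in> carrier_vec d ==> u \<bullet> v = (\<Sum>i<d. u $ i * v $ i)" for u v :: "real vec"
 by (auto simp: scalar_prod_def lessThan_atLeast0)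

lemma mult_vec_sum:
 "A \<in> carrier_mat d d ==> v \<in> carrier_vec d ==> i < d ==> (A *\<^sub>v v) $ i = (\<Sum>j<d. A $$ (i, j) * v $ j)" for v :: "real vec"
 by (auto simp: scalar_prod_def lessThan_atLeast0)

lemma mult_vec_carrier: "A \<in> carrier_mat d d ==> v \<in> carrier_vec d ==> A *\<^sub>v v \<in> carrier_vec d"
 by simp

lemma scalar_prod_self_ge_0: "0 <= u \<bullet> (u :: real vec)"
 by (simp add: scalar_prod_def sum_nonneg)

lemma scalar_prod_self_eq_0:
 assumes "u \<in> carrier_vec d" "u \<bullet> u = (0 :: real)" shows "u = 0\<^sub>v d"
proof (rule eq_vecI)
 fix i assume i: "i < dim_vec (0\<^sub>v d :: real vec)"
 have "(\<Sum>i<d. u $ i * u $ i) = 0" using assms scalar_prod_sum by metis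
 hence "u $ i * u $ i = 0" using i by (subst (asm) sum_nonneg_eq_0_iff) auto
 thus "u $ i = 0\<^sub>v d $ i" using i by simp
qed (use assms in auto)

lemma entry_sq_le: "u \<in> carrier_vec d ==> i < d ==> (u $ i)^2 <= u \<bullet> (u :: real vec)"
 unfolding scalar_prod_sum power2_eq_square by (rule member_le_sum[of i "{..<d}" "%i. u $ i * u $ i"]) auto

lemma Cauchy_Schwarz_vec:
 fixes u v :: "real vec"
 assumes "u \<in> carrier_vec d" "v \<in> carrier_vec d"
 shows "(u \<bullet> v)^2 <= (u \<bullet> u) * (v \<bullet> v)"
 using Cauchy_Schwarz_ineq_sum[of "%i. u $ i" "%i. v $ i" "{..<d}"] assms
 by (simp add: scalar_prod_sum power2_eq_square)

text \<open>A crude bound for the quadratic form on unit vectors; the summand 1 makes it strictly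
  positive, so that it may serve as a divisor.\<close>

definition entry_bound :: "real mat => real" where
 "entry_bound A = 1 + (\<Sum>i<dim_row A. \<Sum>j<dim_row A. abs (A $$ (i, j)))"

lemma entry_bound_pos: "0 < entry_bound A"
 unfolding entry_bound_def by (intro add_pos_nonneg sum_nonneg) auto

lemma form_bound:
 assumes A: "A \<in> carrier_mat d d" and x: "x \<in> carrier_vec d"
 shows "abs (x \<bullet> (A *\<^sub>v x)) <= entry_bound A * (x \<bullet> x)"
proof -
 have "x \<bullet> (A *\<^sub>v x) = (\<Sum>i<d. \<Sum>j<d. A $$ (i, j) * (x $ i * x $ j))"
  using mult_vec_carrier[OF A x] A x
  by (subst scalar_prod_sum) (auto simp: mult_vec_sum sum_distrib_left mult_ac simp del: index_mult_mat_vec intro!: sum.cong)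
 hence "abs (x \<bullet> (A *\<^sub>v x)) <= (\<Sum>i<d. \<Sum>j<d. abs (A $$ (i, j) * (x $ i * x $ j)))"
  by (auto intro: order_trans[OF sum_abs sum_mono] sum_abs)
 also have "... <= (\<Sum>i<d. \<Sum>j<d. abs (A $$ (i, j)) * (x \<bullet> x))"
 proof (intro sum_mono)
  fix i j assume ij: "i \<in> {..<d}" "j \<in> {..<d}"
  have "0 <= (abs (x $ i) - abs (x $ j))^2" by simp
  hence "2 * abs (x $ i * x $ j) <= (x $ i)^2 + (x $ j)^2" by (simp add: sq_simps abs_mult)
  also have "... <= x \<bullet> x + x \<bullet> x" using ij x by (intro add_mono entry_sq_le) auto
  finally have "abs (x $ i * x $ j) <= x \<bullet> x" by simp
  thus "abs (A $$ (i, j) * (x $ i * x $ j)) <= abs (A $$ (i, j)) * (x \<bullet> x)"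
   unfolding abs_mult by (intro mult_left_mono) (auto simp: abs_mult)
 qed
 also have "... = (\<Sum>i<d. \<Sum>j<d. abs (A $$ (i, j))) * (x \<bullet> x)" by (simp add: sum_distrib_right)
 also have "... <= entry_bound A * (x \<bullet> x)"
  unfolding entry_bound_def using A scalar_prod_self_ge_0 by (intro mult_right_mono) auto
 finally show ?thesis .
qed

lemma self_adjoint:
 fixes A :: "real mat"
 assumes A: "A \<in> carrier_mat d d" "transpose_mat A = A" and x: "x \<in> carrier_vec d" and y: "y \<in> carrier_vec d"
 shows "(A *\<^sub>v x) \<bullet> y = x \<bullet> (A *\<^sub>v y)"
 using transpose_vec_mult_scalar[OF A(1) y x] A x y
 by (metis comm_scalar_prod mult_vec_carrier)

lemma norm_bound:
 fixes A :: "real mat"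
 assumes A: "A \<in> carrier_mat d d" and x: "x \<in> carrier_vec d"
 shows "(A *\<^sub>v x) \<bullet> (A *\<^sub>v x) <= entry_bound (transpose_mat A * A) * (x \<bullet> x)"
proof -
 have "(A *\<^sub>v x) \<bullet> (A *\<^sub>v x) = x \<bullet> (transpose_mat A *\<^sub>v (A *\<^sub>v x))"
  using transpose_vec_mult_scalar[OF A x mult_vec_carrier[OF A x]] A x
  by (metis comm_scalar_prod mult_mat_vec_carrier transpose_carrier_mat)
 also have "transpose_mat A *\<^sub>v (A *\<^sub>v x) = (transpose_mat A * A) *\<^sub>v x"
  using A x by (metis assoc_mult_mat_vec transpose_carrier_mat)
 finally show ?thesis
  using form_bound[of "transpose_mat A * A" d x] A x by (auto simp: abs_le_iff)
qed

lemma form_shift: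
 fixes A :: "real mat" and t :: real
 assumes A: "A \<in> carrier_mat d d" "transpose_mat A = A" and u: "u \<in> carrier_vec d" and w: "w \<in> carrier_vec d"
 shows "(u + t \<cdot>\<^sub>v w) \<bullet> (A *\<^sub>v (u + t \<cdot>\<^sub>v w)) = u \<bullet> (A *\<^sub>v u) + 2 * t * (w \<bullet> (A *\<^sub>v u)) + t^2 * (w \<bullet> (A *\<^sub>v w))"
proof -
 have tw: "t \<cdot>\<^sub>v w \<in> carrier_vec d" using w by simp
 have 1: "A *\<^sub>v (u + t \<cdot>\<^sub>v w) = A *\<^sub>v u + t \<cdot>\<^sub>v (A *\<^sub>v w)"
  using A u w tw by (simp add: mult_add_distrib_mat_vec mult_mat_vec)
 have c: "A *\<^sub>v u \<in> carrier_vec d" "A *\<^sub>v w \<in> carrier_vec d" "t \<cdot>\<^sub>v (A *\<^sub>v w) \<in> carrier_vec d" using A u w by auto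
 have "u \<bullet> (A *\<^sub>v w) = w \<bullet> (A *\<^sub>v u)"
  using self_adjoint[OF A w u] c u w by (metis comm_scalar_prod)
 thus ?thesis unfolding 1 using u w tw c
  by (simp add: add_scalar_prod_distrib[of _ d] scalar_prod_add_distrib[of _ d] sq_simps)
qed

text \<open>The form is evaluated at u - w / K with w = A u, where nonnegativity and the upper bound
  on w . A w leave u . w >= (w . w) / K. This stands in for a spectral decomposition in several
  places.\<close>

lemma psd_norm_bound:
 fixes A :: "real mat"
 assumes A: "A \<in> carrier_mat d d" "transpose_mat A = A"
  and psd: "!!x. x \<in> carrier_vec d ==> 0 <= x \<bullet> (A *\<^sub>v x)"
  and K: "0 < K" "!!x. x \<in> carrier_vec d ==> x \<bullet> (A *\<^sub>v x) <= K * (x \<bullet> x)"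
  and u: "u \<in> carrier_vec d"
 shows "(A *\<^sub>v u) \<bullet> (A *\<^sub>v u) <= K * (u \<bullet> (A *\<^sub>v u))"
proof -
 define w where "w = A *\<^sub>v u"
 have w: "w \<in> carrier_vec d" unfolding w_def using A u by simp
 have "0 <= (u + (- 1 / K) \<cdot>\<^sub>v w) \<bullet> (A *\<^sub>v (u + (- 1 / K) \<cdot>\<^sub>v w))" using u w by (intro psd) auto
 also have "... = u \<bullet> w - 2 / K * (w \<bullet> w) + (w \<bullet> (A *\<^sub>v w)) / K^2"
  unfolding form_shift[OF A u w] w_def[symmetric] by (simp add: power_divide)
 also have "... <= u \<bullet> w - 2 / K * (w \<bullet> w) + (K * (w \<bullet> w)) / K^2"
  using K(2)[OF w] by (intro add_left_mono divide_right_mono) auto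
 also have "... = u \<bullet> w - (w \<bullet> w) / K" using K by (simp add: sq_field_simps)
 finally show ?thesis unfolding w_def[symmetric] using K by (simp add: field_simps)
qed

lemma minv_invertible:
 assumes A: "A \<in> carrier_mat d d" and det: "det A ~= (0::real)"
 shows "minv A \<in> carrier_mat d d" "A * minv A = 1\<^sub>m d" "minv A * A = 1\<^sub>m d"
proof -
 have "mat_inverse A ~= None" using mat_inverse(1)[OF A, of "()"] det_non_zero_imp_unit[OF A det, of "()"] by blast
 then obtain B where B: "mat_inverse A = Some B" by auto
 hence "minv A = B" by (simp add: minv_def)
 thus "minv A \<in> carrier_mat d d" "A * minv A = 1\<^sub>m d" "minv A * A = 1\<^sub>m d"
  using mat_inverse(2)[OF A B] by auto
qed

lemma minv_singular:
 assumes A: "A \<in> carrier_mat d d" and det: "det A = (0::real)"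
 shows "minv A = 0\<^sub>m d d"
proof -
 have "mat_inverse A = None"
 proof (rule ccontr)
  assume "mat_inverse A ~= None"
  then obtain B where "mat_inverse A = Some B" by auto
  hence B: "A * B = 1\<^sub>m d" "B \<in> carrier_mat d d" using mat_inverse(2)[OF A] by auto
  hence "det A * det B = 1" using det_mult[OF A B(2)] by simp
  thus False using det by simp
 qed
 thus ?thesis using A by (simp add: minv_def)
qed

lemma minv_carrier: "A \<in> carrier_mat d d ==> minv A \<in> carrier_mat d d"
 using minv_invertible(1) minv_singular by (cases "det A = 0") auto

lemma minv_unique:
 assumes A: "A \<in> carrier_mat d d" and B: "B \<in> carrier_mat d d" "B * A = 1\<^sub>m d"
 shows "minv A = (B :: real mat)"
proof -
 have "det B * det A = 1" using det_mult[OF B(1) A] B(2) by simp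
 hence "det A ~= 0" by auto
 note m = minv_invertible[OF A this]
 have "minv A = (B * A) * minv A" unfolding B(2) using m by simp
 also have "... = B * (A * minv A)" using assoc_mult_mat[OF B(1) A m(1)] .
 also have "... = B" unfolding m(2) using B by simp
 finally show ?thesis .
qed

text \<open>Cramer's formula, including the singular default; it makes the entries of the inverse
  measurable functions of the matrix entries.\<close>

lemma minv_entry:
 assumes A: "A \<in> carrier_mat d d" and ij: "i < d" "j < d"
 shows "minv A $$ (i, j) = (if det A = 0 then 0 else adj_mat A $$ (i, j) / det A)"
proof (cases "det A = 0")
 case False
 have "minv A = (1 / det A) \<cdot>\<^sub>m adj_mat A"
 proof (rule minv_unique[OF A])
  show "(1 / det A) \<cdot>\<^sub>m adj_mat A \<in> carrier_mat d d" using adj_mat[OF A] by simp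
  have "(1 / det A) \<cdot>\<^sub>m adj_mat A * A = (1 / det A) \<cdot>\<^sub>m (adj_mat A * A)"
   by (rule mult_smult_assoc_mat[OF adj_mat(1)[OF A] A])
  also have "... = 1\<^sub>m d" unfolding adj_mat(3)[OF A] using False by (intro eq_matI) auto
  finally show "(1 / det A) \<cdot>\<^sub>m adj_mat A * A = 1\<^sub>m d" .
 qed
 thus ?thesis using adj_mat(1)[OF A] ij False by simp
qed (use minv_singular[OF A] ij in simp)

lemma minv_symmetric:
 assumes A: "A \<in> carrier_mat d d" "transpose_mat A = A"
 shows "transpose_mat (minv A) = (minv A :: real mat)"
proof (cases "det A = 0")
 case True thus ?thesis using minv_singular[OF A(1)] by simp
next
 case False
 note m = minv_invertible[OF A(1) False]
 have "transpose_mat (minv A) * A = transpose_mat (A * minv A)"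
  using transpose_mult[OF A(1) m(1)] A(2) by simp
 hence "transpose_mat (minv A) * A = 1\<^sub>m d" unfolding m(2) by simp
 from minv_unique[OF A(1) _ this] m(1) show ?thesis by simp
qed

lemma borel_measurable_det:
 assumes "!!x. F x \<in> carrier_mat d d" "!!i j. i < d ==> j < d ==> (%x. F x $$ (i, j)) \<in> borel_measurable M"
 shows "(%x. det (F x) :: real) \<in> borel_measurable M"
proof -
 have "(%x. det (F x)) = (%x. \<Sum>p\<in>{p. p permutes {0..<d}}. signof p * (\<Prod>i = 0..<d. F x $$ (i, p i)))"
  using det_def'[OF assms(1)] by (intro ext)
 also have "... \<in> borel_measurable M"
  using assms(2) permutes_in_image
  by (intro borel_measurable_sum borel_measurable_times borel_measurable_const borel_measurable_prod)
   (fastforce dest: permutes_in_image)+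
 finally show ?thesis .
qed

lemma borel_measurable_minv:
 assumes F: "!!x. F x \<in> carrier_mat d d" "!!i j. i < d ==> j < d ==> (%x. F x $$ (i, j)) \<in> borel_measurable M"
  and ij: "i < d" "j < d"
 shows "(%x. minv (F x) $$ (i, j) :: real) \<in> borel_measurable M"
proof -
 have dm: "(%x. det (F x)) \<in> borel_measurable M" by (rule borel_measurable_det[OF F])
 have cm: "(%x. det (mat_delete (F x) j i)) \<in> borel_measurable M"
 proof (rule borel_measurable_det)
  show "mat_delete (F x) j i \<in> carrier_mat (d - 1) (d - 1)" for x by (rule mat_delete_carrier[OF F(1)])
  fix k l assume kl: "k < d - 1" "l < d - 1"
  have "(%x. mat_delete (F x) j i $$ (k, l)) = (%x. F x $$ (if k < j then k else Suc k, if l < i then l else Suc l))"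
   using kl by (auto simp: mat_delete_def carrier_matD[OF F(1)])
  also have "... \<in> borel_measurable M" using kl by (intro F(2)) auto
  finally show "(%x. mat_delete (F x) j i $$ (k, l)) \<in> borel_measurable M" .
 qed
 have "(%x. minv (F x) $$ (i, j)) = (%x. if det (F x) = 0 then 0 else ((-1)^(j+i) * det (mat_delete (F x) j i)) / det (F x))"
  using minv_entry[OF F(1) ij] F(1) ij by (auto simp: adj_mat_def cofactor_def carrier_matD[OF F(1)])
 also have "... \<in> borel_measurable M" using dm cm by measurable
 finally show ?thesis .
qed

text \<open>Take m to be the infimum of the Rayleigh quotient. If B = A - m were invertible, then
  |u|^2 <= K' * |B u|^2 <= K' * K * (u . B u), so the quotient would stay above m + 1 / (K' * K).
  Hence m is an eigenvalue, without any appeal to compactness of the sphere.\<close>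

lemma symmetric_eigenvalue_min:
 fixes A :: "real mat"
 assumes A: "A \<in> carrier_mat d d" "transpose_mat A = A" and d: "0 < d"
 obtains m where "eigenvalue A m" "!!u. u \<in> carrier_vec d ==> m * (u \<bullet> u) <= u \<bullet> (A *\<^sub>v u)"
proof -
 define S where "S = {u \<bullet> (A *\<^sub>v u) | u. u \<in> carrier_vec d \<and> u \<bullet> u = 1}"
 define m where "m = Inf S"
 have Sne: "S ~= {}"
 proof -
  have "unit_vec d 0 \<bullet> unit_vec d 0 = (1::real)" using d by simp
  thus ?thesis unfolding S_def using d by (auto intro!: exI[of _ "unit_vec d 0"])
 qed
 have lb: "- entry_bound A <= x" if "x \<in> S" for x
  using that form_bound[OF A(1)] unfolding S_def by (force simp: abs_le_iff)
 have bdd: "bdd_below S" using lb by (auto simp: bdd_below_def)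
 have mle: "m * (u \<bullet> u) <= u \<bullet> (A *\<^sub>v u)" if u: "u \<in> carrier_vec d" for u
 proof (cases "u \<bullet> u = 0")
  case True
  hence "u = 0\<^sub>v d" using scalar_prod_self_eq_0[OF u] by simp
  thus ?thesis using A True by (simp add: scalar_prod_def)
 next
  case False
  define r where "r = sqrt (u \<bullet> u)"
  have r: "0 < r" "r * r = u \<bullet> u" using False scalar_prod_self_ge_0[of u] unfolding r_def by auto
  have Au: "A *\<^sub>v u \<in> carrier_vec d" using A u by simp
  have "((1/r) \<cdot>\<^sub>v u) \<bullet> ((1/r) \<cdot>\<^sub>v u) = 1" using u r False by (simp add: field_simps)
  moreover have "((1/r) \<cdot>\<^sub>v u) \<bullet> (A *\<^sub>v ((1/r) \<cdot>\<^sub>v u)) = (u \<bullet> (A *\<^sub>v u)) / (r * r)"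
   using u Au A r by (simp add: mult_mat_vec[OF A(1) u] field_simps)
  ultimately have "(u \<bullet> (A *\<^sub>v u)) / (r * r) \<in> S" unfolding S_def using u
   by (auto intro!: exI[of _ "(1/r) \<cdot>\<^sub>v u"])
  hence "m <= (u \<bullet> (A *\<^sub>v u)) / (r * r)" unfolding m_def using bdd by (rule cInf_lower)
  hence "m * (r * r) <= u \<bullet> (A *\<^sub>v u)" by (simp only: pos_le_divide_eq[OF mult_pos_pos[OF r(1) r(1)]])
  thus ?thesis using r by simp
 qed
 define B where "B = char_matrix A m"
 have B: "B \<in> carrier_mat d d" unfolding B_def using A by simp
 have Bu: "B *\<^sub>v u = A *\<^sub>v u - m \<cdot>\<^sub>v u" if u: "u \<in> carrier_vec d" for u
 proof -
  have "B *\<^sub>v u = A *\<^sub>v u + ((- m) \<cdot>\<^sub>m 1\<^sub>m d) *\<^sub>v u"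
   unfolding B_def char_matrix_def using A u by (simp add: add_mult_distrib_mat_vec[of _ d d])
  also have "((- m) \<cdot>\<^sub>m 1\<^sub>m d) *\<^sub>v u = (- m) \<cdot>\<^sub>v u"
   using u by (intro eq_vecI) (auto simp: row_smult smult_scalar_prod_distrib[of _ d])
  finally show ?thesis using A u by (intro eq_vecI) auto
 qed
 have Bsym: "transpose_mat B = B"
 proof (rule eq_matI)
  fix i j assume "i < dim_row B" "j < dim_col B"
  hence ij: "i < d" "j < d" using B by auto
  have "A $$ (j, i) = transpose_mat A $$ (i, j)" using A(1) ij by simp
  hence "A $$ (j, i) = A $$ (i, j)" unfolding A(2) .
  thus "transpose_mat B $$ (i, j) = B $$ (i, j)" using B ij A(1) unfolding B_def char_matrix_def by auto
 qed (use B in auto)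
 have Bform: "u \<bullet> (B *\<^sub>v u) = u \<bullet> (A *\<^sub>v u) - m * (u \<bullet> u)" if u: "u \<in> carrier_vec d" for u
  unfolding Bu[OF u] using u A by (simp add: scalar_prod_minus_distrib[of _ d])
 have "det B = 0"
 proof (rule ccontr)
  assume "det B ~= 0"
  note inv = minv_invertible[OF B this]
  define K where "K = entry_bound B"
  define K' where "K' = entry_bound (transpose_mat (minv B) * minv B)"
  have K: "0 < K" "0 < K'" unfolding K_def K'_def by (rule entry_bound_pos)+
  have low: "1 / (K' * K) <= u \<bullet> (B *\<^sub>v u)" if u: "u \<in> carrier_vec d" "u \<bullet> u = 1" for u
  proof -
   have Buc: "B *\<^sub>v u \<in> carrier_vec d" using B u by simp
   have "minv B *\<^sub>v (B *\<^sub>v u) = (minv B * B) *\<^sub>v u" using inv(1) B u(1) by (metis assoc_mult_mat_vec)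
   hence "minv B *\<^sub>v (B *\<^sub>v u) = u" unfolding inv(3) using u by simp
   hence "1 <= K' * ((B *\<^sub>v u) \<bullet> (B *\<^sub>v u))" using norm_bound[OF inv(1) Buc] u(2) unfolding K'_def by simp
   also have "... <= K' * (K * (u \<bullet> (B *\<^sub>v u)))"
   proof (intro mult_left_mono psd_norm_bound[OF B Bsym _ K(1)] u)
    show "0 <= x \<bullet> (B *\<^sub>v x)" if "x \<in> carrier_vec d" for x using Bform[OF that] mle[OF that] by simp
    show "x \<bullet> (B *\<^sub>v x) <= K * (x \<bullet> x)" if "x \<in> carrier_vec d" for x
    using form_bound[OF B that] unfolding K_def by (simp add: abs_le_iff)
   qed (use K in simp)
   finally show ?thesis using K by (simp add: field_simps)
  qed
  have "m + 1 / (K' * K) <= Inf S"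
  proof (rule cInf_greatest[OF Sne])
   fix x assume "x \<in> S"
   then obtain u where u: "u \<in> carrier_vec d" "u \<bullet> u = 1" "x = u \<bullet> (A *\<^sub>v u)" unfolding S_def by auto
   show "m + 1 / (K' * K) <= x" using low[OF u(1,2)] Bform[OF u(1)] u by simp
  qed
  hence "1 / (K' * K) <= 0" unfolding m_def by simp
  thus False using K by (simp add: divide_le_0_iff) (metis mult_pos_pos not_less)
 qed
 hence "eigenvalue A m" using eigenvalue_det[OF A(1)] by (simp add: B_def)
 thus ?thesis using that mle by blast
qed

lemma spectrum_eq: "spectrum A = {k. eigenvalue A k}"
 by (auto simp: spectrum_def)

lemma lambda_min_form:
 fixes A :: "real mat"
 assumes A: "A \<in> carrier_mat d d" "transpose_mat A = A" and d: "0 < d" and l: "l <= lambda_min A" and u: "u \<in> carrier_vec d"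
 shows "l * (u \<bullet> u) <= u \<bullet> (A *\<^sub>v u)"
proof -
 obtain m where m: "eigenvalue A m" "!!u. u \<in> carrier_vec d ==> m * (u \<bullet> u) <= u \<bullet> (A *\<^sub>v u)"
  using symmetric_eigenvalue_min[OF A d] by blast
 have "lambda_min A <= m" unfolding lambda_min_def using m(1) card_finite_spectrum(1)[OF A(1)]
  by (intro Min_le) (auto simp: spectrum_eq)
 hence "l * (u \<bullet> u) <= m * (u \<bullet> u)" using l scalar_prod_self_ge_0 by (intro mult_right_mono) auto
 thus ?thesis using m(2)[OF u] by linarith
qed

lemma lambda_max_form:
 fixes A :: "real mat"
 assumes A: "A \<in> carrier_mat d d" "transpose_mat A = A" and d: "0 < d" and l: "lambda_max A <= l" and u: "u \<in> carrier_vec d"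
 shows "u \<bullet> (A *\<^sub>v u) <= l * (u \<bullet> u)"
proof -
 have A': "- A \<in> carrier_mat d d" "transpose_mat (- A) = - A" using A by (auto simp: transpose_uminus)
 obtain m where m: "eigenvalue (- A) m" "!!u. u \<in> carrier_vec d ==> m * (u \<bullet> u) <= u \<bullet> (- A *\<^sub>v u)"
  using symmetric_eigenvalue_min[OF A' d] by blast
 have neg: "- A *\<^sub>v v = - (A *\<^sub>v v)" if "v \<in> carrier_vec d" for v using A that by (intro uminus_mult_mat_vec) auto
 from m(1) obtain v where v: "v \<in> carrier_vec d" "v ~= 0\<^sub>v d" "- A *\<^sub>v v = m \<cdot>\<^sub>v v"
  unfolding eigenvalue_def eigenvector_def using A by auto
 have "A *\<^sub>v v = (- m) \<cdot>\<^sub>v v"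
 proof (rule eq_vecI)
  fix i assume "i < dim_vec (- m \<cdot>\<^sub>v v)"
  hence i: "i < d" using v by simp
  have "(- (A *\<^sub>v v)) $ i = (m \<cdot>\<^sub>v v) $ i" using v(3) neg[OF v(1)] by simp
  thus "(A *\<^sub>v v) $ i = (- m \<cdot>\<^sub>v v) $ i" using i A v by simp
 qed (use A v in auto)
 hence "eigenvalue A (- m)" unfolding eigenvalue_def eigenvector_def using A v by auto
 hence "- m <= lambda_max A" unfolding lambda_max_def using card_finite_spectrum(1)[OF A(1)]
  by (intro Max_ge) (auto simp: spectrum_eq)
 hence "- m * (u \<bullet> u) <= l * (u \<bullet> u)" using l scalar_prod_self_ge_0 by (intro mult_right_mono) auto
 moreover have "u \<bullet> (- A *\<^sub>v u) = - (u \<bullet> (A *\<^sub>v u))" unfolding neg[OF u] using u A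
  by (simp add: scalar_prod_def sum_negf)
 ultimately show ?thesis using m(2)[OF u] by simp
qed

lemma posdef_det:
 fixes A :: "real mat"
 assumes A: "A \<in> carrier_mat d d" and pos: "!!u. u \<in> carrier_vec d ==> u ~= 0\<^sub>v d ==> 0 < u \<bullet> (A *\<^sub>v u)"
 shows "det A ~= 0"
proof
 assume "det A = 0"
 then obtain v where v: "v \<in> carrier_vec d" "v ~= 0\<^sub>v d" "A *\<^sub>v v = 0\<^sub>v d"
  using det_0_iff_vec_prod_zero_field[OF A] by auto
 have "v \<bullet> (A *\<^sub>v v) = 0" unfolding v(3) using v(1) by (simp add: scalar_prod_def)
 thus False using pos[OF v(1,2)] by simp
qed

lemma minv_apply:
 assumes A: "A \<in> carrier_mat d d" "det A ~= (0::real)" and u: "u \<in> carrier_vec d"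
 shows "A *\<^sub>v (minv A *\<^sub>v u) = u" "minv A *\<^sub>v (A *\<^sub>v u) = u"
 using minv_invertible[OF A] A(1) u by (metis assoc_mult_mat_vec one_mult_mat_vec)+

text \<open>Completing the square around \<open>minv A *\<^sub>v b\<close> shows that the minimiser
  is unique, so the choice operator in \<open>arg_min_on\<close> has only one value to choose. It
  serves the population and the empirical least squares problems alike.\<close>

lemma quadratic_arg_min:
 fixes A :: "real mat"
 assumes A: "A \<in> carrier_mat d d" "transpose_mat A = A"
  and pos: "!!u. u \<in> carrier_vec d ==> u ~= 0\<^sub>v d ==> 0 < u \<bullet> (A *\<^sub>v u)"
  and b: "b \<in> carrier_vec d" and k: "0 < k"
  and f: "!!h. h \<in> carrier_vec d ==> f h = k * (c - 2 * (b \<bullet> h) + h \<bullet> (A *\<^sub>v h))"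
 shows "arg_min_on f (carrier_vec d) = minv A *\<^sub>v b"
proof -
 define s where "s = minv A *\<^sub>v b"
 note det = posdef_det[OF A(1) pos]
 have s: "s \<in> carrier_vec d" unfolding s_def using minv_carrier[OF A(1)] b by simp
 have As: "A *\<^sub>v s = b" unfolding s_def by (rule minv_apply[OF A(1) det b])
 have key: "f h = f s + k * ((h - s) \<bullet> (A *\<^sub>v (h - s)))" if t: "h \<in> carrier_vec d" for h
 proof -
  have w: "h - s \<in> carrier_vec d" using t s by simp
  have ts: "h = s + 1 \<cdot>\<^sub>v (h - s)" using t s by (intro eq_vecI) auto
  have bt: "b \<bullet> h = b \<bullet> s + (h - s) \<bullet> b"
   using t s b w by (simp add: minus_scalar_prod_distrib[of _ d] comm_scalar_prod[of b d h] comm_scalar_prod[of b d s])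
  have "h \<bullet> (A *\<^sub>v h) = s \<bullet> (A *\<^sub>v s) + 2 * ((h - s) \<bullet> b) + (h - s) \<bullet> (A *\<^sub>v (h - s))"
   using form_shift[OF A s w, of 1] As ts by simp
  thus ?thesis unfolding f[OF t] f[OF s] bt by (simp add: algebra_simps)
 qed
 have uniq: "h = s" if t: "h \<in> carrier_vec d" and le: "f h <= f s" for h
 proof (rule ccontr)
  assume ne: "h ~= s"
  have w: "h - s \<in> carrier_vec d" using t s by simp
  have "h - s ~= 0\<^sub>v d"
  proof
   assume z: "h - s = 0\<^sub>v d"
   have "h = s"
   proof (rule eq_vecI)
    fix i assume "i < dim_vec s"
    hence "(h - s) $ i = 0" unfolding z using s by simp
    thus "h $ i = s $ i" using \<open>i < dim_vec s\<close> t s by simp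
   qed (use t s in auto)
   thus False using ne by simp
  qed
  hence "0 < k * ((h - s) \<bullet> (A *\<^sub>v (h - s)))" using pos[OF w] k by simp
  thus False using key[OF t] le by simp
 qed
 have ge: "f s <= f h" if "h \<in> carrier_vec d" for h
 proof -
  have w: "h - s \<in> carrier_vec d" using that s by simp
  have "0 <= (h - s) \<bullet> (A *\<^sub>v (h - s))"
  proof (cases "h - s = 0\<^sub>v d")
   case True thus ?thesis using A by (simp add: scalar_prod_def)
  qed (use pos[OF w] in simp)
  thus ?thesis using key[OF that] k by simp
 qed
 have "is_arg_min f (%x. x \<in> carrier_vec d) s" unfolding is_arg_min_def using s ge by (auto simp: not_less)
 hence "is_arg_min f (%x. x \<in> carrier_vec d) (arg_min_on f (carrier_vec d))"
  unfolding arg_min_on_def arg_min_def by (rule someI)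
 hence a: "arg_min_on f (carrier_vec d) \<in> carrier_vec d" "\<not> f s < f (arg_min_on f (carrier_vec d))"
  unfolding is_arg_min_def using s by auto
 show ?thesis using uniq[OF a(1)] a(2) by (simp add: s_def)
qed

section \<open>Square roots of positive definite matrices by the binomial series\<close>

lemma pow_mat_carrier: "B \<in> carrier_mat d d ==> B ^\<^sub>m k \<in> carrier_mat d d"
 by simp

lemma pow_mat_plus:
 fixes B :: "real mat"
 assumes B: "B \<in> carrier_mat d d"
 shows "B ^\<^sub>m (k + m) = B ^\<^sub>m k * B ^\<^sub>m m"
proof (induction m)
 case 0 thus ?case using B by simp
next
 case (Suc m)
 have "B ^\<^sub>m (k + Suc m) = (B ^\<^sub>m k * B ^\<^sub>m m) * B" using Suc by simp
 also have "... = B ^\<^sub>m k * (B ^\<^sub>m m * B)" using B by (intro assoc_mult_mat) auto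
 finally show ?case by simp
qed

lemma mult_mat_entry:
 fixes A B :: "real mat"
 assumes "A \<in> carrier_mat d d" "B \<in> carrier_mat d d" "i < d" "j < d"
 shows "(A * B) $$ (i, j) = (\<Sum>l<d. A $$ (i, l) * B $$ (l, j))"
 using assms by (auto simp: scalar_prod_def lessThan_atLeast0)

lemma pow_mat_symmetric:
 fixes B :: "real mat"
 assumes B: "B \<in> carrier_mat d d" "transpose_mat B = B"
 shows "transpose_mat (B ^\<^sub>m k) = B ^\<^sub>m k"
proof (induction k)
 case 0 thus ?case using B by simp
next
 case (Suc k)
 have "transpose_mat (B ^\<^sub>m k * B) = transpose_mat B * transpose_mat (B ^\<^sub>m k)"
  using B by (intro transpose_mult) auto
 also have "... = B ^\<^sub>m 1 * B ^\<^sub>m k" using B Suc by simp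
 also have "... = B ^\<^sub>m (1 + k)" using pow_mat_plus[OF B(1), of 1 k] by simp
 finally show ?case by simp
qed

text \<open>Successive coefficients have ratio (a - k) / (k + 1), of absolute value at most 1 for a
  in [0, 1]; the binomial series is then dominated by a geometric one.\<close>

lemma gchoose_le_1: assumes "0 <= a" "a <= 1" shows "abs (a gchoose k) <= (1::real)"
proof (induction k)
 case (Suc k)
 have eq: "a gchoose (Suc k) = (a gchoose k) * ((a - real k) / real (Suc k))"
  using gbinomial_absorption'[of "Suc k" a] gbinomial_mult_1[of a k] by (simp add: field_simps)
 have "abs ((a - real k) / real (Suc k)) <= 1" using assms by (simp add: abs_divide)
 hence "abs (a gchoose k) * abs ((a - real k) / real (Suc k)) <= 1 * 1" using Suc by (intro mult_mono) auto
 thus ?case unfolding eq abs_mult by simp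
qed simp

locale contraction_mat =
 fixes d :: nat and B :: "real mat" and \<beta> :: real
 assumes B: "B \<in> carrier_mat d d" "transpose_mat B = B" and \<beta>: "0 < \<beta>" "\<beta> < 1"
  and form: "!!u. u \<in> carrier_vec d ==> 0 <= u \<bullet> (B *\<^sub>v u)" "!!u. u \<in> carrier_vec d ==> u \<bullet> (B *\<^sub>v u) <= \<beta> * (u \<bullet> u)"
begin

lemma contract: "u \<in> carrier_vec d ==> (B *\<^sub>v u) \<bullet> (B *\<^sub>v u) <= \<beta>^2 * (u \<bullet> u)"
proof -
 assume u: "u \<in> carrier_vec d"
 have "(B *\<^sub>v u) \<bullet> (B *\<^sub>v u) <= \<beta> * (u \<bullet> (B *\<^sub>v u))" by (rule psd_norm_bound[OF B form(1) \<beta>(1) form(2) u])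
 also have "... <= \<beta> * (\<beta> * (u \<bullet> u))" using \<beta> form(2)[OF u] by (intro mult_left_mono) auto
 finally show ?thesis by (simp add: power2_eq_square)
qed

lemma contract_pow: "u \<in> carrier_vec d ==> (B ^\<^sub>m k *\<^sub>v u) \<bullet> (B ^\<^sub>m k *\<^sub>v u) <= (\<beta>^2) ^ k * (u \<bullet> u)"
proof (induction k arbitrary: u)
 case 0 thus ?case using B by simp
next
 case (Suc k)
 have Bu: "B *\<^sub>v u \<in> carrier_vec d" using B Suc by simp
 have "B ^\<^sub>m Suc k *\<^sub>v u = B ^\<^sub>m k *\<^sub>v (B *\<^sub>v u)"
  using B Suc.prems by (simp add: assoc_mult_mat_vec[of _ d d _ d])
 hence "(B ^\<^sub>m Suc k *\<^sub>v u) \<bullet> (B ^\<^sub>m Suc k *\<^sub>v u) <= (\<beta>^2) ^ k * ((B *\<^sub>v u) \<bullet> (B *\<^sub>v u))" using Suc.IH[OF Bu] by simp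
 also have "... <= (\<beta>^2) ^ k * (\<beta>^2 * (u \<bullet> u))" using contract[OF Suc.prems] by (intro mult_left_mono) auto
 finally show ?case by (simp add: mult_ac)
qed

lemma pow_entry: assumes "i < d" "j < d" shows "abs ((B ^\<^sub>m k) $$ (i, j)) <= \<beta> ^ k"
proof -
 have e: "unit_vec d j \<in> carrier_vec d" by simp
 have c: "B ^\<^sub>m k *\<^sub>v unit_vec d j \<in> carrier_vec d" by (rule mult_vec_carrier[OF pow_mat_carrier[OF B(1)] e])
 have "(B ^\<^sub>m k *\<^sub>v unit_vec d j) $ i = (B ^\<^sub>m k) $$ (i, j)"
  using mult_vec_sum[OF pow_mat_carrier[OF B(1)] e assms(1)] assms
  by (simp add: unit_vec_def if_distrib sum.delta cong: if_cong)
 hence "((B ^\<^sub>m k) $$ (i, j))^2 <= (B ^\<^sub>m k *\<^sub>v unit_vec d j) \<bullet> (B ^\<^sub>m k *\<^sub>v unit_vec d j)"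
  using entry_sq_le[OF c assms(1)] by simp
 also have "... <= (\<beta>^2) ^ k * (unit_vec d j \<bullet> unit_vec d j)" by (rule contract_pow[OF e])
 also have "unit_vec d j \<bullet> unit_vec d j = (1::real)" using assms by simp
 finally have "abs ((B ^\<^sub>m k) $$ (i, j))^2 <= (\<beta> ^ k)^2" by (simp add: power_mult[symmetric] mult.commute)
 thus ?thesis by (rule power2_le_imp_le) (use \<beta> in simp)
qed

definition pterm :: "real => nat => nat => nat => real" where
 "pterm a i j k = (a gchoose k) * (- 1) ^ k * (B ^\<^sub>m k) $$ (i, j)"

text \<open>The power (1 - B)^a, summed entry by entry, so that only convergence of real series is
  involved.\<close>

definition P :: "real => real mat" where
 "P a = mat d d (%(i, j). \<Sum>k. pterm a i j k)"

lemma P_carrier: "P a \<in> carrier_mat d d" by (simp add: P_def)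

lemma pterm_summable:
 assumes a: "0 <= a" "a <= 1" and ij: "i < d" "j < d"
 shows "summable (%k. norm (pterm a i j k))"
proof (rule summable_comparison_test')
 show "summable (%k. \<beta> ^ k)" using \<beta> by (intro summable_geometric) auto
 fix k
 have "abs (a gchoose k) * abs ((B ^\<^sub>m k) $$ (i, j)) <= 1 * \<beta> ^ k"
  using gchoose_le_1[OF a] pow_entry[OF ij] by (intro mult_mono) auto
 thus "norm (norm (pterm a i j k)) <= \<beta> ^ k" by (simp add: pterm_def abs_mult power_abs)
qed

text \<open>Exponents add by the Cauchy product of absolutely convergent series and Vandermonde's
  convolution of the binomial coefficients.\<close>

lemma P_mult:
 assumes a: "0 <= a" "a <= 1" and b: "0 <= b" "b <= 1"
 shows "P a * P b = P (a + b)"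
proof (rule eq_matI)
 fix i j assume "i < dim_row (P (a + b))" "j < dim_col (P (a + b))"
 hence ij: "i < d" "j < d" by (auto simp: P_def)
 have "(P a * P b) $$ (i, j) = (\<Sum>l<d. (\<Sum>k. pterm a i l k) * (\<Sum>k. pterm b l j k))"
  unfolding mult_mat_entry[OF P_carrier P_carrier ij] using ij by (simp add: P_def)
 also have "... = (\<Sum>l<d. \<Sum>n. \<Sum>k\<le>n. pterm a i l k * pterm b l j (n - k))"
  using pterm_summable a b ij by (intro sum.cong refl Cauchy_product) auto
 also have "... = (\<Sum>n. \<Sum>l<d. \<Sum>k\<le>n. pterm a i l k * pterm b l j (n - k))"
  using pterm_summable a b ij by (intro suminf_sum[symmetric] summable_Cauchy_product) auto
 also have "... = (\<Sum>n. pterm (a + b) i j n)"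
 proof (rule suminf_cong)
  fix n
  have "(\<Sum>l<d. \<Sum>k\<le>n. pterm a i l k * pterm b l j (n - k)) = (\<Sum>k\<le>n. \<Sum>l<d. pterm a i l k * pterm b l j (n - k))"
   by (rule sum.swap)
  also have "... = (\<Sum>k\<le>n. (a gchoose k) * (b gchoose (n - k)) * ((- 1) ^ n * (B ^\<^sub>m n) $$ (i, j)))"
  proof (rule sum.cong[OF refl])
   fix k assume "k \<in> {..n}"
   hence k: "k + (n - k) = n" by simp
   have "(B ^\<^sub>m n) $$ (i, j) = (\<Sum>l<d. (B ^\<^sub>m k) $$ (i, l) * (B ^\<^sub>m (n - k)) $$ (l, j))"
    using pow_mat_plus[OF B(1), of k "n - k"] mult_mat_entry[OF pow_mat_carrier[OF B(1)] pow_mat_carrier[OF B(1)] ij] k by simp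
   moreover have "(- 1 :: real) ^ n = (- 1) ^ k * (- 1) ^ (n - k)" using k by (metis power_add)
   ultimately show "(\<Sum>l<d. pterm a i l k * pterm b l j (n - k)) = (a gchoose k) * (b gchoose (n - k)) * ((- 1) ^ n * (B ^\<^sub>m n) $$ (i, j))"
    unfolding pterm_def by (simp add: sum_distrib_left mult_ac)
  qed
  also have "... = pterm (a + b) i j n"
   unfolding sum_distrib_right[symmetric] pterm_def
   using gbinomial_Vandermonde[of a b n] by (simp add: atLeast0AtMost mult_ac)
  finally show "(\<Sum>l<d. \<Sum>k\<le>n. pterm a i l k * pterm b l j (n - k)) = pterm (a + b) i j n" .
 qed
 finally show "(P a * P b) $$ (i, j) = P (a + b) $$ (i, j)" using ij by (simp add: P_def)
qed (auto simp: P_def)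

lemma P_1: assumes ij: "i < d" "j < d" shows "P 1 $$ (i, j) = (if i = j then 1 else 0) - B $$ (i, j)"
proof -
 have z: "pterm 1 i j k = 0" if "k \<notin> {0, 1}" for k
 proof -
  have "(1::real) gchoose k = of_nat (1 choose k)" by (metis binomial_gbinomial of_nat_1)
  also have "1 choose k = 0" using that by (intro binomial_eq_0) auto
  finally show ?thesis by (simp add: pterm_def)
 qed
 have "(\<Sum>k. pterm 1 i j k) = (\<Sum>k\<in>{0, 1}. pterm 1 i j k)" using z by (intro suminf_finite) auto
 also have "... = (if i = j then 1 else 0) - B $$ (i, j)" using B ij by (simp add: pterm_def)
 finally show ?thesis using ij by (simp add: P_def)
qed

lemma P_symmetric: "transpose_mat (P a) = P a"
proof (rule eq_matI)
 fix i j assume "i < dim_row (P a)" "j < dim_col (P a)"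
 hence ij: "i < d" "j < d" by (auto simp: P_def)
 have "(B ^\<^sub>m k) $$ (j, i) = (B ^\<^sub>m k) $$ (i, j)" for k
 proof -
  have "(B ^\<^sub>m k) $$ (j, i) = transpose_mat (B ^\<^sub>m k) $$ (i, j)" using pow_mat_carrier[OF B(1), of k] ij by (metis carrier_matD index_transpose_mat(1))
  thus ?thesis unfolding pow_mat_symmetric[OF B] .
 qed
 thus "transpose_mat (P a) $$ (i, j) = P a $$ (i, j)" using ij by (simp add: P_def pterm_def)
qed (auto simp: P_def)

end

text \<open>With D = R - S one has R D = A - R S = - D S, although R and S need not commute. Hence
  the trace of D^T R D, a sum over the columns of D, equals minus that of D S D^T, a sum over its
  rows, and both vanish. So R, and therefore A = R R, kills every column of D, and A is
  definite.\<close>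

lemma psd_sqrt_unique:
 fixes A R S :: "real mat"
 assumes A: "A \<in> carrier_mat d d" and pos: "!!u. u \<in> carrier_vec d ==> u ~= 0\<^sub>v d ==> 0 < u \<bullet> (A *\<^sub>v u)"
  and R: "psd R" "R * R = A" and S: "psd S" "S * S = A"
 shows "R = S"
proof -
 have cR: "R \<in> carrier_mat d d"
 proof -
  have "dim_row R = dim_row (R * R)" by simp
  hence "dim_row R = d" unfolding R(2) using A by simp
  thus ?thesis using R(1) unfolding psd_def by (auto intro!: carrier_matI)
 qed
 have cS: "S \<in> carrier_mat d d"
 proof -
  have "dim_row S = dim_row (S * S)" by simp
  hence "dim_row S = d" unfolding S(2) using A by simp
  thus ?thesis using S(1) unfolding psd_def by (auto intro!: carrier_matI)
 qed
 define D where "D = R - S"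
 have cD: "D \<in> carrier_mat d d" unfolding D_def using cS by (rule minus_carrier_mat)
 have RD: "R * D = A - R * S" "D * S = R * S - A"
  unfolding D_def using cR cS R S by (simp_all add: mult_minus_distrib_mat[of _ d d _ d] minus_mult_distrib_mat[of _ d d _ _ d])
 have RDe: "(R * D) $$ (j, i) = - ((D * S) $$ (j, i))" if "i < d" "j < d" for i j
  unfolding RD using that A cR cS by auto
 define w where "w = (%i. D *\<^sub>v unit_vec d i)"
 have w: "w i \<in> carrier_vec d" for i unfolding w_def using cD by simp
 have we: "w i $ j = D $$ (j, i)" if "i < d" "j < d" for i j
  unfolding w_def using mult_vec_sum[OF cD unit_vec_carrier that(2)] that
  by (simp add: unit_vec_def if_distrib sum.delta cong: if_cong)
 define r where "r = (%j. vec d (%k. D $$ (j, k)))"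
 have r: "r j \<in> carrier_vec d" for j unfolding r_def by simp
 have Rpsd: "0 <= x \<bullet> (R *\<^sub>v x)" if "x \<in> carrier_vec d" for x using R(1) that cR unfolding psd_def by auto
 have Spsd: "0 <= x \<bullet> (S *\<^sub>v x)" if "x \<in> carrier_vec d" for x using S(1) that cS unfolding psd_def by auto
 have "(\<Sum>i<d. w i \<bullet> (R *\<^sub>v w i)) = (\<Sum>i<d. \<Sum>j<d. D $$ (j, i) * (R * D) $$ (j, i))"
 proof (rule sum.cong[OF refl])
  fix i assume "i \<in> {..<d}"
  hence i: "i < d" by simp
  have "w i \<bullet> (R *\<^sub>v w i) = (\<Sum>j<d. w i $ j * (R *\<^sub>v w i) $ j)"
   using mult_vec_carrier[OF cR w] by (rule scalar_prod_sum)
  also have "... = (\<Sum>j<d. D $$ (j, i) * (R * D) $$ (j, i))"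
  proof (rule sum.cong[OF refl])
   fix j assume "j \<in> {..<d}"
   hence j: "j < d" by simp
   have "(R *\<^sub>v w i) $ j = (\<Sum>k<d. R $$ (j, k) * D $$ (k, i))"
    unfolding mult_vec_sum[OF cR w j] using we i by simp
   thus "w i $ j * (R *\<^sub>v w i) $ j = D $$ (j, i) * (R * D) $$ (j, i)"
    unfolding mult_mat_entry[OF cR cD j i] we[OF i j] by simp
  qed
  finally show "w i \<bullet> (R *\<^sub>v w i) = (\<Sum>j<d. D $$ (j, i) * (R * D) $$ (j, i))" .
 qed
 also have "... = (\<Sum>i<d. \<Sum>j<d. - (D $$ (j, i) * (D * S) $$ (j, i)))" using RDe by (intro sum.cong) auto
 also have "... = (\<Sum>j<d. \<Sum>i<d. - (D $$ (j, i) * (D * S) $$ (j, i)))" by (rule sum.swap)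
 also have "... = (\<Sum>j<d. - (r j \<bullet> (S *\<^sub>v r j)))"
 proof (rule sum.cong[OF refl])
  fix j assume "j \<in> {..<d}"
  hence j: "j < d" by simp
  have "r j \<bullet> (S *\<^sub>v r j) = (\<Sum>k<d. r j $ k * (S *\<^sub>v r j) $ k)"
   using mult_vec_carrier[OF cS r] by (rule scalar_prod_sum)
  also have "... = (\<Sum>k<d. \<Sum>i<d. D $$ (j, k) * (S $$ (k, i) * D $$ (j, i)))"
   using mult_vec_sum[OF cS r] by (intro sum.cong) (auto simp: r_def sum_distrib_left)
  also have "... = (\<Sum>i<d. \<Sum>k<d. D $$ (j, k) * (S $$ (k, i) * D $$ (j, i)))" by (rule sum.swap)
  also have "... = (\<Sum>i<d. D $$ (j, i) * (D * S) $$ (j, i))"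
   using mult_mat_entry[OF cD cS j] by (intro sum.cong) (auto simp: sum_distrib_left mult_ac)
  finally show "(\<Sum>i<d. - (D $$ (j, i) * (D * S) $$ (j, i))) = - (r j \<bullet> (S *\<^sub>v r j))" by (simp add: sum_negf)
 qed
 also have "... <= 0" using Spsd[OF r] by (intro sum_nonpos) auto
 finally have "(\<Sum>i<d. w i \<bullet> (R *\<^sub>v w i)) = 0" using Rpsd[OF w] by (intro antisym sum_nonneg) auto
 hence wR: "w i \<bullet> (R *\<^sub>v w i) = 0" if "i < d" for i
  using that Rpsd[OF w] by (subst (asm) sum_nonneg_eq_0_iff) auto
 have w0: "w i = 0\<^sub>v d" if i: "i < d" for i
 proof (rule ccontr)
  assume ne: "w i ~= 0\<^sub>v d"
  have Rw: "R *\<^sub>v w i \<in> carrier_vec d" using cR w by simp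
  have "(R *\<^sub>v w i) \<bullet> (R *\<^sub>v w i) <= entry_bound R * (w i \<bullet> (R *\<^sub>v w i))"
   using form_bound[OF cR] R(1)
   by (intro psd_norm_bound[OF cR _ Rpsd entry_bound_pos _ w]) (auto simp: psd_def abs_le_iff)
  hence "(R *\<^sub>v w i) \<bullet> (R *\<^sub>v w i) = 0" using wR[OF i] scalar_prod_self_ge_0[of "R *\<^sub>v w i"] by simp
  hence z: "R *\<^sub>v w i = 0\<^sub>v d" using scalar_prod_self_eq_0[OF Rw] by simp
  have "w i \<bullet> (A *\<^sub>v w i) = w i \<bullet> (R *\<^sub>v (R *\<^sub>v w i))"
   unfolding R(2)[symmetric] using cR w by (simp add: assoc_mult_mat_vec[of _ d d _ d])
  also have "... = (R *\<^sub>v w i) \<bullet> (R *\<^sub>v w i)"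
   using self_adjoint[OF cR _ w Rw] R(1) by (simp add: psd_def)
  also have "... = 0" unfolding z by simp
  finally show False using pos[OF w ne] by simp
 qed
 have "D $$ (j, i) = 0" if "i < d" "j < d" for i j using we[OF that] w0[OF that(1)] that by simp
 thus "R = S" using cR cS unfolding D_def by (intro eq_matI) auto
qed

text \<open>Writing A = c * (1 - B) with c above the size of A makes B a strict contraction, and
  sqrt c * (1 - B)^(1/2) is a root. It is positive semidefinite because (1 - B)^(1/2) is itself the
  square of the symmetric matrix (1 - B)^(1/4).\<close>

lemma psd_sqrt_exists:
 fixes A :: "real mat"
 assumes A: "A \<in> carrier_mat d d" "transpose_mat A = A" and \<alpha>: "0 < \<alpha>"
  and low: "!!u. u \<in> carrier_vec d ==> \<alpha> * (u \<bullet> u) <= u \<bullet> (A *\<^sub>v u)"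
 obtains R where "R \<in> carrier_mat d d" "psd R" "R * R = A"
proof -
 \<comment> \<open>Adding 2 * \<alpha> guarantees \<alpha> / c <= 1/2, so that the contraction
   factor 1 - \<alpha> / c lies strictly between 0 and 1.\<close>
 define c where "c = entry_bound A + 2 * \<alpha>"
 have c: "0 < c" "2 * \<alpha> <= c" unfolding c_def using entry_bound_pos[of A] \<alpha> by auto
 define B where "B = 1\<^sub>m d - (1 / c) \<cdot>\<^sub>m A"
 have cB: "B \<in> carrier_mat d d" unfolding B_def using A by auto
 have Bu: "B *\<^sub>v u = u - (1 / c) \<cdot>\<^sub>v (A *\<^sub>v u)" if u: "u \<in> carrier_vec d" for u
 proof -
  have "B *\<^sub>v u = 1\<^sub>m d *\<^sub>v u - ((1 / c) \<cdot>\<^sub>m A) *\<^sub>v u"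
   unfolding B_def using A u by (intro minus_mult_distrib_mat_vec) auto
  moreover have "((1 / c) \<cdot>\<^sub>m A) *\<^sub>v u = (1 / c) \<cdot>\<^sub>v (A *\<^sub>v u)"
   using A u by (intro eq_vecI) (auto simp: scalar_prod_smult_left)
  ultimately show ?thesis using u by simp
 qed
 have Bf: "u \<bullet> (B *\<^sub>v u) = u \<bullet> u - (u \<bullet> (A *\<^sub>v u)) / c" if u: "u \<in> carrier_vec d" for u
  unfolding Bu[OF u] using u A by (simp add: scalar_prod_minus_distrib[of _ d])
 interpret contraction_mat d B "1 - \<alpha> / c"
 proof
  show "B \<in> carrier_mat d d" by fact
  show "transpose_mat B = B"
  proof (rule eq_matI)
   fix i j assume "i < dim_row B" "j < dim_col B"
   hence ij: "i < d" "j < d" using cB by auto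
   have "A $$ (j, i) = transpose_mat A $$ (i, j)" using A(1) ij by simp
   hence "A $$ (j, i) = A $$ (i, j)" unfolding A(2) .
   thus "transpose_mat B $$ (i, j) = B $$ (i, j)" using ij A(1) unfolding B_def by auto
  qed (use cB in auto)
  have "\<alpha> / c <= 1/2" using c by (simp add: field_simps)
  thus "0 < 1 - \<alpha> / c" by linarith
  show "1 - \<alpha> / c < 1" using \<alpha> c by simp
  fix u :: "real vec" assume u: "u \<in> carrier_vec d"
  have "u \<bullet> (A *\<^sub>v u) <= entry_bound A * (u \<bullet> u)" using form_bound[OF A(1) u] by (simp add: abs_le_iff)
  also have "... <= c * (u \<bullet> u)" unfolding c_def using \<alpha> scalar_prod_self_ge_0 by (intro mult_right_mono) auto
  finally have "(u \<bullet> (A *\<^sub>v u)) / c <= u \<bullet> u" using c by (simp add: divide_le_eq mult.commute)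
  thus "0 <= u \<bullet> (B *\<^sub>v u)" unfolding Bf[OF u] by simp
  have "\<alpha> * (u \<bullet> u) / c <= (u \<bullet> (A *\<^sub>v u)) / c" using low[OF u] c by (intro divide_right_mono) auto
  thus "u \<bullet> (B *\<^sub>v u) <= (1 - \<alpha> / c) * (u \<bullet> u)" unfolding Bf[OF u] by (simp add: algebra_simps)
 qed
 define R where "R = sqrt c \<cdot>\<^sub>m P (1/2)"
 have cR: "R \<in> carrier_mat d d" unfolding R_def using P_carrier by simp
 have "R * R = c \<cdot>\<^sub>m (P (1/2) * P (1/2))"
 proof (rule eq_matI)
  fix i j assume "i < dim_row (c \<cdot>\<^sub>m (P (1/2) * P (1/2)))" "j < dim_col (c \<cdot>\<^sub>m (P (1/2) * P (1/2)))"
  hence ij: "i < d" "j < d" using P_carrier[of "1/2"] by auto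
  have "(R * R) $$ (i, j) = (\<Sum>l<d. (sqrt c * P (1/2) $$ (i, l)) * (sqrt c * P (1/2) $$ (l, j)))"
   unfolding mult_mat_entry[OF cR cR ij] unfolding R_def using P_carrier[of "1/2"] ij by simp
  also have "... = (sqrt c * sqrt c) * (\<Sum>l<d. P (1/2) $$ (i, l) * P (1/2) $$ (l, j))"
   unfolding sum_distrib_left by (intro sum.cong refl) (simp only: mult_ac)
  finally show "(R * R) $$ (i, j) = (c \<cdot>\<^sub>m (P (1/2) * P (1/2))) $$ (i, j)"
   using ij P_carrier[of "1/2"] c by (simp add: mult_mat_entry[OF P_carrier P_carrier ij] del: index_mult_mat(1))
 qed (use cR P_carrier[of "1/2"] in auto)
 also have "P (1/2) * P (1/2) = P 1" using P_mult[of "1/2" "1/2"] by simp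
 also have "c \<cdot>\<^sub>m P 1 = A"
  using P_1 A c P_carrier[of 1] unfolding B_def by (intro eq_matI) (auto simp: field_simps)
 finally have RR: "R * R = A" .
 have "psd R" unfolding psd_def
 proof (intro conjI ballI)
  show "square_mat R" using cR by auto
  show "transpose_mat R = R"
  proof (rule eq_matI)
   fix i j assume "i < dim_row R" "j < dim_col R"
   hence ij: "i < d" "j < d" using cR by auto
   have "P (1/2) $$ (j, i) = transpose_mat (P (1/2)) $$ (i, j)" using P_carrier[of "1/2"] ij by simp
   hence "P (1/2) $$ (j, i) = P (1/2) $$ (i, j)" unfolding P_symmetric .
   thus "transpose_mat R $$ (i, j) = R $$ (i, j)" unfolding R_def using P_carrier[of "1/2"] ij by auto
  qed (use cR in auto)
  fix v :: "real vec" assume "v \<in> carrier_vec (dim_row R)"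
  hence v: "v \<in> carrier_vec d" using cR by simp
  have S: "P (1/4) \<in> carrier_mat d d" "P (1/4) * P (1/4) = P (1/2)"
   using P_carrier P_mult[of "1/4" "1/4"] by auto
  have Sv: "P (1/4) *\<^sub>v v \<in> carrier_vec d" using S v by simp
  have "R *\<^sub>v v = sqrt c \<cdot>\<^sub>v (P (1/2) *\<^sub>v v)"
   unfolding R_def using P_carrier[of "1/2"] v by (intro eq_vecI) (auto simp: scalar_prod_smult_left)
  also have "P (1/2) *\<^sub>v v = P (1/4) *\<^sub>v (P (1/4) *\<^sub>v v)"
   unfolding S(2)[symmetric] using S(1) v by (intro assoc_mult_mat_vec) auto
  finally have "v \<bullet> (R *\<^sub>v v) = sqrt c * (v \<bullet> (P (1/4) *\<^sub>v (P (1/4) *\<^sub>v v)))"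
   using v S by (simp add: scalar_prod_smult_distrib[of _ d])
  also have "v \<bullet> (P (1/4) *\<^sub>v (P (1/4) *\<^sub>v v)) = (P (1/4) *\<^sub>v v) \<bullet> (P (1/4) *\<^sub>v v)"
   using self_adjoint[OF S(1) P_symmetric v Sv] by simp
  finally show "0 <= v \<bullet> (R *\<^sub>v v)" using scalar_prod_self_ge_0 c by simp
 qed
 thus ?thesis using that cR RR by blast
qed

lemma msqrt_posdef:
 fixes A :: "real mat"
 assumes A: "A \<in> carrier_mat d d" "transpose_mat A = A" and \<alpha>: "0 < \<alpha>"
  and low: "!!u. u \<in> carrier_vec d ==> \<alpha> * (u \<bullet> u) <= u \<bullet> (A *\<^sub>v u)"
 shows "msqrt A \<in> carrier_mat d d" "psd (msqrt A)" "msqrt A * msqrt A = A"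
proof -
 obtain R where R: "R \<in> carrier_mat d d" "psd R" "R * R = A" using psd_sqrt_exists[OF A \<alpha> low] .
 have pos: "0 < u \<bullet> (A *\<^sub>v u)" if u: "u \<in> carrier_vec d" "u ~= 0\<^sub>v d" for u
 proof -
  have "u \<bullet> u ~= 0" using scalar_prod_self_eq_0[OF u(1)] u(2) by auto
  hence "0 < \<alpha> * (u \<bullet> u)" using scalar_prod_self_ge_0[of u] \<alpha> by simp
  thus ?thesis using low[OF u(1)] by linarith
 qed
 have "msqrt A = R" unfolding msqrt_def
  using R psd_sqrt_unique[OF A(1) pos] by (intro the_equality) auto
 thus "msqrt A \<in> carrier_mat d d" "psd (msqrt A)" "msqrt A * msqrt A = A" using R by auto
qed

subsection \<open>Uniform lower deviations\<close>

definition mx :: "'u set => ('u => real) => real" where "mx T f = Max (f ` T)"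

lemma mx_ge: "finite T ==> u \<in> T ==> f u <= mx T f"
 by (simp add: mx_def)

lemma mx_le: "finite T ==> T ~= {} ==> (!!u. u \<in> T ==> f u <= c) ==> mx T f <= c"
 by (simp add: mx_def)

lemma mx_attained: assumes "finite T" "T ~= {}" obtains u where "u \<in> T" "mx T f = f u"
proof -
 have "mx T f \<in> f ` T" unfolding mx_def using assms by (intro Max_in) auto
 thus ?thesis using that by auto
qed

lemma bm_mx: assumes "finite T" "T ~= {}" "!!u. u \<in> T ==> bm M (f u)"
 shows "bm M (%x. mx T (%u. f u x))"
 using assms
proof (induction T rule: finite_ne_induct)
 case (singleton u)
 thus ?case by (simp add: mx_def)
next
 case (insert u T)
 have "mx (insert u T) (%u. f u x) = max (f u x) (mx T (%u. f u x))" for x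
  using insert by (simp add: mx_def)
 thus ?case using insert by (auto intro!: bm_max)
qed

text \<open>Attaching a fair sign to each observation turns symmetrised sums into ordinary i.i.d.
  sums over another law, to which the same moment lemmas apply.\<close>

definition coin_space :: "'b measure => ('b \<times> bool) measure" where
 "coin_space N = N \<Otimes>\<^sub>M uniform_count_measure UNIV"

definition signed :: "('b => real) => 'b \<times> bool => real" where
 "signed f p = (if snd p then f (fst p) else - f (fst p))"

context iid
begin

lemma iid_coin_space: "iid (coin_space N)"
proof -
 interpret U: prob_space "uniform_count_measure (UNIV :: bool set)"
  by (rule prob_space_uniform_count_measure) auto
 interpret P: pair_prob_space N "uniform_count_measure (UNIV :: bool set)" ..
 show ?thesis unfolding coin_space_def iid_def by (rule P.prob_space_axioms)
qed

lemma coin_measurable: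
 assumes "(%y. f (y, True)) \<in> borel_measurable N" "(%y. f (y, False)) \<in> borel_measurable N"
 shows "(f :: 'b \<times> bool => real) \<in> borel_measurable (coin_space N)"
proof -
 have s: "snd \<in> coin_space N \<rightarrow>\<^sub>M count_space UNIV"
 proof -
  have "coin_space N \<rightarrow>\<^sub>M uniform_count_measure UNIV = coin_space N \<rightarrow>\<^sub>M count_space (UNIV :: bool set)"
   by (intro measurable_cong_sets) (auto simp: sets_uniform_count_measure)
  thus ?thesis unfolding coin_space_def using measurable_snd[of N "uniform_count_measure (UNIV :: bool set)"] by simp
 qed
 have f: "fst \<in> coin_space N \<rightarrow>\<^sub>M N" unfolding coin_space_def by simp
 have "(%p. if snd p then f (fst p, True) else f (fst p, False)) \<in> borel_measurable (coin_space N)"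
  using measurable_compose[OF f assms(1)] measurable_compose[OF f assms(2)] s
  by (intro measurable_If) (auto simp: pred_def[symmetric])
 also have "(%p. if snd p then f (fst p, True) else f (fst p, False)) = f"
  by (auto simp: fun_eq_iff)
 finally show ?thesis .
qed

lemma bm_signed: assumes "bm N f" shows "bm (coin_space N) (signed f)"
proof -
 obtain K where K: "!!x. abs (f x) <= K" using assms by (metis bm_bound)
 show ?thesis using K assms
  by (intro bmI[of _ _ K] coin_measurable) (auto simp: signed_def bm_def)
qed

lemma integral_coin:
 assumes "bm (coin_space N) f"
 shows "(LINT p|coin_space N. f p) = (LINT y|N. (f (y, True) + f (y, False)) / 2)"
proof -
 interpret U: prob_space "uniform_count_measure (UNIV :: bool set)"
  by (rule prob_space_uniform_count_measure) auto
 interpret P: pair_prob_space N "uniform_count_measure (UNIV :: bool set)" ..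
 have "integrable (N \<Otimes>\<^sub>M uniform_count_measure UNIV) f"
  using assms unfolding coin_space_def by (rule P.bm_integrable)
 hence "(LINT p|coin_space N. f p) = (LINT y|N. (LINT b|uniform_count_measure UNIV. f (y, b)))"
  unfolding coin_space_def using P.integral_fst'[of f] by simp
 moreover have "(LINT b|uniform_count_measure UNIV. f (y, b)) = (f (y, True) + f (y, False)) / 2" for y
  by (subst integral_uniform_count_measure) (auto simp: UNIV_bool)
 ultimately show ?thesis by simp
qed

text \<open>Symmetrisation and contraction for a single coordinate. The centring constant is
  replaced by an independent copy y', pulled out of the maximum, and y and y' are averaged over
  their exchange. Pairing the maximisers for the two orders turns differences of c into differences
  at a common argument, where the Lipschitz bound applies.\<close>

lemma contraction_step:
 assumes T: "finite T" "T ~= {}" and g: "!!u. u \<in> T ==> bm N (g u)"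
  and c: "c \<in> borel_measurable borel" "!!a. abs (c a) <= K" "!!a b. abs (c a - c b) <= L * abs (a - b)"
 shows "(LINT y|N. mx T (%u. G u + ((LINT y'|N. c (g u y')) - c (g u y))))
  <= (LINT p|coin_space N. mx T (%u. G u + 2 * L * signed (g u) p))"
proof -
 interpret P: pair_prob_space N N ..
 interpret C: iid "coin_space N" by (rule iid_coin_space)
 have b\<phi>: "bm M (%x. c (f x))" if "f \<in> borel_measurable M" for M :: "'x measure" and f
  using c(1,2) that by (rule bm_comp)
 define m where "m = (%y' y. mx T (%u. G u + (c (g u y') - c (g u y))))"
 have bpair: "bm (N \<Otimes>\<^sub>M N) (%(y', y). m y' y)"
  unfolding m_def split_beta'
  using g[THEN bm_measurable] by (intro bm_mx T bm_add bm_diff bm_const b\<phi>) auto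
 have i1: "integrable (N \<Otimes>\<^sub>M N) (%(y', y). m y' y)" using bpair by (rule P.bm_integrable)
 have bm1: "bm N (%y'. m y' y)" for y
  unfolding m_def using g[THEN bm_measurable] by (intro bm_mx T bm_add bm_diff bm_const b\<phi>) auto
 have bm2: "bm N (%y. m y' y)" for y'
  unfolding m_def using g[THEN bm_measurable] by (intro bm_mx T bm_add bm_diff bm_const b\<phi>) auto
 have i2: "integrable N (%y. \<integral>y'. m y' y \<partial>N)" using P.integrable_snd[OF i1] by simp
 have i3: "integrable N (%y'. \<integral>y. m y' y \<partial>N)" using P.integrable_fst[OF i1] by simp
 define h where "h = (%y. mx T (%u. G u + 2 * L * g u y) + mx T (%u. G u - 2 * L * g u y))"
 have bh: "bm N h" unfolding h_def using g by (intro bm_add bm_mx T bm_diff bm_mult bm_const)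
 have mh: "m y' y + m y y' <= (h y + h y') / 2" for y y'
 proof -
  obtain u where u: "u \<in> T" "m y' y = G u + (c (g u y') - c (g u y))" unfolding m_def by (rule mx_attained[OF T])
  obtain w where w: "w \<in> T" "m y y' = G w + (c (g w y) - c (g w y'))" unfolding m_def by (rule mx_attained[OF T])
  \<comment> \<open>The two maxima in h carry opposite signs, so the larger of g u t and g w t can
    always be given the plus sign.\<close>
  have A: "G u + G w + 2 * (L * abs (g u t - g w t)) <= h t" for t
  proof (cases "g w t <= g u t")
   case True
   have "G u + 2 * L * g u t <= mx T (%u. G u + 2 * L * g u t)" "G w - 2 * L * g w t <= mx T (%u. G u - 2 * L * g u t)"
    using mx_ge[OF T(1) u(1), of "%u. G u + 2 * L * g u t"] mx_ge[OF T(1) w(1), of "%u. G u - 2 * L * g u t"] by auto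
   thus ?thesis unfolding h_def using True by (simp add: algebra_simps)
  next
   case False
   have "G w + 2 * L * g w t <= mx T (%u. G u + 2 * L * g u t)" "G u - 2 * L * g u t <= mx T (%u. G u - 2 * L * g u t)"
    using mx_ge[OF T(1) w(1), of "%u. G u + 2 * L * g u t"] mx_ge[OF T(1) u(1), of "%u. G u - 2 * L * g u t"] by auto
   thus ?thesis unfolding h_def using False by (simp add: algebra_simps)
  qed
  define a1 a2 where "a1 = L * abs (g u y - g w y)" and "a2 = L * abs (g u y' - g w y')"
  have "c (g u y') - c (g w y') <= a2" "c (g w y) - c (g u y) <= a1"
   using c(3)[of "g u y'" "g w y'"] c(3)[of "g u y" "g w y"] unfolding a1_def a2_def by (simp_all only: abs_le_iff minus_diff_eq)
  moreover have "G u + G w + 2 * a1 <= h y" "G u + G w + 2 * a2 <= h y'"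
   using A[of y] A[of y'] unfolding a1_def a2_def by simp_all
  ultimately show ?thesis unfolding u(2) w(2) by simp
 qed
 have "(LINT y|N. mx T (%u. G u + ((LINT y'|N. c (g u y')) - c (g u y)))) <= (LINT y|N. (LINT y'|N. m y' y))"
 proof (intro integral_mono i2)
  show "integrable N (%y. mx T (%u. G u + ((LINT y'|N. c (g u y')) - c (g u y))))"
   using g[THEN bm_measurable] by (intro int_N bm_mx T bm_add bm_diff bm_const b\<phi>) auto
  fix y
  show "mx T (%u. G u + ((LINT y'|N. c (g u y')) - c (g u y))) <= (LINT y'|N. m y' y)"
  proof (intro mx_le T)
   fix u assume u: "u \<in> T"
   have bu: "bm N (%y'. c (g u y'))" using g[OF u] by (intro b\<phi>) (auto simp: bm_def)
   have "G u + ((LINT y'|N. c (g u y')) - c (g u y)) = (LINT y'|N. G u + (c (g u y') - c (g u y)))"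
    using int_N[OF bu] prob_space by simp
   also have "... <= (LINT y'|N. m y' y)"
    using bu by (intro integral_mono int_N bm1 bm_add bm_diff bm_const) (auto simp: m_def intro!: mx_ge T u)
   finally show "G u + ((LINT y'|N. c (g u y')) - c (g u y)) <= (LINT y'|N. m y' y)" .
  qed
 qed
 also have "(LINT y|N. (LINT y'|N. m y' y)) = ((LINT y|N. (LINT y'|N. m y' y)) + (LINT y|N. (LINT y'|N. m y y'))) / 2"
  using P.Fubini_integral[OF i1] by simp
 also have "... = (LINT y|N. (LINT y'|N. m y' y + m y y')) / 2"
  using i2 i3 int_N[OF bm1] int_N[OF bm2] by simp
 also have "... <= (LINT y|N. (LINT y'|N. (h y + h y') / 2)) / 2"
 proof (intro divide_right_mono integral_mono)
  show "integrable N (%y. \<integral>y'. m y' y + m y y' \<partial>N)" using i2 i3 int_N[OF bm1] int_N[OF bm2] by simp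
  have "(LINT y'|N. (h y + h y') / 2) = (h y + integral\<^sup>L N h) / 2" for y using int_N[OF bh] prob_space by simp
  thus "integrable N (%y. \<integral>y'. (h y + h y') / 2 \<partial>N)" using int_N[OF bh] by simp
  show "integrable N (%y'. m y' y + m y y')" for y using int_N[OF bm1] int_N[OF bm2] by simp
  show "integrable N (%y'. (h y + h y') / 2)" for y using int_N[OF bh] by simp
 qed (use mh in auto)
 also have "... = (LINT y|N. h y / 2)" using int_N[OF bh] prob_space by (simp add: field_simps)
 also have "... = (LINT p|coin_space N. mx T (%u. G u + 2 * L * signed (g u) p))"
 proof (subst integral_coin)
  show "bm (coin_space N) (%p. mx T (%u. G u + 2 * L * signed (g u) p))"
   by (intro bm_mx T bm_add bm_mult bm_const bm_signed g)
 qed (simp add: signed_def h_def)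
 finally show ?thesis .
qed

text \<open>One coordinate is exchanged at a time; the part already signed joins the offset G, which
  is why the induction must be uniform in G.\<close>

lemma symmetrisation_contraction:
 assumes T: "finite T" "T ~= {}" and g: "!!u. u \<in> T ==> bm N (g u)"
  and c: "c \<in> borel_measurable borel" "!!a. abs (c a) <= K" "!!a b. abs (c a - c b) <= L * abs (a - b)"
  and J: "finite J"
 defines "a \<equiv> %u y. (LINT y'|N. c (g u y')) - c (g u y)"
 shows "(LINT w|PI J. mx T (%u. G u + SS (a u) J w))
  <= (LINT w|PiM J (%_. coin_space N). mx T (%u. G u + 2 * L * SS (signed (g u)) J w))"
 using J
proof (induction J arbitrary: G)
 case empty
 interpret C: iid "coin_space N" by (rule iid_coin_space)
 have "prob_space (PI {})" "prob_space (C.PI {})" using prob_space_PI C.prob_space_PI by auto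
 thus ?case by (simp add: prob_space.prob_space)
next
 case (insert i J)
 interpret C: iid "coin_space N" by (rule iid_coin_space)
 interpret A: prob_space "PI J" by (rule prob_space_PI)
 interpret PC: pair_prob_space "PI J" "coin_space N" ..
 have ba: "bm N (a u)" if "u \<in> T" for u
  unfolding a_def using c(1,2) bm_measurable[OF g[OF that]] by (intro bm_diff bm_const bm_comp)
 have bs: "bm (coin_space N) (signed (g u))" if "u \<in> T" for u using bm_signed g[OF that] .
 let ?f = "%x p. mx T (%u. (G u + SS (a u) J x) + 2 * L * signed (g u) p)"
 have bpair: "bm (PI J \<Otimes>\<^sub>M coin_space N) (%(x, p). ?f x p)"
 proof -
  have 1: "bm (PI J \<Otimes>\<^sub>M coin_space N) (%z. SS (a u) J (fst z))" if "u \<in> T" for u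
  proof -
   have b: "bm (PI J) (SS (a u) J)" using ba[OF that] by (intro bm_SS) auto
   then obtain K where "!!x. abs (SS (a u) J x) <= K" by (metis bm_bound)
   thus ?thesis using bm_measurable[OF b] by (intro bmI[of _ _ K]) auto
  qed
  have 2: "bm (PI J \<Otimes>\<^sub>M coin_space N) (%z. signed (g u) (snd z))" if "u \<in> T" for u
  proof -
   from bs[OF that] obtain K where "!!x. abs (signed (g u) x) <= K" by (metis bm_bound)
   thus ?thesis using bm_measurable[OF bs[OF that]] by (intro bmI[of _ _ K]) auto
  qed
  show ?thesis unfolding split_beta' using 1 2 by (intro bm_mx T bm_add bm_mult bm_const)
 qed
 have ip: "integrable (PI J \<Otimes>\<^sub>M coin_space N) (%(x, p). ?f x p)" using bpair by (rule PC.bm_integrable)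
 have "(LINT w|PI (insert i J). mx T (%u. G u + SS (a u) (insert i J) w))
   = (LINT x|PI J. (LINT y|N. mx T (%u. G u + SS (a u) (insert i J) (x(i := y)))))"
  using ba T insert by (intro psf.product_integral_insert int_PI bm_mx bm_add bm_const bm_SS) auto
 also have "... = (LINT x|PI J. (LINT y|N. mx T (%u. (G u + SS (a u) J x) + a u y)))"
  using insert by (simp add: SS_insert SS_upd add.assoc)
 also have "... <= (LINT x|PI J. (LINT p|coin_space N. ?f x p))"
 proof (rule integral_mono)
  have "integrable (PI (insert i J)) (%w. mx T (%u. G u + SS (a u) (insert i J) w))"
   using ba T by (intro int_PI bm_mx bm_add bm_const bm_SS) auto
  interpret PN: pair_prob_space "PI J" N ..
  have "bm (PI J \<Otimes>\<^sub>M N) (%(x, y). mx T (%u. (G u + SS (a u) J x) + a u y))"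
  proof -
   have 1: "bm (PI J \<Otimes>\<^sub>M N) (%z. SS (a u) J (fst z))" if "u \<in> T" for u
   proof -
    have b: "bm (PI J) (SS (a u) J)" using ba[OF that] by (intro bm_SS) auto
    then obtain K where "!!x. abs (SS (a u) J x) <= K" by (metis bm_bound)
    thus ?thesis using bm_measurable[OF b] by (intro bmI[of _ _ K]) auto
   qed
   have 2: "bm (PI J \<Otimes>\<^sub>M N) (%z. a u (snd z))" if "u \<in> T" for u
   proof -
    from ba[OF that] obtain K where "!!x. abs (a u x) <= K" by (metis bm_bound)
    thus ?thesis using bm_measurable[OF ba[OF that]] by (intro bmI[of _ _ K]) auto
   qed
   show ?thesis unfolding split_beta' using 1 2 by (intro bm_mx T bm_add bm_const)
  qed
  hence "integrable (PI J \<Otimes>\<^sub>M N) (%(x, y). mx T (%u. (G u + SS (a u) J x) + a u y))" by (rule PN.bm_integrable)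
  thus "integrable (PI J) (%x. \<integral>y. mx T (%u. (G u + SS (a u) J x) + a u y) \<partial>N)"
   using PN.integrable_fst by fastforce
  show "integrable (PI J) (%x. \<integral>p. ?f x p \<partial>coin_space N)" using PC.integrable_fst[OF ip] by simp
  show "(LINT y|N. mx T (%u. (G u + SS (a u) J x) + a u y)) <= (LINT p|coin_space N. ?f x p)" for x
   unfolding a_def by (rule contraction_step[OF T g c])
 qed
 also have "... = (LINT p|coin_space N. (LINT x|PI J. ?f x p))" using PC.Fubini_integral[OF ip] by simp
 also have "... <= (LINT p|coin_space N. (LINT x|C.PI J. mx T (%u. (G u + 2 * L * signed (g u) p) + 2 * L * SS (signed (g u)) J x)))"
 proof (rule integral_mono)
  show "integrable (coin_space N) (%p. \<integral>x. ?f x p \<partial>PI J)" using PC.integrable_snd[OF ip] by simp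
  interpret CA: prob_space "C.PI J" by (rule C.prob_space_PI)
  interpret PP: pair_prob_space "C.PI J" "coin_space N" ..
  have "bm (C.PI J \<Otimes>\<^sub>M coin_space N) (%(x, p). mx T (%u. (G u + 2 * L * signed (g u) p) + 2 * L * SS (signed (g u)) J x))"
  proof -
   have 1: "bm (C.PI J \<Otimes>\<^sub>M coin_space N) (%z. SS (signed (g u)) J (fst z))" if "u \<in> T" for u
   proof -
    have b: "bm (C.PI J) (SS (signed (g u)) J)" using bs[OF that] by (intro C.bm_SS) auto
    then obtain K where "!!x. abs (SS (signed (g u)) J x) <= K" by (metis bm_bound)
    thus ?thesis using bm_measurable[OF b] by (intro bmI[of _ _ K]) auto
   qed
   have 2: "bm (C.PI J \<Otimes>\<^sub>M coin_space N) (%z. signed (g u) (snd z))" if "u \<in> T" for u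
   proof -
    from bs[OF that] obtain K where "!!x. abs (signed (g u) x) <= K" by (metis bm_bound)
    thus ?thesis using bm_measurable[OF bs[OF that]] by (intro bmI[of _ _ K]) auto
   qed
   show ?thesis unfolding split_beta' using 1 2 by (intro bm_mx T bm_add bm_mult bm_const)
  qed
  hence "integrable (C.PI J \<Otimes>\<^sub>M coin_space N) (%(x, p). mx T (%u. (G u + 2 * L * signed (g u) p) + 2 * L * SS (signed (g u)) J x))"
   by (rule PP.bm_integrable)
  thus "integrable (coin_space N) (%p. \<integral>x. mx T (%u. (G u + 2 * L * signed (g u) p) + 2 * L * SS (signed (g u)) J x) \<partial>C.PI J)"
   using PP.integrable_snd by fastforce
  fix p
  have "(LINT x|PI J. ?f x p) = (LINT x|PI J. mx T (%u. (G u + 2 * L * signed (g u) p) + SS (a u) J x))"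
   by (simp add: add_ac)
  also have "... <= (LINT x|C.PI J. mx T (%u. (G u + 2 * L * signed (g u) p) + 2 * L * SS (signed (g u)) J x))"
   by (rule insert.IH)
  finally show "(LINT x|PI J. ?f x p) <= ..." .
 qed
 also have "... = (LINT p|coin_space N. (LINT x|C.PI J. mx T (%u. G u + 2 * L * SS (signed (g u)) (insert i J) (x(i := p)))))"
  using insert by (simp add: SS_insert SS_upd algebra_simps)
 also have "... = (LINT w|C.PI (insert i J). mx T (%u. G u + 2 * L * SS (signed (g u)) (insert i J) w))"
  using bs T insert by (intro C.PI_insert_rev[symmetric] bm_mx bm_add bm_mult bm_const C.bm_SS) auto
 finally show ?case .
qed

text \<open>Contraction strips off f and leaves a class of linear functionals, whose supremum is at
  most W * sqrt Z by Cauchy-Schwarz with E Z = n * trace. The bound does not see the cardinality of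
  T. The zero functional u0 makes the maximal deviation nonnegative, so that Markov's inequality
  applies.\<close>

lemma uniform_lower_deviation:
 fixes cf :: "'u => nat => real" and c :: "nat => 'b => real" and D :: "nat set"
 assumes T: "finite T" and T0: "u0 \<in> T" "!!j. j \<in> D ==> cf u0 j = 0" and D: "finite D"
  and c: "!!j. j \<in> D ==> bm N (c j)"
  and f: "f \<in> borel_measurable borel" "!!a. abs (f a) <= K" "!!a b. abs (f a - f b) <= L * abs (a - b)" "f 0 = 0"
  and J: "finite J" "J ~= {}" and t: "0 < t" and W: "0 <= W" "!!u. u \<in> T ==> (\<Sum>j\<in>D. (cf u j)^2) <= W^2" and L: "0 <= L"
 defines "g \<equiv> %u y. \<Sum>j\<in>D. cf u j * c j y"
 shows "\<P>(w in PI J. \<exists>u\<in>T. SS (%y. f (g u y)) J w <= card J * ((LINT y|N. f (g u y)) - t))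
  <= 2 * L * W * sqrt ((\<Sum>j\<in>D. \<integral>y. (c j y)^2 \<partial>N) / card J) / t"
proof -
 interpret A: prob_space "PI J" by (rule prob_space_PI)
 interpret C: iid "coin_space N" by (rule iid_coin_space)
 interpret CA: prob_space "C.PI J" by (rule C.prob_space_PI)
 define n where "n = real (card J)"
 have n: "0 < n" using J by (simp add: n_def card_gt_0_iff)
 define Tr where "Tr = (\<Sum>j\<in>D. \<integral>y. (c j y)^2 \<partial>N)"
 have Tr0: "0 <= Tr" unfolding Tr_def by (intro sum_nonneg) auto
 define a where "a = (%u y. (LINT y'|N. f (g u y')) - f (g u y))"
 have Tne: "T ~= {}" using T0 by auto
 have bg: "bm N (g u)" for u unfolding g_def using c by (intro bm_sum bm_mult bm_const)
 have b\<phi>: "bm N (%y. f (g u y))" for u using f(1,2) bm_measurable[OF bg] by (rule bm_comp)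
 have ba: "bm N (a u)" for u unfolding a_def using b\<phi> by (intro bm_diff bm_const)
 have a0: "a u0 y = 0" for y
 proof -
  have "g u0 y = 0" for y unfolding g_def using T0(2) by simp
  thus ?thesis unfolding a_def using f(4) by simp
 qed
 define m where "m = (%w. mx T (%u. 0 + SS (a u) J w))"
 have bmm: "bm (PI J) m" unfolding m_def using ba by (intro bm_mx T Tne bm_add bm_const bm_SS order_refl)
 have m0: "0 <= m w" for w
  using mx_ge[OF T T0(1), of "%u. 0 + SS (a u) J w"] unfolding m_def by (simp add: SS_def a0)
 have bcs: "bm (coin_space N) (signed (c j))" if "j \<in> D" for j using bm_signed c[OF that] .
 define Z where "Z = (%w. \<Sum>j\<in>D. (SS (signed (c j)) J w)^2)"
 have bZ: "bm (C.PI J) Z" unfolding Z_def using bcs by (intro bm_sum bm_power C.bm_SS order_refl)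
 have Z0: "0 <= Z w" for w unfolding Z_def by (intro sum_nonneg) auto
 have EZ: "(LINT w|C.PI J. Z w) = n * Tr"
 proof -
  have "(LINT w|C.PI J. Z w) = (\<Sum>j\<in>D. \<integral>w. (SS (signed (c j)) J w)^2 \<partial>C.PI J)"
   unfolding Z_def using bcs by (intro Bintegral_sum C.int_PI bm_power C.bm_SS order_refl)
  also have "... = (\<Sum>j\<in>D. n * (LINT y|N. (c j y)^2))"
  proof (rule sum.cong[OF refl])
   fix j assume j: "j \<in> D"
   have "integral\<^sup>L (coin_space N) (signed (c j)) = 0"
    by (subst integral_coin[OF bcs[OF j]]) (simp add: signed_def)
   hence "(LINT w|C.PI J. (SS (signed (c j)) J w)^2) = n * (LINT p|coin_space N. (signed (c j) p)^2)"
    unfolding n_def by (intro C.E_SS_sq J bcs[OF j])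
   also have "(LINT p|coin_space N. (signed (c j) p)^2) = (LINT y|N. (c j y)^2)"
    by (subst integral_coin[OF bm_power[OF bcs[OF j]]]) (simp add: signed_def)
   finally show "(LINT w|C.PI J. (SS (signed (c j)) J w)^2) = n * (LINT y|N. (c j y)^2)" .
  qed
  finally show ?thesis by (simp add: Tr_def sum_distrib_left)
 qed
 have lin: "SS (signed (g u)) J w <= W * sqrt (Z w)" if u: "u \<in> T" for u w
 proof -
  have "signed (g u) p = (\<Sum>j\<in>D. cf u j * signed (c j) p)" for p
   by (simp add: signed_def g_def sum_negf)
  hence "SS (signed (g u)) J w = (\<Sum>j\<in>D. cf u j * SS (signed (c j)) J w)"
   unfolding SS_def by (simp add: sum_distrib_left sum.swap[of _ J])
  also have "... <= sqrt ((\<Sum>j\<in>D. (cf u j)^2) * (\<Sum>j\<in>D. (SS (signed (c j)) J w)^2))"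
   using Cauchy_Schwarz_ineq_sum[of "cf u" "%j. SS (signed (c j)) J w" D] by (rule real_le_rsqrt)
  also have "... <= sqrt (W^2 * Z w)"
   unfolding Z_def using W(2)[OF u] by (intro real_sqrt_le_mono mult_right_mono sum_nonneg) auto
  also have "... = W * sqrt (Z w)" using W by (simp add: real_sqrt_mult)
  finally show ?thesis .
 qed
 define r where "r = sqrt (n * Tr)"
 have first: "(LINT w|PI J. m w) <= (LINT w|C.PI J. mx T (%u. 0 + 2 * L * SS (signed (g u)) J w))"
  unfolding m_def a_def by (rule symmetrisation_contraction[OF T Tne bg f(1,2,3) J(1)])
 \<comment> \<open>The arithmetic-geometric mean inequality against r + e takes the place of
   Jensen's inequality for the root; e > 0 keeps the divisor positive when r = 0 and is sent to 0
   afterwards.\<close>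
 have second: "(LINT w|C.PI J. mx T (%u. 0 + 2 * L * SS (signed (g u)) J w)) <= 2 * L * W * (r + e)" if e: "0 < e" for e
 proof -
  have re: "0 < r + e" unfolding r_def using n Tr0 e by (simp add: add_nonneg_pos)
  have "(LINT w|C.PI J. mx T (%u. 0 + 2 * L * SS (signed (g u)) J w))
   <= (LINT w|C.PI J. 2 * L * (W * ((Z w / (r + e) + (r + e)) / 2)))"
  proof (intro integral_mono C.int_PI)
   show "bm (C.PI J) (%w. mx T (%u. 0 + 2 * L * SS (signed (g u)) J w))"
    using bm_signed[OF bg] by (intro bm_mx T Tne bm_add bm_mult bm_const C.bm_SS order_refl)
   show "bm (C.PI J) (%w. 2 * L * (W * ((Z w / (r + e) + (r + e)) / 2)))"
    using bZ by (intro bm_mult bm_const bm_divide bm_add)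
   fix w
   have "0 <= (sqrt (Z w) - (r + e))^2" by simp
   hence "2 * sqrt (Z w) * (r + e) <= Z w + (r + e) * (r + e)" using Z0[of w] by (simp add: sq_simps)
   hence sq: "sqrt (Z w) <= (Z w / (r + e) + (r + e)) / 2" using re by (simp add: field_simps)
   show "mx T (%u. 0 + 2 * L * SS (signed (g u)) J w) <= 2 * L * (W * ((Z w / (r + e) + (r + e)) / 2))"
   proof (intro mx_le T Tne)
    fix u assume "u \<in> T"
    hence "SS (signed (g u)) J w <= W * sqrt (Z w)" by (rule lin)
    also have "... <= W * ((Z w / (r + e) + (r + e)) / 2)" using sq W by (intro mult_left_mono)
    finally have "2 * L * SS (signed (g u)) J w <= 2 * L * (W * ((Z w / (r + e) + (r + e)) / 2))"
    using L by (intro mult_left_mono) auto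
    thus "0 + 2 * L * SS (signed (g u)) J w <= 2 * L * (W * ((Z w / (r + e) + (r + e)) / 2))" by simp
   qed
  qed
  also have "... = 2 * L * (W * ((n * Tr / (r + e) + (r + e)) / 2))"
   using C.int_PI[OF bZ] EZ CA.prob_space by simp
  also have "... <= 2 * L * (W * (((r + e) + (r + e)) / 2))"
  proof (intro mult_left_mono divide_right_mono add_right_mono)
   have "n * Tr = r * r" unfolding r_def using n Tr0 by simp
   also have "... <= (r + e) * (r + e)" using e n Tr0 by (intro mult_mono) (auto simp: r_def)
   finally show "n * Tr / (r + e) <= r + e" using re by (simp add: divide_le_eq)
  qed (use W L in auto)
  also have "... = 2 * L * W * (r + e)" by (simp add: algebra_simps)
  finally show ?thesis .
 qed
 have H: "(LINT w|PI J. m w) <= 2 * L * W * r + (2 * L * W) * e" if "0 < e" for e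
  using order_trans[OF first second[OF that]] by (simp only: distrib_left)
 have Em: "(LINT w|PI J. m w) <= 2 * L * W * r"
 proof -
  show ?thesis
  proof (rule field_le_epsilon)
   fix e :: real assume e: "0 < e"
   have p: "0 < 2 * L * W + 1" using L W by (simp add: add_nonneg_pos)
   have "(LINT w|PI J. m w) <= 2 * L * W * r + (2 * L * W) * (e / (2 * L * W + 1))"
    using H[of "e / (2 * L * W + 1)"] e p by simp
   also have "(2 * L * W) * (e / (2 * L * W + 1)) <= (2 * L * W + 1) * (e / (2 * L * W + 1))"
    using e p by (intro mult_right_mono) auto
   also have "... = e" using p by simp
   finally show "(LINT w|PI J. m w) <= 2 * L * W * r + e" by simp
  qed
 qed
 have "\<P>(w in PI J. \<exists>u\<in>T. SS (%y. f (g u y)) J w <= card J * ((LINT y|N. f (g u y)) - t))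
  <= (LINT w|PI J. m w / (n * t))"
 proof (rule A.measure_le_integral)
  have [measurable]: "SS (%y. f (g u y)) J \<in> borel_measurable (PI J)" for u using bm_measurable[OF b\<phi>] by auto
  show "{w \<in> space (PI J). \<exists>u\<in>T. SS (%y. f (g u y)) J w <= card J * ((LINT y|N. f (g u y)) - t)} \<in> A.events"
   using T by measurable
  show "integrable (PI J) (%w. m w / (n * t))" using bmm by (intro int_PI bm_divide)
  fix w
  show "indicator {w \<in> space (PI J). \<exists>u\<in>T. SS (%y. f (g u y)) J w <= card J * ((LINT y|N. f (g u y)) - t)} w <= m w / (n * t)"
  proof (cases "\<exists>u\<in>T. SS (%y. f (g u y)) J w <= card J * ((LINT y|N. f (g u y)) - t)")
   case True
   then obtain u where u: "u \<in> T" "SS (%y. f (g u y)) J w <= n * ((LINT y|N. f (g u y)) - t)" by (auto simp: n_def)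
   have "n * t <= SS (a u) J w" using u(2) unfolding a_def SS_def by (simp add: sum_subtractf n_def algebra_simps)
   also have "... <= m w" using mx_ge[OF T u(1), of "%u. 0 + SS (a u) J w"] unfolding m_def by simp
   finally have "1 <= m w / (n * t)" using n t by simp
   moreover have "indicator {w \<in> space (PI J). \<exists>u\<in>T. SS (%y. f (g u y)) J w <= card J * ((LINT y|N. f (g u y)) - t)} w <= (1::real)"
    by (simp add: indicator_def)
   ultimately show ?thesis by linarith
  next
   case False
   thus ?thesis using m0[of w] n t by (simp add: indicator_def)
  qed
 qed
 also have "... = (LINT w|PI J. m w) / (n * t)" by simp
 also have "... <= 2 * L * W * r / (n * t)" using Em n t by (intro divide_right_mono) auto
 also have "... = 2 * L * W * sqrt (Tr / n) / t"
 proof -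
  have "r / n = sqrt (Tr / n)" unfolding r_def using n by (simp add: real_sqrt_mult real_sqrt_divide field_simps)
  thus ?thesis using n t by (simp add: field_simps)
 qed
 finally show ?thesis unfolding Tr_def n_def .
qed

end

subsection \<open>Population moments\<close>

definition dot :: "nat => real vec => real vec => real" where
 "dot d u x = (\<Sum>j<d. u $ j * x $ j)"

lemma dot_eq: "x \<in> carrier_vec d ==> u \<bullet> x = dot d u x"
 unfolding dot_def by (rule scalar_prod_sum)

lemma dot_comm: "dot d u x = dot d x u" unfolding dot_def by (simp add: mult.commute)

lemma nn_integral_bound_integral:
 assumes "f \<in> borel_measurable M" "!!x. 0 <= f x" "0 <= c" "(\<integral>\<^sup>+x. ennreal (f x) \<partial>M) <= ennreal c"
 shows "integrable M f" "integral\<^sup>L M f <= c"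
proof -
 have "(\<integral>\<^sup>+x. ennreal (f x) \<partial>M) < \<infinity>" using assms(4) by (simp add: le_less_trans)
 thus i: "integrable M f" using assms by (intro integrableI_nonneg) auto
 have "ennreal (integral\<^sup>L M f) = (\<integral>\<^sup>+x. ennreal (f x) \<partial>M)" using nn_integral_eq_integral[OF i] assms by simp
 thus "integral\<^sup>L M f <= c" using assms by (metis ennreal_le_iff)
qed

definition L2 :: "'b measure => ('b => real) => bool" where
 "L2 M f \<longleftrightarrow> f \<in> borel_measurable M \<and> integrable M (%x. (f x)^2)"

lemma L2_mult: assumes "L2 M f" "L2 M g" shows "integrable M (%x. f x * g x)"
proof (rule Bintegrable_bound)
 show "integrable M (%x. (f x)^2 + (g x)^2)" using assms by (simp add: L2_def)
 show "AE x in M. norm (f x * g x) <= norm ((f x)^2 + (g x)^2)"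
 proof (rule AE_I2)
  fix x
  have "2 * abs (f x) * abs (g x) <= abs (f x)^2 + abs (g x)^2" by (rule sum_squares_bound)
  hence "2 * abs (f x * g x) <= (f x)^2 + (g x)^2" by (simp add: abs_mult)
  thus "norm (f x * g x) <= norm ((f x)^2 + (g x)^2)"
   unfolding real_norm_def using abs_ge_zero[of "f x * g x"] abs_ge_self[of "(f x)^2 + (g x)^2"] by linarith
 qed
qed (use assms in \<open>auto simp: L2_def\<close>)

lemma L2_cmult: "L2 M f ==> L2 M (%x. c * f x)"
 by (auto simp: L2_def power_mult_distrib intro!: borel_measurable_times)

lemma L2_add: assumes "L2 M f" "L2 M g" shows "L2 M (%x. f x + g x)"
proof -
 have "integrable M (%x. (f x)^2 + (g x)^2 + 2 * (f x * g x))" using L2_mult[OF assms] assms by (simp add: L2_def)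
 thus ?thesis using assms by (auto simp: L2_def power2_sum mult.assoc intro!: borel_measurable_add)
qed

lemma L2_diff: assumes "L2 M f" "L2 M g" shows "L2 M (%x. f x - g x)"
 using L2_add[OF assms(1) L2_cmult[OF assms(2), of "- 1"]] by simp

lemma L2_sum: assumes "finite J" "!!j. j \<in> J ==> L2 M (f j)" shows "L2 M (%x. \<Sum>j\<in>J. f j x)"
 using assms by (induction J rule: finite_induct) (auto intro: L2_add simp: L2_def[of _ "%x. 0"])

lemma powr_moment_mono:
 fixes f :: "'b => real"
 assumes M: "prob_space M" and f: "f \<in> borel_measurable M" "integrable M (%x. abs (f x) powr q)" and p: "0 < p" "p <= q"
 shows "integrable M (%x. abs (f x) powr p)" "(LINT x|M. abs (f x) powr p) <= 1 + (LINT x|M. abs (f x) powr q)"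
proof -
 interpret prob_space M by fact
 have le: "abs (f x) powr p <= 1 + abs (f x) powr q" for x
 proof (cases "abs (f x) <= 1")
  case True
  hence "abs (f x) powr p <= 1" using p by (intro powr_le1) auto
  thus ?thesis by (simp add: add_increasing2)
 next
  case False
  hence "abs (f x) powr p <= abs (f x) powr q" using p by (intro powr_mono) auto
  thus ?thesis by simp
 qed
 show i: "integrable M (%x. abs (f x) powr p)"
 proof (rule Bintegrable_bound)
  show "integrable M (%x. 1 + abs (f x) powr q)" using f by simp
  show "AE x in M. norm (abs (f x) powr p) <= norm (1 + abs (f x) powr q)" using le by (intro AE_I2) auto
 qed (use f in measurable)
 have "(LINT x|M. abs (f x) powr p) <= (LINT x|M. 1 + abs (f x) powr q)" using f le by (intro integral_mono i) auto
 thus "(LINT x|M. abs (f x) powr p) <= 1 + (LINT x|M. abs (f x) powr q)" using f prob_space by simp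
qed

text \<open>Young's inequality with weights q / p and q / r, which sum to 1, is applied pointwise to
  the factors divided by a and b, and then integrated.\<close>

lemma Holder_moment:
 fixes f g :: "'b => real"
 assumes f: "f \<in> borel_measurable M" "integrable M (%x. abs (f x) powr p)" "(LINT x|M. abs (f x) powr p) <= a powr p"
  and g: "g \<in> borel_measurable M" "integrable M (%x. abs (g x) powr r)" "(LINT x|M. abs (g x) powr r) <= b powr r"
  and ab: "0 < a" "0 < b" and pr: "0 < p" "0 < r" "0 < q" "1 / q = 1 / p + 1 / r"
 shows "integrable M (%x. abs (f x * g x) powr q)" "(LINT x|M. abs (f x * g x) powr q) <= (a * b) powr q"
proof -
 define A where "A = (a * b) powr q"
 define h where "h = (%x. A * (q / p * (abs (f x) powr p / a powr p) + q / r * (abs (g x) powr r / b powr r)))"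
 have "q / p + q / r = q * (1 / q)" unfolding pr(4) by (simp add: distrib_left)
 moreover have "q * (1 / q) = 1" using pr(3) by simp
 ultimately have qs: "q / p + q / r = 1" by (rule trans)
 have A: "0 < A" unfolding A_def using ab by simp
 have le: "abs (f x * g x) powr q <= h x" for x
 proof (cases "f x = 0 \<or> g x = 0")
  case True
  thus ?thesis unfolding h_def using A pr ab by auto
 next
  case False
  define u v where "u = abs (f x) / a" and "v = abs (g x) / b"
  have uv: "0 < u" "0 < v" unfolding u_def v_def using False ab by auto
  have fg: "abs (f x * g x) = a * b * (u * v)" unfolding u_def v_def using ab by (simp add: abs_mult)
  have "(u powr p) powr (q / p) * (v powr r) powr (q / r) <= q / p * u powr p + q / r * v powr r"
   using uv pr qs by (intro Youngs_inequality_0) auto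
  hence "u powr q * v powr q <= q / p * u powr p + q / r * v powr r" using pr by (simp add: powr_powr)
  hence "A * (u powr q * v powr q) <= A * (q / p * u powr p + q / r * v powr r)" using A by simp
  moreover have "abs (f x * g x) powr q = A * (u powr q * v powr q)"
   unfolding fg A_def using uv ab by (simp add: powr_mult)
  moreover have "u powr p = abs (f x) powr p / a powr p" "v powr r = abs (g x) powr r / b powr r"
   unfolding u_def v_def using ab by (auto simp: powr_divide)
  ultimately show ?thesis unfolding h_def by simp
 qed
 have ih: "integrable M h" unfolding h_def using f g by simp
 show i: "integrable M (%x. abs (f x * g x) powr q)"
 proof (rule Bintegrable_bound[OF ih])
  show "AE x in M. norm (abs (f x * g x) powr q) <= norm (h x)"
   using le by (intro AE_I2) (auto intro: order_trans[OF _ abs_ge_self])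
 qed (use f g in measurable)
 have "(LINT x|M. abs (f x * g x) powr q) <= integral\<^sup>L M h" using le by (intro integral_mono i ih) auto
 also have "... = A * (q / p * ((LINT x|M. abs (f x) powr p) / a powr p) + q / r * ((LINT x|M. abs (g x) powr r) / b powr r))"
  unfolding h_def using f g by simp
 also have "... <= A * (q / p * 1 + q / r * 1)"
  using A pr ab f g by (intro mult_left_mono add_mono) (auto simp: divide_le_eq)
 finally show "(LINT x|M. abs (f x * g x) powr q) <= (a * b) powr q" using qs unfolding A_def by simp
qed

lemma integral_lincomb:
 fixes g :: "nat => 'b => real"
 assumes "!!j. j < d ==> integrable M (g j)"
 shows "integrable M (%z. \<Sum>j<d. c j * g j z)" "(LINT z|M. (\<Sum>j<d. c j * g j z)) = (\<Sum>j<d. c j * integral\<^sup>L M (g j))"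
proof -
 have i: "integrable M (%z. c j * g j z)" if "j \<in> {..<d}" for j using assms that by simp
 show "integrable M (%z. \<Sum>j<d. c j * g j z)" by (intro Bintegrable_sum i)
 have "(LINT z|M. (\<Sum>j<d. c j * g j z)) = (\<Sum>j<d. \<integral>z. c j * g j z \<partial>M)" by (intro Bintegral_sum i)
 thus "(LINT z|M. (\<Sum>j<d. c j * g j z)) = (\<Sum>j<d. c j * integral\<^sup>L M (g j))" by simp
qed

section \<open>The population regression and its standardised scores\<close>

locale regression =
 fixes d :: nat and P :: "(real vec \<times> real) measure" and lS uS lV qx qy Kx Ky qxy :: real
 assumes d: "0 < d" and law: "regression_law d P" and spec: "spectral_bounds d P lS uS lV"
  and mom: "moment_bounds d P qx qy Kx Ky"
  and pos: "0 < lS" "lS <= uS" "0 < lV" "1 <= qx" "1 <= qy" "1 <= Kx" "1 <= Ky"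
  and qxy: "qxy = inverse (1 / qx + 1 / qy)" "2 < qxy"
begin

definition res :: "real vec \<times> real => real" where
 "res z = snd z - dot d (beta0 d P) (fst z)"

text \<open>The score v . psi (z, beta0), the scalar summand in every numerator once the direction v
  is frozen.\<close>

definition W :: "real vec => real vec \<times> real => real" where
 "W v z = - res z * dot d v (fst z)"

abbreviation "Sg \<equiv> Sigma_mat d P"

abbreviation "V \<equiv> V_mat d P"

sublocale prob_space P using law by (simp add: regression_law_def)

lemma space_P: "space P = carrier_vec d \<times> UNIV"
proof -
 have "sets P = sets (borel_vec d \<Otimes>\<^sub>M borel)" using law by (simp add: regression_law_def)
 hence "space P = space (borel_vec d \<Otimes>\<^sub>M (borel :: real measure))" by (rule sets_eq_imp_space_eq)
 thus ?thesis by (simp add: space_pair_measure borel_vec_def)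
qed

lemma measurable_P: "borel_measurable P = borel_measurable (borel_vec d \<Otimes>\<^sub>M borel)"
 using law by (intro measurable_cong_sets) (auto simp: regression_law_def)

lemma meas_coord: "j < d ==> (%z. fst z $ j) \<in> borel_measurable P"
proof -
 assume j: "j < d"
 have "(%v :: real vec. \<lambda>j\<in>{..<d}. v $ j) \<in> borel_vec d \<rightarrow>\<^sub>M (\<Pi>\<^sub>M j\<in>{..<d}. borel)"
  unfolding borel_vec_def by (rule measurable_vimage_algebra1) (auto simp: space_PiM)
 moreover have "(%f. f j) \<in> (\<Pi>\<^sub>M j\<in>{..<d}. borel :: real measure) \<rightarrow>\<^sub>M borel"
  using j by (intro measurable_component_singleton) auto
 ultimately have "(%v :: real vec. (\<lambda>j\<in>{..<d}. v $ j) j) \<in> borel_vec d \<rightarrow>\<^sub>M borel" by (rule measurable_compose)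
 hence "(%v :: real vec. v $ j) \<in> borel_vec d \<rightarrow>\<^sub>M borel" using j by simp
 thus ?thesis unfolding measurable_P using measurable_compose[OF measurable_fst] by blast
qed

lemma meas_snd: "snd \<in> borel_measurable P"
 unfolding measurable_P by (rule measurable_snd)

lemma meas_dot: "(%z. dot d u (fst z)) \<in> borel_measurable P"
 unfolding dot_def using meas_coord by (intro borel_measurable_sum borel_measurable_times) auto

lemma meas_res: "res \<in> borel_measurable P"
 unfolding res_def using meas_snd meas_dot by measurable

lemma meas_W: "W v \<in> borel_measurable P"
 unfolding W_def using meas_res meas_dot by measurable

lemma L2_coord: "j < d ==> L2 P (%z. fst z $ j)"
 using law meas_coord unfolding L2_def regression_law_def by (auto simp: case_prod_unfold)

lemma L2_snd: "L2 P snd"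
 using law meas_snd unfolding L2_def regression_law_def by (auto simp: case_prod_unfold)

lemma L2_dot: "L2 P (%z. dot d u (fst z))"
 unfolding dot_def using L2_coord by (intro L2_sum L2_cmult) auto

lemma L2_res: "L2 P res"
 unfolding res_def by (intro L2_diff L2_snd L2_dot)

lemma mat_expectation_carrier: "mat_expectation d P F \<in> carrier_mat d d"
 by (simp add: mat_expectation_def)

lemma Sg_carrier: "Sg \<in> carrier_mat d d"
 unfolding Sigma_mat_def by (rule mat_expectation_carrier)

lemma V_carrier: "V \<in> carrier_mat d d"
 unfolding V_mat_def by (rule mat_expectation_carrier)

lemma Sg_entry: "i < d ==> j < d ==> Sg $$ (i, j) = (LINT z|P. fst z $ i * fst z $ j)"
 unfolding Sigma_mat_def mat_expectation_def
 by (auto simp: case_prod_beta outer_def space_P intro!: Bintegral_cong)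

lemma V_entry:
 assumes ij: "i < d" "j < d" and b: "beta0 d P \<in> carrier_vec d"
 shows "V $$ (i, j) = (LINT z|P. (res z * fst z $ i) * (res z * fst z $ j))"
proof -
 have "(case z of (x, y) => (y - x \<bullet> beta0 d P)\<^sup>2 \<cdot>\<^sub>m outer x x) $$ (i, j) = (res z * fst z $ i) * (res z * fst z $ j)"
  if "z \<in> space P" for z
  using that ij by (auto simp: case_prod_beta outer_def space_P res_def dot_eq[OF b] dot_comm power2_eq_square)
 thus ?thesis unfolding V_mat_def mat_expectation_def
  using ij by (auto intro!: Bintegral_cong)
qed

lemma gram_form:
 assumes A: "A \<in> carrier_mat d d" "!!i j. i < d ==> j < d ==> A $$ (i, j) = (LINT z|P. f i z * f j z)"
  and f: "!!i. i < d ==> L2 P (f i)" and u: "u \<in> carrier_vec d"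
 shows "transpose_mat A = A" "u \<bullet> (A *\<^sub>v u) = (LINT z|P. (\<Sum>i<d. u $ i * f i z)^2)"
proof -
 show "transpose_mat A = A" using A by (intro eq_matI) (auto simp: mult.commute)
 have e: "(\<Sum>i<d. u $ i * f i z)^2 = (\<Sum>i<d. u $ i * (\<Sum>j<d. u $ j * (f i z * f j z)))" for z
  unfolding power2_eq_square sum_product by (simp add: mult_ac sum_distrib_left)
 have "(LINT z|P. (\<Sum>i<d. u $ i * f i z)^2) = (\<Sum>i<d. u $ i * (LINT z|P. (\<Sum>j<d. u $ j * (f i z * f j z))))"
  unfolding e by (intro integral_lincomb L2_mult f)
 also have "... = (\<Sum>i<d. u $ i * (\<Sum>j<d. u $ j * (LINT z|P. f i z * f j z)))"
  using L2_mult[OF f f] by (intro sum.cong arg_cong2[of _ _ _ _ times] refl integral_lincomb) auto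
 also have "... = (\<Sum>i<d. \<Sum>j<d. u $ i * (u $ j * A $$ (i, j)))"
  using A(2) by (simp add: sum_distrib_left)
 also have "... = u \<bullet> (A *\<^sub>v u)"
  using mult_vec_carrier[OF A(1) u] A u
  by (subst scalar_prod_sum) (auto simp: mult_vec_sum sum_distrib_left mult_ac simp del: index_mult_mat_vec intro!: sum.cong)
 finally show "u \<bullet> (A *\<^sub>v u) = (LINT z|P. (\<Sum>i<d. u $ i * f i z)^2)" by simp
qed

lemma Sg_sym: "transpose_mat Sg = Sg"
 using gram_form(1)[OF Sg_carrier Sg_entry L2_coord zero_carrier_vec] .

lemma Sg_form: "u \<in> carrier_vec d ==> u \<bullet> (Sg *\<^sub>v u) = (LINT z|P. (dot d u (fst z))^2)"
 unfolding dot_def using gram_form(2)[OF Sg_carrier Sg_entry L2_coord] .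

lemma Sg_lower: "u \<in> carrier_vec d ==> lS * (u \<bullet> u) <= u \<bullet> (Sg *\<^sub>v u)"
 using lambda_min_form[OF Sg_carrier Sg_sym d] spec by (simp add: spectral_bounds_def)

lemma Sg_upper: "u \<in> carrier_vec d ==> u \<bullet> (Sg *\<^sub>v u) <= uS * (u \<bullet> u)"
 using lambda_max_form[OF Sg_carrier Sg_sym d] spec by (simp add: spectral_bounds_def)

lemma norm_pos: "u \<in> carrier_vec d ==> u ~= 0\<^sub>v d ==> 0 < u \<bullet> (u :: real vec)"
 using scalar_prod_self_eq_0[of u d] scalar_prod_self_ge_0[of u] by (auto simp: less_le)

lemma Sg_pos: "u \<in> carrier_vec d ==> u ~= 0\<^sub>v d ==> 0 < u \<bullet> (Sg *\<^sub>v u)"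
 using Sg_lower[of u] norm_pos[of u] pos(1) by (metis less_le_trans mult_pos_pos)

lemma Sg_det: "det Sg ~= 0"
 by (rule posdef_det[OF Sg_carrier Sg_pos])

definition xy :: "real vec" where "xy = vec d (%j. \<integral>z. fst z $ j * snd z \<partial>P)"

lemma xy_carrier: "xy \<in> carrier_vec d" by (simp add: xy_def)

lemma beta0_eq: "beta0 d P = minv Sg *\<^sub>v xy"
 unfolding beta0_def
proof (rule quadratic_arg_min[where k = 1 and c = "\<integral>z. (snd z)^2 \<partial>P"])
 show "Sg \<in> carrier_mat d d" "transpose_mat Sg = Sg" "xy \<in> carrier_vec d" "0 < (1::real)"
  by (simp_all add: Sg_carrier Sg_sym xy_carrier)
 show "0 < u \<bullet> (Sg *\<^sub>v u)" if "u \<in> carrier_vec d" "u ~= 0\<^sub>v d" for u :: "real vec" by (rule Sg_pos[OF that])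
next
 fix b :: "real vec" assume t: "b \<in> carrier_vec d"
 have "(LINT (x, y)|P. (y - x \<bullet> b)^2) = (LINT z|P. ((snd z)^2 - 2 * (dot d b (fst z) * snd z)) + (dot d b (fst z))^2)"
  by (intro Bintegral_cong)
   (auto simp: dot_eq[OF t] dot_comm[of d b] power2_diff mult_ac)
 also have "... = (LINT z|P. (snd z)^2) - 2 * (LINT z|P. dot d b (fst z) * snd z) + b \<bullet> (Sg *\<^sub>v b)"
  using L2_snd L2_dot L2_mult[OF L2_dot L2_snd] unfolding Sg_form[OF t] by (simp add: L2_def)
 also have "(LINT z|P. dot d b (fst z) * snd z) = xy \<bullet> b"
 proof -
  have "dot d b (fst z) * snd z = (\<Sum>j<d. b $ j * (fst z $ j * snd z))" for z :: "real vec \<times> real"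
   unfolding dot_def by (simp add: sum_distrib_left mult_ac)
  moreover have "(LINT z|P. (\<Sum>j<d. b $ j * (fst z $ j * snd z))) = (\<Sum>j<d. b $ j * (LINT z|P. fst z $ j * snd z))"
   by (intro integral_lincomb L2_mult L2_coord L2_snd)
  ultimately show ?thesis using t by (simp add: scalar_prod_sum xy_def mult_ac)
 qed
 finally show "(LINT (x, y)|P. (y - x \<bullet> b)^2) = 1 * ((LINT z|P. (snd z)^2) - 2 * (xy \<bullet> b) + b \<bullet> (Sg *\<^sub>v b))" by simp
qed

lemma beta0_carrier: "beta0 d P \<in> carrier_vec d"
 unfolding beta0_eq using minv_carrier[OF Sg_carrier] xy_carrier by simp

lemma Sg_beta0: "Sg *\<^sub>v beta0 d P = xy"
 unfolding beta0_eq by (rule minv_apply[OF Sg_carrier Sg_det xy_carrier])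

lemma normal_equation: assumes j: "j < d" shows "(LINT z|P. fst z $ j * res z) = 0"
proof -
 have e: "fst z $ j * res z = fst z $ j * snd z - (\<Sum>k<d. beta0 d P $ k * (fst z $ j * fst z $ k))" for z
  unfolding res_def dot_def by (simp add: right_diff_distrib sum_distrib_left mult_ac)
 have "(LINT z|P. fst z $ j * res z) = (LINT z|P. fst z $ j * snd z) - (\<Sum>k<d. beta0 d P $ k * (LINT z|P. fst z $ j * fst z $ k))"
  unfolding e using L2_mult[OF L2_coord[OF j] L2_snd]
   integral_lincomb[of d P "%k z. fst z $ j * fst z $ k" "%k. beta0 d P $ k", OF L2_mult[OF L2_coord[OF j] L2_coord]] by simp
 also have "... = xy $ j - (Sg *\<^sub>v beta0 d P) $ j"
  using j Sg_entry[OF j] mult_vec_sum[OF Sg_carrier beta0_carrier j] by (simp add: xy_def mult_ac)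
 finally show ?thesis unfolding Sg_beta0 by simp
qed

lemma W_mean: "integrable P (W v)" "integral\<^sup>L P (W v) = 0"
proof -
 have e: "W v z = (\<Sum>j<d. - v $ j * (fst z $ j * res z))" for z
  unfolding W_def dot_def by (simp add: sum_distrib_left mult_ac sum_negf)
 show "integrable P (W v)" "integral\<^sup>L P (W v) = 0"
  unfolding e using integral_lincomb[of d P "%j z. fst z $ j * res z" "%j. - v $ j", OF L2_mult[OF L2_coord L2_res]] normal_equation
  by auto
qed

text \<open>Follows from \<open>psd_norm_bound\<close> at w = \<open>minv Sg *\<^sub>v u\<close>. It
  shows the inverse to be positive definite, so that its \<open>msqrt\<close> is a genuine
  root.\<close>

lemma minv_Sg_lower:
 assumes u: "u \<in> carrier_vec d" shows "1 / uS * (u \<bullet> u) <= u \<bullet> (minv Sg *\<^sub>v u)"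
proof -
 define w where "w = minv Sg *\<^sub>v u"
 have w: "w \<in> carrier_vec d" unfolding w_def using minv_carrier[OF Sg_carrier] u by simp
 have uw: "u = Sg *\<^sub>v w" unfolding w_def using minv_apply(1)[OF Sg_carrier Sg_det u] by simp
 have uS: "0 < uS" using pos by simp
 have nn: "0 <= x \<bullet> (Sg *\<^sub>v x)" if "x \<in> carrier_vec d" for x
  using Sg_lower[OF that] scalar_prod_self_ge_0[of x] pos(1) by (metis less_eq_real_def mult_nonneg_nonneg order_trans)
 have "u \<bullet> u <= uS * (w \<bullet> u)" unfolding uw
  by (rule psd_norm_bound[OF Sg_carrier Sg_sym nn uS Sg_upper w])
 also have "w \<bullet> u = u \<bullet> w" using u w by (simp add: comm_scalar_prod)
 finally show ?thesis unfolding w_def using uS by (simp add: field_simps)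
qed

text \<open>The moment hypothesis speaks of unit vectors acting on the whitened covariate R x, R
  being the root of the inverse. The vector w = R (Sg v) satisfies w . (R x) = v . x and w . w = v .
  Sg v, so the hypothesis is applied to w divided by its norm.\<close>

lemma dot_moment:
 assumes v: "v \<in> carrier_vec d" "v ~= 0\<^sub>v d"
 defines "k \<equiv> Kx * sqrt (uS * (v \<bullet> v))"
 shows "integrable P (%z. abs (dot d v (fst z)) powr qx)" "(LINT z|P. abs (dot d v (fst z)) powr qx) <= k powr qx" "0 < k"
proof -
 have uS: "0 < uS" using pos by simp
 define R where "R = msqrt (minv Sg)"
 have R: "R \<in> carrier_mat d d" "psd R" "R * R = minv Sg"
  unfolding R_def using uS by (intro msqrt_posdef[OF minv_carrier[OF Sg_carrier] minv_symmetric[OF Sg_carrier Sg_sym] _ minv_Sg_lower]; simp)+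
 have Rs: "transpose_mat R = R" using R(2) by (simp add: psd_def)
 define g where "g = sqrt (v \<bullet> (Sg *\<^sub>v v))"
 have g: "0 < g" "g * g = v \<bullet> (Sg *\<^sub>v v)" unfolding g_def using Sg_pos[OF v] by auto
 have \<sigma>k: "Kx * g <= k" unfolding g_def k_def using Sg_upper[OF v(1)] pos by (intro mult_left_mono) auto
 have "0 < Kx * g" using g pos by simp
 with \<sigma>k show "0 < k" by linarith
 define w where "w = R *\<^sub>v (Sg *\<^sub>v v)"
 have Sv: "Sg *\<^sub>v v \<in> carrier_vec d" using mult_vec_carrier[OF Sg_carrier v(1)] .
 have w: "w \<in> carrier_vec d" unfolding w_def using mult_vec_carrier[OF R(1) Sv] .
 have wRx: "w \<bullet> (R *\<^sub>v x) = v \<bullet> x" if x: "x \<in> carrier_vec d" for x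
 proof -
  have "w \<bullet> (R *\<^sub>v x) = (Sg *\<^sub>v v) \<bullet> (R *\<^sub>v (R *\<^sub>v x))"
   unfolding w_def by (rule self_adjoint[OF R(1) Rs Sv mult_vec_carrier[OF R(1) x]])
  also have "R *\<^sub>v (R *\<^sub>v x) = minv Sg *\<^sub>v x" unfolding R(3)[symmetric] using assoc_mult_mat_vec[OF R(1) R(1) x] by simp
  also have "(Sg *\<^sub>v v) \<bullet> (minv Sg *\<^sub>v x) = v \<bullet> (Sg *\<^sub>v (minv Sg *\<^sub>v x))"
   by (rule self_adjoint[OF Sg_carrier Sg_sym v(1) mult_vec_carrier[OF minv_carrier[OF Sg_carrier] x]])
  also have "Sg *\<^sub>v (minv Sg *\<^sub>v x) = x" by (rule minv_apply[OF Sg_carrier Sg_det x])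
  finally show ?thesis .
 qed
 have ww: "w \<bullet> w = g * g" unfolding g(2) using wRx[OF Sv] unfolding w_def[symmetric] .
 define u where "u = (1 / g) \<cdot>\<^sub>v w"
 have u: "u \<in> unit_sphere d" unfolding unit_sphere_def u_def using w ww g(1) by simp
 have uRx: "u \<bullet> (R *\<^sub>v x) = dot d v x / g" if x: "x \<in> carrier_vec d" for x
  unfolding u_def using w wRx[OF x] mult_vec_carrier[OF R(1) x] dot_eq[OF x] by simp
 have "(\<integral>\<^sup>+(x, y). ennreal (abs (u \<bullet> (R *\<^sub>v x)) powr qx) \<partial>P) <= ennreal (Kx powr qx)"
 proof -
  have "(\<integral>\<^sup>+(x, y). ennreal (abs (u \<bullet> (R *\<^sub>v x)) powr qx) \<partial>P)
   <= (SUP u \<in> unit_sphere d. \<integral>\<^sup>+(x, y). ennreal (abs (u \<bullet> (R *\<^sub>v x)) powr qx) \<partial>P)"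
   by (rule SUP_upper[OF u])
  also have "... <= ennreal (Kx powr qx)" using mom unfolding moment_bounds_def R_def by (rule conjunct1)
  finally show ?thesis .
 qed
 moreover have "(\<integral>\<^sup>+(x, y). ennreal (abs (u \<bullet> (R *\<^sub>v x)) powr qx) \<partial>P) = (\<integral>\<^sup>+z. ennreal (abs (dot d v (fst z) / g) powr qx) \<partial>P)"
  by (intro nn_integral_cong) (auto simp: space_P uRx)
 ultimately have b: "(\<integral>\<^sup>+z. ennreal (abs (dot d v (fst z) / g) powr qx) \<partial>P) <= ennreal (Kx powr qx)" by simp
 have m: "(%z. abs (dot d v (fst z) / g) powr qx) \<in> borel_measurable P" using meas_dot by measurable
 note B = nn_integral_bound_integral[OF m _ _ b]
 have e: "abs (dot d v (fst z)) powr qx = g powr qx * abs (dot d v (fst z) / g) powr qx" for z :: "real vec \<times> real"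
  using g(1) by (simp add: powr_divide abs_divide)
 show "integrable P (%z. abs (dot d v (fst z)) powr qx)" unfolding e using B(1) by simp
 have "(LINT z|P. abs (dot d v (fst z)) powr qx) <= g powr qx * Kx powr qx"
  unfolding e using B(2) by (simp add: mult_left_mono)
 also have "... = (Kx * g) powr qx" using g pos by (simp add: powr_mult)
 also have "... <= k powr qx" using \<sigma>k \<open>0 < Kx * g\<close> pos by (intro powr_mono2) auto
 finally show "(LINT z|P. abs (dot d v (fst z)) powr qx) <= k powr qx" .
qed

lemma res_moment: "integrable P (%z. abs (res z) powr qy)" "(LINT z|P. abs (res z) powr qy) <= Ky powr qy"
proof -
 have "(\<integral>\<^sup>+(x, y). ennreal (abs (y - x \<bullet> beta0 d P) powr qy) \<partial>P) = (\<integral>\<^sup>+z. ennreal (abs (res z) powr qy) \<partial>P)"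
  by (intro nn_integral_cong) (auto simp: res_def dot_eq[OF beta0_carrier] dot_comm)
 hence b: "(\<integral>\<^sup>+z. ennreal (abs (res z) powr qy) \<partial>P) <= ennreal (Ky powr qy)"
  using mom unfolding moment_bounds_def by simp
 have "(%z. abs (res z) powr qy) \<in> borel_measurable P" using meas_res by measurable
 from nn_integral_bound_integral[OF this _ _ b]
 show "integrable P (%z. abs (res z) powr qy)" "(LINT z|P. abs (res z) powr qy) <= Ky powr qy" by auto
qed

lemma W_moment:
 assumes v: "v \<in> carrier_vec d" "v ~= 0\<^sub>v d"
 shows "integrable P (%z. abs (W v z) powr qxy)" "(LINT z|P. abs (W v z) powr qxy) <= (Ky * (Kx * sqrt (uS * (v \<bullet> v)))) powr qxy"
proof -
 have q: "1 / qxy = 1 / qy + 1 / qx" unfolding qxy(1) by (simp add: add.commute inverse_eq_divide)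
 have W: "abs (W v z) = abs (res z * dot d v (fst z))" for z by (simp add: W_def abs_mult)
 show "integrable P (%z. abs (W v z) powr qxy)" "(LINT z|P. abs (W v z) powr qxy) <= (Ky * (Kx * sqrt (uS * (v \<bullet> v)))) powr qxy"
  unfolding W using pos qxy(2) q
  by (intro Holder_moment[OF meas_res res_moment meas_dot dot_moment(1,2)[OF v] _ dot_moment(3)[OF v]]; simp)+
qed

lemma W_sq: assumes v: "v \<in> carrier_vec d" shows "integrable P (%z. (W v z)^2)"
proof (cases "v = 0\<^sub>v d")
 case True
 hence "W v z = 0" for z by (simp add: W_def dot_def)
 thus ?thesis by simp
next
 case False
 have "abs x powr 2 = x^2" for x :: real by (cases "x = 0") (auto simp: powr_numeral)
 thus ?thesis
  using powr_moment_mono(1)[OF prob_space_axioms meas_W W_moment(1)[OF v False], of 2] qxy by simp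
qed

lemma L2_res_coord: "j < d ==> L2 P (%z. res z * fst z $ j)"
proof -
 assume j: "j < d"
 have "W (unit_vec d j) z = - (res z * fst z $ j)" for z
 proof -
  have "dot d (unit_vec d j) (fst z) = (\<Sum>k<d. if k = j then fst z $ j else 0)"
   unfolding dot_def using j by (intro sum.cong) (auto simp: unit_vec_def)
  thus ?thesis using j by (simp add: W_def)
 qed
 thus ?thesis using W_sq[of "unit_vec d j"] meas_res meas_coord[OF j] by (simp add: L2_def)
qed

lemma V_form:
 assumes v: "v \<in> carrier_vec d" shows "transpose_mat V = V" "v \<bullet> (V *\<^sub>v v) = (LINT z|P. (W v z)^2)"
proof -
 have "(W v z)^2 = (\<Sum>i<d. v $ i * (res z * fst z $ i))^2" for z
 proof -
  have "(\<Sum>i<d. v $ i * (res z * fst z $ i)) = res z * dot d v (fst z)"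
   unfolding dot_def by (simp add: sum_distrib_left mult_ac)
  thus ?thesis unfolding W_def by (simp add: power_mult_distrib)
 qed
 thus "transpose_mat V = V" "v \<bullet> (V *\<^sub>v v) = (LINT z|P. (W v z)^2)"
  using gram_form[OF V_carrier V_entry[OF _ _ beta0_carrier] L2_res_coord v] by auto
qed

lemma W_sq_lower: assumes v: "v \<in> carrier_vec d" shows "lV * (v \<bullet> v) <= (LINT z|P. (W v z)^2)"
 using lambda_min_form[OF V_carrier V_form(1)[OF v] d _ v] spec unfolding V_form(2)[OF v] by (simp add: spectral_bounds_def)

definition sd :: "real vec => real" where "sd v = sqrt (LINT z|P. (W v z)^2)"

text \<open>A common bound for the moments of all standardised scores. Standardising divides the
  upper spectral bound on Sigma by the lower one on V, so neither the direction nor the dimension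
  remains; the summand 1 covers exponents below qxy.\<close>

definition mb :: real where "mb = 1 + (Ky * (Kx * sqrt (uS / lV))) powr qxy"

lemma sd_pos:
 assumes v: "v \<in> carrier_vec d" "v ~= 0\<^sub>v d"
 shows "0 < sd v" "sqrt (lV * (v \<bullet> v)) <= sd v" "sd v * sd v = (LINT z|P. (W v z)^2)"
proof -
 show 1: "sqrt (lV * (v \<bullet> v)) <= sd v" unfolding sd_def using W_sq_lower[OF v(1)] by simp
 have "0 < sqrt (lV * (v \<bullet> v))" using norm_pos[OF v] pos by simp
 with 1 show 2: "0 < sd v" by linarith
 show "sd v * sd v = (LINT z|P. (W v z)^2)" unfolding sd_def by simp
qed

lemma scaled_moment:
 assumes v: "v \<in> carrier_vec d" "v ~= 0\<^sub>v d"
 shows "integrable P (%z. abs (W v z / sd v) powr qxy)" "(LINT z|P. abs (W v z / sd v) powr qxy) <= mb - 1"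
proof -
 note s = sd_pos[OF v]
 have e: "abs (W v z / sd v) powr qxy = abs (W v z) powr qxy / sd v powr qxy" for z
  using s by (simp add: powr_divide abs_divide)
 show "integrable P (%z. abs (W v z / sd v) powr qxy)" unfolding e using W_moment(1)[OF v] by simp
 have "Ky * (Kx * sqrt (uS * (v \<bullet> v))) = (Ky * (Kx * sqrt (uS / lV))) * sqrt (lV * (v \<bullet> v))"
  using pos by (simp add: real_sqrt_mult real_sqrt_divide)
 also have "... <= (Ky * (Kx * sqrt (uS / lV))) * sd v" using s(2) pos by (intro mult_left_mono) auto
 finally have 1: "Ky * (Kx * sqrt (uS * (v \<bullet> v))) <= (Ky * (Kx * sqrt (uS / lV))) * sd v" .
 have "(LINT z|P. abs (W v z) powr qxy) <= (Ky * (Kx * sqrt (uS * (v \<bullet> v)))) powr qxy" by (rule W_moment(2)[OF v])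
 also have "... <= ((Ky * (Kx * sqrt (uS / lV))) * sd v) powr qxy"
  using 1 pos qxy scalar_prod_self_ge_0[of v] by (intro powr_mono2) auto
 also have "... = (mb - 1) * sd v powr qxy" unfolding mb_def using s pos by (simp add: powr_mult)
 finally show "(LINT z|P. abs (W v z / sd v) powr qxy) <= mb - 1"
  unfolding e using s by (simp add: divide_le_eq)
qed

lemma scaled_moment_le:
 assumes v: "v \<in> carrier_vec d" "v ~= 0\<^sub>v d" and s: "0 < s" "s <= qxy"
 shows "integrable P (%z. abs (W v z / sd v) powr s)" "(LINT z|P. abs (W v z / sd v) powr s) <= mb"
proof -
 have "(%z. W v z / sd v) \<in> borel_measurable P" using meas_W by measurable
 from powr_moment_mono[OF prob_space_axioms this scaled_moment(1)[OF v] s] scaled_moment(2)[OF v]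
 show "integrable P (%z. abs (W v z / sd v) powr s)" "(LINT z|P. abs (W v z / sd v) powr s) <= mb" by auto
qed

lemma scaled_standard:
 assumes v: "v \<in> carrier_vec d" "v ~= 0\<^sub>v d"
 shows "integrable P (%z. (W v z / sd v)^2)" "(LINT z|P. (W v z / sd v)^2) = 1"
  "integrable P (%z. W v z / sd v)" "(LINT z|P. W v z / sd v) = 0" "(%z. W v z / sd v) \<in> borel_measurable P"
 using W_sq[OF v(1)] sd_pos[OF v] W_mean meas_W[of v] by (auto simp: power_divide power2_eq_square)

lemma mb_ge_1: "1 <= mb" unfolding mb_def by simp

end

subsection \<open>Plug-in variance\<close>

text \<open>A relative change of the threshold costs O(t) uniformly in z, because y * dnorm y is
  bounded by 1.\<close>

lemma Q_shrink:
 assumes "0 <= z" "0 <= t" "t <= 1/2"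
 shows "Q (z * (1 - t)) <= Q z + 2 * t"
proof (cases "z * t = 0")
 case True
 hence "z * (1 - t) = z" by (auto simp: algebra_simps)
 hence "Q (z * (1 - t)) = Q z" by (rule arg_cong)
 thus ?thesis using assms(2) by linarith
next
 case False
 define y where "y = z * (1 - t)"
 have zp: "0 < z" "0 < t" using False assms by auto
 have "0 < z * t" using zp by simp
 hence yz: "y < z" unfolding y_def by (simp add: algebra_simps)
 have y0: "0 <= y" unfolding y_def using assms by simp
 from MVT2[OF yz, of Q "%x. - dnorm x"] Q_deriv obtain c where
  c: "y < c" "Q z - Q y = (z - y) * - dnorm c" by blast
 have "Q y - Q z = (z - y) * dnorm c" using c by simp
 also have "... <= (z - y) * dnorm y" using yz c y0 by (intro mult_left_mono dnorm_antimono) auto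
 also have "z - y = z * t" by (simp add: y_def algebra_simps)
 also have "z * t * dnorm y <= (2 * y) * t * dnorm y"
 proof (intro mult_right_mono)
  have "z * 1 <= z * (2 * (1 - t))" using assms by (intro mult_left_mono) auto
  thus "z <= 2 * y" unfolding y_def by (simp add: algebra_simps)
 qed (use assms dnorm_pos[of y] in auto)
 also have "... = 2 * t * (y * dnorm y)" by simp
 also have "... <= 2 * t * 1"
 proof (intro mult_left_mono)
  have "0 <= (y - 1)^2" by simp
  hence "y <= 1 + y^2 / 2" by (simp add: sq_simps)
  also have "... <= exp (y^2 / 2)" by (rule exp_ge_add_one_self)
  finally have "y * exp (- y\<^sup>2 / 2) <= exp (y^2/2) * exp (- y\<^sup>2 / 2)" by (intro mult_right_mono) auto
  hence 1: "y * exp (- y\<^sup>2 / 2) <= 1" by (simp flip: exp_add)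
  have "1 / sqrt (2*pi) <= 1" using pi_gt3 by (simp add: divide_le_eq_1)
  hence "(1 / sqrt (2*pi)) * (y * exp (- y\<^sup>2 / 2)) <= 1 * 1" using 1 y0 by (intro mult_mono) auto
  thus "y * dnorm y <= 1" by (simp add: std_normal_density_def mult_ac)
 qed (use assms in auto)
 finally show ?thesis by (simp add: y_def)
qed

lemma powr_sum3:
 fixes a b c q :: real
 assumes "0 <= a" "0 <= b" "0 <= c" "0 <= q" "q <= 4"
 shows "(a + b + c) powr q <= 81 * (a powr q + b powr q + c powr q)"
proof -
 define m where "m = max a (max b c)"
 have m: "0 <= m" "a + b + c <= 3 * m" "m powr q <= a powr q + b powr q + c powr q"
 proof -
  show "0 <= m" "a + b + c <= 3 * m" using assms by (auto simp: m_def)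
  have "m \<in> {a, b, c}" by (auto simp: m_def max_def)
  thus "m powr q <= a powr q + b powr q + c powr q" by auto
 qed
 have "(a + b + c) powr q <= (3 * m) powr q" using assms m by (intro powr_mono2) auto
 also have "... = 3 powr q * m powr q" using m by (intro powr_mult)
 also have "... <= 81 * (a powr q + b powr q + c powr q)"
 proof (rule mult_mono)
  have "(3::real) powr q <= 3 powr 4" using assms by (intro powr_mono) auto
  thus "(3::real) powr q <= 81" by simp
 qed (use m in auto)
 finally show ?thesis .
qed

context iid
begin

lemma product_coords:
 fixes f g :: "'b => real"
 assumes J: "finite J" "i \<in> J" "j \<in> J" "i ~= j" and f: "integrable N f" "integrable N g"
 shows "integrable (PI J) (%w. f (w i) * g (w j))"
  "(LINT w|PI J. f (w i) * g (w j)) = integral\<^sup>L N f * integral\<^sup>L N g"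
proof -
 define h where "h = (%k. if k = i then f else if k = j then g else (%_. 1))"
 have ih: "integrable N (h k)" for k unfolding h_def using f by simp
 have e: "(\<Prod>k\<in>J. h k (w k)) = f (w i) * g (w j)" for w
 proof -
  have "(\<Prod>k\<in>J. h k (w k)) = (\<Prod>k\<in>{i, j}. h k (w k))"
   using J by (intro prod.mono_neutral_right) (auto simp: h_def)
  thus ?thesis using J(4) by (simp add: h_def)
 qed
 show "integrable (PI J) (%w. f (w i) * g (w j))"
  using psf.product_integrable_prod[of J h, OF J(1) ih] by (simp only: e)
 have "(LINT w|PI J. f (w i) * g (w j)) = (\<Prod>k\<in>J. integral\<^sup>L N (h k))"
  using psf.product_integral_prod[of J h, OF J(1) ih] by (simp only: e)
 also have "... = (\<Prod>k\<in>{i, j}. integral\<^sup>L N (h k))"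
  using J prob_space by (intro prod.mono_neutral_right) (auto simp: h_def)
 finally show "(LINT w|PI J. f (w i) * g (w j)) = integral\<^sup>L N f * integral\<^sup>L N g"
  using J(4) by (simp add: h_def)
qed

lemma E_SS_sq_L2:
 fixes f :: "'b => real"
 assumes J: "finite J" and f: "integrable N f" "integrable N (%y. (f y)^2)" "integral\<^sup>L N f = 0"
 shows "integrable (PI J) (%w. (SS f J w)^2)"
  "(LINT w|PI J. (SS f J w)^2) = card J * (LINT y|N. (f y)^2)"
proof -
 have e: "(SS f J w)^2 = (\<Sum>i\<in>J. \<Sum>j\<in>J. f (w i) * f (w j))" for w
  unfolding SS_def power2_eq_square by (rule sum_product)
 have ij: "integrable (PI J) (%w. f (w i) * f (w j))"
  "(LINT w|PI J. f (w i) * f (w j)) = (if i = j then (LINT y|N. (f y)^2) else 0)" if "i \<in> J" "j \<in> J" for i j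
 proof -
  have "integrable (PI J) (%w. f (w i) * f (w j)) \<and>
   (LINT w|PI J. f (w i) * f (w j)) = (if i = j then (LINT y|N. (f y)^2) else 0)"
  proof (cases "i = j")
   case True
   thus ?thesis using integrable_coord[OF that(1) f(2)] E_coord[OF that(1), of "%y. (f y)^2"] f(2)
    by (simp add: power2_eq_square)
  next
   case False
   thus ?thesis using product_coords[OF J that False f(1) f(1)] f(3) by simp
  qed
  thus "integrable (PI J) (%w. f (w i) * f (w j))"
   "(LINT w|PI J. f (w i) * f (w j)) = (if i = j then (LINT y|N. (f y)^2) else 0)" by auto
 qed
 show "integrable (PI J) (%w. (SS f J w)^2)"
  unfolding e using ij(1) by (intro Bintegrable_sum)
 have "(LINT w|PI J. (SS f J w)^2) = (\<Sum>i\<in>J. \<Sum>j\<in>J. \<integral>w. f (w i) * f (w j) \<partial>PI J)"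
  unfolding e using ij(1)
  by (subst Bintegral_sum, intro Bintegrable_sum, assumption+)
   (intro sum.cong refl Bintegral_sum)
 also have "... = (\<Sum>i\<in>J. \<Sum>j\<in>J. if i = j then (LINT y|N. (f y)^2) else 0)"
  using ij(2) by (intro sum.cong) auto
 also have "... = card J * (LINT y|N. (f y)^2)" using J by (simp add: sum.delta)
 finally show "(LINT w|PI J. (SS f J w)^2) = card J * (LINT y|N. (f y)^2)" .
qed

end

text \<open>The numerator is built from X and the variance from U: they are the scores at two
  different parameter values.\<close>

definition plugin_excess :: "('b => real) => ('b => real) => nat set => real => (nat => 'b) => bool" where
 "plugin_excess X U J z w \<longleftrightarrow>
  z^2 * (SS (%y. (U y)^2) J w - (SS U J w)^2 / card J) < (SS X J w)^2"

lemma abs_le_sq: "abs x <= 1 + (x::real)^2"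
proof -
 have "0 <= (abs x - 1)^2" by simp
 hence "2 * abs x <= 1 + x^2" by (simp add: sq_simps)
 thus ?thesis using abs_ge_zero[of x] by linarith
qed

text \<open>Only too small a variance estimate can hurt. With high probability the sample variance
  of U = X + G exceeds 1 - t, where t collects 2 * r from the population variance, e from the left
  tail of the sum of squares and v from centring. The event then implies an excess of the plain
  normalised sum over z * (1 - t), a fixed threshold.\<close>

theorem plugin_Berry_Esseen:
 fixes s B p :: real
 assumes s: "2 < s" "s <= 3" and B: "1 <= B" and p: "1 < p" "p <= 2"
 shows "\<exists>C>0. \<forall>(N :: 'b measure) X G J z r. iid_moment N X s B \<and> finite J \<and> J ~= {} \<and> 0 <= z \<and> 0 < r \<and>
  integrable N (%y. abs (X y) powr (2 * p)) \<and> (LINT y|N. abs (X y) powr (2 * p)) <= B \<and>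
  G \<in> borel_measurable N \<and> integrable N (%y. (G y)^2) \<and> (LINT y|N. (G y)^2) <= r^2 \<and>
  integrable N (%y. abs (G y) powr (2 * p)) \<and> (LINT y|N. abs (G y) powr (2 * p)) <= B * r powr (2 * p) \<longrightarrow>
  \<P>(w in PiM J (%_. N). plugin_excess X (%y. X y + G y) J z w)
   <= 2 * Q z + C * (card J powr (1 - s/2) + card J powr (- (1/2)) + ((1 + ln (card J)) / card J) powr (1 - 1/p) + r)"
proof -
 \<comment> \<open>The factor 324 in the p-th moment of Y is 81 from three summands with exponent at
   most 4, times 4 from dividing by g >= 1/2; three terms bounded by B then give 972.\<close>
 define B' where "B' = 972 * B"
 define c where "c = 1 / (2 * (2 * B') powr (1 / (p - 1)))"
 have B': "1 <= B'" using B by (simp add: B'_def)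
 have c: "0 < c" unfolding c_def using B' by simp
 define k where "k = (1 / c) powr (1 - 1/p)"
 have k: "0 < k" unfolding k_def using c by simp
 define C where "C = 20 + 8 * k + 128000000 * B"
 have Cpos: "0 < C" unfolding C_def using k B by (intro add_pos_pos) auto
 have C8: "8 <= C" "8 * k <= C" "4 + 128000000 * B <= C" using k B unfolding C_def by auto
 have main: "\<P>(w in PiM J (%_. N). plugin_excess X (%y. X y + G y) J z w)
   <= 2 * Q z + C * (card J powr (1 - s/2) + card J powr (- (1/2)) + ((1 + ln (card J)) / card J) powr (1 - 1/p) + r)"
  if h: "iid_moment N X s B" and J: "finite J" "J ~= {}" and z: "0 <= z" and r: "0 < r"
   and X2p: "integrable N (%y. abs (X y) powr (2 * p))" "(LINT y|N. abs (X y) powr (2 * p)) <= B"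
   and Gm: "G \<in> borel_measurable N" and G2: "integrable N (%y. (G y)^2)" "(LINT y|N. (G y)^2) <= r^2"
   and G2p: "integrable N (%y. abs (G y) powr (2 * p))" "(LINT y|N. abs (G y) powr (2 * p)) <= B * r powr (2 * p)"
  for N :: "'b measure" and X G J z r
 proof -
  interpret iid_moment N X s B by fact
  interpret A: prob_space "PI J" by (rule prob_space_PI)
  have cJ: "1 <= card J" using J by (simp add: Suc_le_eq card_gt_0_iff)
  define m where "m = real (card J)"
  have m: "1 <= m" using cJ by (simp add: m_def)
  define rt where "rt = ((1 + ln m) / m) powr (1 - 1/p)"
  define e where "e = k * rt"
  define v where "v = m powr (- (1/2))"
  define t where "t = 2 * r + e + v"
  define rhs where "rhs = m powr (1 - s/2) + v + rt + r"
  have l: "1 <= 1 + ln m" using m by simp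
  have "0 < (1 + ln m) / m" using l m by (intro divide_pos_pos; linarith)
  hence rt: "0 < rt" unfolding rt_def by (simp only: powr_gt_zero)
  have e: "0 < e" unfolding e_def using k rt by simp
  have v: "0 < v" unfolding v_def using m by simp
  have ms: "0 <= m powr (1 - s/2)" by simp
  show ?thesis
  proof (cases "t <= 1/2")
   case False
   have "\<P>(w in PI J. plugin_excess X (%y. X y + G y) J z w) <= 1" by (rule A.prob_le_1)
   also have "1 <= 2 * t" using False by simp
   also have "... = 4 * r + 2 * k * rt + 2 * v" by (simp add: t_def e_def)
   also have "... <= C * r + C * rt + C * v"
    using C8 r rt v k by (intro add_mono mult_right_mono) auto
   also have "... <= C * rhs" unfolding rhs_def using ms Cpos by (simp add: algebra_simps)
   finally show ?thesis using Q_nonneg[of z] unfolding rhs_def rt_def v_def m_def by linarith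
  next
   case True
   define U where "U = (%y. X y + G y)"
   have iG: "integrable N G"
   proof (rule Bintegrable_bound)
    show "integrable N (%y. 1 + (G y)^2)" using G2 by simp
    show "AE y in N. norm (G y) <= norm (1 + (G y)^2)" using abs_le_sq by (intro AE_I2) simp
   qed (rule Gm)
   have iXG: "integrable N (%y. X y * G y)"
   proof (rule Bintegrable_bound)
    show "integrable N (%y. (X y)^2 + (G y)^2)" using G2 X_sq by simp
    show "AE y in N. norm (X y * G y) <= norm ((X y)^2 + (G y)^2)"
    proof (rule AE_I2)
    fix y
    have "2 * abs (X y) * abs (G y) <= abs (X y)^2 + abs (G y)^2" by (rule sum_squares_bound)
    hence "2 * abs (X y * G y) <= (X y)^2 + (G y)^2" by (simp add: abs_mult)
    thus "norm (X y * G y) <= norm ((X y)^2 + (G y)^2)"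
    unfolding real_norm_def using abs_ge_zero[of "X y * G y"] abs_ge_self[of "(X y)^2 + (G y)^2"] by linarith
    qed
   qed (use Gm in measurable)
   have iU: "integrable N U" unfolding U_def using X_mean iG by simp
   have U2e: "(U y)^2 = (X y)^2 + (2 * (X y * G y) + (G y)^2)" for y
    unfolding U_def by (simp add: sq_simps)
   have iU2: "integrable N (%y. (U y)^2)" unfolding U2e using X_sq iXG G2 by simp
   define j where "j = integral\<^sup>L N U"
   have \<mu>G: "j = integral\<^sup>L N G" unfolding j_def U_def using X_mean iG by simp
   define g where "g = (LINT y|N. (U y)^2) - j^2"
   have var\<tau>: "(LINT y|N. (U y - j)^2) = g" unfolding g_def j_def by (rule variance_eq[OF iU iU2])
   have r4: "r <= 1/4" using True r e v unfolding t_def by linarith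
   have \<mu>sq: "j^2 <= (LINT y|N. (G y)^2)"
   proof -
    have "0 <= (LINT y|N. (G y - j)^2)" by simp
    also have "... = (LINT y|N. (G y)^2) - j^2" unfolding \<mu>G by (rule variance_eq[OF iG G2(1)])
    finally show ?thesis by simp
   qed
   have \<mu>r: "abs j <= r"
   proof (rule power2_le_imp_le)
    show "abs j^2 <= r^2" using \<mu>sq G2(2) by simp
   qed (use r in simp)
   \<comment> \<open>The cross term is bounded below by -2 * X * G <= r * X^2 + G^2 / r, with mean
     at most 2 * r, and the squared mean of G never exceeds its second moment.\<close>
   have \<tau>low: "1 - 2 * r <= g"
   proof -
    have "(LINT y|N. - (r * (X y)^2 + (G y)^2 / r)) <= (LINT y|N. 2 * (X y * G y))"
    proof (rule integral_mono)
    fix y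
    have "0 <= (r * X y + G y)^2" by simp
    hence "- (2 * r * (X y * G y)) <= r * r * (X y)^2 + (G y)^2" by (simp add: sq_simps)
    hence "- (2 * (X y * G y)) <= r * (X y)^2 + (G y)^2 / r" using r by (simp add: field_simps power2_eq_square)
    thus "- (r * (X y)^2 + (G y)^2 / r) <= 2 * (X y * G y)" by simp
    qed (use X_sq G2 iXG in auto)
    moreover have "(LINT y|N. - (r * (X y)^2 + (G y)^2 / r)) = - (r + (LINT y|N. (G y)^2) / r)" using X_sq G2 by simp
    moreover have "(LINT y|N. (G y)^2) / r <= r" using G2(2) r by (simp add: divide_le_eq power2_eq_square)
    ultimately have "- 2 * r <= (LINT y|N. 2 * (X y * G y))" by linarith
    moreover have "(LINT y|N. (U y)^2) = 1 + ((LINT y|N. 2 * (X y * G y)) + (LINT y|N. (G y)^2))"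
    unfolding U2e using X_sq iXG G2 by simp
    ultimately show ?thesis unfolding g_def using \<mu>sq by linarith
   qed
   have \<tau>half: "1/2 <= g" using \<tau>low r4 by linarith
   define Y where "Y = (%y. (U y - j)^2 / g)"
   have iUm: "integrable N (%y. (U y - j)^2)"
   proof -
    have "(U y - j)^2 = (U y)^2 - 2 * j * U y + j^2" for y by (simp add: sq_simps)
    thus ?thesis using iU iU2 by simp
   qed
   have [measurable]: "U \<in> borel_measurable N" using iU by auto
   have iY: "integrable N Y" "integral\<^sup>L N Y = 1" unfolding Y_def using iUm var\<tau> \<tau>half by auto
   have Yp: "Y y powr p <= 324 * (abs (X y) powr (2*p) + abs (G y) powr (2*p) + 1)" for y
   proof -
    have "(U y - j)\<^sup>2 powr p = abs (U y - j) powr (2 * p)"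
    proof (cases "U y - j = 0")
    case False
    hence e: "(U y - j)^2 = abs (U y - j) powr 2" by (subst powr_numeral) auto
    show ?thesis unfolding e powr_powr by simp
    qed simp
    also have "... <= (abs (X y) + abs (G y) + abs j) powr (2 * p)" using p unfolding U_def by (intro powr_mono2) auto
    also have "... <= 81 * (abs (X y) powr (2*p) + abs (G y) powr (2*p) + abs j powr (2*p))" using p by (intro powr_sum3) auto
    also have "abs j powr (2*p) <= 1" using \<mu>r r4 p by (intro powr_le1) auto
    finally have 1: "(U y - j)\<^sup>2 powr p <= 81 * (abs (X y) powr (2*p) + abs (G y) powr (2*p) + 1)" by simp
    have "Y y powr p <= ((U y - j)^2 / (1/2)) powr p"
    unfolding Y_def using \<tau>half p by (intro powr_mono2 frac_le) auto
    also have "... = (U y - j)\<^sup>2 powr p * 2 powr p" by (simp add: powr_mult)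
    also have "2 powr p <= (2::real) powr 2" using p by (intro powr_mono) auto
    also have "(U y - j)\<^sup>2 powr p * 2 powr 2 <= 81 * (abs (X y) powr (2*p) + abs (G y) powr (2*p) + 1) * 4"
    using 1 by simp
    finally show ?thesis by (simp add: mult_left_mono)
   qed
   have iYp: "integrable N (%y. Y y powr p)"
   proof (rule Bintegrable_bound)
    show "integrable N (%y. 324 * (abs (X y) powr (2*p) + abs (G y) powr (2*p) + 1))" using X2p G2p by simp
    show "AE y in N. norm (Y y powr p) <= norm (324 * (abs (X y) powr (2*p) + abs (G y) powr (2*p) + 1))"
    using Yp by (intro AE_I2) (auto intro: order_trans[OF _ abs_ge_self])
   qed (unfold Y_def, measurable)
   have EYp: "(LINT y|N. Y y powr p) <= B'"
   proof -
    have "(LINT y|N. Y y powr p) <= (LINT y|N. 324 * (abs (X y) powr (2*p) + abs (G y) powr (2*p) + 1))"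
    using X2p G2p Yp by (intro integral_mono iYp) auto
    also have "... = 324 * ((LINT y|N. abs (X y) powr (2*p)) + (LINT y|N. abs (G y) powr (2*p)) + 1)" using X2p G2p prob_space by simp
    also have "(LINT y|N. abs (G y) powr (2*p)) <= B"
    proof -
    have "r powr (2*p) <= 1" using r r4 p by (intro powr_le1) auto
    hence "B * r powr (2*p) <= B * 1" using B by (intro mult_left_mono) auto
    thus ?thesis using G2p(2) by simp
    qed
    finally have "(LINT y|N. Y y powr p) <= 324 * ((LINT y|N. abs (X y) powr (2*p)) + B + 1)" by simp
    also have "324 * (a + B + 1) <= B'" if "a <= B" for a using that B unfolding B'_def by simp
    note this[OF X2p(2)]
    finally show ?thesis .
   qed
   \<comment> \<open>By its choice e satisfies c * m * e^(p/(p-1)) = 1 + ln m, so the exponential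
     bound is below m^(-1) and hence below v.\<close>
   have low: "\<P>(w in PI J. SS Y J w <= m * (1 - e)) <= v"
   proof -
    have "\<P>(w in PI J. SS Y J w <= m * (1 - e))
    <= exp (- (m * (e powr (p / (p - 1)) / (2 * (2 * B') powr (1 / (p - 1))))))"
    unfolding m_def
    proof (rule lower_tail[OF J(1) _ _ iY p iYp EYp B' e])
    show "Y \<in> borel_measurable N" unfolding Y_def by measurable
    show "0 <= Y y" for y unfolding Y_def using \<tau>half by simp
    qed
    also have "m * (e powr (p / (p - 1)) / (2 * (2 * B') powr (1 / (p - 1)))) = 1 + ln m"
    proof -
    have "e = ((1 + ln m) / (c * m)) powr (1 - 1/p)"
    unfolding e_def k_def rt_def using c m l by (simp add: powr_mult[symmetric] field_simps)
    hence "e powr (p / (p - 1)) = ((1 + ln m) / (c * m)) powr ((1 - 1/p) * (p / (p - 1)))" by (simp add: powr_powr)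
    also have "(1 - 1/p) * (p / (p - 1)) = 1" using p by (simp add: field_simps)
    finally have "e powr (p / (p - 1)) = (1 + ln m) / (c * m)" using c m l by simp
    moreover have "1 / (2 * (2 * B') powr (1 / (p - 1))) = c" by (simp add: c_def)
    ultimately have "m * (e powr (p / (p - 1)) * (1 / (2 * (2 * B') powr (1 / (p - 1))))) = m * ((1 + ln m) / (c * m) * c)" by (simp only:)
    thus ?thesis using c m by simp
    qed
    also have "exp (- (1 + ln m)) <= exp (- (1/2 * ln m))" using ln_ge_zero[OF m] by simp
    also have "... = v" unfolding v_def using m by (simp add: powr_def)
    finally show ?thesis .
   qed
   define f where "f = (%y. U y - j)"
   have if': "integrable N f" "integral\<^sup>L N f = 0" unfolding f_def using iU prob_space by (auto simp: j_def)
   have if2: "integrable N (%y. (f y)^2)" unfolding f_def by (rule iUm)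
   note Ef = E_SS_sq_L2[OF J(1) if'(1) if2 if'(2)]
   have [measurable]: "f \<in> borel_measurable N" using if' by auto
   have mS: "SS X J \<in> borel_measurable (PI J)" "SS f J \<in> borel_measurable (PI J)" "SS Y J \<in> borel_measurable (PI J)"
    "SS U J \<in> borel_measurable (PI J)" "SS (%y. (U y)^2) J \<in> borel_measurable (PI J)"
    using iY by auto
   note [measurable] = mS
   let ?E = "{w \<in> space (PI J). plugin_excess X (%y. X y + G y) J z w}"
   have "measure (PI J) ?E <= (LINT w|PI J. (if z * (1 - t) < abs (SS X J w) / sqrt m then 1 else 0)
    + ((if SS Y J w <= m * (1 - e) then 1 else 0) + (SS f J w)^2 / (m * m * v * g)))"
   proof (rule A.measure_le_integral)
    show "?E \<in> A.events" unfolding plugin_excess_def U_def[symmetric] by measurable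
    have b: "bm (PI J) (%w. if z * (1 - t) < abs (SS X J w) / sqrt m then 1 else 0)"
    "bm (PI J) (%w. if SS Y J w <= m * (1 - e) then 1 else 0)"
    by (intro bm_if pred_less pred_le; measurable)+
    show "integrable (PI J) (%w. (if z * (1 - t) < abs (SS X J w) / sqrt m then 1 else 0)
    + ((if SS Y J w <= m * (1 - e) then 1 else 0) + (SS f J w)^2 / (m * m * v * g)))"
    using Ef(1) by (intro Bintegrable_add int_PI[OF b(1)] int_PI[OF b(2)] integrable_divide)
    fix w
    have den: "0 < m * m * v * g" using m v \<tau>half by simp
    have third: "0 <= (SS f J w)^2 / (m * m * v * g)" using den by simp
    show "indicator ?E w <= (if z * (1 - t) < abs (SS X J w) / sqrt m then 1 else 0)
    + ((if SS Y J w <= m * (1 - e) then 1 else 0) + (SS f J w)^2 / (m * m * v * g))"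
    proof (cases "w \<notin> ?E \<or> SS Y J w <= m * (1 - e) \<or> m * m * v * g <= (SS f J w)^2")
    case T: True
    thus ?thesis
    proof (elim disjE)
    assume "m * m * v * g <= (SS f J w)^2"
    hence "1 <= (SS f J w)^2 / (m * m * v * g)" using den by (simp add: le_divide_eq)
    moreover have "indicator ?E w <= (1::real)" by (simp add: indicator_def)
    moreover have "0 <= (if z * (1 - t) < abs (SS X J w) / sqrt m then 1 else (0::real))"
    "0 <= (if SS Y J w <= m * (1 - e) then 1 else (0::real))" by auto
    ultimately show ?thesis by linarith
    qed (use third in \<open>auto simp: indicator_def\<close>)
    next
    case F: False
    \<comment> \<open>Centring at the population mean j separates a sum of nonnegative terms,
      handled by the left tail, from the square of a centred sum, handled by Chebyshev's
      inequality.\<close>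
    have id: "SS (%y. (U y)^2) J w - (SS U J w)^2 / m = g * SS Y J w - (SS f J w)^2 / m"
    proof -
    have 1: "SS f J w = SS U J w - m * j" unfolding f_def SS_def m_def by (simp add: sum_subtractf)
    have "g * SS Y J w = SS (%y. (U y - j)^2) J w"
    unfolding Y_def SS_def using \<tau>half by (simp add: sum_distrib_left)
    also have "... = SS (%y. (U y)^2) J w - 2 * j * SS U J w + m * j^2"
    unfolding SS_def m_def
    by (simp add: power2_diff sum.distrib sum_subtractf sum_distrib_left mult_ac)
    finally have "g * SS Y J w = SS (%y. (U y)^2) J w - 2 * j * SS U J w + m * j^2" .
    moreover have "(SS U J w - m * j)^2 / m = (SS U J w)^2 / m - 2 * j * SS U J w + m * j^2"
    using m by (simp add: sq_field_simps)
    ultimately show ?thesis unfolding 1 by linarith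
    qed
    have "m * (1 - t) <= g * SS Y J w - (SS f J w)^2 / m"
    proof -
    have e1: "e + v <= 1" using True r unfolding t_def by linarith
    have "g * (m * (1 - e)) <= g * SS Y J w" using F \<tau>half by (intro mult_left_mono) auto
    moreover have "(SS f J w)^2 / m <= m * v * g" using F m by (simp add: divide_le_eq mult_ac)
    moreover have "g * (m * (1 - e)) - m * v * g = m * (g * (1 - e - v))" by (simp add: algebra_simps)
    moreover have "m * (1 - t) <= m * (g * (1 - e - v))"
    proof (rule mult_left_mono)
    have "(1 - 2 * r) * (1 - e - v) <= g * (1 - e - v)" using \<tau>low e1 by (intro mult_right_mono) auto
    moreover have "1 - t <= (1 - 2 * r) * (1 - e - v)"
    proof -
    have "0 <= r * (e + v)" using r e v by simp
    thus ?thesis unfolding t_def by (simp add: algebra_simps)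
    qed
    ultimately show "1 - t <= g * (1 - e - v)" by linarith
    qed (use m in simp)
    ultimately show ?thesis by linarith
    qed
    hence "z^2 * (m * (1 - t)) <= z^2 * (SS (%y. (U y)^2) J w - (SS U J w)^2 / m)"
    unfolding id by (intro mult_left_mono) auto
    also have "... < (SS X J w)^2" using F unfolding plugin_excess_def U_def[symmetric] m_def[symmetric] by simp
    finally have 1: "z^2 * (m * (1 - t)) < (SS X J w)^2" .
    \<comment> \<open>The threshold factor sqrt (1 - t) is weakened to 1 - t, for which
      \<open>Q_shrink\<close> is stated.\<close>
    have "(z * (1 - t) * sqrt m)^2 = z^2 * (m * (1 - t)) * (1 - t)" using m by (simp add: power_mult_distrib power2_eq_square)
    also have "... <= z^2 * (m * (1 - t)) * 1"
    using True m r e v by (intro mult_left_mono) (auto simp: t_def)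
    finally have "(z * (1 - t) * sqrt m)^2 < abs (SS X J w)^2" using 1 by simp
    hence "z * (1 - t) * sqrt m < abs (SS X J w)" by (rule power2_less_imp_less) simp
    hence "z * (1 - t) < abs (SS X J w) / sqrt m" using m by (simp add: less_divide_eq)
    thus ?thesis using third by (auto simp: indicator_def)
    qed
   qed
   also have "... = \<P>(w in PI J. z * (1 - t) < abs (SS X J w) / sqrt m)
    + (\<P>(w in PI J. SS Y J w <= m * (1 - e)) + (m * g) / (m * m * v * g))"
   proof -
    have "bm (PI J) (%w. if z * (1 - t) < abs (SS X J w) / sqrt m then 1 else 0)"
    "bm (PI J) (%w. if SS Y J w <= m * (1 - e) then 1 else 0)"
    by (intro bm_if pred_less pred_le; measurable)+
    hence i: "integrable (PI J) (%w. if z * (1 - t) < abs (SS X J w) / sqrt m then 1 else (0::real))"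
    "integrable (PI J) (%w. if SS Y J w <= m * (1 - e) then 1 else (0::real))" by (auto intro: int_PI)
    have i3: "integrable (PI J) (%w. (SS f J w)^2 / (m * m * v * g))" using Ef(1) by simp
    have "(LINT w|PI J. (SS f J w)^2 / (m * m * v * g)) = (m * g) / (m * m * v * g)"
    using Ef(2) var\<tau> unfolding f_def m_def by simp
    thus ?thesis unfolding integral_if_pred[symmetric] using i i3
    by (simp only: Bintegral_add Bintegrable_add)
   qed
   also have "... <= (2 * Q (z * (1 - t)) + 128000000 * (B * m powr (1 - s/2))) + (v + v)"
   proof (intro add_mono low)
    show "\<P>(w in PI J. z * (1 - t) < abs (SS X J w) / sqrt m) <= 2 * Q (z * (1 - t)) + 128000000 * (B * m powr (1 - s/2))"
    unfolding m_def using Berry_Esseen_two_sided[OF J, of "z * (1 - t)"] z True by simp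
    have "(m * g) / (m * m * v * g) = 1 / (m * v)" using m \<tau>half by simp
    also have "m * v = m powr (1/2)"
    proof -
    have "m * v = m powr 1 * m powr (- (1/2))" unfolding v_def using m by simp
    thus ?thesis by (simp only: powr_add[symmetric]) simp
    qed
    also have "1 / m powr (1/2) = v" unfolding v_def by (simp add: powr_minus_divide)
    finally show "(m * g) / (m * m * v * g) <= v" by simp
   qed
   also have "Q (z * (1 - t)) <= Q z + 2 * t" using z True r e v by (intro Q_shrink) (auto simp: t_def)
   finally have "measure (PI J) ?E <= 2 * Q z + 4 * t + 128000000 * B * m powr (1 - s/2) + 2 * v" by simp
   also have "... = 2 * Q z + (8 * r + 4 * k * rt + 6 * v + 128000000 * B * m powr (1 - s/2))"
    by (simp add: t_def e_def algebra_simps)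
   also have "... <= 2 * Q z + (C * r + C * rt + C * v + C * m powr (1 - s/2))"
    using C8 k r rt v B by (intro add_left_mono add_mono mult_right_mono) auto
   also have "... = 2 * Q z + C * rhs" by (simp add: rhs_def algebra_simps)
   finally show ?thesis unfolding rhs_def rt_def v_def m_def .
  qed
 qed
 show ?thesis using Cpos main by blast
qed

subsection \<open>Non-coverage as an event on scores\<close>

lemma mat_mean_form:
 assumes F: "!!i j k. i \<in> I ==> j < d ==> k < d ==> F i $$ (j, k) = a i j * a i k" and u: "u \<in> carrier_vec d"
 shows "mat_mean d I F \<in> carrier_mat d d" "transpose_mat (mat_mean d I F) = mat_mean d I F"
  "u \<bullet> (mat_mean d I F *\<^sub>v u) = (\<Sum>i\<in>I. (\<Sum>j<d. u $ j * a i j)^2) / card I"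
proof -
 show c: "mat_mean d I F \<in> carrier_mat d d" by (simp add: mat_mean_def)
 have e: "mat_mean d I F $$ (j, k) = (\<Sum>i\<in>I. a i j * a i k) / card I" if "j < d" "k < d" for j k
  using that F by (simp add: mat_mean_def cong: sum.cong)
 show "transpose_mat (mat_mean d I F) = mat_mean d I F"
  using c e by (intro eq_matI) (auto simp: mult.commute)
 have "u \<bullet> (mat_mean d I F *\<^sub>v u) = (\<Sum>j<d. u $ j * (\<Sum>k<d. ((\<Sum>i\<in>I. a i j * a i k) / card I) * u $ k))"
  unfolding scalar_prod_sum[OF mult_vec_carrier[OF c u]]
  using mult_vec_sum[OF c u] e by (intro sum.cong refl) (simp del: index_mult_mat_vec)
 also have "... = (\<Sum>j<d. \<Sum>k<d. \<Sum>i\<in>I. u $ j * a i j * (u $ k * a i k)) / card I"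
  by (simp add: sum_distrib_left sum_divide_distrib sum_distrib_right mult_ac)
 also have "(\<Sum>j<d. \<Sum>k<d. \<Sum>i\<in>I. u $ j * a i j * (u $ k * a i k)) = (\<Sum>i\<in>I. \<Sum>j<d. \<Sum>k<d. u $ j * a i j * (u $ k * a i k))"
  by (subst sum.swap[of _ I]) (intro sum.cong refl sum.swap)
 also have "... = (\<Sum>i\<in>I. (\<Sum>j<d. u $ j * a i j)^2)" by (simp add: power2_eq_square sum_product)
 finally show "u \<bullet> (mat_mean d I F *\<^sub>v u) = (\<Sum>i\<in>I. (\<Sum>j<d. u $ j * a i j)^2) / card I" .
qed

text \<open>Over the extended reals a vanishing denominator gives an infinite ratio for a positive
  numerator and 0 otherwise. Rejection therefore implies a strict inequality after multiplying out,
  also in the degenerate case.\<close>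

lemma t_ratio_gt:
 assumes A: "A \<in> carrier_mat d d" "transpose_mat A = A" and V: "V \<in> carrier_mat d d" and p: "p \<in> carrier_vec d"
  and v: "v \<in> carrier_vec d" and z: "0 <= z" and nn: "!!u. u \<in> carrier_vec d ==> 0 <= u \<bullet> (V *\<^sub>v u)"
  and gt: "\<not> t_ratio m v A p V <= ereal z"
 shows "z^2 * ((A *\<^sub>v v) \<bullet> (V *\<^sub>v (A *\<^sub>v v))) < m * ((A *\<^sub>v v) \<bullet> p)^2"
proof -
 define w where "w = A *\<^sub>v v"
 have w: "w \<in> carrier_vec d" unfolding w_def by (rule mult_vec_carrier[OF A(1) v])
 have n: "v \<bullet> (A *\<^sub>v p) = w \<bullet> p" unfolding w_def by (rule self_adjoint[OF A v p, symmetric])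
 have Vw: "V *\<^sub>v w \<in> carrier_vec d" by (rule mult_vec_carrier[OF V w])
 have "(A * V * A) *\<^sub>v v = A *\<^sub>v (V *\<^sub>v w)"
  unfolding w_def using A(1) V v
  by (simp add: assoc_mult_mat_vec[of _ d d _ d])
 hence b: "v \<bullet> ((A * V * A) *\<^sub>v v) = w \<bullet> (V *\<^sub>v w)"
  using self_adjoint[OF A v Vw] unfolding w_def[symmetric] by simp
 define b a where "b = w \<bullet> (V *\<^sub>v w)" and "a = sqrt (real m) * abs (w \<bullet> p)"
 have b0: "0 <= b" unfolding b_def by (rule nn[OF w])
 have a0: "0 <= a" unfolding a_def by simp
 have gt': "\<not> ereal a / ereal (sqrt b) <= ereal z" using gt unfolding t_ratio_def n \<open>v \<bullet> ((A * V * A) *\<^sub>v v) = w \<bullet> (V *\<^sub>v w)\<close> a_def b_def .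
 have "z * sqrt b < a"
 proof (cases "b = 0")
  case True
  have "a ~= 0" using gt' z True by (auto simp: zero_ereal_def[symmetric])
  thus ?thesis using True a0 by simp
 next
  case False
  hence "0 < sqrt b" using b0 by simp
  moreover have "\<not> a / sqrt b <= z" using gt' False b0 by simp
  ultimately show ?thesis by (simp add: divide_le_eq not_le)
 qed
 hence "(z * sqrt b)^2 < a^2" using z b0 by (intro power_strict_mono) auto
 thus ?thesis using b0 unfolding w_def[symmetric] b_def[symmetric] a_def by (simp add: power_mult_distrib)
qed

lemma mult_zero_vec: "A \<in> carrier_mat d d ==> A *\<^sub>v 0\<^sub>v d = (0\<^sub>v d :: real vec)"
 by (intro eq_vecI) auto

lemma zero_mult_vec: "v \<in> carrier_vec d ==> 0\<^sub>m d d *\<^sub>v v = (0\<^sub>v d :: real vec)"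
 by (intro eq_vecI) auto

lemma SS_cong: "(!!i. i \<in> J ==> f (x i) = g (y i)) ==> SS f J x = SS g J y"
 unfolding SS_def by (rule sum.cong) auto

lemma dot_add: "u \<in> carrier_vec d ==> w \<in> carrier_vec d ==> dot d (u + w) x = dot d u x + dot d w x"
 unfolding dot_def by (simp add: sum.distrib distrib_right)

context regression
begin

definition score :: "real vec => real vec => real vec \<times> real => real" where
 "score t v z = - (snd z - dot d t (fst z)) * dot d v (fst z)"

lemma score_beta0: "score (beta0 d P) v = W v"
 by (simp add: score_def W_def res_def fun_eq_iff)

definition on :: "nat set => (nat => real vec \<times> real) => bool" where
 "on I D \<longleftrightarrow> finite I \<and> I ~= {} \<and> (\<forall>i\<in>I. fst (D i) \<in> carrier_vec d)"

lemma on_card: "on I D ==> 0 < card I" by (simp add: on_def card_gt_0_iff)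

lemma psi_entry: "on I D ==> i \<in> I ==> t \<in> carrier_vec d ==> j < d ==> psi (D i) t $ j = - (snd (D i) - dot d t (fst (D i))) * fst (D i) $ j"
 unfolding psi_def on_def by (auto simp: dot_eq dot_comm[of d t])

lemma psi_carrier: "on I D ==> i \<in> I ==> psi (D i) t \<in> carrier_vec d"
 unfolding psi_def on_def by auto

lemma dot_psi:
 assumes "on I D" "i \<in> I" "t \<in> carrier_vec d"
 shows "(\<Sum>j<d. v $ j * psi (D i) t $ j) = score t v (D i)"
 using psi_entry[OF assms] unfolding score_def dot_def[of d v] by (simp add: sum_distrib_left mult_ac)

lemma psi_bar_carrier: "psi_bar d I D t \<in> carrier_vec d"
 by (simp add: psi_bar_def vec_mean_def)

lemma dot_psi_bar:
 assumes D: "on I D" and t: "t \<in> carrier_vec d"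
 shows "(\<Sum>j<d. v $ j * psi_bar d I D t $ j) = SS (score t v) I D / card I"
proof -
 have "(\<Sum>j<d. v $ j * psi_bar d I D t $ j) = (\<Sum>j<d. \<Sum>i\<in>I. v $ j * psi (D i) t $ j) / card I"
  by (simp add: psi_bar_def vec_mean_def sum_distrib_left sum_divide_distrib)
 also have "(\<Sum>j<d. \<Sum>i\<in>I. v $ j * psi (D i) t $ j) = (\<Sum>i\<in>I. score t v (D i))"
  using dot_psi[OF D _ t] by (subst sum.swap) (simp cong: sum.cong)
 finally show ?thesis by (simp add: SS_def)
qed

lemma V_hat_form:
 assumes D: "on I D" and t: "t \<in> carrier_vec d" and u: "u \<in> carrier_vec d"
 shows "V_hat d I D t \<in> carrier_mat d d"
  "u \<bullet> (V_hat d I D t *\<^sub>v u) = (SS (%z. (score t u z)^2) I D - (SS (score t u) I D)^2 / card I) / card I"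
  "0 <= u \<bullet> (V_hat d I D t *\<^sub>v u)"
proof -
 define a where "a = (%i j. psi (D i) t $ j - psi_bar d I D t $ j)"
 define F where "F = (%i. outer (psi (D i) t - psi_bar d I D t) (psi (D i) t - psi_bar d I D t))"
 have F: "F i $$ (j, k) = a i j * a i k" if "i \<in> I" "j < d" "k < d" for i j k
  using psi_carrier[OF D that(1), of t] psi_bar_carrier[of I D t] that unfolding F_def outer_def a_def by auto
 have VF: "V_hat d I D t = mat_mean d I F" unfolding V_hat_def F_def ..
 note mf = mat_mean_form[of I d F a u, OF F u]
 show "V_hat d I D t \<in> carrier_mat d d" unfolding VF by (rule mf(1))
 define m S where "m = real (card I)" and "S = SS (score t u) I D"
 have m: "0 < m" using on_card[OF D] by (simp add: m_def)
 have au: "(\<Sum>j<d. u $ j * a i j) = score t u (D i) - S / m" if "i \<in> I" for i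
  unfolding a_def S_def m_def using dot_psi[OF D that t, of u] dot_psi_bar[OF D t, of u]
  by (simp add: right_diff_distrib sum_subtractf)
 have "(\<Sum>i\<in>I. (\<Sum>j<d. u $ j * a i j)^2) = (\<Sum>i\<in>I. (score t u (D i) - S / m)^2)"
  by (intro sum.cong refl) (simp only: au)
 hence f: "u \<bullet> (V_hat d I D t *\<^sub>v u) = (\<Sum>i\<in>I. (score t u (D i) - S / m)^2) / m"
  using mf(3) unfolding VF m_def[symmetric] by simp
 show "0 <= u \<bullet> (V_hat d I D t *\<^sub>v u)" unfolding f using m by (intro divide_nonneg_pos sum_nonneg) auto
 have "(\<Sum>i\<in>I. (score t u (D i) - S / m)^2) = SS (%z. (score t u z)^2) I D - 2 * (S / m) * S + m * (S / m)^2"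
 proof -
  have gen: "(\<Sum>i\<in>I. (g i - c)^2) = (\<Sum>i\<in>I. (g i)^2) - 2 * c * (\<Sum>i\<in>I. g i) + real (card I) * c^2" for g :: "nat => real" and c
  proof -
   have "(g i - c)^2 = (g i)^2 - 2 * c * g i + c^2" for i by (simp add: power2_diff)
   thus ?thesis by (simp only: sum.distrib sum_subtractf sum_distrib_left[symmetric] sum_constant)
  qed
  show ?thesis using gen[of "%i. score t u (D i)" "S / m"] unfolding SS_def S_def m_def .
 qed
 also have "... = SS (%z. (score t u z)^2) I D - S^2 / m" using m by (simp add: sq_field_simps)
 finally show "u \<bullet> (V_hat d I D t *\<^sub>v u) = (SS (%z. (score t u z)^2) I D - (SS (score t u) I D)^2 / card I) / card I"
  unfolding f m_def S_def by simp
qed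

lemma Sigma_hat_form:
 assumes D: "on I D" and u: "u \<in> carrier_vec d"
 shows "Sigma_hat d I D \<in> carrier_mat d d" "transpose_mat (Sigma_hat d I D) = Sigma_hat d I D"
  "u \<bullet> (Sigma_hat d I D *\<^sub>v u) = SS (%z. (dot d u (fst z))^2) I D / card I"
proof -
 have F: "outer (fst (D i)) (fst (D i)) $$ (j, k) = fst (D i) $ j * fst (D i) $ k" if "i \<in> I" "j < d" "k < d" for i j k
  using D that unfolding outer_def on_def by auto
 note mf = mat_mean_form[OF F u, folded Sigma_hat_def]
 show "Sigma_hat d I D \<in> carrier_mat d d" "transpose_mat (Sigma_hat d I D) = Sigma_hat d I D"
  "u \<bullet> (Sigma_hat d I D *\<^sub>v u) = SS (%z. (dot d u (fst z))^2) I D / card I"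
  using mf by (auto simp: SS_def dot_def)
qed

text \<open>The direction Sigma_hat^(-1) v in which the scores of the other half are summed; it
  depends on the data in I only, so conditioning on them freezes it.\<close>

definition dir :: "nat set => real vec => (nat => real vec \<times> real) => real vec" where
 "dir I v D = minv (Sigma_hat d I D) *\<^sub>v v"

lemma minv_Sigma_hat:
 assumes D: "on I D"
 shows "minv (Sigma_hat d I D) \<in> carrier_mat d d" "transpose_mat (minv (Sigma_hat d I D)) = minv (Sigma_hat d I D)"
 using Sigma_hat_form[OF D zero_carrier_vec] minv_carrier minv_symmetric by auto

lemma dir_carrier: "on I D ==> v \<in> carrier_vec d ==> dir I v D \<in> carrier_vec d"
 unfolding dir_def by (rule mult_vec_carrier[OF minv_Sigma_hat(1)])

lemma t_ratio_excess:
 assumes D: "on I1 D" "on I2 D" and v: "v \<in> carrier_vec d" and z: "0 <= z" and t: "t \<in> carrier_vec d"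
  and gt: "\<not> t_ratio (card I1) v (minv (Sigma_hat d I2 D)) (psi_bar d I1 D (beta0 d P)) (V_hat d I1 D t) <= ereal z"
 shows "plugin_excess (W (dir I2 v D)) (score t (dir I2 v D)) I1 z D"
proof -
 define w where "w = dir I2 v D"
 have w: "w \<in> carrier_vec d" unfolding w_def by (rule dir_carrier[OF D(2) v])
 define m where "m = real (card I1)"
 have m: "0 < m" using on_card[OF D(1)] by (simp add: m_def)
 have "z^2 * (w \<bullet> (V_hat d I1 D t *\<^sub>v w)) < m * (w \<bullet> psi_bar d I1 D (beta0 d P))^2"
  unfolding w_def dir_def m_def
  using t_ratio_gt[OF minv_Sigma_hat[OF D(2)] V_hat_form(1)[OF D(1) t v] psi_bar_carrier v z V_hat_form(3)[OF D(1) t] gt] .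
 also have "w \<bullet> psi_bar d I1 D (beta0 d P) = SS (W w) I1 D / m"
  unfolding scalar_prod_sum[OF psi_bar_carrier] dot_psi_bar[OF D(1) beta0_carrier] score_beta0 m_def ..
 also have "m * (SS (W w) I1 D / m)^2 = (SS (W w) I1 D)^2 / m" using m by (simp add: power2_eq_square)
 finally have "z^2 * (SS (%z. (score t w z)^2) I1 D - (SS (score t w) I1 D)^2 / m) / m < (SS (W w) I1 D)^2 / m"
  unfolding V_hat_form(2)[OF D(1) t w] m_def[symmetric] by simp
 thus ?thesis unfolding plugin_excess_def w_def[symmetric] m_def[symmetric] using m by (simp only: divide_less_cancel)
qed

lemma plugin_self:
 assumes "plugin_excess X X J z w" shows "self_normalised_excess X J z w"
 using assms unfolding plugin_excess_def self_normalised_excess_def by (simp add: algebra_simps)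

lemma T_SeN_excess:
 assumes D: "on I1 D" "on I2 D" and z: "0 <= z"
  and gt: "\<not> T_SeN d I1 D (beta0 d P) (minv (Sigma_hat d I2 D)) <= ereal z"
 obtains j where "j < d" "self_normalised_excess (W (dir I2 (unit_vec d j) D)) I1 z D"
proof -
 have "\<exists>j<d. \<not> t_ratio (card I1) (unit_vec d j) (minv (Sigma_hat d I2 D)) (psi_bar d I1 D (beta0 d P)) (V_hat d I1 D (beta0 d P)) <= ereal z"
 proof (rule ccontr)
  assume "\<not> ?thesis"
  hence "T_SeN d I1 D (beta0 d P) (minv (Sigma_hat d I2 D)) <= ereal z"
   unfolding T_SeN_def using d by (subst Max_le_iff) auto
  thus False using gt by simp
 qed
 then obtain j where j: "j < d"
  "\<not> t_ratio (card I1) (unit_vec d j) (minv (Sigma_hat d I2 D)) (psi_bar d I1 D (beta0 d P)) (V_hat d I1 D (beta0 d P)) <= ereal z"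
  by blast
 show ?thesis
  using that[OF j(1)] plugin_self[OF t_ratio_excess[OF D unit_vec_carrier z beta0_carrier j(2), unfolded score_beta0]] by blast
qed

definition simultaneous :: "nat => nat set => nat set => (nat => real vec \<times> real) => bool" where
 "simultaneous n I1 I2 D \<longleftrightarrow>
  (\<exists>j<d. self_normalised_excess (W (dir I2 (unit_vec d j) D)) I1 (upper_quantile (1 / (2 * real n * real d))) D)"

text \<open>If \<open>beta0\<close> passes both constraints, its own projection witnesses coverage;
  a miss is therefore caused by this one parameter value.\<close>

lemma CI_miss:
 assumes D: "on I1 D" "on I2 D" and n: "0 < n" and miss: "x \<bullet> beta0 d P \<notin> CI d n I1 I2 D x C"
 shows "beta0 d P \<notin> C \<or> simultaneous n I1 I2 D"
proof (rule ccontr)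
 assume A: "\<not> ?thesis"
 have nd: "1 <= real n * real d" using n d by (simp flip: of_nat_mult add: Suc_le_eq)
 hence "0 <= upper_quantile (1 / (2 * real n * real d))"
  using n d by (intro upper_quantile_nonneg) (auto simp: divide_le_eq mult.assoc)
 hence "T_SeN d I1 D (beta0 d P) (minv (Sigma_hat d I2 D)) <= ereal (upper_quantile (1 / (2 * real n * real d)))"
  using T_SeN_excess[OF D] A unfolding simultaneous_def by metis
 thus False using miss A unfolding CI_def by blast
qed

lemma SeN_miss:
 assumes D: "on I1 D" "on I2 D" and n: "0 < n" and a: "0 < a" "a < 1" and x: "x \<in> carrier_vec d"
  and miss: "x \<bullet> beta0 d P \<notin> CI_SeN d n I1 I2 D x a"
 shows "self_normalised_excess (W (dir I2 x D)) I1 (upper_quantile (a / 2)) D \<or> simultaneous n I1 I2 D"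
 using CI_miss[OF D n miss[unfolded CI_SeN_def]]
proof
 assume "beta0 d P \<notin> C_SeN d I1 I2 D x a"
 hence gt: "\<not> t_ratio (card I1) x (minv (Sigma_hat d I2 D)) (psi_bar d I1 D (beta0 d P)) (V_hat d I1 D (beta0 d P)) <= ereal (upper_quantile (a / 2))"
  unfolding C_SeN_def using beta0_carrier by simp
 have "0 <= upper_quantile (a / 2)" using a by (intro upper_quantile_nonneg) auto
 from plugin_self[OF t_ratio_excess[OF D x this beta0_carrier gt, unfolded score_beta0]] show ?thesis ..
qed simp

definition cross :: "nat set => (nat => real vec \<times> real) => real vec" where
 "cross I D = vec d (%j. SS (%z. fst z $ j * res z) I D / card I)"

lemma cross_carrier: "cross I D \<in> carrier_vec d" by (simp add: cross_def)

text \<open>The estimation error of least squares on I, whenever the empirical second moment matrix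
  is nonsingular.\<close>

definition drift :: "nat set => (nat => real vec \<times> real) => real vec" where
 "drift I D = dir I (cross I D) D"

lemma drift_carrier: "on I D ==> drift I D \<in> carrier_vec d"
 unfolding drift_def by (rule dir_carrier[OF _ cross_carrier])

lemma Sigma_hat_beta0:
 assumes D: "on I D" and j: "j < d"
 shows "(Sigma_hat d I D *\<^sub>v beta0 d P) $ j = SS (%z. fst z $ j * dot d (beta0 d P) (fst z)) I D / card I"
proof -
 have e: "Sigma_hat d I D $$ (j, k) = (\<Sum>i\<in>I. fst (D i) $ j * fst (D i) $ k) / card I" if "k < d" for k
 proof -
  have "(\<Sum>i\<in>I. outer (fst (D i)) (fst (D i)) $$ (j, k)) = (\<Sum>i\<in>I. fst (D i) $ j * fst (D i) $ k)"
   using D j that by (intro sum.cong refl) (auto simp: on_def outer_def)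
  thus ?thesis using that j by (simp add: Sigma_hat_def mat_mean_def)
 qed
 have "(Sigma_hat d I D *\<^sub>v beta0 d P) $ j = (\<Sum>k<d. (\<Sum>i\<in>I. fst (D i) $ j * fst (D i) $ k) / card I * beta0 d P $ k)"
  unfolding mult_vec_sum[OF Sigma_hat_form(1)[OF D zero_carrier_vec] beta0_carrier j] using e by simp
 also have "... = (\<Sum>k<d. \<Sum>i\<in>I. fst (D i) $ j * (beta0 d P $ k * fst (D i) $ k)) / card I"
  by (simp add: sum_divide_distrib[symmetric] sum_distrib_right sum_distrib_left mult_ac)
 also have "(\<Sum>k<d. \<Sum>i\<in>I. fst (D i) $ j * (beta0 d P $ k * fst (D i) $ k)) = SS (%z. fst z $ j * dot d (beta0 d P) (fst z)) I D"
  unfolding SS_def dot_def sum_distrib_left by (rule sum.swap)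
 finally show ?thesis .
qed

text \<open>A nonsingular positive semidefinite matrix is definite, since a vanishing form at u
  forces Sigma_hat u = 0 by \<open>psd_norm_bound\<close>; the least squares criterion then has a
  unique minimiser. Splitting the response into fit and residual isolates
  \<open>beta0\<close>.\<close>

lemma ols_eq:
 assumes D: "on I D" and det: "det (Sigma_hat d I D) ~= 0"
 shows "ols d I D = beta0 d P + drift I D"
proof -
 note S = Sigma_hat_form(1,2)[OF D zero_carrier_vec]
 note f = Sigma_hat_form(3)[OF D]
 define m where "m = real (card I)"
 have m: "0 < m" using on_card[OF D] by (simp add: m_def)
 have nn: "0 <= u \<bullet> (Sigma_hat d I D *\<^sub>v u)" if "u \<in> carrier_vec d" for u
  unfolding f[OF that] SS_def by (intro divide_nonneg_nonneg sum_nonneg) auto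
 have pos': "0 < u \<bullet> (Sigma_hat d I D *\<^sub>v u)" if u: "u \<in> carrier_vec d" "u ~= 0\<^sub>v d" for u
 proof (rule ccontr)
  assume "\<not> ?thesis"
  hence z: "u \<bullet> (Sigma_hat d I D *\<^sub>v u) = 0" using nn[OF u(1)] by simp
  have c: "Sigma_hat d I D *\<^sub>v u \<in> carrier_vec d" by (rule mult_vec_carrier[OF S(1) u(1)])
  have "(Sigma_hat d I D *\<^sub>v u) \<bullet> (Sigma_hat d I D *\<^sub>v u) <= entry_bound (Sigma_hat d I D) * (u \<bullet> (Sigma_hat d I D *\<^sub>v u))"
   using form_bound[OF S(1)] by (intro psd_norm_bound[OF S nn entry_bound_pos _ u(1)]) (auto simp: abs_le_iff)
  hence "(Sigma_hat d I D *\<^sub>v u) \<bullet> (Sigma_hat d I D *\<^sub>v u) = 0" using z scalar_prod_self_ge_0 by (metis antisym mult_zero_right)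
  hence "Sigma_hat d I D *\<^sub>v u = 0\<^sub>v d" by (rule scalar_prod_self_eq_0[OF c])
  hence "minv (Sigma_hat d I D) *\<^sub>v 0\<^sub>v d = u" using minv_apply(2)[OF S(1) det u(1)] by simp
  moreover have "minv (Sigma_hat d I D) *\<^sub>v 0\<^sub>v d = 0\<^sub>v d" by (rule mult_zero_vec[OF minv_Sigma_hat(1)[OF D]])
  ultimately show False using u by simp
 qed
 define b where "b = vec d (%j. SS (%z. fst z $ j * snd z) I D / m)"
 have b: "b \<in> carrier_vec d" by (simp add: b_def)
 have "ols d I D = minv (Sigma_hat d I D) *\<^sub>v b" unfolding ols_def
 proof (rule quadratic_arg_min[OF S pos' b m, where c = "SS (%z. (snd z)^2) I D / m"])
  fix h :: "real vec" assume t: "h \<in> carrier_vec d"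
  have bt: "b \<bullet> h = SS (%z. snd z * dot d h (fst z)) I D / m"
  proof -
   have "b \<bullet> h = (\<Sum>j<d. \<Sum>i\<in>I. snd (D i) * (h $ j * fst (D i) $ j)) / m"
    unfolding scalar_prod_sum[OF t] b_def SS_def by (simp add: sum_divide_distrib[symmetric] sum_distrib_right sum_distrib_left mult_ac)
   also have "(\<Sum>j<d. \<Sum>i\<in>I. snd (D i) * (h $ j * fst (D i) $ j)) = SS (%z. snd z * dot d h (fst z)) I D"
    unfolding SS_def dot_def sum_distrib_left by (rule sum.swap)
   finally show ?thesis .
  qed
  have "(\<Sum>i\<in>I. (snd (D i) - fst (D i) \<bullet> h)^2) = SS (%z. (snd z)^2) I D - 2 * SS (%z. snd z * dot d h (fst z)) I D
    + SS (%z. (dot d h (fst z))^2) I D"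
   unfolding SS_def dot_eq[OF t] dot_comm[of d _ h]
   by (simp add: power2_diff sum.distrib sum_subtractf sum_distrib_left mult_ac)
  thus "(\<Sum>i\<in>I. (snd (D i) - fst (D i) \<bullet> h)^2) = m * (SS (%z. (snd z)^2) I D / m - 2 * (b \<bullet> h) + h \<bullet> (Sigma_hat d I D *\<^sub>v h))"
   unfolding f[OF t] bt m_def[symmetric] using m by (simp add: algebra_simps)
 qed
 also have "b = Sigma_hat d I D *\<^sub>v beta0 d P + cross I D"
 proof (rule eq_vecI)
  fix j assume "j < dim_vec (Sigma_hat d I D *\<^sub>v beta0 d P + cross I D)"
  hence j: "j < d" by (simp add: cross_def)
  have "SS (%z. fst z $ j * snd z) I D = SS (%z. fst z $ j * dot d (beta0 d P) (fst z)) I D + SS (%z. fst z $ j * res z) I D"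
   unfolding SS_def res_def by (simp add: sum.distrib[symmetric] right_diff_distrib)
  thus "b $ j = (Sigma_hat d I D *\<^sub>v beta0 d P + cross I D) $ j"
   using j cross_carrier[of I D] Sigma_hat_beta0[OF D j] unfolding b_def by (simp add: cross_def m_def add_divide_distrib)
 qed (simp add: b_def cross_def)
 also have "minv (Sigma_hat d I D) *\<^sub>v (Sigma_hat d I D *\<^sub>v beta0 d P + cross I D) = beta0 d P + drift I D"
  using mult_add_distrib_mat_vec[OF minv_Sigma_hat(1)[OF D] mult_vec_carrier[OF S(1) beta0_carrier] cross_carrier[of I D]]
   minv_apply(2)[OF S(1) det beta0_carrier]
  by (simp only: drift_def dir_def)
 finally show ?thesis .
qed

definition drift_term :: "real vec => real vec => real vec \<times> real => real" where
 "drift_term e v z = dot d e (fst z) * dot d v (fst z)"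

text \<open>Replacing \<open>beta0\<close> by \<open>ols\<close> in the score adds exactly the drift
  term. The direction is recorded as nonzero because only then can the scores be
  standardised.\<close>

lemma SpN_miss:
 assumes D: "on I1 D" "on I2 D" and n: "0 < n" and a: "0 < a" "a < 1" and e: "e \<in> carrier_vec d"
  and miss: "e \<bullet> beta0 d P \<notin> CI_SpN d n I1 I2 D e a"
 shows "(dir I2 e D ~= 0\<^sub>v d \<and> plugin_excess (W (dir I2 e D)) (%z. W (dir I2 e D) z + drift_term (drift I2 D) (dir I2 e D) z) I1 (upper_quantile (a / 2)) D)
  \<or> simultaneous n I1 I2 D"
 using CI_miss[OF D n miss[unfolded CI_SpN_def]]
proof
 assume "beta0 d P \<notin> C_SpN d I1 I2 D e a"
 hence gt: "\<not> t_ratio (card I1) e (minv (Sigma_hat d I2 D)) (psi_bar d I1 D (beta0 d P)) (V_hat d I1 D (ols d I2 D)) <= ereal (upper_quantile (a / 2))"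
  unfolding C_SpN_def using beta0_carrier by simp
 have z: "0 <= upper_quantile (a / 2)" using a by (intro upper_quantile_nonneg) auto
 define w where "w = dir I2 e D"
 show ?thesis
 proof (cases "det (Sigma_hat d I2 D) = 0")
  \<comment> \<open>With a singular matrix \<open>minv\<close> is zero, the ratio is 0 / 0 = 0 and
    nothing is rejected, so the formula for \<open>ols\<close> is called upon only in the other
    case.\<close>
  case True
  have m0: "minv (Sigma_hat d I2 D) = 0\<^sub>m d d" by (rule minv_singular[OF Sigma_hat_form(1)[OF D(2) zero_carrier_vec] True])
  have "t_ratio (card I1) e (minv (Sigma_hat d I2 D)) (psi_bar d I1 D (beta0 d P)) (V_hat d I1 D (ols d I2 D)) = 0"
  proof -
   have "0\<^sub>m d d *\<^sub>v psi_bar d I1 D (beta0 d P) = 0\<^sub>v d" by (rule zero_mult_vec[OF psi_bar_carrier])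
   hence "e \<bullet> (0\<^sub>m d d *\<^sub>v psi_bar d I1 D (beta0 d P)) = 0" using e by simp
   thus ?thesis unfolding t_ratio_def m0 by (simp add: zero_ereal_def[symmetric])
  qed
  thus ?thesis using gt z by simp
 next
  case False
  note o = ols_eq[OF D(2) False]
  have oc: "ols d I2 D \<in> carrier_vec d" unfolding o using beta0_carrier drift_carrier[OF D(2)] by simp
  have sc: "score (ols d I2 D) w z = W w z + drift_term (drift I2 D) w z" for z
   unfolding score_def o dot_add[OF beta0_carrier drift_carrier[OF D(2)]] W_def res_def drift_term_def by (simp add: algebra_simps)
  have pe: "plugin_excess (W w) (%z. W w z + drift_term (drift I2 D) w z) I1 (upper_quantile (a / 2)) D"
   using t_ratio_excess[OF D e z oc gt] unfolding w_def[symmetric] sc .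
  have "w ~= 0\<^sub>v d"
  proof
   assume "w = 0\<^sub>v d"
   hence "dot d w x = 0" for x by (simp add: dot_def)
   thus False using pe unfolding plugin_excess_def SS_def W_def drift_term_def by simp
  qed
  thus ?thesis using pe unfolding w_def by blast
 qed
qed simp

end

subsection \<open>Smallest eigenvalue of the empirical second moment matrix\<close>

text \<open>The square is not Lipschitz, so contraction cannot be applied to it directly. The capped
  square is bounded and Lipschitz, lies below the square and vanishes at 0.\<close>

definition cap :: "real => real => real" where "cap t a = (min \<bar>a\<bar> t)^2"

lemma cap_Lipschitz:
 assumes "0 <= t" shows "abs (cap t a - cap t b) <= 2 * t * abs (a - b)"
proof -
 define p q where "p = min \<bar>a\<bar> t" and "q = min \<bar>b\<bar> t"
 have 1: "abs (p - q) <= abs (a - b)" unfolding p_def q_def by (auto simp: min_def)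
 have 2: "abs (p + q) <= 2 * t" unfolding p_def q_def using assms by (auto simp: min_def)
 have "cap t a - cap t b = (p + q) * (p - q)" unfolding cap_def p_def q_def by (simp add: sq_simps)
 thus ?thesis using mult_mono[OF 2 1] assms by (simp add: abs_mult)
qed

lemma cap_props:
 assumes "0 <= t" shows "0 <= cap t a" "cap t a <= t^2" "cap t a <= a^2" "cap t 0 = 0"
proof -
 show "cap t a <= t^2" unfolding cap_def using assms by (intro power_mono) auto
 have "cap t a <= abs a^2" unfolding cap_def using assms by (intro power_mono) auto
 thus "cap t a <= a^2" by simp
qed (use assms in \<open>auto simp: cap_def\<close>)

lemma cap_measurable: "cap t \<in> borel_measurable borel"
 unfolding cap_def by measurable

lemma cap_lower:
 assumes t: "0 < t" and q: "2 < q" shows "a^2 - t powr (2 - q) * abs a powr q <= cap t a"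
proof (cases "abs a <= t")
 case True
 thus ?thesis by (simp add: cap_def)
next
 case False
 have "a^2 = abs a powr (2 - q) * abs a powr q"
  using False t by (simp flip: powr_add add: powr_numeral)
 also have "... <= t powr (2 - q) * abs a powr q"
  using False t q by (intro mult_right_mono powr_mono2') auto
 finally show ?thesis using cap_props(1)[of t a] t by linarith
qed

sublocale regression \<subseteq> iid P by unfold_locales

context regression
begin

lemma qx_gt_2: "2 < qx"
proof -
 have "1 / qx <= 1 / qx + 1 / qy" using pos by simp
 hence "inverse (1 / qx + 1 / qy) <= inverse (1 / qx)" using pos by (intro le_imp_inverse_le) auto
 thus ?thesis using qxy pos by simp
qed

text \<open>Solves tau^(2 - qx) * (Kx * sqrt uS)^qx = lS / 8: at this level capping loses at most lS
  / 8 of the second moment in every direction of norm at most 1.\<close>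

definition tau :: real where "tau = (8 * (Kx * sqrt uS) powr qx / lS) powr (1 / (qx - 2))"

lemma tau: "0 < tau" "tau powr (2 - qx) * (Kx * sqrt uS) powr qx = lS / 8"
proof -
 have k: "0 < (Kx * sqrt uS) powr qx" using pos by auto
 thus "0 < tau" unfolding tau_def using pos by simp
 have "tau powr (2 - qx) = (8 * (Kx * sqrt uS) powr qx / lS) powr (- 1)"
  unfolding tau_def powr_powr using qx_gt_2 by (intro arg_cong2[of _ _ _ _ "(powr)"] refl) (simp add: field_simps)
 also have "... = lS / (8 * (Kx * sqrt uS) powr qx)" using k pos by (simp add: powr_minus_divide)
 finally show "tau powr (2 - qx) * (Kx * sqrt uS) powr qx = lS / 8" using k by simp
qed

definition small :: "real => real vec \<times> real => bool" where "small R z \<longleftrightarrow> (\<forall>k<d. abs (fst z $ k) <= R)"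

lemma meas_small: "Measurable.pred P (small R)"
 unfolding small_def using meas_coord by measurable

text \<open>Symmetrisation is available for bounded coordinate functions, so covariates are cut off
  at R. Dominated convergence makes the loss small; R may depend on the law and on d, but it does
  not enter the resulting deviation bound.\<close>

lemma truncation:
 obtains R where "0 <= R" "(LINT z|P. (if small R z then 0 else \<Sum>j<d. (fst z $ j)^2)) <= lS / 8"
proof -
 have "(%n. \<integral>z. (if small (real n) z then 0 else \<Sum>j<d. (fst z $ j)^2) \<partial>P) \<longlonglongrightarrow> (LINT z|P. 0)"
 proof (rule integral_dominated_convergence[where w = "%z. \<Sum>j<d. (fst z $ j)^2"])
  show "integrable P (%z. \<Sum>j<d. (fst z $ j)^2)" using L2_coord by (auto simp: L2_def)
  thus "(%z. if small (real n) z then 0 else \<Sum>j<d. (fst z $ j)^2) \<in> borel_measurable P" for n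
   using meas_small by (intro measurable_If) (auto simp: pred_def[symmetric])
  show "AE z in P. (%n. if small (real n) z then 0 else \<Sum>j<d. (fst z $ j)^2) \<longlonglongrightarrow> 0"
  proof (rule AE_I2)
   fix z :: "real vec \<times> real"
   obtain N where N: "(\<Sum>k<d. abs (fst z $ k)) <= real N" using real_arch_simple by blast
   have "small (real n) z" if "N <= n" for n
    unfolding small_def
   proof (intro allI impI)
    fix k assume "k < d"
    hence "abs (fst z $ k) <= (\<Sum>k<d. abs (fst z $ k))" by (intro member_le_sum[of k "{..<d}" "%k. abs (fst z $ k)"]) auto
    thus "abs (fst z $ k) <= real n" using N that by (meson of_nat_mono order_trans)
   qed
   thus "(%n. if small (real n) z then 0 else \<Sum>j<d. (fst z $ j)^2) \<longlonglongrightarrow> 0"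
    by (intro tendsto_eventually) (auto simp: eventually_sequentially)
  qed
  show "AE z in P. norm (if small (real n) z then 0 else \<Sum>j<d. (fst z $ j)^2) <= (\<Sum>j<d. (fst z $ j)^2)" for n
   by (auto simp: sum_nonneg)
 qed auto
 moreover have "0 < lS / 8" using pos by simp
 ultimately have "eventually (%n. (LINT z|P. (if small (real n) z then 0 else \<Sum>j<d. (fst z $ j)^2)) < lS / 8) sequentially"
  by (intro order_tendstoD(2)) auto
 then obtain n where "(LINT z|P. (if small (real n) z then 0 else \<Sum>j<d. (fst z $ j)^2)) < lS / 8"
  by (auto simp: eventually_sequentially)
 thus ?thesis using that[of "real n"] by simp
qed

lemma dot_moment_unit:
 assumes u: "u \<in> carrier_vec d" "u \<bullet> u <= 1"
 shows "integrable P (%z. abs (dot d u (fst z)) powr qx)" "(LINT z|P. abs (dot d u (fst z)) powr qx) <= (Kx * sqrt uS) powr qx"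
proof -
 have "integrable P (%z. abs (dot d u (fst z)) powr qx) \<and> (LINT z|P. abs (dot d u (fst z)) powr qx) <= (Kx * sqrt uS) powr qx"
 proof (cases "u = 0\<^sub>v d")
  case True
  hence "dot d u x = 0" for x by (simp add: dot_def)
  thus ?thesis by simp
 next
  case False
  have "sqrt (uS * (u \<bullet> u)) <= sqrt uS" using u pos by (simp add: mult_left_le)
  hence "(Kx * sqrt (uS * (u \<bullet> u))) powr qx <= (Kx * sqrt uS) powr qx"
   using pos scalar_prod_self_ge_0[of u] by (intro powr_mono2 mult_left_mono) auto
  thus ?thesis using dot_moment(1,2)[OF u(1) False] by linarith
 qed
 thus "integrable P (%z. abs (dot d u (fst z)) powr qx)" "(LINT z|P. abs (dot d u (fst z)) powr qx) <= (Kx * sqrt uS) powr qx" by auto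
qed

lemma trace_bound: "(\<Sum>j<d. \<integral>z. (fst z $ j)^2 \<partial>P) <= real d * uS"
proof -
 have "(LINT z|P. (fst z $ j)^2) <= uS" if j: "j < d" for j
 proof -
  have "dot d (unit_vec d j) x = x $ j" for x
  proof -
   have "dot d (unit_vec d j) x = (\<Sum>k<d. if k = j then x $ j else 0)"
    unfolding dot_def using j by (intro sum.cong) (auto simp: unit_vec_def)
   thus ?thesis using j by simp
  qed
  thus ?thesis using Sg_upper[of "unit_vec d j"] Sg_form[of "unit_vec d j"] j by simp
 qed
 hence "(\<Sum>j<d. \<integral>z. (fst z $ j)^2 \<partial>P) <= (\<Sum>j<d. uS)" by (intro sum_mono) auto
 thus ?thesis by simp
qed

text \<open>In each direction of the net the capped second moment is at least lS / 2 - lS / 4, and a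
  deviation of lS / 8 still leaves lS / 8. The factor 32 is 2 * 2 * 8, from symmetrisation, the
  Lipschitz constant 2 * tau and the size lS / 8 of the deviation.\<close>

lemma finite_net_deviation:
 assumes T: "finite T" "!!u. u \<in> T ==> u \<in> carrier_vec d \<and> 1/2 <= u \<bullet> u \<and> u \<bullet> u <= 1" and J: "finite J" "J ~= {}"
 shows "\<P>(q in PI J. \<exists>u\<in>T. SS (%z. (dot d u (fst z))^2) J q <= card J * (lS / 8))
  <= 32 * tau * sqrt uS / lS * sqrt (real d / card J)"
proof -
 interpret A: prob_space "PI J" by (rule prob_space_PI)
 define m where "m = real (card J)"
 have m: "0 < m" using J by (simp add: m_def card_gt_0_iff)
 obtain R where R: "0 <= R" "(LINT z|P. (if small R z then 0 else \<Sum>j<d. (fst z $ j)^2)) <= lS / 8" by (rule truncation)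
 define c where "c = (%j z. if small R z then fst z $ j else 0 :: real)"
 define g where "g = (%u z. \<Sum>j<d. u $ j * c j z)"
 have g: "g u z = (if small R z then dot d u (fst z) else 0)" for u z
  unfolding g_def c_def dot_def by simp
 have cb: "bm P (c j)" if "j \<in> {..<d}" for j
 proof (rule bmI[of _ _ R])
  show "c j \<in> borel_measurable P" unfolding c_def
   using meas_small meas_coord that by (intro measurable_If) (auto simp: pred_def[symmetric])
  show "abs (c j z) <= R" for z using R(1) that by (auto simp: c_def small_def)
 qed
 have c2: "(LINT z|P. (c j z)^2) <= (LINT z|P. (fst z $ j)^2)" if "j < d" for j
  using L2_coord[OF that] by (intro integral_mono_AE') (auto simp: L2_def c_def)
 have c2s: "(\<Sum>j<d. \<integral>z. (c j z)^2 \<partial>P) <= real d * uS"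
  using trace_bound c2 by (meson lessThan_iff order_trans sum_mono)
 \<comment> \<open>Two losses of at most lS / 8 each, from cutting off the covariates and from
   capping the square, are subtracted from the population form.\<close>
 have low: "lS * (u \<bullet> u) - lS / 4 <= (LINT z|P. cap tau (g u z))" if u: "u \<in> carrier_vec d" "u \<bullet> u <= 1" for u
 proof -
  define r where "r = (%z :: real vec \<times> real. if small R z then 0 else \<Sum>j<d. (fst z $ j)^2)"
  have ir: "integrable P r"
  proof (rule Bintegrable_bound)
   show i: "integrable P (%z. \<Sum>j<d. (fst z $ j)^2)" using L2_coord by (auto simp: L2_def)
   show "r \<in> borel_measurable P" unfolding r_def
    using meas_small borel_measurable_integrable[OF i] by (intro measurable_If) (auto simp: pred_def[symmetric])
   show "AE z in P. norm (r z) <= norm (\<Sum>j<d. (fst z $ j)^2)" by (auto simp: r_def sum_nonneg)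
  qed
  have pw: "(dot d u (fst z))^2 - r z - tau powr (2 - qx) * abs (dot d u (fst z)) powr qx <= cap tau (g u z)" for z
  proof (cases "small R z")
   case True
   thus ?thesis using cap_lower[OF tau(1) qx_gt_2, of "dot d u (fst z)"] by (simp add: g r_def)
  next
   case False
   have "(dot d u (fst z))^2 <= (\<Sum>j<d. (u $ j)^2) * (\<Sum>j<d. (fst z $ j)^2)"
    unfolding dot_def by (rule Cauchy_Schwarz_ineq_sum)
   also have "... <= 1 * (\<Sum>j<d. (fst z $ j)^2)"
    using u by (intro mult_right_mono sum_nonneg) (auto simp: scalar_prod_sum[OF u(1)] power2_eq_square)
   finally have "(dot d u (fst z))^2 <= r z" using False by (simp add: r_def)
   moreover have "0 <= tau powr (2 - qx) * abs (dot d u (fst z)) powr qx" by simp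
   ultimately show ?thesis using cap_props(1)[of tau "g u z"] tau(1) by linarith
  qed
  have icap: "integrable P (%z. cap tau (g u z))"
  proof (rule int_N[OF bm_comp[OF cap_measurable, where K = "tau^2"]])
   show "abs (cap tau a) <= tau^2" for a using cap_props(1,2)[of tau a] tau(1) by simp
   show "(%z. g u z) \<in> borel_measurable P" unfolding g_def using cb[THEN bm_measurable] by measurable
  qed
  have id2: "integrable P (%z. (dot d u (fst z))^2)" using L2_dot by (simp add: L2_def)
  note im = dot_moment_unit[OF u]
  have "(LINT z|P. (dot d u (fst z))^2 - r z - tau powr (2 - qx) * abs (dot d u (fst z)) powr qx) <= (LINT z|P. cap tau (g u z))"
   using id2 ir im(1) by (intro integral_mono icap pw) auto
  moreover have "(LINT z|P. (dot d u (fst z))^2 - r z - tau powr (2 - qx) * abs (dot d u (fst z)) powr qx)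
   = (LINT z|P. (dot d u (fst z))^2) - integral\<^sup>L P r - tau powr (2 - qx) * (LINT z|P. abs (dot d u (fst z)) powr qx)"
   using id2 ir im(1) by simp
  moreover have "lS * (u \<bullet> u) <= (LINT z|P. (dot d u (fst z))^2)" using Sg_lower[OF u(1)] Sg_form[OF u(1)] by simp
  moreover have "integral\<^sup>L P r <= lS / 8" using R(2) unfolding r_def .
  moreover have "tau powr (2 - qx) * (LINT z|P. abs (dot d u (fst z)) powr qx) <= lS / 8"
   unfolding tau(2)[symmetric] using im(2) by (intro mult_left_mono) auto
  ultimately show ?thesis by linarith
 qed
 let ?B = "%T. {q \<in> space (PI J). \<exists>u\<in>T. SS (%z. cap tau (g u z)) J q <= card J * ((LINT z|P. cap tau (g u z)) - lS / 8)}"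
 \<comment> \<open>The zero vector is added to the net to supply the zero functional demanded by the
   uniform deviation bound.\<close>
 have dev: "measure (PI J) (?B (insert (0\<^sub>v d) T)) <= 2 * (2 * tau) * 1 * sqrt ((\<Sum>j<d. \<integral>z. (c j z)^2 \<partial>P) / card J) / (lS / 8)"
  unfolding g_def
 proof (rule uniform_lower_deviation[where ?u0.0 = "0\<^sub>v d" and K = "tau^2"])
  show "cap tau \<in> borel_measurable borel" by (rule cap_measurable)
  show "abs (cap tau a) <= tau^2" for a using cap_props(1,2)[of tau a] tau(1) by simp
  show "abs (cap tau a - cap tau b) <= 2 * tau * abs (a - b)" for a b using cap_Lipschitz[of tau a b] tau(1) by simp
  show "cap tau 0 = 0" using cap_props(4)[of tau] tau(1) by simp
  show "(\<Sum>j<d. (u $ j)^2) <= 1^2" if "u \<in> insert (0\<^sub>v d) T" for u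
   using that T(2)[of u] by (auto simp: scalar_prod_sum power2_eq_square)
  show "bm P (c j)" if "j \<in> {..<d}" for j by (rule cb[OF that])
 qed (use T J tau(1) pos in auto)
 have "\<P>(q in PI J. \<exists>u\<in>T. SS (%z. (dot d u (fst z))^2) J q <= card J * (lS / 8))
   <= measure (PI J) (?B (insert (0\<^sub>v d) T))"
 proof (rule A.finite_measure_mono)
  show "{q \<in> space (PI J). \<exists>u\<in>T. SS (%z. (dot d u (fst z))^2) J q <= card J * (lS / 8)} \<subseteq> ?B (insert (0\<^sub>v d) T)"
  proof
   fix q assume w: "q \<in> {q \<in> space (PI J). \<exists>u\<in>T. SS (%z. (dot d u (fst z))^2) J q <= card J * (lS / 8)}"
   then obtain u where u: "u \<in> T" "SS (%z. (dot d u (fst z))^2) J q <= card J * (lS / 8)" by blast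
   have "cap tau (g u z) <= (dot d u (fst z))^2" for z
   proof -
    have "cap tau (g u z) <= (g u z)^2" using tau(1) by (intro cap_props) simp
    also have "... <= (dot d u (fst z))^2" by (simp add: g)
    finally show ?thesis .
   qed
   hence "SS (%z. cap tau (g u z)) J q <= SS (%z. (dot d u (fst z))^2) J q" unfolding SS_def by (intro sum_mono)
   also have "... <= m * (lS / 8)" using u(2) by (simp add: m_def)
   also have "... <= m * ((LINT z|P. cap tau (g u z)) - lS / 8)"
   proof (intro mult_left_mono)
    have "lS * (1/2) <= lS * (u \<bullet> u)" using T(2)[OF u(1)] pos by (intro mult_left_mono) auto
    thus "lS / 8 <= (LINT z|P. cap tau (g u z)) - lS / 8" using low[of u] T(2)[OF u(1)] by linarith
   qed (use m in simp)
   finally have "SS (%z. cap tau (g u z)) J q <= card J * ((LINT z|P. cap tau (g u z)) - lS / 8)" unfolding m_def .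
   thus "q \<in> ?B (insert (0\<^sub>v d) T)" using u(1) w by blast
  qed
  have "?B (insert (0\<^sub>v d) T) = (\<Union>u\<in>insert (0\<^sub>v d) T. {q \<in> space (PI J). SS (%z. cap tau (g u z)) J q <= card J * ((LINT z|P. cap tau (g u z)) - lS / 8)})"
   by auto
  also have "... \<in> A.events"
  proof (intro sets.finite_UN)
   fix u
   have "g u \<in> borel_measurable P" unfolding g_def using cb[THEN bm_measurable] by measurable
   hence [measurable]: "(%z. cap tau (g u z)) \<in> borel_measurable P" using cap_measurable by (rule measurable_compose)
   have "SS (%z. cap tau (g u z)) J \<in> borel_measurable (PI J)" by measurable
   thus "{q \<in> space (PI J). SS (%z. cap tau (g u z)) J q <= card J * ((LINT z|P. cap tau (g u z)) - lS / 8)} \<in> A.events"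
    by measurable
  qed (use T in simp)
  finally show "?B (insert (0\<^sub>v d) T) \<in> A.events" .
 qed
 also note dev
 also have "2 * (2 * tau) * 1 * sqrt ((\<Sum>j<d. \<integral>z. (c j z)^2 \<partial>P) / card J) / (lS / 8)
   <= 2 * (2 * tau) * 1 * sqrt ((real d * uS) / card J) / (lS / 8)"
  using c2s tau(1) pos by (intro divide_right_mono mult_left_mono real_sqrt_le_mono) auto
 also have "... = 32 * tau * sqrt uS / lS * sqrt (real d / card J)"
  by (simp add: real_sqrt_mult real_sqrt_divide mult_ac)
 finally show ?thesis .
qed

text \<open>A countable set of directions, hence one with a measurable failure event; the shell has
  nonempty interior, so that every nonzero direction can be rescaled into it and approximated from
  within.\<close>

definition rational_net :: "real vec set" where
 "rational_net = {u \<in> carrier_vec d. (\<forall>j<d. u $ j \<in> \<rat>) \<and> 1/2 <= u \<bullet> u \<and> u \<bullet> u <= 1}"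

lemma countable_rational_net: "countable rational_net"
proof -
 have "rational_net \<subseteq> vec d ` (Pi\<^sub>E {..<d} (%_. \<rat>))"
 proof
  fix u assume u: "u \<in> rational_net"
  have "u = vec d (\<lambda>j\<in>{..<d}. u $ j)" using u by (intro eq_vecI) (auto simp: rational_net_def)
  moreover have "(\<lambda>j\<in>{..<d}. u $ j) \<in> Pi\<^sub>E {..<d} (%_. \<rat>)" using u by (auto simp: rational_net_def)
  ultimately show "u \<in> vec d ` (Pi\<^sub>E {..<d} (%_. \<rat>))" by blast
 qed
 moreover have "countable (vec d ` (Pi\<^sub>E {..<d} (%_. \<rat> :: real set)))"
  by (intro countable_image countable_PiE countable_rat) auto
 ultimately show ?thesis by (rule countable_subset)
qed

definition deficient :: "nat set => (nat => real vec \<times> real) => bool" where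
 "deficient J D \<longleftrightarrow> (\<exists>u\<in>rational_net. SS (%z. (dot d u (fst z))^2) J D <= card J * (lS / 8))"

lemma meas_form_event:
 assumes J: "finite J"
 shows "{w \<in> space (PI J). SS (%z. (dot d u (fst z))^2) J w <= c} \<in> sets (PI J)"
proof -
 have [measurable]: "(%z. (dot d u (fst z))^2) \<in> borel_measurable P" using meas_dot by measurable
 have "SS (%z. (dot d u (fst z))^2) J \<in> borel_measurable (PI J)" by measurable
 thus ?thesis by measurable
qed

text \<open>The bound for finite nets does not depend on their size, so it survives along an
  increasing sequence of finite nets exhausting the countable one, by continuity of the measure from
  below.\<close>

lemma deficient_prob:
 assumes J: "finite J" "J ~= {}"
 shows "{w \<in> space (PI J). deficient J w} \<in> sets (PI J)"
  "\<P>(w in PI J. deficient J w) <= 32 * tau * sqrt uS / lS * sqrt (real d / card J)"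
proof -
 interpret A: prob_space "PI J" by (rule prob_space_PI)
 have ne: "rational_net ~= {}"
 proof -
  have "unit_vec d 0 \<in> rational_net" unfolding rational_net_def using d by (auto simp: unit_vec_def scalar_prod_def if_distrib[of "%x. x * _"] cong: if_cong)
  thus ?thesis by blast
 qed
 define E where "E = (%u. {w \<in> space (PI J). SS (%z. (dot d u (fst z))^2) J w <= card J * (lS / 8)})"
 define S where "S = (%N. \<Union>u\<in>from_nat_into rational_net ` {..<N}. E u)"
 have E: "E u \<in> sets (PI J)" for u unfolding E_def by (rule meas_form_event[OF J(1)])
 have S: "S N \<in> sets (PI J)" for N unfolding S_def by (intro sets.finite_UN E) auto
 have eq: "{w \<in> space (PI J). deficient J w} = (\<Union>N. S N)"
 proof -
  have "{w \<in> space (PI J). deficient J w} = (\<Union>u\<in>rational_net. E u)" unfolding deficient_def E_def by auto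
  also have "... = (\<Union>u\<in>range (from_nat_into rational_net). E u)"
   by (simp only: range_from_nat_into[OF ne countable_rational_net])
  also have "... = (\<Union>N. S N)" unfolding S_def by (auto intro: lessI)
  finally show ?thesis .
 qed
 show "{w \<in> space (PI J). deficient J w} \<in> sets (PI J)" unfolding eq using S by (intro sets.countable_UN) auto
 have "(%N. measure (PI J) (S N)) \<longlonglongrightarrow> measure (PI J) (\<Union>N. S N)"
 proof (rule A.finite_Lim_measure_incseq)
  show "incseq S" unfolding S_def incseq_def by fastforce
 qed (use S in auto)
 moreover have "measure (PI J) (S N) <= 32 * tau * sqrt uS / lS * sqrt (real d / card J)" for N
 proof -
  have "S N = {w \<in> space (PI J). \<exists>u\<in>from_nat_into rational_net ` {..<N}. SS (%z. (dot d u (fst z))^2) J w <= card J * (lS / 8)}"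
   unfolding S_def E_def by auto
  moreover have "u \<in> carrier_vec d \<and> 1/2 <= u \<bullet> u \<and> u \<bullet> u <= 1" if "u \<in> from_nat_into rational_net ` {..<N}" for u
  proof -
   have "u \<in> rational_net" using that from_nat_into[OF ne] by auto
   thus ?thesis by (simp add: rational_net_def)
  qed
  ultimately show ?thesis using finite_net_deviation[OF _ _ J, of "from_nat_into rational_net ` {..<N}"] by simp
 qed
 ultimately show "\<P>(w in PI J. deficient J w) <= 32 * tau * sqrt uS / lS * sqrt (real d / card J)"
  unfolding eq by (intro LIMSEQ_le_const2) auto
qed

text \<open>A direction rescaled to squared norm 3/4, strictly between 1/2 and 1, is a limit of
  vectors that eventually belong to the net, and the empirical form is continuous. Scaling back even
  gains a factor 4/3, which is dropped.\<close>

lemma not_deficient_lower: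
 assumes D: "on J D" and nd: "\<not> deficient J D" and u: "u \<in> carrier_vec d"
 shows "lS / 8 * (u \<bullet> u) <= u \<bullet> (Sigma_hat d J D *\<^sub>v u)"
proof (cases "u = 0\<^sub>v d")
 case True
 hence "SS (%z. (dot d u (fst z))^2) J D = 0" by (simp add: dot_def SS_def)
 thus ?thesis using True unfolding Sigma_hat_form(3)[OF D u] by simp
next
 case False
 define s where "s = sqrt (3 / 4 / (u \<bullet> u))"
 have uu: "0 < u \<bullet> u" by (rule norm_pos[OF u False])
 have s2: "s^2 * (u \<bullet> u) = 3 / 4" unfolding s_def using uu by simp
 have "\<exists>f. (\<forall>n. f n \<in> \<rat>) \<and> f \<longlonglongrightarrow> x" for x :: real
  using closure_sequential[of x "\<rat> :: real set"] Rats_closure_real by auto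
 then obtain f where f: "!!x n. f x n \<in> (\<rat> :: real set)" "!!x. f x \<longlonglongrightarrow> x" by metis
 define v where "v = (%n. vec d (%j. f (s * u $ j) n))"
 have v: "v n \<in> carrier_vec d" for n by (simp add: v_def)
 have vj: "(%n. v n $ j) \<longlonglongrightarrow> s * u $ j" if "j < d" for j using f(2)[of "s * u $ j"] that by (simp add: v_def)
 have "(%n. \<Sum>j<d. v n $ j * v n $ j) \<longlonglongrightarrow> (\<Sum>j<d. (s * u $ j) * (s * u $ j))"
  by (intro tendsto_sum tendsto_mult vj) auto
 moreover have "(\<Sum>j<d. (s * u $ j) * (s * u $ j)) = 3 / 4"
  using s2 unfolding scalar_prod_sum[OF u] by (simp add: sum_distrib_left power2_eq_square mult_ac)
 ultimately have l: "(%n. v n \<bullet> v n) \<longlonglongrightarrow> 3 / 4" unfolding scalar_prod_sum[OF v] by simp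
 have "eventually (%n. 1/2 < v n \<bullet> v n) sequentially" "eventually (%n. v n \<bullet> v n < 1) sequentially"
  using order_tendstoD(1)[OF l, of "1/2"] order_tendstoD(2)[OF l, of 1] by simp_all
 hence "eventually (%n. card J * (lS / 8) <= SS (%z. (dot d (v n) (fst z))^2) J D) sequentially"
 proof eventually_elim
  case (elim n)
  have "v n \<in> rational_net" using elim v[of n] f(1) unfolding rational_net_def by (auto simp: v_def)
  thus ?case using nd unfolding deficient_def by force
 qed
 moreover have "(%n. SS (%z. (dot d (v n) (fst z))^2) J D) \<longlonglongrightarrow> SS (%z. (\<Sum>j<d. (s * u $ j) * fst z $ j)^2) J D"
  unfolding SS_def dot_def by (intro tendsto_sum tendsto_power tendsto_mult vj tendsto_const) auto
 ultimately have "card J * (lS / 8) <= SS (%z. (\<Sum>j<d. (s * u $ j) * fst z $ j)^2) J D"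
  by (intro tendsto_lowerbound) auto
 also have "... = s^2 * SS (%z. (dot d u (fst z))^2) J D"
 proof -
  have "(\<Sum>j<d. (s * u $ j) * x $ j) = s * dot d u x" for x :: "real vec" unfolding dot_def by (simp add: sum_distrib_left mult_ac)
  thus ?thesis unfolding SS_def by (simp add: power_mult_distrib sum_distrib_left)
 qed
 finally have 1: "card J * (lS / 8) * (u \<bullet> u) <= s^2 * SS (%z. (dot d u (fst z))^2) J D * (u \<bullet> u)"
  using uu by (intro mult_right_mono) auto
 have "s^2 * SS (%z. (dot d u (fst z))^2) J D * (u \<bullet> u) = 3 / 4 * SS (%z. (dot d u (fst z))^2) J D"
  using s2 by (simp add: mult_ac)
 also have "... <= 1 * SS (%z. (dot d u (fst z))^2) J D" unfolding SS_def by (intro mult_right_mono sum_nonneg) auto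
 finally have "card J * (lS / 8) * (u \<bullet> u) <= SS (%z. (dot d u (fst z))^2) J D" using 1 by linarith
 thus ?thesis unfolding Sigma_hat_form(3)[OF D u] using on_card[OF D] by (simp add: le_divide_eq mult_ac)
qed

text \<open>Since Sigma_hat e = g for the drift e and the cross vector g, coercivity and
  Cauchy-Schwarz give lS / 8 * |e|^2 <= e . g <= |e| * |g|.\<close>

lemma drift_bound:
 assumes D: "on J D" and nd: "\<not> deficient J D"
 shows "lS / 8 * sqrt (drift J D \<bullet> drift J D) <= sqrt (cross J D \<bullet> cross J D)"
proof -
 note S = Sigma_hat_form(1,2)[OF D zero_carrier_vec]
 define e g where "e = drift J D" and "g = cross J D"
 have c: "e \<in> carrier_vec d" "g \<in> carrier_vec d" unfolding e_def g_def using drift_carrier[OF D] cross_carrier by auto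
 have det: "det (Sigma_hat d J D) ~= 0"
 proof (rule posdef_det[OF S(1)])
  fix u :: "real vec" assume u: "u \<in> carrier_vec d" "u ~= 0\<^sub>v d"
  have "0 < lS / 8 * (u \<bullet> u)" using norm_pos[OF u] pos by simp
  also have "... <= u \<bullet> (Sigma_hat d J D *\<^sub>v u)" by (rule not_deficient_lower[OF D nd u(1)])
  finally show "0 < u \<bullet> (Sigma_hat d J D *\<^sub>v u)" .
 qed
 have "Sigma_hat d J D *\<^sub>v e = g" unfolding e_def g_def drift_def dir_def by (rule minv_apply(1)[OF S(1) det cross_carrier])
 hence 1: "lS / 8 * (e \<bullet> e) <= e \<bullet> g" using not_deficient_lower[OF D nd c(1)] by simp
 have "(e \<bullet> g)^2 <= (e \<bullet> e) * (g \<bullet> g)" by (rule Cauchy_Schwarz_vec[OF c])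
 hence "abs (e \<bullet> g) <= sqrt ((e \<bullet> e) * (g \<bullet> g))" by (rule real_le_rsqrt[of "abs (e \<bullet> g)", simplified])
 hence 2: "e \<bullet> g <= sqrt (e \<bullet> e) * sqrt (g \<bullet> g)" by (simp add: real_sqrt_mult)
 show ?thesis unfolding e_def[symmetric] g_def[symmetric]
 proof (cases "e \<bullet> e = 0")
  case True
  thus "lS / 8 * sqrt (e \<bullet> e) <= sqrt (g \<bullet> g)" using scalar_prod_self_ge_0[of g] by simp
 next
  case False
  hence p: "0 < sqrt (e \<bullet> e)" using scalar_prod_self_ge_0[of e] by simp
  have "sqrt (e \<bullet> e) * (lS / 8 * sqrt (e \<bullet> e)) = lS / 8 * (e \<bullet> e)"
   using scalar_prod_self_ge_0[of e] by (simp add: mult.left_commute)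
  hence "sqrt (e \<bullet> e) * (lS / 8 * sqrt (e \<bullet> e)) <= sqrt (e \<bullet> e) * sqrt (g \<bullet> g)" using 1 2 by linarith
  thus "lS / 8 * sqrt (e \<bullet> e) <= sqrt (g \<bullet> g)" using p by simp
 qed
qed

definition mw :: real where "mw = 1 + (Ky * (Kx * sqrt uS)) powr qxy"

lemma cross_sq:
 assumes J: "finite J" "J ~= {}"
 shows "integrable (PI J) (%w. cross J w \<bullet> cross J w)"
  "(LINT w|PI J. cross J w \<bullet> cross J w) <= mw * (real d / card J)"
proof -
 define m where "m = real (card J)"
 have m: "0 < m" using J by (simp add: m_def card_gt_0_iff)
 define f where "f = (%j z. fst z $ j * res z)"
 have e: "cross J w \<bullet> cross J w = (\<Sum>j<d. (1 / m^2) * (SS (f j) J w)^2)" for w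
  unfolding scalar_prod_sum[OF cross_carrier] unfolding cross_def f_def m_def by (simp add: power2_eq_square)
 have fW: "f j z = - W (unit_vec d j) z" if "j < d" for j z
 proof -
  have "dot d (unit_vec d j) (fst z) = (\<Sum>k<d. if k = j then fst z $ j else 0)"
   unfolding dot_def using that by (intro sum.cong) (auto simp: unit_vec_def)
  thus ?thesis using that by (simp add: W_def f_def)
 qed
 have f1: "integrable P (f j)" "integral\<^sup>L P (f j) = 0" "integrable P (%z. (f j z)^2)" "(LINT z|P. (f j z)^2) <= mw" if j: "j < d" for j
 proof -
  have ne: "unit_vec d j ~= (0\<^sub>v d :: real vec)" using j by (metis index_unit_vec(1) index_zero_vec(1) zero_neq_one)
  have c: "unit_vec d j \<in> carrier_vec d" by simp
  have fe: "f j = (%z. - W (unit_vec d j) z)" using fW[OF j] by auto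
  show "integrable P (f j)" "integral\<^sup>L P (f j) = 0" "integrable P (%z. (f j z)^2)"
   unfolding fe using W_mean[of "unit_vec d j"] W_sq[OF c] by auto
  have a: "abs x powr 2 = x^2" for x :: real by (cases "x = 0") (auto simp: powr_numeral)
  have "(LINT z|P. (W (unit_vec d j) z)^2) <= 1 + (LINT z|P. abs (W (unit_vec d j) z) powr qxy)"
   using powr_moment_mono(2)[OF prob_space_axioms meas_W W_moment(1)[OF c ne], of 2] qxy unfolding a by simp
  also have "... <= mw" using W_moment(2)[OF c ne] j unfolding mw_def by simp
  finally show "(LINT z|P. (f j z)^2) <= mw" unfolding fe by simp
 qed
 have i: "integrable (PI J) (%w. (SS (f j) J w)^2)" if "j < d" for j using E_SS_sq_L2(1)[OF J(1)] f1[OF that] by blast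
 have v: "(LINT w|PI J. (SS (f j) J w)^2) <= m * mw" if "j < d" for j
 proof -
  have "(LINT w|PI J. (SS (f j) J w)^2) = m * (LINT z|P. (f j z)^2)"
   unfolding m_def using E_SS_sq_L2(2)[OF J(1)] f1[OF that] by blast
  thus ?thesis using f1(4)[OF that] m by simp
 qed
 show "integrable (PI J) (%w. cross J w \<bullet> cross J w)" unfolding e by (rule integral_lincomb(1)[OF i])
 have "(LINT w|PI J. cross J w \<bullet> cross J w) = (\<Sum>j<d. (1 / m^2) * (LINT w|PI J. (SS (f j) J w)^2))"
  unfolding e by (rule integral_lincomb(2)[OF i])
 also have "... <= (\<Sum>j<d. (1 / m^2) * (m * mw))" using v by (intro sum_mono mult_left_mono) auto
 also have "... = mw * (real d / card J)" using m unfolding m_def[symmetric] by (simp add: power2_eq_square)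
 finally show "(LINT w|PI J. cross J w \<bullet> cross J w) <= mw * (real d / card J)" .
qed

end

subsection \<open>Conditioning on the second half of the sample\<close>

lemma self_normalised_excess_scale:
 assumes "c ~= 0"
 shows "self_normalised_excess (%y. X y / c) J z w \<longleftrightarrow> self_normalised_excess X J z w"
proof -
 define a b where "a = z^2 * SS (%y. (X y)^2) J w" and "b = (SS X J w)^2 * (1 + z^2 / card J)"
 have "z^2 * SS (%y. (X y / c)^2) J w = a / c^2" "(SS (%y. X y / c) J w)^2 * (1 + z^2 / card J) = b / c^2"
  unfolding a_def b_def SS_def by (simp_all add: power_divide sum_divide_distrib[symmetric])
 moreover have "a / c^2 < b / c^2 \<longleftrightarrow> a < b" using assms by (simp add: divide_less_cancel)
 ultimately show ?thesis unfolding self_normalised_excess_def a_def b_def by simp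
qed

lemma plugin_excess_scale:
 assumes "c ~= 0"
 shows "plugin_excess (%y. X y / c) (%y. U y / c) J z w \<longleftrightarrow> plugin_excess X U J z w"
proof -
 define a b where "a = z^2 * (SS (%y. (U y)^2) J w - (SS U J w)^2 / card J)" and "b = (SS X J w)^2"
 have "z^2 * (SS (%y. (U y / c)^2) J w - (SS (%y. U y / c) J w)^2 / card J) = a / c^2" "(SS (%y. X y / c) J w)^2 = b / c^2"
  unfolding a_def b_def SS_def by (simp_all add: power_divide sum_divide_distrib[symmetric] diff_divide_distrib right_diff_distrib mult_ac)
 moreover have "a / c^2 < b / c^2 \<longleftrightarrow> a < b" using assms by (simp add: divide_less_cancel)
 ultimately show ?thesis unfolding plugin_excess_def a_def b_def by simp
qed

lemma self_normalised_excess_cong: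
 "(!!i. i \<in> J ==> x i = y i) ==> self_normalised_excess X J z x = self_normalised_excess X J z y"
 unfolding self_normalised_excess_def by (simp add: SS_cong[of J _ x _ y])

lemma plugin_excess_cong:
 "(!!i. i \<in> J ==> x i = y i) ==> plugin_excess X U J z x = plugin_excess X U J z y"
 unfolding plugin_excess_def by (simp add: SS_cong[of J _ x _ y])

text \<open>Packages the conclusion of the tail bound for a fixed constant, since C must be chosen
  before the law, the dimension and the sample are introduced.\<close>

definition tail_const :: "real => real => real => bool" where
 "tail_const s B C \<longleftrightarrow> (\<forall>(N :: (real vec \<times> real) measure) X J d. iid_moment N X s B \<and> finite J \<and> J ~= {} \<and> 1 <= d \<and> d <= card J \<longrightarrow>
  real d * \<P>(w in PiM J (%_. N). self_normalised_excess X J (upper_quantile (1 / (4 * real (card J) * real d))) w) <= C * card J powr (- (1/2)))"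

definition plugin_const :: "(nat => real) => real => real => real => real => bool" where
 "plugin_const rate s B p C \<longleftrightarrow> (\<forall>(N :: (real vec \<times> real) measure) X G J z r. iid_moment N X s B \<and> finite J \<and> J ~= {} \<and> 0 <= z \<and> 0 < r \<and>
  integrable N (%y. abs (X y) powr (2 * p)) \<and> (LINT y|N. abs (X y) powr (2 * p)) <= B \<and>
  G \<in> borel_measurable N \<and> integrable N (%y. (G y)^2) \<and> (LINT y|N. (G y)^2) <= r^2 \<and>
  integrable N (%y. abs (G y) powr (2 * p)) \<and> (LINT y|N. abs (G y) powr (2 * p)) <= B * r powr (2 * p) \<longrightarrow>
  \<P>(w in PiM J (%_. N). plugin_excess X (%y. X y + G y) J z w) <= 2 * Q z + C * (rate (card J) + r))"

context iid
begin

text \<open>Tonelli's theorem over the two halves of the sample. The bound on the sections may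
  depend on the first block, as it does when the drift of the plug-in estimator enters.\<close>

lemma PI_split_bound:
 assumes I: "finite I" "finite J" "I \<inter> J = {}" and E: "E \<in> sets (PI (I \<union> J))"
  and h: "integrable (PI I) h" "!!x. x \<in> space (PI I) ==> \<P>(y in PI J. merge I J (x, y) \<in> E) <= h x"
 shows "measure (PI (I \<union> J)) E <= integral\<^sup>L (PI I) h"
proof -
 interpret A: prob_space "PI I" by (rule prob_space_PI)
 interpret B: prob_space "PI J" by (rule prob_space_PI)
 interpret C: prob_space "PI (I \<union> J)" by (rule prob_space_PI)
 have nn: "0 <= h x" if "x \<in> space (PI I)" for x using order_trans[OF measure_nonneg h(2)[OF that]] .
 have inn: "0 <= integral\<^sup>L (PI I) h" using nn by (intro integral_nonneg_AE AE_I2)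
 have "emeasure (PI (I \<union> J)) E = (\<integral>\<^sup>+w. indicator E w \<partial>PI (I \<union> J))" using E by simp
 also have "... = (\<integral>\<^sup>+x. (\<integral>\<^sup>+y. indicator E (merge I J (x, y)) \<partial>PI J) \<partial>PI I)"
  using E by (intro psf.product_nn_integral_fold I(3,1,2)) auto
 also have "... <= (\<integral>\<^sup>+x. ennreal (h x) \<partial>PI I)"
 proof (rule nn_integral_mono)
  fix x assume x: "x \<in> space (PI I)"
  have mm: "(%y. merge I J (x, y)) \<in> PI J \<rightarrow>\<^sub>M PI (I \<union> J)"
   using measurable_compose[OF measurable_Pair1'[OF x] measurable_merge] .
  have S: "{y \<in> space (PI J). merge I J (x, y) \<in> E} \<in> sets (PI J)"
   using measurable_sets[OF mm E] by (simp add: vimage_def Int_def conj_commute)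
  have "(\<integral>\<^sup>+y. indicator E (merge I J (x, y)) \<partial>PI J) = (\<integral>\<^sup>+y. indicator {y \<in> space (PI J). merge I J (x, y) \<in> E} y \<partial>PI J)"
   by (intro nn_integral_cong) (auto simp: indicator_def)
  also have "... = ennreal (\<P>(y in PI J. merge I J (x, y) \<in> E))"
   using S by (simp add: B.emeasure_eq_measure)
  also have "... <= ennreal (h x)" using h(2)[OF x] by (rule ennreal_leI)
  finally show "(\<integral>\<^sup>+y. indicator E (merge I J (x, y)) \<partial>PI J) <= ennreal (h x)" .
 qed
 also have "... = ennreal (integral\<^sup>L (PI I) h)" using h(1) nn by (intro nn_integral_eq_integral AE_I2) auto
 finally show ?thesis using inn by (simp add: C.emeasure_eq_measure)
qed

lemma measurable_coord: "i \<in> K ==> f \<in> borel_measurable N ==> (%D. f (D i)) \<in> borel_measurable (PI K)"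
 by (rule measurable_compose[OF measurable_component_singleton])

end

context regression
begin

lemma dir_cong: assumes "!!i. i \<in> I ==> D i = D' i" shows "dir I v D = dir I v D'"
 unfolding dir_def Sigma_hat_def mat_mean_def using assms by simp

lemma drift_cong: assumes "!!i. i \<in> I ==> D i = D' i" shows "drift I D = drift I D'"
proof -
 have "cross I D = cross I D'" unfolding cross_def using assms by (simp add: SS_cong[of I _ D _ D'])
 thus ?thesis unfolding drift_def using dir_cong[OF assms] by simp
qed

lemma on_PI: "finite I ==> I ~= {} ==> I \<subseteq> K ==> D \<in> space (PI K) ==> on I D"
 unfolding on_def by (auto simp: space_PiM space_P PiE_def Pi_def)

lemma meas_dir:
 assumes I: "finite I" "I ~= {}" "I \<subseteq> K" and v: "!!D. v D \<in> carrier_vec d" "!!k. k < d ==> (%D. v D $ k) \<in> borel_measurable (PI K)" and j: "j < d"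
 shows "(%D. dir I (v D) D $ j) \<in> borel_measurable (PI K)"
proof -
 define F where "F = (%D :: nat => real vec \<times> real. mat d d (%(j, k). (\<Sum>i\<in>I. fst (D i) $ j * fst (D i) $ k) / card I))"
 have F: "F D \<in> carrier_mat d d" for D by (simp add: F_def)
 have Fm: "(%D. F D $$ (j, k)) \<in> borel_measurable (PI K)" if "j < d" "k < d" for j k
 proof -
  have "(%D. (\<Sum>i\<in>I. fst (D i) $ j * fst (D i) $ k) / card I) \<in> borel_measurable (PI K)"
   using I that by (intro borel_measurable_divide borel_measurable_sum borel_measurable_times measurable_coord[OF _ meas_coord]) auto
  thus ?thesis using that by (simp add: F_def)
 qed
 have e: "dir I (v D) D $ j = (\<Sum>k<d. minv (F D) $$ (j, k) * v D $ k)" if D: "D \<in> space (PI K)" for D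
 proof -
  have on: "on I D" by (rule on_PI[OF I D])
  have oe: "outer (fst (D i)) (fst (D i)) $$ (j, k) = fst (D i) $ j * fst (D i) $ k" if "i \<in> I" "j < d" "k < d" for i j k
   using on that unfolding on_def outer_def by auto
  have "Sigma_hat d I D = F D" unfolding F_def Sigma_hat_def mat_mean_def
   by (intro eq_matI) (simp_all add: oe cong: sum.cong)
  thus ?thesis unfolding dir_def using mult_vec_sum[OF minv_carrier[OF F] v(1) j] by simp
 qed
 have "(%D. \<Sum>k<d. minv (F D) $$ (j, k) * v D $ k) \<in> borel_measurable (PI K)"
  using v(2) j by (intro borel_measurable_sum borel_measurable_times borel_measurable_minv[OF F Fm]) auto
 thus ?thesis using e by (subst measurable_cong) auto
qed

lemma meas_W_sum:
 assumes I: "finite J" "J \<subseteq> K" and w: "!!k. k < d ==> (%D. w D $ k) \<in> borel_measurable (PI K)"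
  and u: "!!k. k < d ==> (%D. u D $ k) \<in> borel_measurable (PI K)"
 shows "i \<in> K ==> (%D. W (w D) (D i)) \<in> borel_measurable (PI K)"
  "i \<in> K ==> (%D. drift_term (u D) (w D) (D i)) \<in> borel_measurable (PI K)"
proof -
 have dm: "(%D. dot d (u D) (fst (D i))) \<in> borel_measurable (PI K)"
  if "i \<in> K" "!!k. k < d ==> (%D. u D $ k) \<in> borel_measurable (PI K)" for i u
  unfolding dot_def using that by (intro borel_measurable_sum borel_measurable_times measurable_coord[OF _ meas_coord]) auto
 show "(%D. W (w D) (D i)) \<in> borel_measurable (PI K)" if "i \<in> K" for i
  unfolding W_def using dm[OF that w] measurable_coord[OF that meas_res] by (intro borel_measurable_times borel_measurable_uminus) auto
 show "(%D. drift_term (u D) (w D) (D i)) \<in> borel_measurable (PI K)" if "i \<in> K" for i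
  unfolding drift_term_def using dm[OF that w] dm[OF that u] by (intro borel_measurable_times) auto
qed

lemma meas_drift:
 assumes I: "finite I" "I ~= {}" "I \<subseteq> K" and j: "j < d"
 shows "(%D. drift I D $ j) \<in> borel_measurable (PI K)"
 unfolding drift_def
proof (rule meas_dir[OF I cross_carrier _ j])
 fix k assume k: "k < d"
 have m: "(%z. fst z $ k * res z) \<in> borel_measurable P" using meas_coord[OF k] meas_res by simp
 have "(%D. SS (%z. fst z $ k * res z) I D / card I) \<in> borel_measurable (PI K)"
  unfolding SS_def using I by (intro borel_measurable_divide borel_measurable_sum measurable_coord[OF _ m]) auto
 thus "(%D. cross I D $ k) \<in> borel_measurable (PI K)" using k by (simp add: cross_def)
qed

lemma meas_excess:
 assumes I: "finite I1" "I1 \<subseteq> K" and w: "!!k. k < d ==> (%D. w D $ k) \<in> borel_measurable (PI K)"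
 shows "{D \<in> space (PI K). self_normalised_excess (W (w D)) I1 z D} \<in> sets (PI K)"
proof -
 note m = meas_W_sum(1)[OF I w w]
 have [measurable]: "(%D. SS (W (w D)) I1 D) \<in> borel_measurable (PI K)" "(%D. SS (%y. (W (w D) y)^2) I1 D) \<in> borel_measurable (PI K)"
  unfolding SS_def using I by (intro borel_measurable_sum borel_measurable_power m; auto)+
 show ?thesis unfolding self_normalised_excess_def by measurable
qed

lemma meas_plugin:
 assumes I: "finite I1" "I1 \<subseteq> K" and w: "!!k. k < d ==> (%D. w D $ k) \<in> borel_measurable (PI K)"
  and u: "!!k. k < d ==> (%D. u D $ k) \<in> borel_measurable (PI K)" and wc: "!!D. D \<in> space (PI K) ==> w D \<in> carrier_vec d"
 shows "{D \<in> space (PI K). w D ~= 0\<^sub>v d \<and> plugin_excess (W (w D)) (%z. W (w D) z + drift_term (u D) (w D) z) I1 z D} \<in> sets (PI K)"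
proof -
 note m = meas_W_sum[OF I w u]
 have [measurable]: "(%D. SS (W (w D)) I1 D) \<in> borel_measurable (PI K)"
  "(%D. SS (%z. W (w D) z + drift_term (u D) (w D) z) I1 D) \<in> borel_measurable (PI K)"
  "(%D. SS (%z. (W (w D) z + drift_term (u D) (w D) z)^2) I1 D) \<in> borel_measurable (PI K)"
  unfolding SS_def using I by (intro borel_measurable_sum borel_measurable_power borel_measurable_add m; auto)+
 \<comment> \<open>Nonvanishing of the direction is expressed through its coordinates, whose
   measurability is known.\<close>
 have ne: "w D ~= 0\<^sub>v d \<longleftrightarrow> (\<Sum>k<d. (w D $ k)^2) ~= 0" if "D \<in> space (PI K)" for D
 proof (cases "w D = 0\<^sub>v d")
  case False
  thus ?thesis using norm_pos[OF wc[OF that] False] unfolding scalar_prod_sum[OF wc[OF that]] by (simp add: power2_eq_square)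
 qed simp
 have [measurable]: "(%D. \<Sum>k<d. (w D $ k)^2) \<in> borel_measurable (PI K)" using w by (intro borel_measurable_sum borel_measurable_power) auto
 have "{D \<in> space (PI K). w D ~= 0\<^sub>v d \<and> plugin_excess (W (w D)) (%z. W (w D) z + drift_term (u D) (w D) z) I1 z D}
  = {D \<in> space (PI K). (\<Sum>k<d. (w D $ k)^2) ~= 0 \<and> plugin_excess (W (w D)) (%z. W (w D) z + drift_term (u D) (w D) z) I1 z D}"
  using ne by auto
 also have "... \<in> sets (PI K)" unfolding plugin_excess_def by measurable
 finally show ?thesis .
qed

lemma meas_dir_const:
 "finite I ==> I ~= {} ==> I \<subseteq> K ==> v \<in> carrier_vec d ==> j < d ==> (%D. dir I v D $ j) \<in> borel_measurable (PI K)"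
 by (rule meas_dir) auto

lemma meas_simultaneous:
 assumes I: "finite I1" "I1 \<subseteq> K" "finite I2" "I2 ~= {}" "I2 \<subseteq> K"
 shows "{D \<in> space (PI K). simultaneous n I1 I2 D} \<in> sets (PI K)"
proof -
 have "{D \<in> space (PI K). simultaneous n I1 I2 D} = (\<Union>j\<in>{..<d}. {D \<in> space (PI K).
  self_normalised_excess (W (dir I2 (unit_vec d j) D)) I1 (upper_quantile (1 / (2 * real n * real d))) D})"
  unfolding simultaneous_def by auto
 also have "... \<in> sets (PI K)"
  using I by (intro sets.finite_UN meas_excess meas_dir_const) auto
 finally show ?thesis .
qed

lemma iid_moment_W:
 assumes v: "v \<in> carrier_vec d" "v ~= 0\<^sub>v d" and s: "2 < s" "s <= 3" "s <= qxy" and B: "mb <= B"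
 shows "iid_moment P (%z. W v z / sd v) s B"
 unfolding iid_moment_def iid_moment_axioms_def
 using iid_axioms scaled_standard[OF v] scaled_moment_le[OF v, of s] s B mb_ge_1 by auto

lemma W_zero_excess: "\<not> self_normalised_excess (W (0\<^sub>v d)) J z w"
proof -
 have "W (0\<^sub>v d) y = 0" for y by (simp add: W_def dot_def)
 thus ?thesis by (simp add: self_normalised_excess_def SS_def)
qed

text \<open>A union bound over the d directions, each with failure probability at most C * m powr (-
  (1/2)) / d. Vanishing directions cannot be standardised but never produce an excess.\<close>

lemma simultaneous_prob:
 assumes C: "tail_const s B C" "0 <= C" and s: "2 < s" "s <= 3" "s <= qxy" and B: "mb <= B"
  and J: "finite J" "J ~= {}" "d <= card J" and v: "!!j. j < d ==> v j \<in> carrier_vec d"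
 shows "\<P>(y in PI J. \<exists>j<d. self_normalised_excess (W (v j)) J (upper_quantile (1 / (4 * real (card J) * real d))) y)
  <= C * card J powr (- (1/2))"
proof -
 interpret A: prob_space "PI J" by (rule prob_space_PI)
 define F where "F = (%j. {y \<in> space (PI J). self_normalised_excess (W (v j)) J (upper_quantile (1 / (4 * real (card J) * real d))) y})"
 have F: "F j \<in> sets (PI J)" for j unfolding F_def using J by (intro meas_excess) auto
 have le: "real d * measure (PI J) (F j) <= C * card J powr (- (1/2))" if j: "j < d" for j
 proof (cases "v j = 0\<^sub>v d")
  case True
  thus ?thesis unfolding F_def using W_zero_excess C(2) by simp
 next
  case False
  have ne: "sd (v j) ~= 0" using sd_pos(1)[OF v[OF j] False] by simp
  have "F j = {y \<in> space (PI J). self_normalised_excess (%z. W (v j) z / sd (v j)) J (upper_quantile (1 / (4 * real (card J) * real d))) y}"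
   unfolding F_def by (simp only: self_normalised_excess_scale[OF ne])
  thus ?thesis using C(1) iid_moment_W[OF v[OF j] False s B] J d unfolding tail_const_def by (simp add: Suc_le_eq)
 qed
 have "{y \<in> space (PI J). \<exists>j<d. self_normalised_excess (W (v j)) J (upper_quantile (1 / (4 * real (card J) * real d))) y} = (\<Union>j\<in>{..<d}. F j)"
  unfolding F_def by auto
 also have "measure (PI J) ... <= (\<Sum>j<d. measure (PI J) (F j))"
  using F by (intro A.finite_measure_subadditive_finite) auto
 also have "... <= (\<Sum>j<d. C * card J powr (- (1/2)) / real d)"
  using le d by (intro sum_mono) (simp add: le_divide_eq mult.commute)
 also have "... = C * card J powr (- (1/2))" using d by simp
 finally show ?thesis .
qed

lemma merge_right: "I \<inter> J = {} ==> i \<in> J ==> merge I J (x, y) i = y i"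
 by (auto simp: merge_def)

lemma merge_left: "i \<in> I ==> merge I J (x, y) i = x i"
 by (auto simp: merge_def)

context
 fixes n :: nat and I1 I2 :: "nat set"
 assumes split: "half_split n I1 I2" and dn: "real d <= real n / 2"
begin

lemma split_facts: "finite I1" "finite I2" "I1 ~= {}" "I2 ~= {}" "I2 \<inter> I1 = {}" "I2 \<union> I1 = {1..n}"
 "n = 2 * card I1" "card I2 = card I1" "d <= card I1" "1 <= card I1" "0 < n"
proof -
 have h: "even n" "I1 \<union> I2 = {1..n}" "I1 \<inter> I2 = {}" "card I1 = n div 2" "card I2 = n div 2" using split by (auto simp: half_split_def)
 show n2: "n = 2 * card I1" using h by auto
 show c: "card I2 = card I1" using h by simp
 show dc: "d <= card I1" using dn unfolding n2 by simp
 thus "1 <= card I1" "0 < n" using d n2 by auto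
 show "finite I1" "finite I2" using h(2) by (metis finite_Un finite_atLeastAtMost)+
 show "I1 ~= {}" "I2 ~= {}" using dc d c by (metis card.empty le_zero_eq neq0_conv)+
 show "I2 \<inter> I1 = {}" "I2 \<union> I1 = {1..n}" using h by auto
qed

text \<open>For a fixed second half x the directions no longer depend on y, and n = 2 * card I1
  turns the quantile level into that of the tail bound.\<close>

lemma section_simultaneous:
 assumes C: "tail_const s B C" "0 <= C" and s: "2 < s" "s <= 3" "s <= qxy" and B: "mb <= B"
  and x: "x \<in> space (PI I2)"
 shows "\<P>(y in PI I1. simultaneous n I1 I2 (merge I2 I1 (x, y))) <= C * card I1 powr (- (1/2))"
  "{y \<in> space (PI I1). simultaneous n I1 I2 (merge I2 I1 (x, y))} \<in> sets (PI I1)"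
proof -
 note f = split_facts
 have on: "on I2 x" using f x by (intro on_PI[of I2 I2]) auto
 have q: "2 * real n * real d = 4 * real (card I1) * real d" using f(7) by simp
 have e: "simultaneous n I1 I2 (merge I2 I1 (x, y)) \<longleftrightarrow>
  (\<exists>j<d. self_normalised_excess (W (dir I2 (unit_vec d j) x)) I1 (upper_quantile (1 / (4 * real (card I1) * real d))) y)" for y
 proof -
  have "dir I2 v (merge I2 I1 (x, y)) = dir I2 v x" for v by (rule dir_cong) (simp add: merge_left)
  moreover have "self_normalised_excess X I1 z (merge I2 I1 (x, y)) = self_normalised_excess X I1 z y" for X :: "real vec \<times> real => real" and z
   by (rule self_normalised_excess_cong) (simp add: merge_right[OF f(5)])
  ultimately show ?thesis unfolding simultaneous_def q by simp
 qed
 show "\<P>(y in PI I1. simultaneous n I1 I2 (merge I2 I1 (x, y))) <= C * card I1 powr (- (1/2))"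
  unfolding e using f by (intro simultaneous_prob[OF C s B] dir_carrier[OF on]) auto
 have "{y \<in> space (PI I1). \<exists>j<d. self_normalised_excess (W (dir I2 (unit_vec d j) x)) I1 (upper_quantile (1 / (4 * real (card I1) * real d))) y}
  = (\<Union>j\<in>{..<d}. {y \<in> space (PI I1). self_normalised_excess (W (dir I2 (unit_vec d j) x)) I1 (upper_quantile (1 / (4 * real (card I1) * real d))) y})" by auto
 also have "... \<in> sets (PI I1)" using f by (intro sets.finite_UN meas_excess) auto
 finally show "{y \<in> space (PI I1). simultaneous n I1 I2 (merge I2 I1 (x, y))} \<in> sets (PI I1)" unfolding e .
qed

text \<open>The miss event may fail to be measurable but is contained in the preimage of the
  measurable event EV, so the outer probability is bounded by a probability on the product space.
  Indices outside {1..n} are unconstrained, hence the restriction X and the congruence assumption on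
  EV.\<close>

lemma outer_prob_bound:
 fixes M :: "'c measure"
 assumes iid: "iid_sample M P n Z" and E: "{D \<in> space (PI {1..n}). EV D} \<in> sets (PI {1..n})"
  and miss: "!!D. on I1 D ==> on I2 D ==> R D ==> EV D"
  and cong: "!!D D'. (!!i. i \<in> {1..n} ==> D i = D' i) ==> EV D = EV D'"
 shows "outer_prob M (%v. R (%i. Z i v)) <= \<P>(D in PI {1..n}. EV D)"
proof -
 interpret M: prob_space M using iid by (simp add: iid_sample_def)
 interpret A: prob_space "PI {1..n}" by (rule prob_space_PI)
 have iv: "M.indep_vars (%_. P) Z {1..n}" using iid by (simp add: iid_sample_def)
 have rv: "Z i \<in> M \<rightarrow>\<^sub>M P" if "i \<in> {1..n}" for i using iv that by (simp add: M.indep_vars_def)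
 define X where "X = (%v. \<lambda>i\<in>{1..n}. Z i v)"
 have Xm: "X \<in> M \<rightarrow>\<^sub>M PI {1..n}" unfolding X_def using rv by (intro measurable_restrict) auto
 have ne: "{1..n} ~= {}" using split_facts(11) by simp
 have "distr M (PI {1..n}) X = (\<Pi>\<^sub>M i\<in>{1..n}. distr M P (Z i))"
  using M.indep_vars_iff_distr_eq_PiM'[OF ne, where M' = "%_. P" and X = Z] rv iv unfolding X_def by simp
 also have "... = PI {1..n}" using iid by (intro PiM_cong) (auto simp: iid_sample_def)
 finally have dX: "distr M (PI {1..n}) X = PI {1..n}" .
 define E' where "E' = X -` {D \<in> space (PI {1..n}). EV D} \<inter> space M"
 have E': "E' \<in> sets M" unfolding E'_def by (rule measurable_sets[OF Xm E])
 have sub: "{v \<in> space M. R (%i. Z i v)} \<subseteq> E'"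
 proof
  fix v assume w: "v \<in> {v \<in> space M. R (%i. Z i v)}"
  have Zc: "fst (Z i v) \<in> carrier_vec d" if "i \<in> {1..n}" for i
   using measurable_space[OF rv[OF that], of v] w by (auto simp: space_P)
  have sub: "I1 \<subseteq> {1..n}" "I2 \<subseteq> {1..n}" using split_facts(6) by auto
  have "EV (%i. Z i v)" using w Zc sub split_facts by (intro miss) (auto simp: on_def)
  hence "EV (X v)" using cong[of "X v" "%i. Z i v"] by (simp add: X_def)
  thus "v \<in> E'" unfolding E'_def using w measurable_space[OF Xm] by auto
 qed
 have "outer_measure_of M {v \<in> space M. R (%i. Z i v)} <= outer_measure_of M E'" by (rule outer_measure_of_mono[OF sub])
 also have "... = emeasure M E'" by (rule outer_measure_of_eq[OF E'])
 finally have "outer_prob M (%v. R (%i. Z i v)) <= measure M E'"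
  unfolding outer_prob_def by (simp add: M.emeasure_eq_measure enn2real_leI)
 also have "measure M E' = measure (distr M (PI {1..n}) X) {D \<in> space (PI {1..n}). EV D}"
  unfolding E'_def using measure_distr[OF Xm E] by simp
 finally show ?thesis unfolding dX .
qed

text \<open>On each section the direction is a constant vector. If it is nonzero, dividing the
  scores by their standard deviation leaves the excess event unchanged and brings it under the
  i.i.d. bound; if it is zero, no excess occurs.\<close>

lemma SeN_coverage:
 fixes M :: "'c measure"
 assumes C1: "tail_const s B C1" "0 <= C1" and s: "2 < s" "s <= 3" "s <= qxy" and B: "mb <= B"
  and C2: "!!X (J :: nat set) z. iid_moment P X s B ==> finite J ==> J ~= {} ==> 0 <= z ==>
   \<P>(q in PI J. self_normalised_excess X J z q) <= 2 * Q z + C2 * rate (card J)" "0 <= C2" "0 <= rate (card I1)"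
  and iid: "iid_sample M P n Z" and a: "0 < a" "a < 1" and e: "e \<in> carrier_vec d"
 shows "outer_prob M (%q. e \<bullet> beta0 d P \<notin> CI_SeN d n I1 I2 (%i. Z i q) e a)
  <= a + (C2 * rate (card I1) + C1 * card I1 powr (- (1/2)))"
proof -
 note f = split_facts
 have sub: "I1 \<subseteq> {1..n}" "I2 \<subseteq> {1..n}" using f(6) by auto
 define z where "z = upper_quantile (a / 2)"
 have z: "0 <= z" "2 * Q z = a" unfolding z_def using a upper_quantile_nonneg[of "a / 2"] Q_upper_quantile[of "a / 2"] by auto
 define EV where "EV = (%D. self_normalised_excess (W (dir I2 e D)) I1 z D \<or> simultaneous n I1 I2 D)"
 have "{D \<in> space (PI {1..n}). EV D} = {D \<in> space (PI {1..n}). self_normalised_excess (W (dir I2 e D)) I1 z D} \<union> {D \<in> space (PI {1..n}). simultaneous n I1 I2 D}"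
  unfolding EV_def by auto
 also have "... \<in> sets (PI {1..n})" using f sub e by (intro sets.Un meas_excess meas_simultaneous meas_dir_const) auto
 finally have E: "{D \<in> space (PI {1..n}). EV D} \<in> sets (PI {1..n})" .
 have cong: "EV D = EV D'" if h: "!!i. i \<in> {1..n} ==> D i = D' i" for D D'
 proof -
  have "dir I2 v D = dir I2 v D'" for v using sub h by (intro dir_cong) auto
  moreover have "self_normalised_excess X I1 z D = self_normalised_excess X I1 z D'" for X :: "real vec \<times> real => real" and z
   using sub h by (intro self_normalised_excess_cong) auto
  ultimately show ?thesis unfolding EV_def simultaneous_def by simp
 qed
 have "outer_prob M (%q. e \<bullet> beta0 d P \<notin> CI_SeN d n I1 I2 (%i. Z i q) e a) <= \<P>(D in PI {1..n}. EV D)"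
 proof (rule outer_prob_bound[OF iid E _ cong])
  show "EV D" if "on I1 D" "on I2 D" "e \<bullet> beta0 d P \<notin> CI_SeN d n I1 I2 D e a" for D
   unfolding EV_def z_def by (rule SeN_miss[OF that(1,2) f(11) a e that(3)])
 qed
 also have "... <= (LINT x|PI I2. a + (C2 * rate (card I1) + C1 * card I1 powr (- (1/2))))"
  unfolding f(6)[symmetric]
 proof (rule PI_split_bound[OF f(2,1,5)])
  interpret A: prob_space "PI I2" by (rule prob_space_PI)
  interpret B: prob_space "PI I1" by (rule prob_space_PI)
  show "integrable (PI I2) (%x. a + (C2 * rate (card I1) + C1 * card I1 powr (- (1/2))))" by simp
  show "{D \<in> space (PI (I2 \<union> I1)). EV D} \<in> sets (PI (I2 \<union> I1))" unfolding f(6) by (rule E)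
  fix x assume x: "x \<in> space (PI I2)"
  have on: "on I2 x" using f x by (intro on_PI[of I2 I2]) auto
  define w where "w = dir I2 e x"
  have w: "w \<in> carrier_vec d" unfolding w_def by (rule dir_carrier[OF on e])
  define F where "F = {y \<in> space (PI I1). self_normalised_excess (W w) I1 z y}"
  define G where "G = {y \<in> space (PI I1). simultaneous n I1 I2 (merge I2 I1 (x, y))}"
  note G = section_simultaneous[OF C1 s B x, folded G_def]
  have F: "F \<in> sets (PI I1)" unfolding F_def using f by (intro meas_excess) auto
  have "\<P>(y in PI I1. merge I2 I1 (x, y) \<in> {D \<in> space (PI (I2 \<union> I1)). EV D}) <= measure (PI I1) (F \<union> G)"
  proof (rule B.finite_measure_mono)
   show "{y \<in> space (PI I1). merge I2 I1 (x, y) \<in> {D \<in> space (PI (I2 \<union> I1)). EV D}} \<subseteq> F \<union> G"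
   proof (rule subsetI, rule ccontr)
    fix y assume "y \<in> {y \<in> space (PI I1). merge I2 I1 (x, y) \<in> {D \<in> space (PI (I2 \<union> I1)). EV D}}" and nFG: "y \<notin> F \<union> G"
    hence y: "y \<in> space (PI I1)" "EV (merge I2 I1 (x, y))" "y \<notin> G" by auto
    have "dir I2 e (merge I2 I1 (x, y)) = w" unfolding w_def by (rule dir_cong) (simp add: merge_left)
    hence "self_normalised_excess (W w) I1 z (merge I2 I1 (x, y))" using y unfolding EV_def G_def by auto
    moreover have "self_normalised_excess (W w) I1 z (merge I2 I1 (x, y)) = self_normalised_excess (W w) I1 z y"
    by (rule self_normalised_excess_cong) (simp add: merge_right[OF f(5)])
    ultimately have "y \<in> F" unfolding F_def using y by simp
    thus False using nFG by simp
   qed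
  qed (use F G(2) in auto)
  also have "... <= measure (PI I1) F + measure (PI I1) G" by (rule measure_subadditive[OF F G(2)]) (simp_all add: B.emeasure_eq_measure)
  also have "measure (PI I1) F <= a + C2 * rate (card I1)"
  proof (cases "w = 0\<^sub>v d")
   case True
   thus ?thesis unfolding F_def using W_zero_excess a C2(2,3) by simp
  next
   case False
   have ne: "sd w ~= 0" using sd_pos(1)[OF w False] by simp
   have "F = {y \<in> space (PI I1). self_normalised_excess (%z. W w z / sd w) I1 z y}"
    unfolding F_def by (simp only: self_normalised_excess_scale[OF ne])
   thus ?thesis using C2(1)[OF iid_moment_W[OF w False s B] f(1,3) z(1)] z(2) by simp
  qed
  also note G(1)
  finally show "\<P>(y in PI I1. merge I2 I1 (x, y) \<in> {D \<in> space (PI (I2 \<union> I1)). EV D})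
   <= a + (C2 * rate (card I1) + C1 * card I1 powr (- (1/2)))" by simp
 qed
 also have "... = a + (C2 * rate (card I1) + C1 * card I1 powr (- (1/2)))"
 proof -
  interpret A: prob_space "PI I2" by (rule prob_space_PI)
  show ?thesis using A.prob_space by simp
 qed
 finally show ?thesis .
qed

text \<open>Product of the bounds for the two factors of the standardised drift term: Kx * sqrt uS
  per unit of drift, and Kx * sqrt (uS / lV) for the direction divided by its standard
  deviation.\<close>

definition kap :: real where "kap = Kx * sqrt uS * (Kx * sqrt (uS / lV))"

text \<open>The drift term is a product of two linear forms in the covariate, each with qx moments,
  so Hoelder's inequality reaches the exponent qx / 2; this is where q <= qx / 2 originates. A
  strictly positive r majorises the drift, which may itself vanish.\<close>

lemma drift_moment:
 assumes w: "w \<in> carrier_vec d" "w ~= 0\<^sub>v d" and h: "h \<in> carrier_vec d"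
  and r: "0 < r" "kap * sqrt (h \<bullet> h) <= r" and a: "0 < a" "a <= qx / 2"
 shows "integrable P (%z. abs (drift_term h w z / sd w) powr a)" "(LINT z|P. abs (drift_term h w z / sd w) powr a) <= 2 * r powr a"
proof -
 note sw = sd_pos[OF w]
 define H where "H = (%z. drift_term h w z / (sd w * r))"
 have Hm: "H \<in> borel_measurable P" unfolding H_def drift_term_def using meas_dot by measurable
 have e: "abs (drift_term h w z / sd w) powr a = r powr a * abs (H z) powr a" for z
  unfolding H_def using r sw by (simp add: powr_mult[symmetric] abs_divide abs_mult)
 have H: "integrable P (%z. abs (H z) powr (qx / 2)) \<and> (LINT z|P. abs (H z) powr (qx / 2)) <= 1"
 proof (cases "h = 0\<^sub>v d")
  case True
  hence "H z = 0" for z unfolding H_def drift_term_def by (simp add: dot_def)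
  thus ?thesis by simp
 next
  case False
  define k1 k2 where "k1 = Kx * sqrt (uS * (h \<bullet> h))" and "k2 = Kx * sqrt (uS * (w \<bullet> w))"
  note m1 = dot_moment[OF h False, folded k1_def] and m2 = dot_moment[OF w, folded k2_def]
  have q: "1 / (qx / 2) = 1 / qx + 1 / qx" by simp
  have qp: "0 < qx" "0 < qx / 2" using pos by auto
  note HM = Holder_moment[OF meas_dot m1(1,2) meas_dot m2(1,2) m1(3) m2(3) qp(1) qp(1) qp(2) q]
  have k: "k1 * k2 <= sd w * r"
  proof -
   have "k2 = (Kx * sqrt (uS / lV)) * sqrt (lV * (w \<bullet> w))" unfolding k2_def using pos by (simp add: real_sqrt_mult real_sqrt_divide)
   also have "... <= (Kx * sqrt (uS / lV)) * sd w" using sw(2) pos by (intro mult_left_mono) auto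
   finally have "k1 * k2 <= k1 * ((Kx * sqrt (uS / lV)) * sd w)" using m1(3) by (intro mult_left_mono) auto
   also have "... = (kap * sqrt (h \<bullet> h)) * sd w" unfolding k1_def kap_def by (simp add: real_sqrt_mult)
   also have "... <= r * sd w" using r sw by (intro mult_right_mono) auto
   finally show ?thesis by (simp add: mult.commute)
  qed
  have e2: "abs (H z) powr (qx / 2) = abs (dot d h (fst z) * dot d w (fst z)) powr (qx / 2) / (sd w * r) powr (qx / 2)" for z
   unfolding H_def drift_term_def using r sw by (simp add: powr_divide abs_divide)
  have "(LINT z|P. abs (H z) powr (qx / 2)) <= (k1 * k2) powr (qx / 2) / (sd w * r) powr (qx / 2)"
   unfolding e2 using HM(2) by (simp add: divide_right_mono)
  also have "... <= 1"
  proof -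
   have "(k1 * k2) powr (qx / 2) <= (sd w * r) powr (qx / 2)" using k m1(3) m2(3) qp by (intro powr_mono2) auto
   thus ?thesis using r sw by (simp add: divide_le_eq_1)
  qed
  finally show ?thesis unfolding e2 using HM(1) by simp
 qed
 note mm = powr_moment_mono[OF prob_space_axioms Hm conjunct1[OF H] a]
 show "integrable P (%z. abs (drift_term h w z / sd w) powr a)" unfolding e using mm(1) by simp
 have "(LINT z|P. abs (H z) powr a) <= 2" using mm(2) conjunct2[OF H] by linarith
 hence "r powr a * (LINT z|P. abs (H z) powr a) <= r powr a * 2" by (intro mult_left_mono) auto
 thus "(LINT z|P. abs (drift_term h w z / sd w) powr a) <= 2 * r powr a" unfolding e by (simp add: mult.commute)
qed

lemma plugin_section:
 assumes s: "2 < s" "s <= 3" "s <= qxy" and B: "mb <= B" "2 <= B" and p: "1 < p" "2 * p <= qxy" "2 * p <= qx / 2" and qx: "4 < qx"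
  and C3: "plugin_const rate s B p C3"
  and J: "finite J" "J ~= {}" and z: "0 <= z"
  and w: "w \<in> carrier_vec d" "w ~= 0\<^sub>v d" and h: "h \<in> carrier_vec d" and r: "0 < r" "kap * sqrt (h \<bullet> h) <= r"
 shows "\<P>(q in PI J. plugin_excess (W w) (%z. W w z + drift_term h w z) J z q) <= 2 * Q z + C3 * (rate (card J) + 2 * r)"
proof -
 note sw = sd_pos[OF w]
 define X G where "X = (%z. W w z / sd w)" and "G = (%z. drift_term h w z / sd w)"
 have e: "plugin_excess (W w) (%z. W w z + drift_term h w z) J z q \<longleftrightarrow> plugin_excess X (%y. X y + G y) J z q" for q
  using plugin_excess_scale[of "sd w" "W w" "%z. W w z + drift_term h w z" J z q] sw(1)
  unfolding X_def G_def by (simp add: add_divide_distrib)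
 have sq: "abs x powr 2 = x^2" for x :: real by (cases "x = 0") (auto simp: powr_numeral)
 note g2 = drift_moment[OF w h r, of 2, unfolded sq]
 note gp = drift_moment[OF w h r, of "2 * p"]
 note xp = scaled_moment_le[OF w, of "2 * p"]
 show ?thesis unfolding e
 proof (rule C3[unfolded plugin_const_def, rule_format], intro conjI)
  show "iid_moment P X s B" unfolding X_def by (rule iid_moment_W[OF w s B(1)])
  show "G \<in> borel_measurable P" unfolding G_def drift_term_def using meas_dot by measurable
  show "integrable P (%y. (G y)^2)" unfolding G_def using qx by (intro g2(1)) auto
  have "(LINT y|P. (G y)^2) <= 2 * r powr 2" unfolding G_def using qx by (intro g2(2)) auto
  also have "... = 2 * r^2" using r(1) by (simp add: powr_numeral)
  \<comment> \<open>The moment bound 2 * r^2 exceeds r^2, so the plug-in theorem is applied with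
    radius 2 * r.\<close>
  also have "... <= (2 * r)^2" by (simp add: power_mult_distrib)
  finally show "(LINT y|P. (G y)^2) <= (2 * r)^2" .
  show "integrable P (%y. abs (G y) powr (2 * p))" unfolding G_def using p by (intro gp(1)) auto
  have "(LINT y|P. abs (G y) powr (2 * p)) <= 2 * r powr (2 * p)" unfolding G_def using p by (intro gp(2)) auto
  also have "... <= B * (2 * r) powr (2 * p)" using B(2) r p by (intro mult_mono powr_mono2) auto
  finally show "(LINT y|P. abs (G y) powr (2 * p)) <= B * (2 * r) powr (2 * p)" .
  show "integrable P (%y. abs (X y) powr (2 * p))" unfolding X_def using p by (intro xp(1)) auto
  have "(LINT y|P. abs (X y) powr (2 * p)) <= mb" unfolding X_def using p by (intro xp(2)) auto
  thus "(LINT y|P. abs (X y) powr (2 * p)) <= B" using B(1) by linarith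
 qed (use J z r in auto)
qed

text \<open>Given the second half, the plug-in bound is linear in a majorant of the drift, and its
  expectation is taken afterwards. Where the second moment matrix is deficient the trivial bound 1
  is used, at the price of the probability of that event.\<close>

lemma SpN_coverage:
 fixes M :: "'c measure"
 assumes C1: "tail_const s B C1" "0 <= C1" and s: "2 < s" "s <= 3" "s <= qxy" and B: "mb <= B" "2 <= B"
  and p: "1 < p" "2 * p <= qxy" "2 * p <= qx / 2" and qx: "4 < qx"
  and C3: "plugin_const rate s B p C3"
  and C3': "0 <= C3" "0 <= rate (card I1)"
  and iid: "iid_sample M P n Z" and a: "0 < a" "a < 1" and j: "j \<in> carrier_vec d"
 shows "outer_prob M (%q. j \<bullet> beta0 d P \<notin> CI_SpN d n I1 I2 (%i. Z i q) j a)
  <= a + (C3 * (rate (card I1) + 8 * kap / lS * (mw + 1) * sqrt (real d / card I1)) + C1 * card I1 powr (- (1/2))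
    + 32 * tau * sqrt uS / lS * sqrt (real d / card I1))"
proof -
 note f = split_facts
 have sub: "I1 \<subseteq> {1..n}" "I2 \<subseteq> {1..n}" using f(6) by auto
 define b where "b = sqrt (real d / card I1)"
 have b: "0 < b" "b * b = real d / card I1" unfolding b_def using d f(10) by auto
 have kap: "0 < kap" unfolding kap_def using pos by simp
 define z where "z = upper_quantile (a / 2)"
 have z: "0 <= z" "2 * Q z = a" unfolding z_def using a upper_quantile_nonneg[of "a / 2"] Q_upper_quantile[of "a / 2"] by auto
 define PE where "PE = (%D. dir I2 j D ~= 0\<^sub>v d \<and> plugin_excess (W (dir I2 j D)) (%z. W (dir I2 j D) z + drift_term (drift I2 D) (dir I2 j D) z) I1 z D)"
 define EV where "EV = (%D. PE D \<or> simultaneous n I1 I2 D)"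
 have "{D \<in> space (PI {1..n}). EV D} = {D \<in> space (PI {1..n}). PE D} \<union> {D \<in> space (PI {1..n}). simultaneous n I1 I2 D}"
  unfolding EV_def by auto
 also have "... \<in> sets (PI {1..n})"
 proof (rule sets.Un)
  show "{D \<in> space (PI {1..n}). PE D} \<in> sets (PI {1..n})"
   unfolding PE_def using f sub j
   by (intro meas_plugin meas_dir_const meas_drift dir_carrier[OF on_PI[OF f(2,4) sub(2)]]) auto
  show "{D \<in> space (PI {1..n}). simultaneous n I1 I2 D} \<in> sets (PI {1..n})" using f sub by (intro meas_simultaneous) auto
 qed
 finally have E: "{D \<in> space (PI {1..n}). EV D} \<in> sets (PI {1..n})" .
 have cong: "EV D = EV D'" if h: "!!i. i \<in> {1..n} ==> D i = D' i" for D D'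
 proof -
  have 1: "dir I2 v D = dir I2 v D'" for v using sub h by (intro dir_cong) auto
  have 2: "drift I2 D = drift I2 D'" using sub h by (intro drift_cong) auto
  have 3: "self_normalised_excess X I1 z D = self_normalised_excess X I1 z D'" for X :: "real vec \<times> real => real" and z
   using sub h by (intro self_normalised_excess_cong) auto
  have 4: "plugin_excess X U I1 z D = plugin_excess X U I1 z D'" for X U :: "real vec \<times> real => real" and z
   using sub h by (intro plugin_excess_cong) auto
  show ?thesis unfolding EV_def PE_def simultaneous_def 1 2 3 4 ..
 qed
 have "outer_prob M (%q. j \<bullet> beta0 d P \<notin> CI_SpN d n I1 I2 (%i. Z i q) j a) <= \<P>(D in PI {1..n}. EV D)"
 proof (rule outer_prob_bound[OF iid E _ cong])
  show "EV D" if "on I1 D" "on I2 D" "j \<bullet> beta0 d P \<notin> CI_SpN d n I1 I2 D j a" for D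
   unfolding EV_def PE_def z_def by (rule SpN_miss[OF that(1,2) f(11) a j that(3)])
 qed
 also have "... <= (LINT x|PI I2. (a + C3 * rate (card I1) + C1 * card I1 powr (- (1/2)) + C3 * (8 * kap / lS * b))
   + (C3 * (8 * kap / lS / b) * (cross I2 x \<bullet> cross I2 x) + indicator {q \<in> space (PI I2). deficient I2 q} x))"
  (is "_ <= (LINT x|_. ?c + (?k * _ + _))")
  unfolding f(6)[symmetric]
 proof (rule PI_split_bound[OF f(2,1,5)])
  interpret A: prob_space "PI I2" by (rule prob_space_PI)
  interpret B: prob_space "PI I1" by (rule prob_space_PI)
  have "integrable (PI I2) (indicat_real {q \<in> space (PI I2). deficient I2 q})"
   using deficient_prob(1)[OF f(2,4)] by (intro integrable_real_indicator) (auto simp: A.emeasure_eq_measure)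
  thus "integrable (PI I2) (%x. ?c + (?k * (cross I2 x \<bullet> cross I2 x) + indicator {q \<in> space (PI I2). deficient I2 q} x))"
   using cross_sq(1)[OF f(2,4)] by (intro Bintegrable_add integrable_mult_right) auto
  show "{D \<in> space (PI (I2 \<union> I1)). EV D} \<in> sets (PI (I2 \<union> I1))" unfolding f(6) by (rule E)
  fix x assume x: "x \<in> space (PI I2)"
  have on: "on I2 x" using f x by (intro on_PI[of I2 I2]) auto
  have k0: "0 <= ?k" using C3' kap b pos by simp
  have gg: "0 <= cross I2 x \<bullet> cross I2 x" by (rule scalar_prod_self_ge_0)
  show "\<P>(y in PI I1. merge I2 I1 (x, y) \<in> {D \<in> space (PI (I2 \<union> I1)). EV D})
   <= ?c + (?k * (cross I2 x \<bullet> cross I2 x) + indicator {q \<in> space (PI I2). deficient I2 q} x)"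
  proof (cases "deficient I2 x")
   case True
   have "\<P>(y in PI I1. merge I2 I1 (x, y) \<in> {D \<in> space (PI (I2 \<union> I1)). EV D}) <= 1" by (rule B.prob_le_1)
   moreover have "0 <= ?c" using a C3' C1(2) kap b pos by (intro add_nonneg_nonneg mult_nonneg_nonneg) auto
   moreover have "0 <= ?k * (cross I2 x \<bullet> cross I2 x)" by (rule mult_nonneg_nonneg[OF k0 gg])
   moreover have "indicator {q \<in> space (PI I2). deficient I2 q} x = (1::real)" using True x by simp
   ultimately show ?thesis by linarith
  next
   case False
   define w e where "w = dir I2 j x" and "e = drift I2 x"
   have w: "w \<in> carrier_vec d" unfolding w_def by (rule dir_carrier[OF on j])
   have e: "e \<in> carrier_vec d" unfolding e_def by (rule drift_carrier[OF on])
   \<comment> \<open>The drift norm is at most 8 / lS times the norm g of the cross vector, and 2 *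
     g <= g^2 / b + b trades that norm for its square, whose mean is at most mw * b^2. The choice b
     = sqrt (d / m) balances the two terms and keeps r positive.\<close>
   define r where "r = 4 * kap / lS * ((cross I2 x \<bullet> cross I2 x) / b + b)"
   have r0: "0 < r" unfolding r_def using kap pos b gg by (intro mult_pos_pos divide_pos_pos add_nonneg_pos) auto
   have r1: "kap * sqrt (e \<bullet> e) <= r"
   proof -
    define g where "g = sqrt (cross I2 x \<bullet> cross I2 x)"
    have "0 <= (g - b)^2" by simp
    hence "2 * g * b <= g * g + b * b" by (simp add: sq_simps)
    hence 1: "2 * g <= g * g / b + b" using b(1) by (simp add: field_simps)
    have "sqrt (e \<bullet> e) <= 8 / lS * g"
    using drift_bound[OF on False] pos unfolding g_def e_def by (simp add: field_simps)
    hence "kap * sqrt (e \<bullet> e) <= kap * (8 / lS * g)" using kap by (intro mult_left_mono) auto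
    also have "... = 4 * kap / lS * (2 * g)" by simp
    also have "... <= 4 * kap / lS * (g * g / b + b)" using 1 kap pos by (intro mult_left_mono) auto
    finally show ?thesis unfolding r_def g_def using gg by simp
   qed
   define F where "F = {y \<in> space (PI I1). w ~= 0\<^sub>v d \<and> plugin_excess (W w) (%z. W w z + drift_term e w z) I1 z y}"
   define G where "G = {y \<in> space (PI I1). simultaneous n I1 I2 (merge I2 I1 (x, y))}"
   note G = section_simultaneous[OF C1 s B(1) x, folded G_def]
   have F: "F \<in> sets (PI I1)" unfolding F_def using f w by (intro meas_plugin) auto
   have "\<P>(y in PI I1. merge I2 I1 (x, y) \<in> {D \<in> space (PI (I2 \<union> I1)). EV D}) <= measure (PI I1) (F \<union> G)"
   proof (rule B.finite_measure_mono)
    show "{y \<in> space (PI I1). merge I2 I1 (x, y) \<in> {D \<in> space (PI (I2 \<union> I1)). EV D}} \<subseteq> F \<union> G"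
    proof (rule subsetI, rule ccontr)
    fix y assume "y \<in> {y \<in> space (PI I1). merge I2 I1 (x, y) \<in> {D \<in> space (PI (I2 \<union> I1)). EV D}}" and nFG: "y \<notin> F \<union> G"
    hence y: "y \<in> space (PI I1)" "EV (merge I2 I1 (x, y))" "y \<notin> G" by auto
    have 1: "dir I2 j (merge I2 I1 (x, y)) = w" unfolding w_def by (rule dir_cong) (simp add: merge_left)
    have 2: "drift I2 (merge I2 I1 (x, y)) = e" unfolding e_def by (rule drift_cong) (simp add: merge_left)
    have "PE (merge I2 I1 (x, y))" using y unfolding EV_def G_def by auto
    moreover have "plugin_excess X U I1 z (merge I2 I1 (x, y)) = plugin_excess X U I1 z y" for X U :: "real vec \<times> real => real"
    by (rule plugin_excess_cong) (simp add: merge_right[OF f(5)])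
    ultimately have "y \<in> F" unfolding F_def PE_def 1 2 using y by simp
    thus False using nFG by simp
    qed
   qed (use F G(2) in auto)
   also have "... <= measure (PI I1) F + measure (PI I1) G" by (rule measure_subadditive[OF F G(2)]) (simp_all add: B.emeasure_eq_measure)
   also have "measure (PI I1) F <= a + C3 * (rate (card I1) + 2 * r)"
   proof (cases "w = 0\<^sub>v d")
    case True
    thus ?thesis unfolding F_def using a C3' r0 by simp
   next
    case False
    have "F = {y \<in> space (PI I1). plugin_excess (W w) (%z. W w z + drift_term e w z) I1 z y}" unfolding F_def using False by simp
    moreover have "\<P>(y in PI I1. plugin_excess (W w) (%z. W w z + drift_term e w z) I1 z y) <= 2 * Q z + C3 * (rate (card I1) + 2 * r)"
    by (rule plugin_section[OF s B p qx C3 f(1,3) z(1) w False e r0 r1])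
    ultimately show ?thesis using z(2) by simp
   qed
   also note G(1)
   finally have "\<P>(y in PI I1. merge I2 I1 (x, y) \<in> {D \<in> space (PI (I2 \<union> I1)). EV D})
    <= a + C3 * (rate (card I1) + 2 * r) + C1 * card I1 powr (- (1/2))" by simp
   also have "... = ?c + ?k * (cross I2 x \<bullet> cross I2 x)" unfolding r_def by (simp add: algebra_simps)
   finally show ?thesis using False by simp
  qed
 qed
 also have "... = ?c + (?k * (LINT x|PI I2. cross I2 x \<bullet> cross I2 x) + \<P>(q in PI I2. deficient I2 q))"
 proof -
  interpret A: prob_space "PI I2" by (rule prob_space_PI)
  have S: "{q \<in> space (PI I2). deficient I2 q} \<in> sets (PI I2)" by (rule deficient_prob(1)[OF f(2,4)])
  have i: "integrable (PI I2) (indicat_real {q \<in> space (PI I2). deficient I2 q})"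
   using S by (intro integrable_real_indicator) (auto simp: A.emeasure_eq_measure)
  have "(LINT x|PI I2. indicat_real {q \<in> space (PI I2). deficient I2 q} x) = \<P>(q in PI I2. deficient I2 q)"
   using S by (simp add: sets.Int_space_eq2)
  thus ?thesis using i cross_sq(1)[OF f(2,4)] A.prob_space by simp
 qed
 also have "... <= ?c + (?k * (mw * (b * b)) + 32 * tau * sqrt uS / lS * b)"
 proof (intro add_left_mono add_mono mult_left_mono)
  show "(LINT x|PI I2. cross I2 x \<bullet> cross I2 x) <= mw * (b * b)" using cross_sq(2)[OF f(2,4)] unfolding b(2) f(8) .
  show "0 <= ?k" using C3' kap b pos by simp
  show "\<P>(q in PI I2. deficient I2 q) <= 32 * tau * sqrt uS / lS * b"
   using deficient_prob(2)[OF f(2,4)] unfolding b_def f(8) .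
 qed
 also have "?k * (mw * (b * b)) = C3 * (8 * kap / lS * mw * b)" using b(1) by simp
 also have "?c + (C3 * (8 * kap / lS * mw * b) + 32 * tau * sqrt uS / lS * b)
  = a + (C3 * (rate (card I1) + 8 * kap / lS * (mw + 1) * b) + C1 * card I1 powr (- (1/2)) + 32 * tau * sqrt uS / lS * b)"
  by (simp add: algebra_simps add_divide_distrib)
 finally show ?thesis unfolding b_def .
qed

end

end

section \<open>Uniformity in the level, and the final rates\<close>

lemma miscoverage_le:
 assumes "!!a. 0 < a ==> a < 1 ==> outer_prob M (%w. t \<notin> S (%i. Z i w) a) <= a + b" "0 <= b" "b <= c"
 shows "miscoverage_excess M Z t S <= c"
 unfolding miscoverage_excess_def
proof (rule cSUP_least)
 fix a :: real assume "a \<in> {0<..<1}"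
 thus "max (outer_prob M (%w. t \<notin> S (%i. Z i w) a) - a) 0 <= c"
  using assms(1)[of a] assms(2,3) by (auto simp: max_def)
qed auto

lemma powr_half:
 fixes m a :: real assumes "1 <= m" "-1 <= a" "a <= 0" shows "m powr a <= 2 * (2 * m) powr a"
proof -
 have "2 powr (- 1) <= (2::real) powr a" using assms by (intro powr_mono) auto
 hence "1 <= 2 * 2 powr a" by (simp add: powr_minus_divide)
 hence "1 * m powr a <= (2 * 2 powr a) * m powr a" by (intro mult_right_mono) auto
 thus ?thesis using assms by (simp add: powr_mult)
qed

text \<open>As m <= n * d, the factor 1 + ln m is at most the logarithm in the claim. The tail term
  m^(-1/2) is absorbed because s <= 3 and that logarithm is at least 1.\<close>

lemma rate_SeN:
 fixes m n d s C1 C2 :: real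
 assumes m: "1 <= m" and n: "n = 2 * m" and d: "1 <= d" and s: "2 < s" "s <= 3" and C: "0 <= C1" "0 <= C2"
 shows "C2 * (m powr (1 - s/2) * (1 + ln m) powr (s/2)) + C1 * m powr (- (1/2))
  <= (2 * (C1 + C2)) * (ln (exp 1 * n * d) powr (s / 2) / n powr (s / 2 - 1))"
proof -
 define L where "L = ln (exp 1 * n * d)"
 have lm: "1 + ln m <= L"
 proof -
  have "m * 1 <= n * d" unfolding n using m d by (intro mult_mono) auto
  hence "exp 1 * m <= exp 1 * n * d" by simp
  hence "ln (exp 1 * m) <= L" unfolding L_def using m by (intro ln_mono) auto
  thus ?thesis using m by (simp add: ln_mult)
 qed
 have l0: "0 <= ln m" using m by simp
 have La: "(1 + ln m) powr (s/2) <= L powr (s/2)" using lm l0 s by (intro powr_mono2) auto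
 have Lb: "1 <= L powr (s/2)" using lm l0 s by (intro ge_one_powr_ge_zero) auto
 have a: "m powr (1 - s/2) <= 2 * n powr (1 - s/2)" unfolding n using m s by (intro powr_half) auto
 have b: "m powr (- (1/2)) <= m powr (1 - s/2)" using m s by (intro powr_mono) auto
 have "m powr (1 - s/2) * (1 + ln m) powr (s/2) <= (2 * n powr (1 - s/2)) * L powr (s/2)"
  using a La by (intro mult_mono) auto
 moreover have "m powr (- (1/2)) * 1 <= (2 * n powr (1 - s/2)) * L powr (s/2)"
  using a b Lb by (intro mult_mono) auto
 ultimately have "C2 * (m powr (1 - s/2) * (1 + ln m) powr (s/2)) + C1 * m powr (- (1/2))
  <= C2 * ((2 * n powr (1 - s/2)) * L powr (s/2)) + C1 * ((2 * n powr (1 - s/2)) * L powr (s/2))"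
  using C by (intro add_mono mult_left_mono) auto
 also have "... = (2 * (C1 + C2)) * (L powr (s/2) * n powr (1 - s/2))" by (simp add: algebra_simps)
 also have "n powr (1 - s/2) = 1 / n powr (s/2 - 1)" by (simp add: powr_minus_divide[symmetric])
 finally show ?thesis unfolding L_def by simp
qed

text \<open>The exponent 1 - 1/p is 1 - 2 / min q 4 for p = min q 4 / 2. Terms of order m^(-1/2) are
  below sqrt (d / m) because d >= 1, and passing from m to n = 2 * m costs at most a factor
  2.\<close>

lemma rate_SpN:
 fixes m n d q qxy C1 C3 Cd K :: real
 assumes m: "1 <= m" and n: "n = 2 * m" and d: "1 <= d" and q: "2 < q" "q <= qxy" and C: "0 <= C1" "0 <= C3"
 defines "s \<equiv> min qxy 3" and "p \<equiv> min q 4 / 2"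
 shows "C3 * ((m powr (1 - s/2) + m powr (- (1/2)) + ((1 + ln m) / m) powr (1 - 1/p)) + K * sqrt (d / m)) + C1 * m powr (- (1/2)) + Cd * sqrt (d / m)
  <= (2 * (C3 * (2 + abs K) + C1 + abs Cd)) * (sqrt (d / n) + (ln (exp 1 * n) / n) powr (1 - 2 / min q 4))"
proof -
 define k where "k = 1 - 2 / min q 4"
 define r T where "r = sqrt (d / m)" and "T = ((1 + ln m) / m) powr k"
 define r' T' where "r' = sqrt (d / n)" and "T' = (ln (exp 1 * n) / n) powr k"
 have k: "1 - 1/p = k" "0 <= k" "k <= 1" unfolding p_def k_def using q by (auto simp: divide_le_eq)
 have l0: "0 <= ln m" using m by simp
 have \<rho>0: "0 <= r" "0 <= T" "0 <= r'" "0 <= T'" unfolding r_def T_def r'_def T'_def using m n d by auto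
 have h: "m powr (- (1/2)) <= r"
 proof -
  have "m powr (- (1/2)) = sqrt (1 / m)" using m by (simp add: powr_minus_divide powr_half_sqrt real_sqrt_divide)
  also have "... <= r" unfolding r_def using m d by (intro real_sqrt_le_mono divide_right_mono) auto
  finally show ?thesis .
 qed
 have a: "m powr (1 - s/2) <= r + T"
 proof (cases "3 <= qxy")
  case True
  hence "1 - s/2 = - (1/2)" unfolding s_def by simp
  hence "m powr (1 - s/2) = m powr (- (1/2))" by (simp only:)
  thus ?thesis using h \<rho>0 by linarith
 next
  case False
  hence qs: "s = qxy" "min q 4 = q" "q <= s" unfolding s_def using q by auto
  \<comment> \<open>For q <= qxy < 3 the Berry-Esseen term is absorbed by the logarithmic one,
    because 1 - 2 / q <= q / 2 - 1 amounts to (q - 2)^2 >= 0.\<close>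
  have "k <= s/2 - 1"
  proof -
   have "0 <= (q - 2)^2" by simp
   hence "4 * q <= q * q + 4" by (simp add: sq_simps)
   hence "4 * q / q <= (q * q + 4) / q" using q by (intro divide_right_mono) auto
   hence "4 <= q + 4 / q" using q by (simp add: add_divide_distrib)
   moreover have "4 / q = 2 * (2 / q)" by simp
   ultimately have "1 - 2 / q <= q / 2 - 1" by linarith
   thus ?thesis unfolding k_def qs(2) using qs(3) by linarith
  qed
  hence "m powr (1 - s/2) <= m powr (- k)" using m by (intro powr_mono) auto
  also have "... = (1 / m) powr k" using m by (simp add: powr_minus_divide powr_divide)
  also have "... <= T" unfolding T_def using m l0 k by (intro powr_mono2 divide_right_mono) auto
  finally show ?thesis using \<rho>0 by linarith
 qed
 have tot: "C3 * ((m powr (1 - s/2) + m powr (- (1/2)) + T) + K * r) + C1 * m powr (- (1/2)) + Cd * r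
  <= C3 * ((2 * r + 2 * T) + abs K * r) + C1 * r + abs Cd * r"
 proof -
  have "m powr (1 - s/2) + m powr (- (1/2)) + T <= 2 * r + 2 * T" using a h by linarith
  moreover have K: "K * r <= abs K * r" "Cd * r <= abs Cd * r" using \<rho>0 by (auto intro: mult_right_mono)
  ultimately have "C3 * ((m powr (1 - s/2) + m powr (- (1/2)) + T) + K * r) <= C3 * ((2 * r + 2 * T) + abs K * r)"
   using C by (intro mult_left_mono) linarith+
  moreover have "C1 * m powr (- (1/2)) <= C1 * r" using h C by (intro mult_left_mono) auto
  ultimately show ?thesis using K(2) by linarith
 qed
 have "r <= 2 * r'"
 proof -
  have "d / m <= 4 * (d / n)" unfolding n using m d by (simp add: field_simps)
  hence "r <= sqrt (4 * (d / n))" unfolding r_def by (rule real_sqrt_le_mono)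
  also have "... = 2 * r'" unfolding r'_def by (simp only: real_sqrt_mult real_sqrt_four)
  finally show ?thesis .
 qed
 moreover have "T <= 2 * T'"
 proof -
  have n1: "1 <= n" using m n by simp
  have "ln m <= ln n" using m n by (intro ln_mono) auto
  hence "(1 + ln m) / m <= 2 * (ln (exp 1 * n) / n)" using m n1 unfolding n by (simp add: ln_mult field_simps)
  hence "T <= (2 * (ln (exp 1 * n) / n)) powr k" unfolding T_def using m l0 k by (intro powr_mono2) auto
  also have "... = 2 powr k * T'" unfolding T'_def by (rule powr_mult)
  also have "... <= 2 powr 1 * T'" using k \<rho>0 by (intro mult_right_mono powr_mono) auto
  finally show ?thesis by simp
 qed
 ultimately have fin: "r + T <= 2 * (r' + T')" by simp
 define c where "c = C3 * (2 + abs K) + C1 + abs Cd"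
 have "C3 * ((2 * r + 2 * T) + abs K * r) + C1 * r + abs Cd * r + (C3 * abs K * T + C1 * T + abs Cd * T)
  = c * (r + T)" unfolding c_def by (simp add: algebra_simps)
 moreover have "0 <= C3 * abs K * T + C1 * T + abs Cd * T" using C \<rho>0 by simp
 moreover have "c * (r + T) <= c * (2 * (r' + T'))"
  unfolding c_def using fin C by (intro mult_left_mono add_nonneg_nonneg mult_nonneg_nonneg) auto
 moreover have "c * (2 * (r' + T')) = (2 * c) * (r' + T')" by simp
 ultimately have "C3 * ((2 * r + 2 * T) + abs K * r) + C1 * r + abs Cd * r <= (2 * c) * (r' + T')" by linarith
 with tot show ?thesis unfolding k(1) r_def T_def r'_def T'_def unfolding k_def c_def by linarith
qed

lemma unit_sphere_dim: "x \<in> unit_sphere d ==> 0 < d"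
 unfolding unit_sphere_def by (cases d) (auto simp: scalar_prod_def)

text \<open>Outside the locale, \<open>regression.mb\<close> takes only the moment and spectral
  parameters, neither d nor P. All constants can therefore be fixed before the dimension, the law
  and the sample are introduced.\<close>

lemma SeN_bound:
 fixes lS uS lV qx qy Kx Ky qxy :: real
 assumes h: "0 < lS" "lS <= uS" "0 < lV" "1 <= qx" "1 <= qy" "1 <= Kx" "1 <= Ky" "qxy = inverse (1 / qx + 1 / qy)" "2 < qxy"
 defines "s \<equiv> min qxy 3"
 shows "\<exists>C>0. \<forall>(M :: 'a measure) P Z d n I1 I2 x.
    regression_law d P \<and> spectral_bounds d P lS uS lV \<and> moment_bounds d P qx qy Kx Ky \<and>
    iid_sample M P n Z \<and> half_split n I1 I2 \<and> real d <= real n / 2 \<and> x \<in> unit_sphere d \<longrightarrow>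
    miscoverage_excess M Z (x \<bullet> beta0 d P) (%D c. CI_SeN d n I1 I2 D x c)
    <= C * (ln (exp 1 * real n * real d) powr (s / 2) / real n powr (s / 2 - 1))"
proof -
 define B where "B = max 2 (regression.mb uS lV Kx Ky qxy)"
 have s: "2 < s" "s <= 3" "s <= qxy" using h(9) unfolding s_def by auto
 have B: "1 <= B" by (simp add: B_def)
 obtain C1 where C1: "0 < C1" "tail_const s B C1"
  using self_normalised_tail[OF s(1,2) B, where ?'b = "real vec \<times> real"] unfolding tail_const_def by blast
 obtain C2 where C2: "0 < C2" "!!(N :: (real vec \<times> real) measure) X J z. iid_moment N X s B ==> finite J ==> J ~= {} ==> 0 <= z ==>
  \<P>(w in PiM J (%_. N). self_normalised_excess X J z w)
   <= 2 * Q z + C2 * (card J powr (1 - s/2) * (1 + ln (card J)) powr (s/2))"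
  using self_normalised_Berry_Esseen[OF s(1,2) B, where ?'b = "real vec \<times> real"] by blast
 show ?thesis
 proof (intro exI[of _ "2 * (C1 + C2)"] conjI allI impI)
  show "0 < 2 * (C1 + C2)" using C1 C2 by simp
  fix M :: "'a measure" and P Z d n I1 I2 x
  assume a: "regression_law d P \<and> spectral_bounds d P lS uS lV \<and> moment_bounds d P qx qy Kx Ky \<and>
    iid_sample M P n Z \<and> half_split n I1 I2 \<and> real d <= real n / 2 \<and> x \<in> unit_sphere d"
  have d: "0 < d" using a unit_sphere_dim by blast
  interpret regression d P lS uS lV qx qy Kx Ky qxy using a d h by unfold_locales auto
  have split: "half_split n I1 I2" "real d <= real n / 2" using a by auto
  note f = split_facts[OF split]
  define m where "m = real (card I1)"
  have m: "1 <= m" "real n = 2 * m" unfolding m_def using f by auto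
  define rate where "rate = (%m :: nat. m powr (1 - s/2) * (1 + ln m) powr (s/2))"
  have rate: "0 <= rate (card I1)" by (simp add: rate_def)
  have mbB: "mb <= B" by (simp add: B_def)
  have iid: "iid_sample M P n Z" and x: "x \<in> carrier_vec d" using a by (auto simp: unit_sphere_def)
  show "miscoverage_excess M Z (x \<bullet> beta0 d P) (%D c. CI_SeN d n I1 I2 D x c)
    <= (2 * (C1 + C2)) * (ln (exp 1 * real n * real d) powr (s / 2) / real n powr (s / 2 - 1))"
  proof (rule miscoverage_le)
   show "outer_prob M (%w. x \<bullet> beta0 d P \<notin> CI_SeN d n I1 I2 (%i. Z i w) x c)
    <= c + (C2 * rate (card I1) + C1 * card I1 powr (- (1/2)))" if "0 < c" "c < 1" for c
   proof (rule SeN_coverage[where rate = rate, OF split C1(2) _ s mbB _ _ rate iid that x])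
    show "\<P>(w in PI J. self_normalised_excess X J z w) <= 2 * Q z + C2 * rate (card J)"
    if "iid_moment P X s B" "finite J" "J ~= {}" "0 <= z" for X and J :: "nat set" and z
    unfolding rate_def by (rule C2(2)[OF that])
   qed (use C1 C2 in auto)
   show "0 <= C2 * rate (card I1) + C1 * card I1 powr (- (1/2))" using C1 C2 rate by simp
   show "C2 * rate (card I1) + C1 * card I1 powr (- (1/2)) <= (2 * (C1 + C2)) * (ln (exp 1 * real n * real d) powr (s / 2) / real n powr (s / 2 - 1))"
    unfolding rate_def m_def[symmetric] using C1 C2 d by (intro rate_SeN m s) auto
  qed
 qed
qed

lemma SpN_bound:
 fixes lS uS lV qx qy Kx Ky qxy :: real
 assumes h: "0 < lS" "lS <= uS" "0 < lV" "1 <= qx" "1 <= qy" "1 <= Kx" "1 <= Ky" "qxy = inverse (1 / qx + 1 / qy)" "2 < qxy"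
  and q: "2 < q" "q = min (qx / 2) qxy"
 shows "\<exists>C>0. \<forall>(M :: 'a measure) P Z d n I1 I2 x.
    regression_law d P \<and> spectral_bounds d P lS uS lV \<and> moment_bounds d P qx qy Kx Ky \<and>
    iid_sample M P n Z \<and> half_split n I1 I2 \<and> real d <= real n / 2 \<and> x \<in> unit_sphere d \<longrightarrow>
    miscoverage_excess M Z (x \<bullet> beta0 d P) (%D c. CI_SpN d n I1 I2 D x c)
    <= C * (sqrt (real d / real n) + (ln (exp 1 * real n) / real n) powr (1 - 2 / min q 4))"
proof -
 define B where "B = max 2 (regression.mb uS lV Kx Ky qxy)"
 \<comment> \<open>Here 2 * p = min q 4 respects both available exponents: qxy for the scores and qx
   / 2 for the drift term. The cap at 4 keeps p <= 2, as the left-tail bound requires.\<close>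
 define s p where "s = min qxy 3" and "p = min q 4 / 2"
 have s: "2 < s" "s <= 3" "s <= qxy" using h(9) unfolding s_def by auto
 have p: "1 < p" "p <= 2" "2 * p <= qxy" "2 * p <= qx / 2" and qx: "4 < qx" unfolding p_def using q by auto
 have B: "1 <= B" "2 <= B" by (auto simp: B_def)
 obtain C1 where C1: "0 < C1" "tail_const s B C1"
  using self_normalised_tail[OF s(1,2) B(1), where ?'b = "real vec \<times> real"] unfolding tail_const_def by blast
 define rate where "rate = (%m :: nat. m powr (1 - s/2) + m powr (- (1/2)) + ((1 + ln m) / m) powr (1 - 1/p))"
 obtain C3 where C3: "0 < C3" "plugin_const rate s B p C3"
  using plugin_Berry_Esseen[OF s(1,2) B(1) p(1,2), where ?'b = "real vec \<times> real"] unfolding plugin_const_def rate_def by blast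
 define K where "K = 8 * regression.kap uS lV Kx / lS * (regression.mw uS Kx Ky qxy + 1)"
 define Cd where "Cd = 32 * regression.tau lS uS qx Kx * sqrt uS / lS"
 define C where "C = 2 * (C3 * (2 + abs K) + C1 + abs Cd)"
 show ?thesis
 proof (intro exI[of _ C] conjI allI impI)
  show "0 < C" unfolding C_def using C1(1) C3(1) by (intro mult_pos_pos add_pos_nonneg add_pos_pos) auto
  fix M :: "'a measure" and P Z d n I1 I2 x
  assume a: "regression_law d P \<and> spectral_bounds d P lS uS lV \<and> moment_bounds d P qx qy Kx Ky \<and>
    iid_sample M P n Z \<and> half_split n I1 I2 \<and> real d <= real n / 2 \<and> x \<in> unit_sphere d"
  have d: "0 < d" using a unit_sphere_dim by blast
  interpret regression d P lS uS lV qx qy Kx Ky qxy using a d h by unfold_locales auto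
  have split: "half_split n I1 I2" "real d <= real n / 2" using a by auto
  note f = split_facts[OF split]
  define m where "m = real (card I1)"
  have m: "1 <= m" "real n = 2 * m" unfolding m_def using f by auto
  have rate: "0 <= rate (card I1)" by (simp add: rate_def)
  have mbB: "mb <= B" by (simp add: B_def)
  have iid: "iid_sample M P n Z" and x: "x \<in> carrier_vec d" using a by (auto simp: unit_sphere_def)
  define b where "b = C3 * (rate (card I1) + K * sqrt (real d / m)) + C1 * m powr (- (1/2)) + Cd * sqrt (real d / m)"
  have cov: "outer_prob M (%w. x \<bullet> beta0 d P \<notin> CI_SpN d n I1 I2 (%i. Z i w) x c) <= c + b" if "0 < c" "c < 1" for c
   unfolding b_def K_def Cd_def m_def
   using C1(1) C3(1) by (intro SpN_coverage[where rate = rate, OF split C1(2) _ s mbB B(2) p(1,3,4) qx C3(2) _ rate iid that x]) auto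
  have bC: "b <= C * (sqrt (real d / real n) + (ln (exp 1 * real n) / real n) powr (1 - 2 / min q 4))"
   unfolding b_def rate_def m_def[symmetric] C_def s_def p_def
   using C1 C3 q d by (intro rate_SpN m) auto
  have C0: "0 <= C" using C1(1) C3(1) unfolding C_def by (intro mult_nonneg_nonneg add_nonneg_nonneg) auto
  show "miscoverage_excess M Z (x \<bullet> beta0 d P) (%D c. CI_SpN d n I1 I2 D x c)
    <= C * (sqrt (real d / real n) + (ln (exp 1 * real n) / real n) powr (1 - 2 / min q 4))"
  proof (rule miscoverage_le[where b = "max b 0"])
   show "outer_prob M (%w. x \<bullet> beta0 d P \<notin> CI_SpN d n I1 I2 (%i. Z i w) x c) <= c + max b 0" if "0 < c" "c < 1" for c
    using cov[OF that] by linarith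
   show "max b 0 <= C * (sqrt (real d / real n) + (ln (exp 1 * real n) / real n) powr (1 - 2 / min q 4))"
    using bC C0 by (simp add: mult_nonneg_nonneg add_nonneg_nonneg)
  qed simp
 qed
qed

theorem theorem9:
  fixes lS uS lV qx qy Kx Ky qxy :: real
  assumes "0 < lS" and "lS \<le> uS" and "0 < lV"
    and "1 \<le> qx" and "1 \<le> qy" and "1 \<le> Kx" and "1 \<le> Ky"
    and "qxy = inverse (1 / qx + 1 / qy)" and "2 < qxy"
  shows
    "(let s = min qxy 3 in
      \<exists>C>0. \<forall>(M :: 'a measure) P Z d n I1 I2 \<xi>.
        regression_law d P \<and> spectral_bounds d P lS uS lV \<and> moment_bounds d P qx qy Kx Ky \<and>
        iid_sample M P n Z \<and> half_split n I1 I2 \<and> real d \<le> real n / 2 \<and> \<xi> \<in> unit_sphere d \<longrightarrow>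
        miscoverage_excess M Z (\<xi> \<bullet> beta0 d P) (\<lambda>D \<alpha>. CI_SeN d n I1 I2 D \<xi> \<alpha>)
          \<le> C * (ln (exp 1 * real n * real d) powr (s / 2) / real n powr (s / 2 - 1))) \<and>
     (let q = min (qx / 2) qxy in
      q > 2 \<longrightarrow>
      (\<exists>C>0. \<forall>(M :: 'a measure) P Z d n I1 I2 \<xi>.
        regression_law d P \<and> spectral_bounds d P lS uS lV \<and> moment_bounds d P qx qy Kx Ky \<and>
        iid_sample M P n Z \<and> half_split n I1 I2 \<and> real d \<le> real n / 2 \<and> \<xi> \<in> unit_sphere d \<longrightarrow>
        miscoverage_excess M Z (\<xi> \<bullet> beta0 d P) (\<lambda>D \<alpha>. CI_SpN d n I1 I2 D \<xi> \<alpha>)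
          \<le> C * (sqrt (real d / real n)
                 + (ln (exp 1 * real n) / real n) powr (1 - 2 / min q 4))))"
  unfolding Let_def
proof (rule conjI)
 show "min (qx / 2) qxy > 2 \<longrightarrow>
   (\<exists>C>0. \<forall>(M :: 'a measure) P Z d n I1 I2 \<xi>.
    regression_law d P \<and> spectral_bounds d P lS uS lV \<and> moment_bounds d P qx qy Kx Ky \<and>
    iid_sample M P n Z \<and> half_split n I1 I2 \<and> real d <= real n / 2 \<and> \<xi> \<in> unit_sphere d \<longrightarrow>
    miscoverage_excess M Z (\<xi> \<bullet> beta0 d P) (%D \<alpha>. CI_SpN d n I1 I2 D \<xi> \<alpha>)
     <= C * (sqrt (real d / real n) + (ln (exp 1 * real n) / real n) powr (1 - 2 / min (min (qx / 2) qxy) 4)))"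
  using SpN_bound[OF assms _ refl] by blast
qed (rule SeN_bound[OF assms])

end
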